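(* Let $q\ge2$ be an integer, $\epsilon\in(0,1)$. For any energy level $\sigma\in\,]0,\mathbf{Tr}(\Sigma)]$, with probability at least $1-2\epsilon$, for any $\theta\in\mathbb R^d\setminus\{0\}$, $$\left|\frac{\max\{N(\theta),\sigma\|\theta\|^2\}}{\max\{\widehat N(\theta),\sigma\|\theta\|^2\}}-1\right|\le B_*\big(\|\theta\|^{-2}N(\theta)\big),$$ where $$B_*(t)=\begin{cases}\dfrac{(q\lfloor n/q\rfloor)^{-1/2}\zeta_q(\max\{t,\sigma\})}{1-4(q\lfloor n/q\rfloor)^{-1/2}\zeta_q(\max\{t,\sigma\})},&\text{if }\big(6+q/\tau_q(\kappa)\big)\zeta_q(\max\{t,\sigma\})\le(q\lfloor n/q\rfloor)^{1/2},\\ +\infty,&\text{otherwise,}\end{cases}$$ $$\zeta_q(t)=\sqrt{2.032\,\tau_q(\kappa)\Big(\frac{0.73\,\mathbf{Tr}(\Sigma)}{t}+\log(K)+\log(\epsilon^{-1})\Big)}+\sqrt{\frac{98.5\,(q+\tau_q(\kappa))\,\mathbf{Tr}(\Sigma)}{t}},$$ with $$K=1+\left\lceil\frac12\log\Big(\frac{\lfloor n/q\rfloor}{72(2+c)(1+\tau_q(\kappa)/q)^{1/2}}\Big)\right\rceil,\qquad\tau_q(\kappa)=\kappa-1+\frac{2}{q-1}.$$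
   Context: $X\in\mathbb R^d$ is a random vector with unknown law, $X_1,\dots,X_n$ an i.i.d. sample; $\Sigma=\mathbb E[(X-\mathbb E[X])(X-\mathbb E[X])^\top]$, $N(\theta)=\theta^\top\Sigma\theta$, $\mathbf{Tr}(\Sigma)=\mathbb E(\|X-\mathbb E X\|^2)$, and $$\kappa=\sup_{\theta\in\mathbb R^d,\ N(\theta)>0}\frac{\mathbb E[\langle\theta,X-\mathbb E(X)\rangle^4]}{\mathbb E[\langle\theta,X-\mathbb E(X)\rangle^2]^2}$$ is assumed finite. $c=\frac{15}{8\log(2)(\sqrt2-1)}\exp\big(\frac{1+2\sqrt2}{2}\big)$. Block construction: put $m=\lfloor n/q\rfloor$ and, for $1\le i\le m$, $$A_i=\frac{1}{q(q-1)}\sum_{(i-1)q<j<k\le iq}(X_j-X_k)(X_j-X_k)^\top,$$ which are i.i.d. symmetric positive semi-definite random matrices with $\mathbb E[A_i]=\Sigma$. Let $A$ denote a random matrix with the same law as $A_1$, let $\|A\|_\infty$ be its operator norm (largest eigenvalue), and put $$\kappa'=\sup_{\theta\in\mathbb R^d,\ \mathbb E(\|A^{1/2}\theta\|^2)>0}\frac{\mathbb E[\|A^{1/2}\theta\|^4]}{\mathbb E[\|A^{1/2}\theta\|^2]^2},\qquad s_4=\mathbb E[\|A\|_\infty^2]^{1/4}.$$ Estimator (the robust estimator of the expectation of a symmetric positive semi-definite random matrix, applied to the sample $A_1,\dots,A_m$): let $a=1/2$ and $K'=1+\big\lceil a^{-1}\log\big(\frac{m}{72(2+c)\kappa'^{1/2}}\big)\big\rceil$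 ($K$ and $K'$ being $\ge1$). Let $\psi:\mathbb R\to\mathbb R$ be the odd function with $\psi(t)=-\log(1-t+t^2/2)$ for $0\le t\le1$ and $\psi(t)=\log2$ for $t\ge1$. For $\lambda>0$ let $r_\lambda(\theta)=\frac1m\sum_{i=1}^m\psi(\|A_i^{1/2}\theta\|^2-\lambda)$, $\widehat\alpha_\lambda(\theta)=\sup\{\alpha\in\mathbb R_+:r_\lambda(\alpha\theta)\le0\}\in(0,+\infty]$ and $\widetilde N_\lambda(\theta)=\lambda/\widehat\alpha_\lambda(\theta)^2$ (equal to $0$ if $\widehat\alpha_\lambda(\theta)=+\infty$). Let $\Lambda=\{(\lambda_j,\beta_j):0\le j<K'\}$ with $$\lambda_j=\sqrt{\frac{2}{(\kappa'-1)m}\Big(\frac{(2+3c)\,\mathbb E[\mathbf{Tr}(A^2)]}{4(2+c)\kappa'^{1/2}\,\mathbb E[\|A\|_\infty^2]}\exp(ja)+\log(K'/\epsilon)\Big)},\qquad\beta_j=\sqrt{2(2+c)\kappa'^{1/2}\,\mathbb E[\|A\|_\infty^2]\,m\exp[-(j-1/2)a]}.$$ For $(\lambda,\beta)\in\Lambda$ put $\xi=\frac{\kappa'\lambda}{2}$, $\mu=\lambda(\kappa'-1)+\frac{(2+c)\kappa'^{1/2}s_4^2}{\beta}$, $\gamma=\frac\lambda2(\kappa'-1)+\frac{(2+c)\kappa'^{1/2}s_4^2}{\beta}+\frac{(2+3c)\,\mathbb E[\mathbf{Tr}(A^2)]}{2\beta^2\lambda}+\frac{\log(|\Lambda|/\epsilon)}{m\lambda}$,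 $\delta=\frac{\beta}{2m\lambda}$, and $$B_{\lambda,\beta}(t)=\frac{\gamma+\lambda\delta/\max\{t,\sigma\}}{1-\mu-\gamma-2\lambda\delta/\max\{t,\sigma\}}\ \text{ if }\xi+\mu+\gamma+\frac{2\delta\lambda}{\max\{t,\sigma\}}<1,\qquad B_{\lambda,\beta}(t)=+\infty\text{ otherwise.}$$ For $\theta\ne0$ let $(\widehat\lambda,\widehat\beta)\in\arg\min_{(\lambda,\beta)\in\Lambda}B_{\lambda,\beta}[\|\theta\|^{-2}\widetilde N_\lambda(\theta)]$ and $\widehat N(\theta)=\widetilde N_{\widehat\lambda}(\theta)$. An inequality with right-hand side $+\infty$ is void. "With probability at least $p$" means that the event contains a measurable event of probability at least $p$. *)

theory Defs
  imports "HOL-Probability.Probability"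
begin

definition cst_c :: real where
  "cst_c = 15 / (8 * ln 2 * (sqrt 2 - 1)) * exp ((1 + 2 * sqrt 2) / 2)"

definition outer_prod :: "real^'d \<Rightarrow> real^'d^'d" where
  "outer_prod v = (\<chi> i j. v $ i * v $ j)"

definition sym_psd :: "real^'d^'d \<Rightarrow> bool" where
  "sym_psd A \<longleftrightarrow> transpose A = A \<and> (\<forall>v. 0 \<le> v \<bullet> (A *v v))"

definition psd_sqrt :: "real^'d^'d \<Rightarrow> real^'d^'d" where
  "psd_sqrt A = (THE B. sym_psd B \<and> B ** B = A)"

definition op_norm :: "real^'d^'d \<Rightarrow> real" where
  "op_norm A = onorm ((*v) A)"

text \<open>A random vector \<open>X\<close> enters through its law \<open>P\<close> on \<open>real^'d\<close>, a random matrix \<open>A\<close>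
  through its law \<open>Q\<close> on \<open>real^'d^'d\<close>.\<close>

definition mean_vec :: "(real^'d) measure \<Rightarrow> real^'d" where
  "mean_vec P = (\<integral>x. x \<partial>P)"

definition cov_mat :: "(real^'d) measure \<Rightarrow> real^'d^'d" where
  "cov_mat P = (\<integral>x. outer_prod (x - mean_vec P) \<partial>P)"

definition energy :: "(real^'d) measure \<Rightarrow> real^'d \<Rightarrow> real" where
  "energy P \<theta> = \<theta> \<bullet> (cov_mat P *v \<theta>)"

text \<open>The kurtosis coefficients take values in \<open>[0,\<infinity>]\<close>, so that \<open>kurtosis P < \<infinity>\<close> is a genuine
  condition (it entails finiteness of the fourth moments).\<close>

definition kurtosis :: "(real^'d) measure \<Rightarrow> ennreal" where
  "kurtosis P = (SUP \<theta>\<in>{\<theta>. 0 < energy P \<theta>}.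
     (\<integral>\<^sup>+x. ennreal ((\<theta> \<bullet> (x - mean_vec P)) ^ 4) \<partial>P) /
     (\<integral>\<^sup>+x. ennreal ((\<theta> \<bullet> (x - mean_vec P)) ^ 2) \<partial>P) ^ 2)"

definition kurtosis_mat :: "(real^'d^'d) measure \<Rightarrow> ennreal" where
  "kurtosis_mat Q = (SUP \<theta>\<in>{\<theta>. 0 < (\<integral>\<^sup>+A. ennreal (norm (psd_sqrt A *v \<theta>) ^ 2) \<partial>Q)}.
     (\<integral>\<^sup>+A. ennreal (norm (psd_sqrt A *v \<theta>) ^ 4) \<partial>Q) /
     (\<integral>\<^sup>+A. ennreal (norm (psd_sqrt A *v \<theta>) ^ 2) \<partial>Q) ^ 2)"

definition s4 :: "(real^'d^'d) measure \<Rightarrow> real" where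
  "s4 Q = (\<integral>A. (op_norm A)\<^sup>2 \<partial>Q) powr (1/4)"

definition block_mat :: "nat \<Rightarrow> (nat \<Rightarrow> real^'d) \<Rightarrow> nat \<Rightarrow> real^'d^'d" where
  "block_mat q x i = (1 / (real q * (real q - 1))) *\<^sub>R
     (\<Sum>k\<in>{(i - 1) * q<..i * q}. \<Sum>j\<in>{(i - 1) * q<..<k}. outer_prod (x j - x k))"

text \<open>The common law of the blocks: that of the first block of an i.i.d. sample with law \<open>P\<close>.\<close>

definition block_law :: "nat \<Rightarrow> (real^'d) measure \<Rightarrow> (real^'d^'d) measure" where
  "block_law q P = distr (Pi\<^sub>M {1..q} (\<lambda>_. P)) borel (\<lambda>x. block_mat q x 1)"

definition psi :: "real \<Rightarrow> real" where
  "psi t = (if 1 \<le> t then ln 2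
            else if 0 \<le> t then - ln (1 - t + t\<^sup>2 / 2)
            else if -1 \<le> t then ln (1 + t + t\<^sup>2 / 2)
            else - ln 2)"

text \<open>In the following, \<open>A 1, \<dots>, A m\<close> are the observed matrices.\<close>

definition r_emp :: "nat \<Rightarrow> (nat \<Rightarrow> real^'d^'d) \<Rightarrow> real \<Rightarrow> real^'d \<Rightarrow> real" where
  "r_emp m A lam \<theta> = (1 / real m) * (\<Sum>i = 1..m. psi (norm (psd_sqrt (A i) *v \<theta>) ^ 2 - lam))"

definition alpha_hat :: "nat \<Rightarrow> (nat \<Rightarrow> real^'d^'d) \<Rightarrow> real \<Rightarrow> real^'d \<Rightarrow> ereal" where
  "alpha_hat m A lam \<theta> = Sup (ereal ` {\<alpha>. 0 \<le> \<alpha> \<and> r_emp m A lam (\<alpha> *\<^sub>R \<theta>) \<le> 0})"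

definition N_tilde :: "nat \<Rightarrow> (nat \<Rightarrow> real^'d^'d) \<Rightarrow> real \<Rightarrow> real^'d \<Rightarrow> real" where
  "N_tilde m A lam \<theta> = (if alpha_hat m A lam \<theta> = \<infinity> then 0
     else lam / (real_of_ereal (alpha_hat m A lam \<theta>))\<^sup>2)"

definition mesh :: real where
  "mesh = 1 / 2"

definition K' :: "(real^'d^'d) measure \<Rightarrow> nat \<Rightarrow> int" where
  "K' Q m = 1 + \<lceil>inverse mesh *
     ln (real m / (72 * (2 + cst_c) * sqrt (enn2real (kurtosis_mat Q))))\<rceil>"

definition lam_grid :: "(real^'d^'d) measure \<Rightarrow> nat \<Rightarrow> real \<Rightarrow> nat \<Rightarrow> real" where
  "lam_grid Q m \<epsilon> j = (let \<kappa>' = enn2real (kurtosis_mat Q) in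
     sqrt (2 / ((\<kappa>' - 1) * real m) *
       ((2 + 3 * cst_c) * (\<integral>A. trace (A ** A) \<partial>Q) /
          (4 * (2 + cst_c) * sqrt \<kappa>' * (\<integral>A. (op_norm A)\<^sup>2 \<partial>Q)) * exp (real j * mesh)
        + ln (real_of_int (K' Q m) / \<epsilon>))))"

definition beta_grid :: "(real^'d^'d) measure \<Rightarrow> nat \<Rightarrow> nat \<Rightarrow> real" where
  "beta_grid Q m j = sqrt (2 * (2 + cst_c) * sqrt (enn2real (kurtosis_mat Q)) *
     (\<integral>A. (op_norm A)\<^sup>2 \<partial>Q) * real m * exp (- ((real j - 1/2) * mesh)))"

definition Lam :: "(real^'d^'d) measure \<Rightarrow> nat \<Rightarrow> real \<Rightarrow> (real \<times> real) set" where
  "Lam Q m \<epsilon> = {(lam_grid Q m \<epsilon> j, beta_grid Q m j) | j. int j < K' Q m}"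

definition B_bound ::
  "(real^'d^'d) measure \<Rightarrow> nat \<Rightarrow> real \<Rightarrow> real \<Rightarrow> real \<Rightarrow> real \<Rightarrow> real \<Rightarrow> ereal" where
  "B_bound Q m \<epsilon> \<sigma> lam \<beta> t =
     (let \<kappa>' = enn2real (kurtosis_mat Q);
          \<xi> = \<kappa>' * lam / 2;
          \<mu> = lam * (\<kappa>' - 1) + (2 + cst_c) * sqrt \<kappa>' * (s4 Q)\<^sup>2 / \<beta>;
          \<gamma> = lam / 2 * (\<kappa>' - 1) + (2 + cst_c) * sqrt \<kappa>' * (s4 Q)\<^sup>2 / \<beta>
               + (2 + 3 * cst_c) * (\<integral>A. trace (A ** A) \<partial>Q) / (2 * \<beta>\<^sup>2 * lam)
               + ln (real (card (Lam Q m \<epsilon>)) / \<epsilon>) / (real m * lam);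
          \<delta> = \<beta> / (2 * real m * lam)
      in if \<xi> + \<mu> + \<gamma> + 2 * \<delta> * lam / max t \<sigma> < 1
         then ereal ((\<gamma> + lam * \<delta> / max t \<sigma>) / (1 - \<mu> - \<gamma> - 2 * lam * \<delta> / max t \<sigma>))
         else \<infinity>)"

definition is_best_pair ::
  "(real^'d^'d) measure \<Rightarrow> nat \<Rightarrow> real \<Rightarrow> real \<Rightarrow> (nat \<Rightarrow> real^'d^'d) \<Rightarrow> real^'d
     \<Rightarrow> real \<times> real \<Rightarrow> bool" where
  "is_best_pair Q m \<epsilon> \<sigma> A \<theta> p \<longleftrightarrow> is_arg_min
     (\<lambda>(lam, \<beta>). B_bound Q m \<epsilon> \<sigma> lam \<beta> (N_tilde m A lam \<theta> / (norm \<theta>)\<^sup>2))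
     (\<lambda>p. p \<in> Lam Q m \<epsilon>) p"

definition tau :: "nat \<Rightarrow> real \<Rightarrow> real" where
  "tau q \<kappa> = \<kappa> - 1 + 2 / (real q - 1)"

definition K :: "nat \<Rightarrow> real \<Rightarrow> nat \<Rightarrow> int" where
  "K q \<kappa> n = 1 + \<lceil>1 / 2 *
     ln (real (n div q) / (72 * (2 + cst_c) * sqrt (1 + tau q \<kappa> / real q)))\<rceil>"

definition zeta :: "(real^'d) measure \<Rightarrow> nat \<Rightarrow> nat \<Rightarrow> real \<Rightarrow> real \<Rightarrow> real" where
  "zeta P q n \<epsilon> t = (let \<kappa> = enn2real (kurtosis P); T = trace (cov_mat P) in
     sqrt (2.032 * tau q \<kappa> *
       (0.73 * T / t + ln (real_of_int (K q \<kappa> n)) + ln (1 / \<epsilon>)))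
     + sqrt (98.5 * (real q + tau q \<kappa>) * T / t))"

definition B_star ::
  "(real^'d) measure \<Rightarrow> nat \<Rightarrow> nat \<Rightarrow> real \<Rightarrow> real \<Rightarrow> real \<Rightarrow> ereal" where
  "B_star P q n \<epsilon> \<sigma> t =
     (let \<kappa> = enn2real (kurtosis P);
          z = zeta P q n \<epsilon> (max t \<sigma>);
          R = sqrt (real (q * (n div q)))
      in if (6 + real q / tau q \<kappa>) * z \<le> R
         then ereal ((z / R) / (1 - 4 * (z / R)))
         else \<infinity>)"

end

theory Submission
  imports Defs
begin

text \<open>
  A PAC-Bayesian inequality with Gaussian perturbations of \<open>\<theta>\<close> bounds \<open>r\<^sub>\<lambda>(\<theta>)\<close> above and below, uniformly in
  \<open>\<theta>\<close> and over the finite grid, by \<open>N(\<theta>) - \<lambda>\<close> up to second order terms. Since the empirical criterion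
  vanishes at the root defining the estimator, inverting these bounds gives the relative error \<open>B\<close> of each
  \<open>N\<^sub>\<lambda>\<close> as a function of the estimator itself. The kurtosis of the block matrices is exactly
  \<open>\<kappa>' = 1 + \<tau>/q\<close>, and a Cauchy--Schwarz argument bounds their matrix moments by \<open>\<kappa>'\<close> and \<open>Tr(\<Sigma>)\<close>. For each
  energy \<open>t\<close> some grid point nearly balances the terms of the bound, and the selected point does no worse.

  The grid has more points than the bound accounts for. This is compensated by the fact that the deviation
  inequality holds with a constant less than half of \<open>c\<close>. At energy levels \<open>\<sigma> > 4 s\<^sub>4\<^sup>2\<close>, which no grid point
  balances, both \<open>N\<close> and all its estimators are below \<open>\<sigma>\<close>.
\<close>

section \<open>Positive semidefinite matrices\<close>

text \<open>Since \<open>mesh\<close> is 1/2, \<open>K'\<close> contains twice a logarithm of which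
  \<open>K\<close> contains half. So \<open>L\<close> may exceed the logarithmic part of
  \<open>zeta\<close> by as much as 2 ln 2, and minimising \<open>B_bound\<close> alone cannot give
  \<open>B_star\<close>. The selected point is therefore judged twice: its \<open>B_bound\<close>,
  computed with \<open>cst_c\<close>, is compared with that of a balanced grid point, and its true
  error obeys the same formula with \<open>dev_cst\<close> in place of \<open>cst_c\<close>. The
  change of constant lowers gamma by an amount s proportional to 1 / beta, while the term lambda
  delta / t is proportional to beta. Only the product of the two has to beat the loss, so beta
  cancels and nothing has to be known about which point the data select.

  In the deviation inequality the obstacle is that psi is neither convex nor concave, so that its
  value at theta is not controlled by its Gaussian average around theta. It is bounded instead by
  the average of \<open>log_minorant\<close>: a truncated logarithm of a quadratic, plus a truncated
  compensator for the variance of the perturbation.\<close>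

lemma sym_inner: "transpose A = (A::real^'d^'d) \<Longrightarrow> x \<bullet> (A *v y) = (A *v x) \<bullet> y"
  by (metis dot_lmul_matrix transpose_matrix_vector)

text \<open>A derivative-free first-order condition: small t of either sign force the linear
  coefficient at an extremum to vanish. It serves for the maximum of a quadratic form on a sphere
  and for the minimum of a semidefinite form.\<close>

lemma zero_if_linear_le_quadratic:
  fixes a C :: real assumes "\<And>t. t * a \<le> t\<^sup>2 * C" shows "a = 0"
proof (rule ccontr)
  assume a: "a \<noteq> 0"
  define t where "t = a / (1 + \<bar>C\<bar>)"
  have p: "1 + \<bar>C\<bar> > 0" by simp
  have "t * a \<le> t\<^sup>2 * C" by (rule assms)
  then have "t * a * (1 + \<bar>C\<bar>)\<^sup>2 \<le> t\<^sup>2 * C * (1 + \<bar>C\<bar>)\<^sup>2" by (intro mult_right_mono) auto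
  moreover have "t * (1 + \<bar>C\<bar>) = a" unfolding t_def using p by simp
  ultimately have "a\<^sup>2 * (1 + \<bar>C\<bar>) \<le> a\<^sup>2 * C"
    by (simp add: power2_eq_square) (metis mult.assoc mult.commute)
  then have "a\<^sup>2 * (1 + \<bar>C\<bar> - C) \<le> 0" by (simp add: algebra_simps)
  moreover have "a\<^sup>2 * (1 + \<bar>C\<bar> - C) > 0" using a by (intro mult_pos_pos) auto
  ultimately show False by simp
qed

text \<open>The vector that maximises the quadratic form on the unit sphere of \<open>S\<close>
  works. The residual w = \<open>A *v v - l *\<^sub>R v\<close> stays in \<open>S\<close> by
  invariance, and the first variation in its direction is 2 |w|^2, so w = 0.\<close>

lemma sym_eigenvector:
  fixes A :: "real^'d^'d"
  assumes sym: "transpose A = A" and S: "subspace S" "S \<noteq> {0}" and inv: "\<And>x. x \<in> S \<Longrightarrow> A *v x \<in> S"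
  obtains v l where "v \<in> S" "norm v = 1" "A *v v = l *\<^sub>R v"
proof -
  define K where "K = S \<inter> sphere 0 1"
  define f where "f x = x \<bullet> (A *v x)" for x
  have "compact K" unfolding K_def using S by (intro closed_Int_compact closed_subspace) auto
  moreover have "K \<noteq> {}"
  proof -
    obtain x where x: "x \<in> S" "x \<noteq> 0" using S subspace_0 by blast
    have "(1 / norm x) *\<^sub>R x \<in> K" using x S by (auto simp: K_def subspace_scale)
    then show ?thesis by blast
  qed
  moreover have "continuous_on K f" unfolding f_def
    by (intro continuous_intros linear_continuous_on bounded_linear.linear matrix_vector_mul_bounded_linear)
  ultimately obtain v where v: "v \<in> K" "\<And>y. y \<in> K \<Longrightarrow> f y \<le> f v"
    using continuous_attains_sup[of K f] by blast
  define l where "l = f v"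
  have vS: "v \<in> S" and v1: "norm v = 1" using v by (auto simp: K_def)
  have vv: "v \<bullet> v = 1" using v1 by (simp add: norm_eq_1)
  have fle: "f x \<le> l * (x \<bullet> x)" if "x \<in> S" for x
  proof (cases "x = 0")
    case False
    have "(1 / norm x) *\<^sub>R x \<in> K" using that False S by (auto simp: K_def subspace_scale)
    then have "f ((1 / norm x) *\<^sub>R x) \<le> l" unfolding l_def by (rule v(2))
    then have "f x / (norm x)\<^sup>2 \<le> l"
      by (simp add: f_def matrix_vector_mult_scaleR power2_eq_square)
    then show ?thesis using False by (simp add: field_simps dot_square_norm)
  qed (simp add: f_def)
  define w where "w = A *v v - l *\<^sub>R v"
  have wS: "w \<in> S" unfolding w_def using inv[OF vS] vS S by (simp add: subspace_diff subspace_scale)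
  have "t * (2 * (w \<bullet> w)) \<le> t\<^sup>2 * (l * (w \<bullet> w) - f w)" for t
  proof -
    have "f (v + t *\<^sub>R w) \<le> l * ((v + t *\<^sub>R w) \<bullet> (v + t *\<^sub>R w))"
      using vS wS S by (intro fle) (simp add: subspace_add subspace_scale)
    moreover have "f (v + t *\<^sub>R w) = l + 2 * t * (w \<bullet> (A *v v)) + t\<^sup>2 * f w"
      unfolding f_def l_def using sym_inner[OF sym, of v w]
      by (simp add: matrix_vector_mult_scaleR matrix_vector_right_distrib inner_add_left inner_add_right
          algebra_simps power2_eq_square inner_commute)
    moreover have "(v + t *\<^sub>R w) \<bullet> (v + t *\<^sub>R w) = 1 + 2 * t * (w \<bullet> v) + t\<^sup>2 * (w \<bullet> w)"
      using vv by (simp add: inner_add_left inner_add_right algebra_simps power2_eq_square inner_commute)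
    moreover have "w \<bullet> (A *v v) = w \<bullet> w + l * (w \<bullet> v)"
      unfolding w_def by (simp add: inner_diff_right)
    ultimately have "l + 2 * t * (w \<bullet> w + l * (w \<bullet> v)) + t\<^sup>2 * f w \<le> l * (1 + 2 * t * (w \<bullet> v) + t\<^sup>2 * (w \<bullet> w))"
      by metis
    then show ?thesis by (simp only: algebra_simps)
  qed
  from zero_if_linear_le_quadratic[OF this] have "w = 0" by simp
  then have "A *v v = l *\<^sub>R v" by (simp add: w_def)
  with vS v1 show ?thesis by (rule that)
qed

text \<open>Induction on the dimension: the vectors of \<open>S\<close> orthogonal to one
  eigenvector form a smaller subspace, which is again invariant by symmetry of
  \<open>A\<close>.\<close>

lemma sym_eigenbasis_subspace:
  fixes A :: "real^'d^'d"
  assumes sym: "transpose A = A" and "subspace S" and "\<And>x. x \<in> S \<Longrightarrow> A *v x \<in> S"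
  shows "\<exists>E. finite E \<and> pairwise orthogonal E \<and> (\<forall>e\<in>E. norm e = 1 \<and> (\<exists>l. A *v e = l *\<^sub>R e)) \<and> span E = S"
  using assms(2,3)
proof (induction "dim S" arbitrary: S rule: less_induct)
  case less
  show ?case
  proof (cases "S = {0}")
    case True
    then show ?thesis by (intro exI[of _ "{}"]) auto
  next
    case False
    from sym_eigenvector[OF sym less(2) False less(3)] obtain v l where
      v: "v \<in> S" "norm v = 1" "A *v v = l *\<^sub>R v" by blast
    define S' where "S' = S \<inter> {x. v \<bullet> x = 0}"
    have sub: "subspace S'" unfolding S'_def using less(2) by (intro subspace_inter subspace_hyperplane)
    have "v \<notin> S'" using v(2) by (auto simp: S'_def)
    then have "S' \<subset> S" using v(1) unfolding S'_def by blast
    then have "dim S' < dim S" using sub less(2) by (intro dim_psubset) (simp add: span_eq_iff[THEN iffD2])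
    moreover have "A *v x \<in> S'" if "x \<in> S'" for x
      using that less(3) v(3) sym_inner[OF sym, of v x] by (auto simp: S'_def)
    ultimately obtain E where E: "finite E" "pairwise orthogonal E"
      "\<And>e. e \<in> E \<Longrightarrow> norm e = 1 \<and> (\<exists>l. A *v e = l *\<^sub>R e)" "span E = S'"
      using less(1)[OF _ sub] by blast
    have ES: "E \<subseteq> S'" using E(4) span_superset by auto
    have "span (insert v E) = S"
    proof
      show "span (insert v E) \<subseteq> S"
        using v ES less(2) by (intro span_minimal) (auto simp: S'_def)
      show "S \<subseteq> span (insert v E)"
      proof
        fix x assume x: "x \<in> S"
        have "x - (v \<bullet> x) *\<^sub>R v \<in> S'"
          using x v less(2) by (auto simp: S'_def subspace_diff subspace_scale inner_diff_right dot_square_norm)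
        then have "x - (v \<bullet> x) *\<^sub>R v \<in> span (insert v E)" using E(4) span_mono[of E "insert v E"] by auto
        moreover have "(v \<bullet> x) *\<^sub>R v \<in> span (insert v E)" by (intro span_scale span_base) auto
        ultimately have "(x - (v \<bullet> x) *\<^sub>R v) + (v \<bullet> x) *\<^sub>R v \<in> span (insert v E)" by (rule span_add)
        then show "x \<in> span (insert v E)" by simp
      qed
    qed
    moreover have "pairwise orthogonal (insert v E)"
      using E(2) ES by (auto simp: pairwise_insert orthogonal_def S'_def inner_commute)
    ultimately show ?thesis using E(1,3) v by (intro exI[of _ "insert v E"]) auto
  qed
qed

lemma sym_eigenbasis:
  fixes A :: "real^'d^'d"
  assumes "transpose A = A"
  shows "\<exists>E l. finite E \<and> (\<forall>e\<in>E. norm e = 1 \<and> A *v e = l e *\<^sub>R e) \<and> (\<forall>x. (\<Sum>e\<in>E. (x \<bullet> e) *\<^sub>R e) = x)"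
proof -
  from sym_eigenbasis_subspace[OF assms, of UNIV] obtain E where
    E: "finite E" "pairwise orthogonal E" "\<And>e. e \<in> E \<Longrightarrow> norm e = 1 \<and> (\<exists>l. A *v e = l *\<^sub>R e)" "span E = UNIV"
    by auto
  then obtain l where l: "\<And>e. e \<in> E \<Longrightarrow> A *v e = l e *\<^sub>R e" by metis
  have "(\<Sum>e\<in>E. (x \<bullet> e) *\<^sub>R e) = x" for x
    using E by (intro orthonormal_basis_expand) auto
  then show ?thesis using E l by (intro exI[of _ E] exI[of _ l]) auto
qed

text \<open>The vector x minimises the nonnegative form, so the first variation at x in the
  direction \<open>A *v x\<close> vanishes.\<close>

lemma psd_quad_zero:
  assumes "sym_psd (A::real^'d^'d)" "x \<bullet> (A *v x) = 0" shows "A *v x = 0"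
proof -
  have sym: "transpose A = A" and pos: "\<And>v. 0 \<le> v \<bullet> (A *v v)" using assms by (auto simp: sym_psd_def)
  define w where "w = A *v x"
  have "t * (2 * (w \<bullet> w)) \<le> t\<^sup>2 * (w \<bullet> (A *v w))" for t
    using pos[of "x - t *\<^sub>R w"] assms(2) sym_inner[OF sym, of x w]
    by (simp add: w_def[symmetric] matrix_vector_mult_scaleR matrix_vector_mult_diff_distrib inner_diff_left
        inner_diff_right algebra_simps power2_eq_square inner_commute)
  from zero_if_linear_le_quadratic[OF this] show ?thesis by (simp add: w_def)
qed

lemma psd_sqrt_exists:
  fixes A :: "real^'d^'d"
  assumes "sym_psd A" shows "\<exists>B. sym_psd B \<and> B ** B = A"
proof -
  have sym: "transpose A = A" and pos: "\<And>v. 0 \<le> v \<bullet> (A *v v)" using assms by (auto simp: sym_psd_def)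
  obtain E l where *: "finite E" "\<forall>e\<in>E. norm e = 1 \<and> A *v e = l e *\<^sub>R e"
    "\<forall>x. (\<Sum>e\<in>E. (x \<bullet> e) *\<^sub>R e) = x" using sym_eigenbasis[OF sym] by blast
  have E: "finite E" "\<And>e. e \<in> E \<Longrightarrow> norm e = 1" "\<And>e. e \<in> E \<Longrightarrow> A *v e = l e *\<^sub>R e"
    "\<And>x. (\<Sum>e\<in>E. (x \<bullet> e) *\<^sub>R e) = x" using * by auto
  have l: "0 \<le> l e" if "e \<in> E" for e using pos[of e] E(2,3)[OF that] by (simp add: dot_square_norm)
  define f where "f x = (\<Sum>e\<in>E. (sqrt (l e) * (x \<bullet> e)) *\<^sub>R e)" for x
  have lin: "linear f" unfolding f_def
    by (intro linear_compose_sum ballI linearI) (auto simp: inner_add_left algebra_simps)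
  define B where "B = matrix f"
  have Bf: "B *v x = f x" for x unfolding B_def using lin by (simp add: matrix_works)
  have "f x \<bullet> y = x \<bullet> f y" for x y
    by (simp add: f_def inner_sum_left inner_sum_right inner_commute algebra_simps)
  then have "x \<bullet> (transpose B *v y) = x \<bullet> (B *v y)" for x y
    by (metis Bf dot_lmul_matrix transpose_matrix_vector inner_commute)
  then have "transpose B *v y = B *v y" for y by (metis vector_eq_rdot inner_commute)
  then have "transpose B = B" by (simp add: matrix_eq del: transpose_matrix_vector)
  moreover have "0 \<le> v \<bullet> (B *v v)" for v
    by (auto simp: Bf f_def inner_sum_right mult.assoc intro!: sum_nonneg l mult_nonneg_nonneg[OF _ zero_le_square])
  moreover have "B ** B = A"
  proof -
    have fe: "f e = sqrt (l e) *\<^sub>R e" if "e \<in> E" for e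
    proof -
      \<comment> \<open>Orthogonality of \<open>E\<close> was not kept in
        \<open>sym_eigenbasis\<close>. By symmetry of \<open>A\<close>, either the two eigenvalues
        agree or the inner product is zero.\<close>
      have "sqrt (l e') * (e \<bullet> e') = sqrt (l e) * (e \<bullet> e')" if "e' \<in> E" for e'
      proof -
        have "l e * (e \<bullet> e') = l e' * (e \<bullet> e')"
          using sym_inner[OF sym, of e e'] E(3)[OF \<open>e \<in> E\<close>] E(3)[OF that] by auto
        then show ?thesis by (metis mult_cancel_right)
      qed
      then have "f e = (\<Sum>e'\<in>E. (sqrt (l e) * (e \<bullet> e')) *\<^sub>R e')" unfolding f_def by (intro sum.cong) auto
      also have "\<dots> = sqrt (l e) *\<^sub>R (\<Sum>e'\<in>E. (e \<bullet> e') *\<^sub>R e')" by (simp add: scaleR_sum_right)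
      finally show ?thesis by (simp add: E(4))
    qed
    have "f (f x) = A *v x" for x
    proof -
      have "f (f x) = (\<Sum>e\<in>E. (sqrt (l e) * (x \<bullet> e)) *\<^sub>R f e)"
        by (subst f_def) (simp add: linear_sum[OF lin] linear_cmul[OF lin])
      also have "\<dots> = (\<Sum>e\<in>E. (x \<bullet> e) *\<^sub>R (A *v e))"
        by (intro sum.cong) (auto simp: fe E(3) l real_sqrt_mult[symmetric] mult.commute mult.left_commute)
      also have "\<dots> = A *v (\<Sum>e\<in>E. (x \<bullet> e) *\<^sub>R e)"
        by (simp add: linear_sum[OF matrix_vector_mul_linear] matrix_vector_mult_scaleR)
      finally show ?thesis by (simp add: E(4))
    qed
    then show ?thesis by (simp add: matrix_eq matrix_vector_mul_assoc[symmetric] Bf)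
  qed
  ultimately show ?thesis by (auto simp: sym_psd_def)
qed

text \<open>Diagonalise B - C. On an eigenvector e with nonzero eigenvalue, |B e| = |C e| makes B e
  - C e orthogonal to B e + C e. Hence the nonnegative numbers e.Be and e.Ce add up to zero, and B e
  and C e both vanish.\<close>

lemma psd_sqrt_unique:
  fixes B C :: "real^'d^'d"
  assumes B: "sym_psd B" and C: "sym_psd C" and eq: "B ** B = C ** C" shows "B = C"
proof -
  have sB: "transpose B = B" and sC: "transpose C = C" using B C by (auto simp: sym_psd_def)
  have "transpose (B - C) = B - C" using sB sC by (simp add: transpose_def vec_eq_iff)
  note sym = this
  obtain E l where *: "finite E" "\<forall>e\<in>E. norm e = 1 \<and> (B - C) *v e = l e *\<^sub>R e"
    "\<forall>x. (\<Sum>e\<in>E. (x \<bullet> e) *\<^sub>R e) = x" using sym_eigenbasis[OF sym] by blast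
  have E: "finite E" "\<And>e. e \<in> E \<Longrightarrow> norm e = 1" "\<And>e. e \<in> E \<Longrightarrow> (B - C) *v e = l e *\<^sub>R e"
    "\<And>x. (\<Sum>e\<in>E. (x \<bullet> e) *\<^sub>R e) = x" using * by auto
  have 0: "(B - C) *v e = 0" if "e \<in> E" for e
  proof (cases "l e = 0")
    case False
    have 1: "B *v e - C *v e = l e *\<^sub>R e" using E(3)[OF that] by (simp add: matrix_vector_mult_diff_rdistrib)
    have "(B *v e) \<bullet> (B *v e) = (C *v e) \<bullet> (C *v e)"
      using eq sym_inner[OF sB, of e "B *v e"] sym_inner[OF sC, of e "C *v e"] by (simp add: matrix_vector_mul_assoc)
    then have "(B *v e - C *v e) \<bullet> (B *v e + C *v e) = 0"
      by (simp only: inner_diff_left inner_add_right inner_commute[of "C *v e" "B *v e"])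
    then have "l e * (e \<bullet> (B *v e) + e \<bullet> (C *v e)) = 0" by (simp add: 1 inner_add_right distrib_left)
    then have "e \<bullet> (B *v e) + e \<bullet> (C *v e) = 0" using False by (simp only: mult_eq_0_iff simp_thms)
    moreover have "0 \<le> e \<bullet> (B *v e)" "0 \<le> e \<bullet> (C *v e)" using B C by (auto simp: sym_psd_def)
    ultimately have "e \<bullet> (B *v e) = 0" "e \<bullet> (C *v e) = 0" by auto
    from this(1)[THEN psd_quad_zero[OF B]] this(2)[THEN psd_quad_zero[OF C]] show ?thesis
      by (simp add: matrix_vector_mult_diff_rdistrib)
  qed (use E(3)[OF that] in simp)
  have "(B - C) *v x = 0" for x
  proof -
    have "(B - C) *v x = (B - C) *v (\<Sum>e\<in>E. (x \<bullet> e) *\<^sub>R e)" by (simp only: E(4))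
    also have "\<dots> = (\<Sum>e\<in>E. (x \<bullet> e) *\<^sub>R ((B - C) *v e))"
      by (simp only: linear_sum[OF matrix_vector_mul_linear] matrix_vector_mult_scaleR)
    finally show ?thesis by (simp add: 0)
  qed
  then show ?thesis by (simp add: matrix_eq matrix_vector_mult_diff_rdistrib)
qed

lemma psd_sqrt:
  assumes "sym_psd A" shows "sym_psd (psd_sqrt A)" "psd_sqrt A ** psd_sqrt A = A"
proof -
  have "\<exists>!B. sym_psd B \<and> B ** B = A" using psd_sqrt_exists[OF assms] psd_sqrt_unique by blast
  then have "sym_psd (psd_sqrt A) \<and> psd_sqrt A ** psd_sqrt A = A" unfolding psd_sqrt_def by (rule theI')
  then show "sym_psd (psd_sqrt A)" "psd_sqrt A ** psd_sqrt A = A" by auto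
qed

lemma norm_psd_sqrt:
  assumes "sym_psd A" shows "(norm (psd_sqrt A *v x))\<^sup>2 = x \<bullet> (A *v x)"
proof -
  have "transpose (psd_sqrt A) = psd_sqrt A" using psd_sqrt[OF assms] by (simp add: sym_psd_def)
  from sym_inner[OF this, of x "psd_sqrt A *v x"] show ?thesis
    by (simp add: matrix_vector_mul_assoc psd_sqrt[OF assms] power2_norm_eq_inner)
qed

section \<open>Operator norm, trace and Frobenius norm (the norm of the type)\<close>

lemma op_norm_le: "norm (A *v x) \<le> op_norm A * norm (x::real^'d)"
  unfolding op_norm_def by (rule onorm) (rule matrix_vector_mul_bounded_linear)

lemma op_norm_nonneg: "0 \<le> op_norm A"
  unfolding op_norm_def by (rule onorm_pos_le) (rule matrix_vector_mul_bounded_linear)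

lemma norm_matrix_vector_le: "norm (A *v x) \<le> norm (A::real^'d^'d) * norm x"
proof -
  have "(norm (A *v x))\<^sup>2 = (\<Sum>i\<in>UNIV. (A $ i \<bullet> x)\<^sup>2)"
    unfolding power2_norm_eq_inner by (simp add: inner_vec_def matrix_vector_mult_def power2_eq_square)
  also have "\<dots> \<le> (\<Sum>i\<in>UNIV. (A $ i \<bullet> A $ i) * (x \<bullet> x))" by (intro sum_mono Cauchy_Schwarz_ineq)
  also have "\<dots> = (norm A * norm x)\<^sup>2"
    by (simp add: power_mult_distrib power2_norm_eq_inner inner_vec_def sum_distrib_right)
  finally show ?thesis by (rule power2_le_imp_le) simp
qed

lemma op_norm_le_norm: "op_norm A \<le> norm (A::real^'d^'d)"
  unfolding op_norm_def by (rule onorm_bound) (auto intro: norm_matrix_vector_le)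

lemma quad_le_op_norm: "x \<bullet> (A *v x) \<le> op_norm A * (norm (x::real^'d))\<^sup>2"
proof -
  have "x \<bullet> (A *v x) \<le> norm x * norm (A *v x)" by (rule norm_cauchy_schwarz)
  also have "\<dots> \<le> norm x * (op_norm A * norm x)" by (intro mult_left_mono op_norm_le) auto
  finally show ?thesis by (simp add: power2_eq_square algebra_simps)
qed

lemma op_norm_continuous: "continuous_on UNIV (op_norm :: real^'d^'d \<Rightarrow> real)"
proof -
  have "\<bar>op_norm A - op_norm B\<bar> \<le> norm (A - B)" for A B :: "real^'d^'d"
  proof -
    have "op_norm A \<le> op_norm B + op_norm (A - B)" for A B :: "real^'d^'d"
      unfolding op_norm_def
      using onorm_triangle[OF matrix_vector_mul_bounded_linear[of B] matrix_vector_mul_bounded_linear[of "A - B"]]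
      by (simp add: matrix_vector_mult_diff_rdistrib)
    from this[of A B] this[of B A] op_norm_le_norm[of "A - B"] op_norm_le_norm[of "B - A"] show ?thesis
      by (simp add: norm_minus_commute)
  qed
  then show ?thesis unfolding continuous_on_iff dist_norm real_norm_def
    by (meson le_less_trans)
qed

lemma trace_square_sym: "transpose A = (A::real^'d^'d) \<Longrightarrow> trace (A ** A) = (norm A)\<^sup>2"
  by (simp add: trace_def matrix_matrix_mult_def power2_norm_eq_inner inner_vec_def transpose_def vec_eq_iff)

text \<open>Writing A as the square of its root B leaves a single factor of the operator norm in
  front of |B x|^2 = x.Ax. This is what later gives bounds in terms of the energy instead of
  |theta|^2.\<close>

lemma psd_norm_image_le:
  assumes "sym_psd (A::real^'d^'d)" shows "(norm (A *v x))\<^sup>2 \<le> op_norm A * (x \<bullet> (A *v x))"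
proof -
  define B where "B = psd_sqrt A"
  have B: "A *v y = B *v (B *v y)" for y using psd_sqrt(2)[OF assms] by (simp add: B_def matrix_vector_mul_assoc)
  have "(norm (A *v x))\<^sup>2 = (norm (B *v (B *v x)))\<^sup>2" by (simp add: B)
  also have "\<dots> = (B *v x) \<bullet> (A *v (B *v x))" unfolding B_def by (rule norm_psd_sqrt[OF assms])
  also have "\<dots> \<le> op_norm A * (norm (B *v x))\<^sup>2" by (rule quad_le_op_norm)
  also have "(norm (B *v x))\<^sup>2 = x \<bullet> (A *v x)" unfolding B_def by (rule norm_psd_sqrt[OF assms])
  finally show ?thesis .
qed

lemma psd_op_norm_le_trace:
  assumes "sym_psd (A::real^'d^'d)" shows "op_norm A \<le> trace A"
proof -
  define B where "B = psd_sqrt A"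
  have B: "A *v y = B *v (B *v y)" for y using psd_sqrt(2)[OF assms] by (simp add: B_def matrix_vector_mul_assoc)
  have "transpose B = B" using psd_sqrt[OF assms] by (simp add: sym_psd_def B_def)
  from trace_square_sym[OF this] have tr: "trace A = (norm B)\<^sup>2" using psd_sqrt(2)[OF assms] by (simp add: B_def)
  have "norm (A *v x) \<le> trace A * norm x" for x
  proof -
    have "norm (A *v x) \<le> norm B * norm (B *v x)" unfolding B by (rule norm_matrix_vector_le)
    also have "\<dots> \<le> norm B * (norm B * norm x)" by (intro mult_left_mono norm_matrix_vector_le) auto
    finally show ?thesis by (simp add: tr power2_eq_square algebra_simps)
  qed
  then show ?thesis unfolding op_norm_def by (rule onorm_bound[rotated]) (simp add: tr)
qed

lemma trace_eq_sum_axis: "trace A = (\<Sum>i\<in>UNIV. axis i 1 \<bullet> ((A::real^'d^'d) *v axis i 1))"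
  by (simp add: trace_def matrix_vector_mult_basis column_def inner_axis' )

lemma psd_trace_square_le:
  assumes "sym_psd (A::real^'d^'d)" shows "trace (A ** A) \<le> op_norm A * trace A"
proof -
  have sym: "transpose A = A" using assms by (simp add: sym_psd_def)
  have "trace (A ** A) = (\<Sum>i\<in>UNIV. (norm (A *v axis i 1))\<^sup>2)"
    unfolding trace_eq_sum_axis power2_norm_eq_inner
    by (intro sum.cong refl) (simp only: matrix_vector_mul_assoc[symmetric] sym_inner[OF sym, of _ "A *v _"])
  also have "\<dots> \<le> (\<Sum>i\<in>UNIV. op_norm A * (axis i 1 \<bullet> (A *v axis i 1)))"
    by (intro sum_mono psd_norm_image_le assms)
  finally show ?thesis by (simp add: trace_eq_sum_axis sum_distrib_left)
qed

lemma op_norm_square_le_trace_square: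
  assumes "sym_psd (A::real^'d^'d)" shows "(op_norm A)\<^sup>2 \<le> trace (A ** A)"
  using assms op_norm_le_norm[of A] op_norm_nonneg[of A] by (auto simp: trace_square_sym sym_psd_def intro: power_mono)

section \<open>The influence function\<close>

text \<open>The usual upper envelope of \<open>psi\<close>: its exponential is a quadratic
  polynomial, so that exponential moments reduce to second moments.\<close>

definition log_quad :: "real \<Rightarrow> real" where "log_quad t = ln (1 + t + t\<^sup>2 / 2)"

lemma quad_pos: "1 + t + t\<^sup>2 / 2 \<ge> (1/2 :: real)"
  using zero_le_power2[of "1 + t"] by (simp add: power2_eq_square algebra_simps)

lemma quad_pos': "1 + t + t\<^sup>2 / 2 > (0 :: real)" using quad_pos[of t] by linarith

lemma log_quad_ge: "log_quad t \<ge> - ln 2"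
proof -
  have "ln (1/2) \<le> log_quad t" unfolding log_quad_def using quad_pos[of t] by (intro ln_mono) auto
  then show ?thesis by (simp add: ln_div)
qed

definition log_quad_slope :: "real \<Rightarrow> real" where "log_quad_slope t = (1 + t) / (1 + t + t\<^sup>2 / 2)"

lemma log_quad_deriv: "(log_quad has_real_derivative log_quad_slope t) (at t)"
  unfolding log_quad_def[abs_def] log_quad_slope_def by (rule derivative_eq_intros refl | simp add: quad_pos')+

lemma log_quad_slope_deriv: "(log_quad_slope has_real_derivative (- t - t\<^sup>2 / 2) / (1 + t + t\<^sup>2 / 2)\<^sup>2) (at t)"
proof -
  have "(log_quad_slope has_real_derivative (1 * (1 + t + t\<^sup>2 / 2) - (1 + t) * (1 + t)) / ((1 + t + t\<^sup>2 / 2) * (1 + t + t\<^sup>2 / 2))) (at t)"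
    unfolding log_quad_slope_def[abs_def] using quad_pos'[of t] by (auto intro!: derivative_eq_intros)
  moreover have "1 * (1 + t + t\<^sup>2 / 2) - (1 + t) * (1 + t) = - t - t\<^sup>2 / 2"
    by (simp add: power2_eq_square field_simps)
  ultimately show ?thesis unfolding power2_eq_square[of "1 + t + t\<^sup>2 / 2"] by (simp only:)
qed

text \<open>With u = (1 + t)^2 the denominator is (1 + u)^2 / 4 and the numerator (1 - u) / 2. After
  clearing the denominator the difference of the two sides is a perfect square, zero at u =
  3.\<close>

lemma log_quad_slope_deriv_ge: "(- t - t\<^sup>2 / 2) / (1 + t + t\<^sup>2 / 2)\<^sup>2 \<ge> - (1/4 :: real)"
proof -
  have "(1 + t + t\<^sup>2 / 2)\<^sup>2 / 4 + (- t - t\<^sup>2 / 2) = ((1 + t)\<^sup>2 - 3)\<^sup>2 / 16"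
    by (simp add: power2_eq_square field_simps)
  moreover have "((1 + t)\<^sup>2 - 3)\<^sup>2 / 16 \<ge> 0" by simp
  ultimately have "(1 + t + t\<^sup>2 / 2)\<^sup>2 / 4 + (- t - t\<^sup>2 / 2) \<ge> 0" by linarith
  then show ?thesis using quad_pos'[of t] by (simp add: pos_le_divide_eq)
qed

text \<open>By the curvature bound -1/4, \<open>log_quad\<close> plus t^2 / 8 is convex, and a
  convex function lies above its tangents.\<close>

lemma log_quad_taylor: "log_quad h \<ge> log_quad z + log_quad_slope z * (h - z) - (h - z)\<^sup>2 / 8"
proof -
  define g where "g t = log_quad t + t\<^sup>2 / 8" for t
  have 1: "(g has_real_derivative log_quad_slope t + t / 4) (at t)" for t
    unfolding g_def by (rule derivative_eq_intros log_quad_deriv refl | simp)+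
  have 2: "((\<lambda>t. log_quad_slope t + t / 4) has_real_derivative (- t - t\<^sup>2 / 2) / (1 + t + t\<^sup>2 / 2)\<^sup>2 + 1/4) (at t)" for t
    by (rule derivative_eq_intros log_quad_slope_deriv refl | simp)+
  have "convex_on UNIV g"
    by (rule f''_ge0_imp_convex[OF convex_UNIV 1 2]) (use log_quad_slope_deriv_ge in \<open>smt (verit)\<close>)
  then have "g h - g z \<ge> (log_quad_slope z + z / 4) * (h - z)"
    by (rule convex_on_imp_above_tangent[where A=UNIV]) (auto intro!: has_field_derivative_at_within 1)
  then show ?thesis unfolding g_def by (simp add: power2_eq_square algebra_simps add_divide_distrib diff_divide_distrib)
qed

text \<open>The quadratics at z and at -z multiply to 1 + z^4 / 4, which is at least 1.\<close>

lemma psi_le_log_quad: "psi z \<le> log_quad z"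
proof -
  have *: "- ln (1 - z + z\<^sup>2 / 2) \<le> log_quad z"
  proof -
    have "(1 + z + z\<^sup>2 / 2) * (1 - z + z\<^sup>2 / 2) = 1 + (z^2)\<^sup>2 / 4"
      by (simp add: power2_eq_square algebra_simps add_divide_distrib)
    then have "ln ((1 + z + z\<^sup>2 / 2) * (1 - z + z\<^sup>2 / 2)) \<ge> 0" by simp
    moreover have "1 - z + z\<^sup>2 / 2 > 0" using quad_pos'[of "-z"] by simp
    ultimately show ?thesis using quad_pos'[of z] by (simp add: ln_mult log_quad_def)
  qed
  have 1: "ln 2 \<le> log_quad z" if "1 \<le> z"
    unfolding log_quad_def using that by (intro ln_mono) (auto simp: power2_eq_square intro: add_increasing2)
  show ?thesis using * 1 log_quad_ge[of z] by (auto simp: psi_def log_quad_def)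
qed

lemma psi_le: "psi z \<le> ln 2"
proof -
  have "- ln (1 - z + z\<^sup>2 / 2) \<le> ln 2"
  proof -
    have "ln (1/2) \<le> ln (1 - z + z\<^sup>2 / 2)" using quad_pos[of "-z"] by (intro ln_mono) auto
    then show ?thesis by (simp add: ln_div)
  qed
  moreover have "ln (1 + z + z\<^sup>2 / 2) \<le> 0" if "-1 \<le> z" "z \<le> 0"
  proof -
    have "z * (1 + z / 2) \<le> 0" using that by (intro mult_nonpos_nonneg) auto
    then have "1 + z + z\<^sup>2 / 2 \<le> 1" by (simp add: power2_eq_square algebra_simps)
    then show ?thesis using quad_pos'[of z] by simp
  qed
  moreover have "ln 2 \<ge> (0::real)" "- ln 2 \<le> (ln 2 :: real)" by auto
  ultimately show ?thesis unfolding psi_def by (smt (verit))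
qed

text \<open>Clipping the positive and the negative part of the argument to [0, 1] replaces the four
  cases by one formula, from which oddness, continuity and monotonicity can be read off.\<close>

lemma psi_alt: "psi t = - ln (1 - min 1 (max 0 t) + (min 1 (max 0 t))\<^sup>2 / 2)
    + ln (1 - min 1 (max 0 (- t)) + (min 1 (max 0 (- t)))\<^sup>2 / 2)"
  by (auto simp: psi_def min_def max_def ln_div)

lemma psi_minus: "psi (- z) = - psi z"
  unfolding psi_alt by simp

lemma psi_arg_pos: "1 - t + t\<^sup>2 / 2 > (0::real)" using quad_pos'[of "-t"] by simp

lemma psi_cont: "continuous_on UNIV psi"
  unfolding psi_alt[abs_def]
  by (intro continuous_intros) (use psi_arg_pos in \<open>auto simp: less_imp_neq[THEN not_sym]\<close>)

lemma psi_mono: assumes "s \<le> t" shows "psi s \<le> psi t"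
proof -
  have *: "ln (1 - b + b\<^sup>2 / 2) \<le> ln (1 - a + a\<^sup>2 / 2)" if "a \<le> b" "b \<le> 1" for a b :: real
  proof -
    have "(b - a) * (1 - (a + b) / 2) \<ge> 0" using that by (intro mult_nonneg_nonneg) auto
    then have "1 - b + b\<^sup>2 / 2 \<le> 1 - a + a\<^sup>2 / 2" by (simp add: power2_eq_square field_simps)
    then show ?thesis using psi_arg_pos by (intro ln_mono) auto
  qed
  have "min 1 (max 0 s) \<le> min 1 (max 0 t)" "min 1 (max 0 (- t)) \<le> min 1 (max 0 (- s))" using assms by auto
  from this[THEN *] show ?thesis unfolding psi_alt by simp
qed

text \<open>On [0, 1] the function psi is concave, hence above its chord from (0, 0) to (1, ln
  2).\<close>

lemma psi_ge_linear: assumes "0 \<le> u" "u \<le> 1" shows "psi u \<ge> u * ln 2"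
proof -
  define g where "g t = ln (1 - t + t\<^sup>2 / 2)" for t :: real
  define g' where "g' t = (t - 1) / (1 - t + t\<^sup>2 / 2)" for t :: real
  define g'' where "g'' t = (t - t\<^sup>2 / 2) / (1 - t + t\<^sup>2 / 2)\<^sup>2" for t :: real
  have 1: "(g has_real_derivative g' t) (at t)" for t
    unfolding g_def g'_def by (rule derivative_eq_intros refl | simp add: psi_arg_pos)+
  have 2: "(g' has_real_derivative g'' t) (at t)" for t
  proof -
    have "(g' has_real_derivative (1 * (1 - t + t\<^sup>2 / 2) - (t - 1) * (t - 1)) / ((1 - t + t\<^sup>2 / 2) * (1 - t + t\<^sup>2 / 2))) (at t)"
      unfolding g'_def[abs_def] using psi_arg_pos[of t] by (auto intro!: derivative_eq_intros)
    moreover have "1 * (1 - t + t\<^sup>2 / 2) - (t - 1) * (t - 1) = t - t\<^sup>2 / 2"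
      by (simp add: power2_eq_square field_simps)
    ultimately show ?thesis unfolding g''_def power2_eq_square[of "1 - t + t\<^sup>2 / 2"] by (simp only:)
  qed
  have "convex_on {0..1} g"
  proof (rule f''_ge0_imp_convex[OF _ 1 2])
    fix t :: real assume "t \<in> {0..1}"
    then have "t * (1 - t / 2) \<ge> 0" by (intro mult_nonneg_nonneg) auto
    then show "g'' t \<ge> 0" unfolding g''_def
      by (intro divide_nonneg_nonneg zero_le_power2) (simp add: power2_eq_square algebra_simps)
  qed simp
  from convex_onD[OF this, of u 0 1] assms have "g u \<le> u * ln (1/2)" by (simp add: g_def)
  moreover have "psi u = - g u" using assms unfolding psi_alt g_def by simp
  ultimately show ?thesis by (simp add: ln_div)
qed

text \<open>Turns control of psi(y) into control at an arbitrary scale l >= 1. For y <= 1 the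
  argument is not positive and enlarging its modulus only helps, so l = 1 is the worst case and the
  chord bound applies on both sides. For y > 1, psi(y) is the maximum ln 2.\<close>

lemma psi_scaled_le:
  assumes "1 \<le> l" "0 \<le> y" shows "psi (l * (y - 1)) \<le> 2 * psi y - ln 2"
proof (cases "y \<le> 1")
  case True
  have "psi (l * (y - 1)) \<le> psi (y - 1)"
    using assms True mult_right_mono[of 1 l "1 - y"] by (intro psi_mono) (simp add: algebra_simps)
  also have "\<dots> = - psi (1 - y)" using psi_minus[of "1 - y"] by simp
  also have "\<dots> \<le> - ((1 - y) * ln 2)" using psi_ge_linear[of "1 - y"] assms True by simp
  finally have "psi (l * (y - 1)) \<le> y * ln 2 - ln 2" by (simp add: algebra_simps)
  moreover have "y * ln 2 \<ge> 0" using assms by simp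
  moreover have "psi y \<ge> y * ln 2" using psi_ge_linear assms True by simp
  ultimately show ?thesis by linarith
next
  case False
  then have "psi y \<ge> ln 2" using psi_mono[of 1 y] by (simp add: psi_def)
  then show ?thesis using psi_le[of "l * (y - 1)"] by simp
qed

lemma psi_nonpos: "z \<le> 0 \<Longrightarrow> psi z \<le> 0"
proof -
  assume "z \<le> 0"
  moreover have "ln (1 + z + z\<^sup>2 / 2) \<le> 0" if "-1 \<le> z" "z \<le> 0"
  proof -
    have "z * (1 + z / 2) \<le> 0" using that by (intro mult_nonpos_nonneg) auto
    then have "1 + z + z\<^sup>2 / 2 \<le> 1" by (simp add: power2_eq_square algebra_simps)
    then show ?thesis using quad_pos'[of z] by simp
  qed
  ultimately show ?thesis by (auto simp: psi_def)
qed

lemma ln2_bounds: "ln (2::real) \<ge> (69314/100000)" "ln (2::real) \<le> (69315/100000)"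
  using ln_approx_bounds[of 2 5] by (simp_all add: eval_nat_numeral)

lemma log_quad_slope_abs_le: "(log_quad_slope z)\<^sup>2 \<le> 1"
proof -
  have "(\<bar>1 + z\<bar> - 1)\<^sup>2 \<ge> 0" by simp
  then have "\<bar>1 + z\<bar> \<le> 1 + z + z\<^sup>2 / 2" by (simp add: power2_eq_square algebra_simps abs_if split: if_splits)
  then have "\<bar>log_quad_slope z\<bar> \<le> 1" unfolding log_quad_slope_def using quad_pos'[of z] by simp
  then show ?thesis by (simp add: abs_square_le_1)
qed

text \<open>With Q and R the quadratics 1 - z + z^2 / 2 and 1 + z + z^2 / 2, this polynomial is
  1.693 times 2 Q R^2, minus R^2, minus 2 Q (1 + z)^2. Below 1/2 the monomials are compared with z;
  above it the polynomial is expanded at 1/2, where the linear coefficient is the only negative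
  one.\<close>

lemma psi_slope_polynomial:
  fixes z :: real assumes "0 \<le> z" "z \<le> 1"
  shows "0 \<le> (386/1000) - (614/1000) * z + (693/1000) * z^2 - z^3 - (4035/10000) * z^4 + (8465/10000) * z^5 + (42325/100000) * z^6"
proof (cases "z \<le> 1/2")
  case True
  have z2: "z^2 \<ge> z - 1/4" using zero_le_power2[of "z - 1/2"] by (simp add: power2_eq_square algebra_simps)
  have "z^2 \<le> z * (1/2)" unfolding power2_eq_square using True assms by (intro mult_left_mono) auto
  moreover from this have z3: "z^3 \<le> z * (1/4)" using mult_left_mono[of "z^2" "z * (1/2)" z] assms
    by (simp add: power2_eq_square power3_eq_cube)
  moreover from this have z4: "z^4 \<le> z * (1/8)" using mult_left_mono[of "z^3" "z * (1/4)" z] assms \<open>z^2 \<le> z * (1/2)\<close>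
    by (simp add: power2_eq_square power3_eq_cube power4_eq_xxxx)
  moreover have "z^5 \<ge> 0" "z^6 \<ge> 0" using assms by auto
  ultimately show ?thesis using z2 True by linarith
next
  case False
  define y where "y = z - 1/2"
  have y: "0 \<le> y" using False by (simp add: y_def)
  have z: "z = y + 1/2" by (simp add: y_def)
  \<comment> \<open>The tangent line of y^3 at 0.36, whose slope is just large enough to absorb the
    negative linear coefficient.\<close>
  have "0 \<le> (y - (36/100))\<^sup>2 * (y + (72/100))" using y by (intro mult_nonneg_nonneg) auto
  then have y3: "y^3 \<ge> (3888/10000) * y - (93312/1000000)" by (simp add: power2_eq_square power3_eq_cube field_simps)
  have "(386/1000) - (614/1000) * z + (693/1000) * z^2 - z^3 - (4035/10000) * z^4 + (8465/10000) * z^5 + (42325/100000) * z^6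
      = (13509765625/100000000000) - (528859375/1000000000) * y + (42671875/1000000000) * y^2 + (1367375/1000000) * y^3 + (32999375/10000000) * y^4 + (211625/100000) * y^5 + (42325/100000) * y^6"
    unfolding z by (simp add: eval_nat_numeral field_simps)
  moreover have "y^2 \<ge> 0" "y^4 \<ge> 0" "y^5 \<ge> 0" "y^6 \<ge> 0" using y by auto
  ultimately show ?thesis using y3 y by linarith
qed

text \<open>The number 2 ln 2 becomes the truncation level of \<open>log_quad\<close>. It has to
  dominate the maximum over h of the quadratic in \<open>psi_le_minorant\<close>, which is exactly
  this sum.\<close>

lemma psi_plus_slope_le: "psi z + (log_quad_slope z)\<^sup>2 \<le> 2 * ln 2"
proof -
  consider "z < 0" | "0 \<le> z" "z \<le> 1" | "1 < z" by linarith
  then show ?thesis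
  proof cases
    case 1
    then show ?thesis using psi_nonpos[of z] log_quad_slope_abs_le[of z] ln2_bounds by simp
  next
    case 3
    have "0 \<le> (z - 1) * (2 * z + 1)" using 3 by (intro mult_nonneg_nonneg) auto
    then have "1 + z \<le> 4/5 * (1 + z + z\<^sup>2 / 2)" by (simp add: power2_eq_square field_simps)
    then have "log_quad_slope z \<le> 4/5" unfolding log_quad_slope_def using quad_pos'[of z] by (simp add: pos_divide_le_eq)
    moreover have "0 \<le> log_quad_slope z" unfolding log_quad_slope_def using 3 by auto
    ultimately have "(log_quad_slope z)\<^sup>2 \<le> (4/5)\<^sup>2" by (intro power_mono)
    then show ?thesis using psi_le[of z] ln2_bounds by (simp add: power2_eq_square)
  next
    case 2
    define Q where "Q = 1 - z + z\<^sup>2 / 2"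
    define R where "R = 1 + z + z\<^sup>2 / 2"
    have pos: "Q > 0" "R > 0" unfolding Q_def R_def by (rule psi_arg_pos quad_pos')+
    have "psi z = - ln Q" using 2 unfolding Q_def psi_alt by simp
    also have "\<dots> = ln 2 + ln (1 / (2 * Q))" using pos by (simp add: ln_div ln_mult)
    \<comment> \<open>The logarithm is linearised at Q = 1/2, its value for z = 1. What remains is
      to bound 1 / (2 Q) plus the squared slope by 1 + ln 2, rounded down to 1.693.\<close>
    also have "\<dots> \<le> ln 2 + (1 / (2 * Q) - 1)" using pos ln_le_minus_one[of "1 / (2 * Q)"] by simp
    finally have psi: "psi z \<le> ln 2 + 1 / (2 * Q) - 1" by simp
    have "1 / (2 * Q) + (log_quad_slope z)\<^sup>2 \<le> (1693/1000)"
    proof -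
      have "R^2 + 2 * Q * (1 + z)\<^sup>2 \<le> (1693/1000) * (2 * Q * R^2)"
        using psi_slope_polynomial[OF 2] unfolding Q_def R_def by (simp add: eval_nat_numeral field_simps)
      moreover have "1 / (2 * Q) + (log_quad_slope z)\<^sup>2 = (R^2 + 2 * Q * (1 + z)\<^sup>2) / (2 * Q * R^2)"
        using pos unfolding log_quad_slope_def R_def[symmetric] by (simp add: field_simps power2_eq_square)
      ultimately show ?thesis using pos by (simp add: pos_divide_le_eq)
    qed
    then show ?thesis using psi ln2_bounds by linarith
  qed
qed

text \<open>The coefficient 1/4, instead of the 1/8 that \<open>log_quad_taylor\<close> allows,
  makes the maximum of the quadratic over h equal to psi z plus the squared slope, so that it also
  stays below the truncation. Averaged over a perturbation h with mean z, the left side is psi z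
  minus a quarter of the variance.\<close>

lemma psi_le_minorant: "psi z + log_quad_slope z * (h - z) - (h - z)\<^sup>2 / 4 \<le> min (log_quad h) (2 * ln 2)"
proof -
  have "psi z + log_quad_slope z * (h - z) - (h - z)\<^sup>2 / 4 \<le> log_quad h"
    using log_quad_taylor[of z h] psi_le_log_quad[of z] zero_le_power2[of "h - z"] by linarith
  moreover have "0 \<le> (log_quad_slope z - (h - z) / 2)\<^sup>2" by simp
  then have "log_quad_slope z * (h - z) - (h - z)\<^sup>2 / 4 \<le> (log_quad_slope z)\<^sup>2" by (simp add: power2_eq_square algebra_simps)
  ultimately show ?thesis using psi_plus_slope_le[of z] by simp
qed

section \<open>The standard Gaussian measure\<close>

definition gauss :: "(real^'d) measure" where
  "gauss = density lborel (\<lambda>x. ennreal (\<Prod>i\<in>UNIV. std_normal_density (x $ i)))"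

lemma sets_gauss [simp, measurable_cong]: "sets gauss = sets borel" by (simp add: gauss_def)
lemma space_gauss [simp]: "space gauss = UNIV" by (simp add: gauss_def)

lemma prod_Basis_vec: "(\<Prod>b\<in>(Basis :: (real^'d) set). f b) = (\<Prod>i\<in>UNIV. f (axis i 1))"
proof -
  have "(Basis :: (real^'d) set) = (\<lambda>i. axis i 1) ` UNIV" by (auto simp: Basis_vec_def)
  note B = this
  show ?thesis unfolding B by (subst prod.reindex) (auto simp: inj_on_def axis_eq_axis)
qed

lemma nn_integral_gauss_prod:
  fixes f :: "'d::finite \<Rightarrow> real \<Rightarrow> real"
  assumes [measurable]: "\<And>i. f i \<in> borel_measurable borel" and nn: "\<And>i x. 0 \<le> f i x"
  shows "(\<integral>\<^sup>+(x::real^'d). ennreal (\<Prod>i\<in>UNIV. f i (x $ i)) \<partial>gauss) = (\<Prod>i\<in>UNIV. \<integral>\<^sup>+x. ennreal (std_normal_density x * f i x) \<partial>lborel)"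
proof -
  define g where "g b x = (\<lambda>i. std_normal_density x * f i x) (SOME i. b = (axis i 1 :: real^'d))" for b x
  have g: "g (axis i 1) x = std_normal_density x * f i x" for i x
    by (simp add: g_def axis_eq_axis)
  have [measurable]: "g b \<in> borel_measurable borel" for b unfolding g_def[abs_def] by measurable
  have "(\<integral>\<^sup>+(x::real^'d). ennreal (\<Prod>i\<in>UNIV. f i (x $ i)) \<partial>gauss)
     = (\<integral>\<^sup>+(x::real^'d). ennreal (\<Prod>i\<in>UNIV. std_normal_density (x $ i)) * ennreal (\<Prod>i\<in>UNIV. f i (x $ i)) \<partial>lborel)"
    unfolding gauss_def by (subst nn_integral_density) auto
  also have "\<dots> = (\<integral>\<^sup>+x. (\<Prod>b\<in>Basis. ennreal (g b (x \<bullet> b))) \<partial>(lborel :: (real^'d) measure))"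
    by (intro nn_integral_cong)
      (simp add: prod_Basis_vec g prod.distrib prod_ennreal nn ennreal_mult[symmetric] prod_nonneg inner_axis)
  also have "\<dots> = (\<Prod>b\<in>(Basis :: (real^'d) set). \<integral>\<^sup>+x. ennreal (g b x) \<partial>lborel)"
    by (rule nn_integral_lborel_prod) auto
  finally show ?thesis by (simp add: prod_Basis_vec g)
qed

lemma prob_space_gauss: "prob_space (gauss :: (real^'d) measure)"
proof
  have "emeasure (gauss :: (real^'d) measure) (space gauss) = (\<integral>\<^sup>+x. 1 \<partial>(gauss :: (real^'d) measure))" by simp
  also have "\<dots> = (\<Prod>i\<in>(UNIV::'d set). \<integral>\<^sup>+x. ennreal (std_normal_density x * 1) \<partial>lborel)"
    by (subst nn_integral_gauss_prod[symmetric]) auto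
  also have "\<dots> = 1" by (simp add: nn_integral_eq_integral integrable_normal_density integral_normal_density)
  finally show "emeasure (gauss :: (real^'d) measure) (space gauss) = 1" .
qed

lemma measure_gauss_UNIV [simp]: "measure (gauss :: (real^'d) measure) UNIV = 1"
  using prob_space.prob_space[OF prob_space_gauss] by simp

interpretation gauss: prob_space "gauss :: (real^'d) measure" by (rule prob_space_gauss)

text \<open>The Cameron-Martin formula: the exponential is the ratio of the Gaussian densities at x
  + s and at x, and Lebesgue measure is invariant under translation.\<close>

lemma gauss_shift:
  fixes s :: "real^'d"
  assumes [measurable]: "F \<in> borel_measurable borel"
  shows "(\<integral>\<^sup>+x. F (x + s) * ennreal (exp (- (s \<bullet> x) - (norm s)\<^sup>2 / 2)) \<partial>gauss) = (\<integral>\<^sup>+x. F x \<partial>gauss)"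
proof -
  define G where "G x = F x * ennreal (\<Prod>i\<in>UNIV. std_normal_density (x $ i))" for x
  have [measurable]: "G \<in> borel_measurable borel" unfolding G_def by measurable
  have dens: "(\<Prod>i\<in>UNIV. std_normal_density (x $ i)) * exp (- (s \<bullet> x) - (norm s)\<^sup>2 / 2) = (\<Prod>i\<in>UNIV. std_normal_density ((x + s) $ i))" for x
  proof -
    have "exp (- (s \<bullet> x) - (norm s)\<^sup>2 / 2) = (\<Prod>i\<in>UNIV. exp (- (s $ i * x $ i) - (s $ i)\<^sup>2 / 2))"
      unfolding power2_norm_eq_inner
      by (simp add: inner_vec_def exp_sum[symmetric] sum_subtractf sum_negf sum_divide_distrib power2_eq_square)
    moreover have "std_normal_density (x $ i) * exp (- (s $ i * x $ i) - (s $ i)\<^sup>2 / 2) = std_normal_density ((x + s) $ i)" for i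
      by (simp add: std_normal_density_def exp_add[symmetric]) (simp add: power2_eq_square field_simps)
    ultimately show ?thesis by (simp add: prod.distrib[symmetric])
  qed
  have "(\<integral>\<^sup>+x. F (x + s) * ennreal (exp (- (s \<bullet> x) - (norm s)\<^sup>2 / 2)) \<partial>gauss)
     = (\<integral>\<^sup>+x. ennreal (\<Prod>i\<in>UNIV. std_normal_density (x $ i)) * (F (x + s) * ennreal (exp (- (s \<bullet> x) - (norm s)\<^sup>2 / 2))) \<partial>lborel)"
    unfolding gauss_def by (subst nn_integral_density) (auto intro!: borel_measurable_continuous_onI continuous_intros)
  also have "\<dots> = (\<integral>\<^sup>+x. G (s + x) \<partial>lborel)"
    by (intro nn_integral_cong) (simp add: G_def dens[unfolded vector_add_component, symmetric] ennreal_mult prod_nonneg mult_ac add.commute)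
  also have "\<dots> = (\<integral>\<^sup>+x. G x \<partial>distr lborel borel ((+) s))"
    by (subst nn_integral_distr) auto
  also have "\<dots> = (\<integral>\<^sup>+x. G x \<partial>lborel)" by (simp add: lborel_distr_plus)
  also have "\<dots> = (\<integral>\<^sup>+x. F x \<partial>gauss)"
    unfolding gauss_def G_def by (subst nn_integral_density) (auto simp: mult_ac)
  finally show ?thesis .
qed

lemma integral_gauss_uminus:
  fixes f :: "real^'d \<Rightarrow> real"
  assumes [measurable]: "f \<in> borel_measurable borel"
  shows "(\<integral>x. f (- x) \<partial>gauss) = (\<integral>x. f x \<partial>gauss)"
proof -
  have "distr gauss borel uminus = (gauss :: (real^'d) measure)"
  proof (rule measure_eqI)
    fix A :: "(real^'d) set" assume "A \<in> sets (distr gauss borel uminus)"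
    then have [measurable]: "A \<in> sets borel" by simp
    have l: "distr lborel borel uminus = (lborel :: (real^'d) measure)"
      by (subst (2) lborel_affine[of "-1" 0]) (auto simp: density_1)
    have "emeasure (distr gauss borel uminus) A = (\<integral>\<^sup>+x. indicator A (- x) \<partial>gauss)"
      by (subst nn_integral_distr[symmetric, of uminus gauss borel "indicator A"]) auto
    also have "\<dots> = (\<integral>\<^sup>+(x::real^'d). ennreal (\<Prod>i\<in>UNIV. std_normal_density ((- x) $ i)) * indicator A (- x) \<partial>lborel)"
      unfolding gauss_def by (subst nn_integral_density) (auto simp: std_normal_density_def)
    also have "\<dots> = (\<integral>\<^sup>+(x::real^'d). ennreal (\<Prod>i\<in>UNIV. std_normal_density (x $ i)) * indicator A x \<partial>distr lborel borel uminus)"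
      by (subst nn_integral_distr) auto
    also have "\<dots> = emeasure gauss A" unfolding l gauss_def by (simp add: emeasure_density)
    finally show "emeasure (distr gauss borel uminus) A = emeasure gauss A" .
  qed simp
  then have "(\<integral>x. f x \<partial>gauss) = (\<integral>x. f x \<partial>distr gauss borel uminus)" by simp
  also have "\<dots> = (\<integral>x. f (- x) \<partial>gauss)" by (subst integral_distr) auto
  finally show ?thesis by simp
qed

text \<open>The Donsker-Varadhan inequality for N(0, I) and N(s, I), whose relative entropy is |s|^2
  / 2. It is obtained directly: after the shift, exp \<open>u\<close> has mean at most 1, and 1 + u
  <= exp u is integrated.\<close>

lemma gauss_change_of_measure:
  fixes \<Phi> :: "real^'d \<Rightarrow> real" and s :: "real^'d"
  assumes [measurable]: "\<Phi> \<in> borel_measurable borel" and int: "integrable gauss (\<lambda>x. \<Phi> (x + s))"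
    and int1: "integrable gauss (\<lambda>x. s \<bullet> x)" "(\<integral>x. s \<bullet> x \<partial>gauss) = 0"
    and c: "(\<integral>\<^sup>+x. ennreal (exp (\<Phi> x)) \<partial>gauss) \<le> ennreal (exp c)"
  shows "(\<integral>x. \<Phi> (x + s) \<partial>gauss) \<le> c + (norm s)\<^sup>2 / 2"
proof -
  define u where "u x = \<Phi> (x + s) - (s \<bullet> x) - (norm s)\<^sup>2 / 2 - c" for x
  have [measurable]: "(\<lambda>x. s \<bullet> x) \<in> borel_measurable borel" by (intro borel_measurable_continuous_onI continuous_intros)
  have [measurable]: "u \<in> borel_measurable borel" unfolding u_def by measurable
  have iu: "integrable gauss u" unfolding u_def using int int1 by auto
  have eq: "exp (u x) = exp (\<Phi> (x + s)) * exp (- (s \<bullet> x) - (norm s)\<^sup>2 / 2) * exp (- c)" for x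
    by (simp add: u_def exp_add[symmetric] algebra_simps)
  have "(\<integral>\<^sup>+x. ennreal (exp (u x)) \<partial>gauss) = ennreal (exp (- c)) * (\<integral>\<^sup>+x. ennreal (exp (\<Phi> x)) \<partial>gauss)"
    unfolding eq by (simp add: ennreal_mult nn_integral_multc gauss_shift[where F="\<lambda>x. ennreal (exp (\<Phi> x))"])
      (simp add: mult.commute)
  also have "\<dots> \<le> ennreal (exp (- c)) * ennreal (exp c)" by (intro mult_left_mono c) auto
  also have "\<dots> = 1" by (simp add: ennreal_mult[symmetric] exp_add[symmetric])
  finally have le1: "(\<integral>\<^sup>+x. ennreal (exp (u x)) \<partial>gauss) \<le> 1" .
  have ie: "integrable gauss (\<lambda>x. exp (u x))" using le1 by (intro integrableI_nonneg) (auto simp: top_unique less_top[symmetric])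
  have "ennreal (\<integral>x. exp (u x) \<partial>gauss) \<le> 1" using le1 ie by (simp add: nn_integral_eq_integral)
  then have "(\<integral>x. exp (u x) \<partial>gauss) \<le> 1" by simp
  moreover have "(\<integral>x. 1 + u x \<partial>gauss) \<le> (\<integral>x. exp (u x) \<partial>gauss)"
    using ie iu by (intro integral_mono) auto
  moreover have "(\<integral>x. 1 + u x \<partial>gauss) = 1 + (\<integral>x. u x \<partial>gauss)" using iu by (simp add: gauss.prob_space)
  moreover have "(\<integral>x. u x \<partial>gauss) = (\<integral>x. \<Phi> (x + s) \<partial>gauss) - (norm s)\<^sup>2 / 2 - c"
    unfolding u_def using int int1 by (simp add: gauss.prob_space)
  ultimately show ?thesis by simp
qed


section \<open>Moments of the standard Gaussian vector up to order four\<close>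

lemma integral_lborel_prod:
  fixes f :: "'a::euclidean_space \<Rightarrow> real \<Rightarrow> real"
  assumes int: "\<And>b. b \<in> Basis \<Longrightarrow> integrable lborel (f b)"
  shows "integrable (lborel :: 'a measure) (\<lambda>x. \<Prod>b\<in>Basis. f b (x \<bullet> b))"
    and "(\<integral>x. (\<Prod>b\<in>Basis. f b (x \<bullet> b)) \<partial>(lborel :: 'a measure)) = (\<Prod>b\<in>Basis. integral\<^sup>L lborel (f b))"
proof -
  interpret product_sigma_finite "\<lambda>_::'a. lborel :: real measure" by standard
  have [measurable]: "f b \<in> borel_measurable borel" if "b \<in> Basis" for b
    using borel_measurable_integrable[OF int[OF that]] by simp
  have l: "(lborel :: 'a measure) = distr (Pi\<^sub>M Basis (\<lambda>_. lborel)) borel (\<lambda>f. \<Sum>b\<in>Basis. f b *\<^sub>R b)"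
    by (simp add: lborel_def[where 'a='a] lborel_eq_real)
  show "integrable (lborel :: 'a measure) (\<lambda>x. \<Prod>b\<in>Basis. f b (x \<bullet> b))"
    unfolding l by (subst integrable_distr_eq) (auto intro!: product_integrable_prod int)
  show "(\<integral>x. (\<Prod>b\<in>Basis. f b (x \<bullet> b)) \<partial>(lborel :: 'a measure)) = (\<Prod>b\<in>Basis. integral\<^sup>L lborel (f b))"
    unfolding l by (subst integral_distr) (auto simp: product_integral_prod int)
qed

definition gmom :: "nat \<Rightarrow> real" where "gmom k = (\<integral>x. std_normal_density x * x ^ k \<partial>lborel)"

lemma gmom_simps: "gmom 0 = 1" "gmom (Suc 0) = 0" "gmom (Suc (Suc 0)) = 1"
    "gmom (Suc (Suc (Suc 0))) = 0" "gmom (Suc (Suc (Suc (Suc 0)))) = 3"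
  using integral_std_normal_moment_even[of 0] integral_std_normal_moment_even[of 1] integral_std_normal_moment_even[of 2]
    integral_std_normal_moment_odd[of 0] integral_std_normal_moment_odd[of 1]
  by (simp_all add: gmom_def fact_numeral eval_nat_numeral)

lemma gauss_monomial:
  fixes c :: "'d::finite \<Rightarrow> nat"
  shows "integrable gauss (\<lambda>x::real^'d. \<Prod>i\<in>UNIV. (x $ i) ^ c i)"
    and "(\<integral>x. (\<Prod>i\<in>UNIV. (x $ i) ^ c i) \<partial>(gauss :: (real^'d) measure)) = (\<Prod>i\<in>UNIV. gmom (c i))"
proof -
  define g where "g b x = (\<lambda>i. std_normal_density x * x ^ c i) (SOME i. b = (axis i 1 :: real^'d))" for b x
  have g: "g (axis i 1) = (\<lambda>x. std_normal_density x * x ^ c i)" for i by (rule ext) (simp add: g_def axis_eq_axis)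
  have ig: "integrable lborel (g b)" for b unfolding g_def by (rule integrable_std_normal_moment)
  have eq: "(\<Prod>i\<in>UNIV. std_normal_density (x $ i)) *\<^sub>R (\<Prod>i\<in>UNIV. (x $ i) ^ c i) = (\<Prod>b\<in>Basis. g b (x \<bullet> b))" for x :: "real^'d"
    by (simp add: prod_Basis_vec g prod.distrib inner_axis)
  note int = integral_lborel_prod[of g, OF ig]
  show "integrable gauss (\<lambda>x::real^'d. \<Prod>i\<in>UNIV. (x $ i) ^ c i)"
    unfolding gauss_def by (subst integrable_density) (use int(1) in \<open>auto simp: eq[unfolded real_scaleR_def] prod_nonneg\<close>)
  show "(\<integral>x. (\<Prod>i\<in>UNIV. (x $ i) ^ c i) \<partial>(gauss :: (real^'d) measure)) = (\<Prod>i\<in>UNIV. gmom (c i))"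
    unfolding gauss_def by (subst integral_density) (use int(2) in \<open>auto simp: eq[unfolded real_scaleR_def] prod_nonneg prod_Basis_vec g gmom_def\<close>)
qed

lemma prod_single_power: "(\<Prod>r\<in>(UNIV::'d::finite set). (x r :: real) ^ of_bool (r = i)) = x i"
proof -
  have "(\<Prod>r\<in>UNIV. x r ^ of_bool (r = i)) = (\<Prod>r\<in>UNIV. if r = i then x r else 1)" by (intro prod.cong) auto
  then show ?thesis by simp
qed

text \<open>Wick's formula. If some index differs from the three others, its coordinate enters to
  the first power and both sides vanish. Otherwise the indices match in pairs, and four equal
  indices count all three pairings.\<close>

lemma gauss_moment4:
  fixes i j k l :: "'d::finite"
  shows "integrable gauss (\<lambda>x::real^'d. x $ i * x $ j * x $ k * x $ l)"
    and "(\<integral>x. x $ i * x $ j * x $ k * x $ l \<partial>(gauss :: (real^'d) measure)) =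
      of_bool (i = j) * of_bool (k = l) + of_bool (i = k) * of_bool (j = l) + of_bool (j = k) * of_bool (i = l)"
proof -
  define c where "c r = (of_bool (r = i) + of_bool (r = j) + of_bool (r = k) + of_bool (r = l) :: nat)" for r
  have eq: "(\<Prod>r\<in>UNIV. (x $ r) ^ c r) = x $ i * x $ j * x $ k * x $ l" for x :: "real^'d"
    unfolding c_def power_add prod.distrib prod_single_power ..
  show "integrable gauss (\<lambda>x::real^'d. x $ i * x $ j * x $ k * x $ l)"
    using gauss_monomial(1)[of c] by (simp add: eq)
  have zero: "(\<Prod>r\<in>UNIV. gmom (c r)) = 0" if "gmom (c r) = 0" for r using that by (intro prod_zero) auto
  have one: "(\<Prod>r\<in>UNIV. gmom (c r)) = 1" if "\<And>r. gmom (c r) = 1" using that by simp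
  have "(\<Prod>r\<in>UNIV. gmom (c r)) =
      of_bool (i = j) * of_bool (k = l) + of_bool (i = k) * of_bool (j = l) + of_bool (j = k) * of_bool (i = l)"
  proof -
    consider "i = j" "k = l" "i = k" | "i = j" "k = l" "i \<noteq> k" | "i = k" "j = l" "i \<noteq> j" | "i = l" "j = k" "i \<noteq> j"
      | "i \<noteq> j" "i \<noteq> k" "i \<noteq> l" | "j \<noteq> i" "j \<noteq> k" "j \<noteq> l" | "k \<noteq> i" "k \<noteq> j" "k \<noteq> l" | "l \<noteq> i" "l \<noteq> j" "l \<noteq> k" by metis
    then show ?thesis
    proof cases
      case 1
      have "(\<Prod>r\<in>UNIV. gmom (c r)) = (\<Prod>r\<in>UNIV. if r = i then 3 else 1)"
        using 1 by (intro prod.cong) (auto simp: c_def gmom_simps)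
      then show ?thesis using 1 by simp
    next
      case 2 then show ?thesis by (subst one) (auto simp: c_def gmom_simps)
    next
      case 3 then show ?thesis by (subst one) (auto simp: c_def gmom_simps)
    next
      case 4 then show ?thesis by (subst one) (auto simp: c_def gmom_simps)
    next
      case 5 then show ?thesis by (subst zero[of i]) (auto simp: c_def gmom_simps)
    next
      case 6 then show ?thesis by (subst zero[of j]) (auto simp: c_def gmom_simps)
    next
      case 7 then show ?thesis by (subst zero[of k]) (auto simp: c_def gmom_simps)
    next
      case 8 then show ?thesis by (subst zero[of l]) (auto simp: c_def gmom_simps)
    qed
  qed
  then show "(\<integral>x. x $ i * x $ j * x $ k * x $ l \<partial>(gauss :: (real^'d) measure)) =
      of_bool (i = j) * of_bool (k = l) + of_bool (i = k) * of_bool (j = l) + of_bool (j = k) * of_bool (i = l)"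
    using gauss_monomial(2)[of c] by (simp add: eq)
qed

lemma gauss_moment2:
  fixes i j :: "'d::finite"
  shows "integrable gauss (\<lambda>x::real^'d. x $ i * x $ j)"
    and "(\<integral>x. x $ i * x $ j \<partial>(gauss :: (real^'d) measure)) = of_bool (i = j)"
proof -
  define c where "c r = (of_bool (r = i) + of_bool (r = j) :: nat)" for r
  have eq: "(\<Prod>r\<in>UNIV. (x $ r) ^ c r) = x $ i * x $ j" for x :: "real^'d"
    unfolding c_def power_add prod.distrib prod_single_power ..
  show "integrable gauss (\<lambda>x::real^'d. x $ i * x $ j)"
    using gauss_monomial(1)[of c] by (simp add: eq)
  have "(\<Prod>r\<in>UNIV. gmom (c r)) = of_bool (i = j)"
  proof (cases "i = j")
    case True
    then have "gmom (c r) = 1" for r by (auto simp: c_def gmom_simps)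
    then show ?thesis using True by simp
  next
    case False
    then have "gmom (c i) = 0" by (auto simp: c_def gmom_simps)
    then have "(\<Prod>r\<in>UNIV. gmom (c r)) = 0" by (intro prod_zero) auto
    then show ?thesis using False by simp
  qed
  then show "(\<integral>x. x $ i * x $ j \<partial>(gauss :: (real^'d) measure)) = of_bool (i = j)"
    using gauss_monomial(2)[of c] by (simp add: eq)
qed

lemma quad_form_sum: "x \<bullet> ((A::real^'d^'d) *v x) = (\<Sum>i\<in>UNIV. \<Sum>j\<in>UNIV. A $ i $ j * (x $ i * x $ j))"
  by (simp add: inner_vec_def matrix_vector_mult_def sum_distrib_left mult_ac)

lemma sum_delta_of_bool:
  fixes f :: "'d::finite \<Rightarrow> real"
  shows "(\<Sum>j\<in>UNIV. f j * of_bool (i = j)) = f i"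
proof -
  have "(\<Sum>j\<in>UNIV. f j * of_bool (i = j)) = (\<Sum>j\<in>UNIV. if i = j then f j else 0)" by (intro sum.cong) auto
  then show ?thesis by simp
qed

lemma gauss_quad:
  fixes A :: "real^'d^'d"
  shows "integrable gauss (\<lambda>x. x \<bullet> (A *v x))" and "(\<integral>x. x \<bullet> (A *v x) \<partial>gauss) = trace A"
proof -
  show "integrable gauss (\<lambda>x. x \<bullet> (A *v x))"
    unfolding quad_form_sum by (intro Bochner_Integration.integrable_sum integrable_mult_right gauss_moment2)
  have "(\<integral>x. x \<bullet> (A *v x) \<partial>gauss) = (\<Sum>i\<in>UNIV. \<Sum>j\<in>UNIV. A $ i $ j * of_bool (i = j))"
    unfolding quad_form_sum
    by (simp add: Bochner_Integration.integral_sum gauss_moment2)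
  then show "(\<integral>x. x \<bullet> (A *v x) \<partial>gauss) = trace A" unfolding sum_delta_of_bool by (simp add: trace_def)
qed

text \<open>Of the three pairings in Wick's formula one gives the squared trace and, by symmetry of
  A, the two others give the squared Frobenius norm.\<close>

lemma gauss_quad_square:
  fixes A :: "real^'d^'d"
  assumes sym: "transpose A = A"
  shows "integrable gauss (\<lambda>x. (x \<bullet> (A *v x))\<^sup>2)" and "(\<integral>x. (x \<bullet> (A *v x))\<^sup>2 \<partial>gauss) = (trace A)\<^sup>2 + 2 * (norm A)\<^sup>2"
proof -
  have eq: "(x \<bullet> (A *v x))\<^sup>2 = (\<Sum>i\<in>UNIV. \<Sum>j\<in>UNIV. \<Sum>k\<in>UNIV. \<Sum>l\<in>UNIV. A $ i $ j * A $ k $ l * (x $ i * x $ j * x $ k * x $ l))" for x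
    unfolding quad_form_sum power2_eq_square by (simp only: sum_distrib_right) (simp only: sum_distrib_left mult_ac)
  show "integrable gauss (\<lambda>x. (x \<bullet> (A *v x))\<^sup>2)"
    unfolding eq by (intro Bochner_Integration.integrable_sum integrable_mult_right gauss_moment4)
  have s: "A $ j $ i = A $ i $ j" for i j using sym by (simp add: transpose_def vec_eq_iff)
  have "(\<integral>x. (x \<bullet> (A *v x))\<^sup>2 \<partial>gauss) = (\<Sum>i\<in>UNIV. \<Sum>j\<in>UNIV. \<Sum>k\<in>UNIV. \<Sum>l\<in>UNIV. A $ i $ j * A $ k $ l *
     (of_bool (i = j) * of_bool (k = l) + of_bool (i = k) * of_bool (j = l) + of_bool (j = k) * of_bool (i = l)))"
    unfolding eq by (simp add: Bochner_Integration.integral_sum gauss_moment4 del: of_bool_conj)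
  also have "\<dots> = (\<Sum>i\<in>UNIV. \<Sum>j\<in>UNIV. \<Sum>k\<in>UNIV. \<Sum>l\<in>UNIV. A $ i $ j * A $ k $ l * (of_bool (i = j) * of_bool (k = l)))
     + (\<Sum>i\<in>UNIV. \<Sum>j\<in>UNIV. \<Sum>k\<in>UNIV. \<Sum>l\<in>UNIV. A $ i $ j * A $ k $ l * (of_bool (i = k) * of_bool (j = l)))
     + (\<Sum>i\<in>UNIV. \<Sum>j\<in>UNIV. \<Sum>k\<in>UNIV. \<Sum>l\<in>UNIV. A $ i $ j * A $ k $ l * (of_bool (j = k) * of_bool (i = l)))"
    by (simp only: distrib_left sum.distrib)
  also have "(\<Sum>i\<in>UNIV. \<Sum>j\<in>UNIV. \<Sum>k\<in>UNIV. \<Sum>l\<in>UNIV. A $ i $ j * A $ k $ l * (of_bool (i = j) * of_bool (k = l))) = (trace A)\<^sup>2"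
  proof -
    have "(\<Sum>k\<in>UNIV. \<Sum>l\<in>UNIV. A $ i $ j * A $ k $ l * (of_bool (i = j) * of_bool (k = l))) = (A $ i $ j * trace A) * of_bool (i = j)" for i j
      unfolding mult.assoc[symmetric] sum_delta_of_bool by (simp add: trace_def sum_distrib_left sum_distrib_right)
    then show ?thesis unfolding sum_delta_of_bool by (simp only: sum_delta_of_bool) (simp add: trace_def power2_eq_square sum_distrib_right)
  qed
  also have "(\<Sum>i\<in>UNIV. \<Sum>j\<in>UNIV. \<Sum>k\<in>UNIV. \<Sum>l\<in>UNIV. A $ i $ j * A $ k $ l * (of_bool (i = k) * of_bool (j = l))) = (norm A)\<^sup>2"
    unfolding mult.assoc[symmetric] sum_delta_of_bool power2_norm_eq_inner by (simp add: inner_vec_def)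
  also have "(\<Sum>i\<in>UNIV. \<Sum>j\<in>UNIV. \<Sum>k\<in>UNIV. \<Sum>l\<in>UNIV. A $ i $ j * A $ k $ l * (of_bool (j = k) * of_bool (i = l))) = (norm A)\<^sup>2"
    unfolding mult.assoc[symmetric] sum_delta_of_bool power2_norm_eq_inner by (simp add: inner_vec_def s)
  finally show "(\<integral>x. (x \<bullet> (A *v x))\<^sup>2 \<partial>gauss) = (trace A)\<^sup>2 + 2 * (norm A)\<^sup>2" by simp
qed

lemma gauss_linear:
  fixes w :: "real^'d"
  shows "integrable gauss (\<lambda>x. w \<bullet> x)" "(\<integral>x. w \<bullet> x \<partial>gauss) = 0"
    "integrable gauss (\<lambda>x. (w \<bullet> x)\<^sup>2)" "(\<integral>x. (w \<bullet> x)\<^sup>2 \<partial>gauss) = (norm w)\<^sup>2"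
proof -
  have [measurable]: "(\<lambda>x. w \<bullet> x) \<in> borel_measurable borel" by (intro borel_measurable_continuous_onI continuous_intros)
  have eq: "(w \<bullet> x)\<^sup>2 = (\<Sum>i\<in>UNIV. \<Sum>j\<in>UNIV. w $ i * w $ j * (x $ i * x $ j))" for x
    by (simp add: inner_vec_def power2_eq_square sum_product mult_ac)
  show i2: "integrable gauss (\<lambda>x. (w \<bullet> x)\<^sup>2)" unfolding eq by (intro Bochner_Integration.integrable_sum integrable_mult_right gauss_moment2)
  show "integrable gauss (\<lambda>x. w \<bullet> x)" by (rule gauss.square_integrable_imp_integrable[OF _ i2]) simp
  have "(\<integral>x. (w \<bullet> x)\<^sup>2 \<partial>gauss) = (\<Sum>i\<in>UNIV. \<Sum>j\<in>UNIV. w $ i * w $ j * of_bool (i = j))"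
    unfolding eq by (simp add: Bochner_Integration.integral_sum gauss_moment2)
  then show "(\<integral>x. (w \<bullet> x)\<^sup>2 \<partial>gauss) = (norm w)\<^sup>2"
    unfolding sum_delta_of_bool power2_norm_eq_inner by (simp add: inner_vec_def)
  show "(\<integral>x. w \<bullet> x \<partial>gauss) = 0"
    using integral_gauss_uminus[of "\<lambda>x. w \<bullet> x"] by simp
qed

section \<open>A PAC-Bayesian deviation inequality\<close>

text \<open>Plays the role of \<open>cst_c\<close> in the deviation inequality. That it is less than half of \<open>cst_c\<close> leaves
  the slack on which the whole proof relies.\<close>

definition dev_cst :: real where "dev_cst = 15 / ln 2"

text \<open>A Gaussian perturbation of theta with covariance I / b shifts the mean of the quadratic
  form by trace A / b. Subtracting it keeps the mean at theta.A theta - l.\<close>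

definition hquad :: "real \<Rightarrow> real \<Rightarrow> real^'d^'d \<Rightarrow> real^'d \<Rightarrow> real" where
  "hquad b l A y = y \<bullet> (A *v y) - trace A / b - l"

text \<open>At y = theta this is a quarter of the variance of \<open>hquad\<close> under the
  perturbation, which is the loss left by \<open>psi_le_minorant\<close>.\<close>

definition wquad :: "real \<Rightarrow> real^'d^'d \<Rightarrow> real^'d \<Rightarrow> real" where
  "wquad b A y = (norm (A *v y))\<^sup>2 / b + (norm A)\<^sup>2 / (2 * b\<^sup>2)"

text \<open>The truncations keep the function bounded whatever the tails of the matrix, and they are
  matched: 4 ln 2 is twice the most that the first summand can lose against psi, since it is at
  least -ln 2 and psi is at most ln 2. The sign s = 1 or -1 selects upper or lower
  deviations.\<close>

definition log_minorant :: "real \<Rightarrow> real \<Rightarrow> real \<Rightarrow> real^'d^'d \<Rightarrow> real^'d \<Rightarrow> real" where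
  "log_minorant s b l A y = min (log_quad (s * hquad b l A y)) (2 * ln 2) + min (4 * ln 2) (wquad b A y)"

lemma wquad_nonneg: "0 < b \<Longrightarrow> 0 \<le> wquad b A y" by (simp add: wquad_def)

lemma log_minorant_bounds: assumes "0 < b" shows "- ln 2 \<le> log_minorant s b l A y" "log_minorant s b l A y \<le> 6 * ln 2"
proof -
  have "(0::real) \<le> ln 2" by simp
  then show "- ln 2 \<le> log_minorant s b l A y" "log_minorant s b l A y \<le> 6 * ln 2"
    using wquad_nonneg[OF assms, of A y] log_quad_ge[of "s * hquad b l A y"] by (auto simp: log_minorant_def min_def)
qed

text \<open>The chord of the convex function exp over [0, 4 ln 2], along which it grows from 1 to
  16.\<close>

lemma exp_min_le:
  fixes x :: real assumes "0 \<le> x" shows "exp (min (4 * ln 2) x) - 1 \<le> 15 / (4 * ln 2) * x"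
proof -
  define T where "T = 4 * ln (2::real)"
  have T: "T > 0" by (simp add: T_def)
  have eT: "exp T = 16"
  proof -
    have "exp T = (exp (ln 2)) ^ 4" by (simp only: T_def exp_of_nat_mult[symmetric]) simp
    then show ?thesis by simp
  qed
  define t where "t = min T x"
  have t: "0 \<le> t" "t \<le> T" "t \<le> x" using assms T by (auto simp: t_def)
  have "convex_on UNIV (exp :: real \<Rightarrow> real)" by (rule exp_convex)
  from convex_onD[OF this, of "t / T" 0 T] have "exp t \<le> (1 - t / T) * 1 + t / T * exp T" using t T by simp
  then have "exp t - 1 \<le> 15 / T * t" unfolding eT by (simp add: algebra_simps)
  also have "\<dots> \<le> 15 / T * x" using t T by (intro mult_left_mono) auto
  finally show ?thesis by (simp add: t_def T_def)
qed

text \<open>Here the value of \<open>dev_cst\<close> arises. The truncation at 2 ln 2 bounds the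
  first exponential factor by 4, the second factor costs 15 / (4 ln 2) per unit of
  \<open>wquad\<close>, and the product is 15 / ln 2.\<close>

lemma exp_log_minorant_le:
  assumes "0 < b" "\<bar>s\<bar> = 1"
  shows "exp (log_minorant s b l A y) \<le> 1 + s * hquad b l A y + (hquad b l A y)\<^sup>2 / 2 + dev_cst * wquad b A y"
proof -
  define u where "u = exp (min (log_quad (s * hquad b l A y)) (2 * ln 2))"
  define v where "v = exp (min (4 * ln 2) (wquad b A y))"
  have s2: "s\<^sup>2 = 1" using assms(2) by (metis one_power2 power2_abs)
  have "u \<le> exp (log_quad (s * hquad b l A y))" unfolding u_def by simp
  also have "\<dots> = 1 + s * hquad b l A y + (s * hquad b l A y)\<^sup>2 / 2" unfolding log_quad_def using quad_pos' by simp
  finally have u1: "u \<le> 1 + s * hquad b l A y + (hquad b l A y)\<^sup>2 / 2" by (simp add: power_mult_distrib s2)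
  have "u \<le> exp (2 * ln 2)" unfolding u_def by simp
  also have "exp (2 * ln (2::real)) = (exp (ln 2))\<^sup>2" by (simp only: exp_double)
  finally have u2: "u \<le> 4" by simp
  have v1: "1 \<le> v" unfolding v_def using wquad_nonneg[OF assms(1)] by simp
  have "exp (log_minorant s b l A y) = u + u * (v - 1)" unfolding log_minorant_def exp_add u_def v_def by (simp add: algebra_simps)
  also have "u * (v - 1) \<le> 4 * (v - 1)" using u2 v1 by (intro mult_right_mono) auto
  also have "4 * (v - 1) \<le> 4 * (15 / (4 * ln 2) * wquad b A y)"
    unfolding v_def by (intro mult_left_mono exp_min_le wquad_nonneg assms) auto
  also have "4 * (15 / (4 * ln 2) * wquad b A y) = dev_cst * wquad b A y" by (simp add: dev_cst_def)
  finally show ?thesis using u1 by simp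
qed

lemma log_quad_measurable: "log_quad \<in> borel_measurable borel"
  unfolding log_quad_def[abs_def] by measurable

lemma continuous_on_matrix_vector: "continuous_on UNIV (\<lambda>p::(real^'d^'d) \<times> (real^'d). fst p *v snd p)"
  unfolding matrix_vector_mult_def by (intro continuous_intros)

lemma continuous_on_trace: "continuous_on UNIV (trace :: real^'d^'d \<Rightarrow> real)"
  unfolding trace_def by (intro continuous_intros)

lemma hquad_measurable_pair: "0 < b \<Longrightarrow> (\<lambda>p. hquad b l (fst p) (snd p)) \<in> borel_measurable borel"
  unfolding hquad_def
  by (intro borel_measurable_continuous_onI continuous_intros continuous_on_matrix_vector
      continuous_on_compose2[OF continuous_on_trace]) auto

lemma wquad_measurable_pair: "0 < b \<Longrightarrow> (\<lambda>p. wquad b (fst p) (snd p)) \<in> borel_measurable borel"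
  unfolding wquad_def
  by (intro borel_measurable_continuous_onI continuous_intros continuous_on_matrix_vector) auto

lemma log_minorant_measurable_pair:
  assumes "0 < b" shows "(\<lambda>p. log_minorant s b l (fst p) (snd p)) \<in> borel_measurable borel"
proof -
  have "(\<lambda>p. s * hquad b l (fst p) (snd p)) \<in> borel_measurable borel"
    by (rule borel_measurable_times[OF borel_measurable_const hquad_measurable_pair[OF assms]])
  from measurable_compose[OF this log_quad_measurable] wquad_measurable_pair[OF assms]
  show ?thesis unfolding log_minorant_def by measurable
qed

lemma pair_const_measurable: "(\<lambda>y::real^'d. (A::real^'d^'d, y)) \<in> borel_measurable borel"
  by (intro borel_measurable_continuous_onI continuous_intros)

lemma wquad_measurable: "0 < b \<Longrightarrow> wquad b A \<in> borel_measurable borel"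
  using measurable_compose[OF pair_const_measurable wquad_measurable_pair] by simp

lemma log_quad_hquad_measurable: "0 < b \<Longrightarrow> (\<lambda>y. log_quad (s * hquad b l A y)) \<in> borel_measurable borel"
  using measurable_compose[OF borel_measurable_times[OF borel_measurable_const
      measurable_compose[OF pair_const_measurable hquad_measurable_pair]] log_quad_measurable] by simp

lemma log_minorant_measurable: "0 < b \<Longrightarrow> log_minorant s b l A \<in> borel_measurable borel"
  using measurable_compose[OF pair_const_measurable log_minorant_measurable_pair] by simp

context
  fixes A :: "real^'d^'d" and \<theta> :: "real^'d" and b l :: real
  assumes sym: "transpose A = A" and b: "0 < b"
begin

private definition d where "d x = 2 / sqrt b * ((A *v \<theta>) \<bullet> x) + 1 / b * (x \<bullet> (A *v x) - trace A)" for x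

lemma hquad_shift: "hquad b l A (\<theta> + (1 / sqrt b) *\<^sub>R x) = (\<theta> \<bullet> (A *v \<theta>) - l) + d x"
proof -
  have "\<theta> \<bullet> (A *v x) = (A *v \<theta>) \<bullet> x" "x \<bullet> (A *v \<theta>) = (A *v \<theta>) \<bullet> x"
    using sym_inner[OF sym] by (auto simp: inner_commute)
  moreover define c where "c = 1 / sqrt b"
  moreover have "u / b = c * (c * u)" "2 / sqrt b = 2 * c" for u using b by (auto simp: c_def)
  ultimately show ?thesis
    unfolding hquad_def d_def c_def[symmetric]
    by (simp add: matrix_vector_right_distrib matrix_vector_mult_scaleR inner_add_left inner_add_right algebra_simps)
qed

lemma d_moments:
  shows "integrable gauss d" "integral\<^sup>L gauss d = 0" "integrable gauss (\<lambda>x. (d x)\<^sup>2)"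
    "(\<integral>x. (d x)\<^sup>2 \<partial>gauss) = 4 * (norm (A *v \<theta>))\<^sup>2 / b + 2 * (norm A)\<^sup>2 / b\<^sup>2"
proof -
  define p where "p x = (A *v \<theta>) \<bullet> x" for x
  define r where "r x = x \<bullet> (A *v x) - trace A" for x
  have [measurable]: "p \<in> borel_measurable borel" "r \<in> borel_measurable borel" unfolding p_def r_def
    by (intro borel_measurable_continuous_onI continuous_intros linear_continuous_on matrix_vector_mul_bounded_linear)+
  note lin = gauss_linear[of "A *v \<theta>", folded p_def]
  have r: "integrable gauss r" "integral\<^sup>L gauss r = 0"
    unfolding r_def using gauss_quad[of A] by auto
  have r2: "integrable gauss (\<lambda>x. (r x)\<^sup>2)" "(\<integral>x. (r x)\<^sup>2 \<partial>gauss) = 2 * (norm A)\<^sup>2"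
  proof -
    have eq: "(r x)\<^sup>2 = (x \<bullet> (A *v x))\<^sup>2 - 2 * trace A * (x \<bullet> (A *v x)) + (trace A)\<^sup>2" for x
      by (simp add: r_def power2_eq_square algebra_simps)
    show "integrable gauss (\<lambda>x. (r x)\<^sup>2)" unfolding eq using gauss_quad[of A] gauss_quad_square[OF sym] by auto
    show "(\<integral>x. (r x)\<^sup>2 \<partial>gauss) = 2 * (norm A)\<^sup>2" unfolding eq using gauss_quad[of A] gauss_quad_square[OF sym]
      by (simp add: power2_eq_square)
  qed
  have pr: "integrable gauss (\<lambda>x. p x * r x)"
  proof (rule Bochner_Integration.integrable_bound[OF Bochner_Integration.integrable_add[OF lin(3) r2(1)]])
    have "\<bar>p x * r x\<bar> \<le> (p x)\<^sup>2 + (r x)\<^sup>2" for x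
    proof -
      have "0 \<le> (\<bar>p x\<bar> - \<bar>r x\<bar>)\<^sup>2" by simp
      then have "2 * \<bar>p x * r x\<bar> \<le> (p x)\<^sup>2 + (r x)\<^sup>2" by (simp add: power2_eq_square algebra_simps abs_mult)
      then show ?thesis by linarith
    qed
    then show "AE x in gauss. norm (p x * r x) \<le> norm ((p x)\<^sup>2 + (r x)\<^sup>2)" by auto
  qed simp
  \<comment> \<open>The linear part is odd and the quadratic part even under x -> -x, so they are
    uncorrelated.\<close>
  have pr0: "(\<integral>x. p x * r x \<partial>gauss) = 0"
  proof -
    have "(\<integral>x. p x * r x \<partial>gauss) = (\<integral>x. p (- x) * r (- x) \<partial>gauss)"
      by (rule integral_gauss_uminus[of "\<lambda>x. p x * r x", symmetric]) simp
    also have "\<dots> = (\<integral>x. - (p x * r x) \<partial>gauss)"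
      by (simp add: p_def r_def linear_neg[OF matrix_vector_mul_linear])
    finally show ?thesis by simp
  qed
  have d: "d x = 2 / sqrt b * p x + 1 / b * r x" for x by (simp add: d_def p_def r_def)
  show "integrable gauss d" "integral\<^sup>L gauss d = 0" unfolding d using lin r by auto
  have d2: "(d x)\<^sup>2 = 4 / b * (p x)\<^sup>2 + 4 / (b * sqrt b) * (p x * r x) + 1 / b\<^sup>2 * (r x)\<^sup>2" for x
  proof -
    define c where "c = 1 / sqrt b"
    have c: "2 / sqrt b = 2 * c" "1 / b = c * c" "4 / b = 4 * (c * c)" "1 / b\<^sup>2 = c * (c * (c * c))" "4 / (b * sqrt b) = 4 * (c * (c * c))"
      using b by (auto simp: c_def power2_eq_square)
    show ?thesis unfolding d c by (simp add: power2_eq_square algebra_simps)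
  qed
  show "integrable gauss (\<lambda>x. (d x)\<^sup>2)" unfolding d2 using lin pr r2 by auto
  show "(\<integral>x. (d x)\<^sup>2 \<partial>gauss) = 4 * (norm (A *v \<theta>))\<^sup>2 / b + 2 * (norm A)\<^sup>2 / b\<^sup>2"
    unfolding d2 using lin pr r2 pr0 by simp
qed

lemma norm_image_moment: "integrable gauss (\<lambda>x. (norm (A *v x))\<^sup>2)" "(\<integral>x. (norm (A *v x))\<^sup>2 \<partial>gauss) = (norm A)\<^sup>2"
proof -
  have eq: "(norm (A *v x))\<^sup>2 = x \<bullet> ((A ** A) *v x)" for x
    unfolding power2_norm_eq_inner matrix_vector_mul_assoc[symmetric] using sym_inner[OF sym, of x "A *v x"] by simp
  show "integrable gauss (\<lambda>x. (norm (A *v x))\<^sup>2)" "(\<integral>x. (norm (A *v x))\<^sup>2 \<partial>gauss) = (norm A)\<^sup>2"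
    unfolding eq using gauss_quad[of "A ** A"] by (auto simp: trace_square_sym[OF sym])
qed

lemma wquad_shift: "wquad b A (\<theta> + (1 / sqrt b) *\<^sub>R x)
  = (norm (A *v \<theta>))\<^sup>2 / b + 2 / (b * sqrt b) * ((A *v \<theta>) \<bullet> (A *v x)) + (norm (A *v x))\<^sup>2 / b\<^sup>2 + (norm A)\<^sup>2 / (2 * b\<^sup>2)"
proof -
  define c where "c = 1 / sqrt b"
  have c: "u / b = c * (c * u)" "u / b\<^sup>2 = c * (c * (c * (c * u)))" "u / (b * sqrt b) = c * (c * (c * u))" for u
    using b by (auto simp: c_def power2_eq_square)
  have "(norm (A *v (\<theta> + c *\<^sub>R x)))\<^sup>2 = (norm (A *v \<theta>))\<^sup>2 + 2 * c * ((A *v \<theta>) \<bullet> (A *v x)) + c * (c * (norm (A *v x))\<^sup>2)"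
    unfolding power2_norm_eq_inner
    by (simp add: matrix_vector_right_distrib matrix_vector_mult_scaleR inner_add_left inner_add_right inner_commute)
  then show ?thesis unfolding wquad_def c_def[symmetric] by (simp add: c algebra_simps)
qed

lemma wquad_moment:
  shows "integrable gauss (\<lambda>x. wquad b A (\<theta> + (1 / sqrt b) *\<^sub>R x))"
    "(\<integral>x. wquad b A (\<theta> + (1 / sqrt b) *\<^sub>R x) \<partial>gauss) = (norm (A *v \<theta>))\<^sup>2 / b + 3 / 2 * (norm A)\<^sup>2 / b\<^sup>2"
proof -
  have "(A *v \<theta>) \<bullet> (A *v x) = (A *v (A *v \<theta>)) \<bullet> x" for x using sym_inner[OF sym] by simp
  then show "integrable gauss (\<lambda>x. wquad b A (\<theta> + (1 / sqrt b) *\<^sub>R x))"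
    "(\<integral>x. wquad b A (\<theta> + (1 / sqrt b) *\<^sub>R x) \<partial>gauss) = (norm (A *v \<theta>))\<^sup>2 / b + 3 / 2 * (norm A)\<^sup>2 / b\<^sup>2"
    unfolding wquad_shift using gauss_linear[of "A *v (A *v \<theta>)"] norm_image_moment by (auto simp: field_simps)
qed

lemma hquad_moment:
  shows "integrable gauss (\<lambda>x. hquad b l A (\<theta> + (1 / sqrt b) *\<^sub>R x))"
    "(\<integral>x. hquad b l A (\<theta> + (1 / sqrt b) *\<^sub>R x) \<partial>gauss) = \<theta> \<bullet> (A *v \<theta>) - l"
    "integrable gauss (\<lambda>x. (hquad b l A (\<theta> + (1 / sqrt b) *\<^sub>R x))\<^sup>2)"
    "(\<integral>x. (hquad b l A (\<theta> + (1 / sqrt b) *\<^sub>R x))\<^sup>2 \<partial>gauss)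
      = (\<theta> \<bullet> (A *v \<theta>) - l)\<^sup>2 + 4 * (norm (A *v \<theta>))\<^sup>2 / b + 2 * (norm A)\<^sup>2 / b\<^sup>2"
proof -
  define z where "z = \<theta> \<bullet> (A *v \<theta>) - l"
  have eq: "(z + d x)\<^sup>2 = z\<^sup>2 + 2 * z * d x + (d x)\<^sup>2" for x by (simp add: power2_sum)
  show "integrable gauss (\<lambda>x. hquad b l A (\<theta> + (1 / sqrt b) *\<^sub>R x))"
    "(\<integral>x. hquad b l A (\<theta> + (1 / sqrt b) *\<^sub>R x) \<partial>gauss) = \<theta> \<bullet> (A *v \<theta>) - l"
    unfolding hquad_shift z_def[symmetric] using d_moments(1) by (simp_all add: d_moments(2))
  have h2: "(hquad b l A (\<theta> + (1 / sqrt b) *\<^sub>R x))\<^sup>2 = z\<^sup>2 + (2 * z * d x + (d x)\<^sup>2)" for x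
    unfolding hquad_shift z_def[symmetric] eq by simp
  have i1: "integrable gauss (\<lambda>x. 2 * z * d x)" by (rule integrable_mult_right) (rule d_moments(1))
  have i2: "integrable gauss (\<lambda>x. 2 * z * d x + (d x)\<^sup>2)" by (rule Bochner_Integration.integrable_add[OF i1 d_moments(3)])
  have i0: "integrable gauss (\<lambda>x::real^'d. z\<^sup>2)" by simp
  show "integrable gauss (\<lambda>x. (hquad b l A (\<theta> + (1 / sqrt b) *\<^sub>R x))\<^sup>2)"
    unfolding h2 by (rule Bochner_Integration.integrable_add[OF i0 i2])
  show "(\<integral>x. (hquad b l A (\<theta> + (1 / sqrt b) *\<^sub>R x))\<^sup>2 \<partial>gauss)
      = (\<theta> \<bullet> (A *v \<theta>) - l)\<^sup>2 + 4 * (norm (A *v \<theta>))\<^sup>2 / b + 2 * (norm A)\<^sup>2 / b\<^sup>2"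
    unfolding h2 Bochner_Integration.integral_add[OF i0 i2] Bochner_Integration.integral_add[OF i1 d_moments(3)]
      d_moments(4) z_def[symmetric] by (simp add: d_moments(2))
qed

lemma log_minorant_shift_measurable [measurable]:
  "(\<lambda>x. log_minorant s b l A (\<theta> + (1 / sqrt b) *\<^sub>R x)) \<in> borel_measurable borel"
  "(\<lambda>x. wquad b A (\<theta> + (1 / sqrt b) *\<^sub>R x)) \<in> borel_measurable borel"
  "(\<lambda>x. log_quad (s * hquad b l A (\<theta> + (1 / sqrt b) *\<^sub>R x))) \<in> borel_measurable borel"
proof -
  have t: "(\<lambda>x. \<theta> + (1 / sqrt b) *\<^sub>R x) \<in> borel_measurable borel"
    by (intro borel_measurable_continuous_onI continuous_intros)
  show "(\<lambda>x. log_minorant s b l A (\<theta> + (1 / sqrt b) *\<^sub>R x)) \<in> borel_measurable borel"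
    by (rule measurable_compose[OF t log_minorant_measurable[OF b]])
  show "(\<lambda>x. wquad b A (\<theta> + (1 / sqrt b) *\<^sub>R x)) \<in> borel_measurable borel"
    by (rule measurable_compose[OF t wquad_measurable[OF b]])
  show "(\<lambda>x. log_quad (s * hquad b l A (\<theta> + (1 / sqrt b) *\<^sub>R x))) \<in> borel_measurable borel"
    by (rule measurable_compose[OF t log_quad_hquad_measurable[OF b]])
qed

text \<open>On average the truncated logarithm loses at most \<open>y0\<close>, a quarter of the
  variance, and never more than 2 ln 2. The truncated compensator gains at least the smaller of
  these two numbers, so the balance is right in both cases.\<close>

lemma psi_le_integral_log_minorant:
  assumes s: "\<bar>s\<bar> = 1"
  shows "psi (s * (\<theta> \<bullet> (A *v \<theta>) - l)) \<le> (\<integral>x. log_minorant s b l A (\<theta> + (1 / sqrt b) *\<^sub>R x) \<partial>gauss)"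
proof -
  define z where "z = s * (\<theta> \<bullet> (A *v \<theta>) - l)"
  define f where "f x = min (log_quad (s * hquad b l A (\<theta> + (1 / sqrt b) *\<^sub>R x))) (2 * ln 2)" for x
  define w where "w x = wquad b A (\<theta> + (1 / sqrt b) *\<^sub>R x)" for x
  define g where "g x = min (4 * ln 2) (w x)" for x
  define y0 where "y0 = (norm (A *v \<theta>))\<^sup>2 / b + (norm A)\<^sup>2 / (2 * b\<^sup>2)"
  have s2: "s\<^sup>2 = 1" using s by (metis one_power2 power2_abs)
  have ln2: "0 \<le> ln (2::real)" by simp
  have [measurable]: "f \<in> borel_measurable borel" "w \<in> borel_measurable borel" "g \<in> borel_measurable borel"
    unfolding f_def w_def g_def by measurable
  have fb: "- ln 2 \<le> f x" "f x \<le> 2 * ln 2" for x unfolding f_def using log_quad_ge ln2 by (auto simp: min_def)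
  have w0: "0 \<le> w x" for x unfolding w_def using b by (rule wquad_nonneg)
  have if': "integrable gauss f" using fb by (intro gauss.integrable_const_bound[where B="2 * ln 2"]) (auto simp: abs_le_iff intro!: AE_I2, smt (verit))
  have ig: "integrable gauss g" using w0 ln2 unfolding g_def by (intro gauss.integrable_const_bound[where B="4 * ln 2"]) (auto simp: min_def)
  have fge: "f x \<ge> z' + log_quad_slope z * s * d x - (d x)\<^sup>2 / 4" if "z' = psi z" for x z'
    using psi_le_minorant[of z "s * hquad b l A (\<theta> + (1 / sqrt b) *\<^sub>R x)"] that
    unfolding f_def hquad_shift z_def by (simp add: algebra_simps power_mult_distrib s2)
  have "(\<integral>x. psi z + log_quad_slope z * s * d x - (d x)\<^sup>2 / 4 \<partial>gauss) \<le> (\<integral>x. f x \<partial>gauss)"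
    using d_moments if' fge by (intro integral_mono) auto
  moreover have "(\<integral>x. psi z + log_quad_slope z * s * d x - (d x)\<^sup>2 / 4 \<partial>gauss) = psi z - y0"
    using d_moments(1,3) by (simp add: d_moments(2,4) y0_def add_divide_distrib)
  ultimately have 1: "psi z - y0 \<le> (\<integral>x. f x \<partial>gauss)" by simp
  have "(\<integral>x. - ln 2 \<partial>(gauss :: (real^'d) measure)) \<le> (\<integral>x. f x \<partial>gauss)" using fb if' by (intro integral_mono) auto
  then have "- ln 2 \<le> (\<integral>x. f x \<partial>gauss)" by simp
  then have 2: "psi z - 2 * ln 2 \<le> (\<integral>x. f x \<partial>gauss)" using psi_le[of z] by linarith
  have ww: "w x + w (- x) \<ge> 2 * y0" for x
  proof -
    have "w x + w (- x) = 2 * y0 + 2 * ((norm (A *v x))\<^sup>2 / b\<^sup>2)"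
      unfolding w_def wquad_shift y0_def linear_neg[OF matrix_vector_mul_linear] by simp
    then show ?thesis by simp
  qed
  \<comment> \<open>Pairing x with -x cancels the cross term of \<open>wquad\<close>. If neither
    value reaches the truncation, their sum is at least 2 \<open>y0\<close>; otherwise it is at
    least 4 ln 2.\<close>
  have "2 * min (2 * ln 2) y0 \<le> g x + g (- x)" for x
    using ww[of x] w0[of x] w0[of "-x"] ln2 unfolding g_def min_def by (smt (verit))
  then have "(\<integral>x. 2 * min (2 * ln 2) y0 \<partial>(gauss :: (real^'d) measure)) \<le> (\<integral>x. g x + g (- x) \<partial>gauss)"
  proof (intro integral_mono)
    show "integrable gauss (\<lambda>x. g x + g (- x))"
      using w0 ln2 ig unfolding g_def
      by (intro Bochner_Integration.integrable_add gauss.integrable_const_bound[where B="4 * ln 2"]) (auto simp: min_def)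
  qed auto
  also have "\<dots> = (\<integral>x. g x \<partial>gauss) + (\<integral>x. g (- x) \<partial>gauss)"
  proof (rule Bochner_Integration.integral_add[OF ig])
    show "integrable gauss (\<lambda>x. g (- x))"
      using w0 ln2 unfolding g_def by (intro gauss.integrable_const_bound[where B="4 * ln 2"]) (auto simp: min_def)
  qed
  finally have 3: "min (2 * ln 2) y0 \<le> (\<integral>x. g x \<partial>gauss)" by (simp add: integral_gauss_uminus)
  have "(\<integral>x. log_minorant s b l A (\<theta> + (1 / sqrt b) *\<^sub>R x) \<partial>gauss) = (\<integral>x. f x \<partial>gauss) + (\<integral>x. g x \<partial>gauss)"
    unfolding log_minorant_def f_def[symmetric] w_def[symmetric] g_def[symmetric] using if' ig by simp
  then show ?thesis using 1 2 3 unfolding z_def[symmetric] by (auto simp: min_def split: if_splits)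
qed

lemma nn_integral_bound_shift:
  assumes s: "\<bar>s\<bar> = 1"
  shows "(\<integral>\<^sup>+x. ennreal (exp (log_minorant s b l A (\<theta> + (1 / sqrt b) *\<^sub>R x))) \<partial>gauss)
    \<le> ennreal (1 + (s * (\<theta> \<bullet> (A *v \<theta>) - l) + (\<theta> \<bullet> (A *v \<theta>) - l)\<^sup>2 / 2
        + (2 + dev_cst) * (norm (A *v \<theta>))\<^sup>2 / b + (1 + 3 / 2 * dev_cst) * (norm A)\<^sup>2 / b\<^sup>2))"
proof -
  let ?y = "\<lambda>x. \<theta> + (1 / sqrt b) *\<^sub>R x"
  have int: "integrable gauss (\<lambda>x. 1 + s * hquad b l A (?y x) + (hquad b l A (?y x))\<^sup>2 / 2 + dev_cst * wquad b A (?y x))"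
    using hquad_moment wquad_moment by auto
  have "(\<integral>\<^sup>+x. ennreal (exp (log_minorant s b l A (?y x))) \<partial>gauss)
    \<le> (\<integral>\<^sup>+x. ennreal (1 + s * hquad b l A (?y x) + (hquad b l A (?y x))\<^sup>2 / 2 + dev_cst * wquad b A (?y x)) \<partial>gauss)"
    by (intro nn_integral_mono ennreal_leI exp_log_minorant_le b s)
  also have "\<dots> = ennreal (\<integral>x. 1 + s * hquad b l A (?y x) + (hquad b l A (?y x))\<^sup>2 / 2 + dev_cst * wquad b A (?y x) \<partial>gauss)"
    using exp_log_minorant_le[OF b s, of l A] by (intro nn_integral_eq_integral int AE_I2) (smt (verit) exp_ge_zero)
  also have "(\<integral>x. 1 + s * hquad b l A (?y x) + (hquad b l A (?y x))\<^sup>2 / 2 + dev_cst * wquad b A (?y x) \<partial>gauss)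
    = 1 + (s * (\<theta> \<bullet> (A *v \<theta>) - l) + (\<theta> \<bullet> (A *v \<theta>) - l)\<^sup>2 / 2
        + (2 + dev_cst) * (norm (A *v \<theta>))\<^sup>2 / b + (1 + 3 / 2 * dev_cst) * (norm A)\<^sup>2 / b\<^sup>2)"
  proof -
    have alg: "1 + s * z + (z\<^sup>2 + 4 * u + 2 * v) / 2 + dev_cst * (u + 3 / 2 * v)
      = 1 + (s * z + z\<^sup>2 / 2 + (2 + dev_cst) * u + (1 + 3 / 2 * dev_cst) * v)" for z u v :: real
      by (simp add: algebra_simps add_divide_distrib)
    have "(\<integral>x. 1 + s * hquad b l A (?y x) + (hquad b l A (?y x))\<^sup>2 / 2 + dev_cst * wquad b A (?y x) \<partial>gauss)
      = 1 + s * (\<integral>x. hquad b l A (?y x) \<partial>gauss) + (\<integral>x. (hquad b l A (?y x))\<^sup>2 \<partial>gauss) / 2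
        + dev_cst * (\<integral>x. wquad b A (?y x) \<partial>gauss)"
      using hquad_moment(1,3) wquad_moment(1) by simp
    then show ?thesis
      unfolding hquad_moment(2,4) wquad_moment(2)
      using alg[of "\<theta> \<bullet> (A *v \<theta>) - l" "(norm (A *v \<theta>))\<^sup>2 / b" "(norm A)\<^sup>2 / b\<^sup>2"] by simp
  qed
  finally show ?thesis .
qed

end

text \<open>The right-hand side of \<open>nn_integral_bound_shift\<close> minus 1, so that its mean
  under the law of the matrix bounds a log-Laplace transform.\<close>

definition dev_term :: "real \<Rightarrow> real \<Rightarrow> real \<Rightarrow> real^'d \<Rightarrow> real^'d^'d \<Rightarrow> real" where
  "dev_term s b l \<theta> A = s * (\<theta> \<bullet> (A *v \<theta>) - l) + (\<theta> \<bullet> (A *v \<theta>) - l)\<^sup>2 / 2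
        + (2 + dev_cst) * (norm (A *v \<theta>))\<^sup>2 / b + (1 + 3 / 2 * dev_cst) * (norm A)\<^sup>2 / b\<^sup>2"

lemma dev_cst_pos: "0 < dev_cst" by (simp add: dev_cst_def)

lemma dev_term_ge:
  assumes "\<bar>s\<bar> = 1" "0 < b" shows "0 \<le> 1 + dev_term s b l \<theta> A"
proof -
  define z where "z = \<theta> \<bullet> (A *v \<theta>) - l"
  have s2: "s\<^sup>2 = 1" using assms by (metis one_power2 power2_abs)
  have "0 \<le> 1 + s * z + z\<^sup>2 / 2" using quad_pos[of "s * z"] by (simp add: power_mult_distrib s2)
  moreover have "0 \<le> (2 + dev_cst) * (norm (A *v \<theta>))\<^sup>2 / b" "0 \<le> (1 + 3 / 2 * dev_cst) * (norm A)\<^sup>2 / b\<^sup>2"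
    using dev_cst_pos assms by auto
  ultimately show ?thesis unfolding dev_term_def z_def by linarith
qed

lemma quad_abs_le: "\<bar>\<theta> \<bullet> (A *v \<theta>)\<bar> \<le> norm (A::real^'d^'d) * (norm \<theta>)\<^sup>2"
proof -
  have "\<bar>\<theta> \<bullet> (A *v \<theta>)\<bar> \<le> norm \<theta> * norm (A *v \<theta>)" by (rule Cauchy_Schwarz_ineq2)
  also have "\<dots> \<le> norm \<theta> * (norm A * norm \<theta>)" by (intro mult_left_mono norm_matrix_vector_le) auto
  finally show ?thesis by (simp add: power2_eq_square mult_ac)
qed

lemma mat_vec_measurable [measurable]: "(\<lambda>A::real^'d^'d. A *v \<theta>) \<in> borel_measurable borel"
proof -
  have "(\<lambda>A::real^'d^'d. (A, \<theta>)) \<in> borel_measurable borel" by (intro borel_measurable_continuous_onI continuous_intros)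
  from measurable_compose[OF this borel_measurable_continuous_onI[OF continuous_on_matrix_vector]] show ?thesis by simp
qed

lemma integrable_square_norm_matrix:
  fixes Q :: "(real^'d^'d) measure"
  assumes Q: "prob_space Q" and sets: "sets Q = sets borel" and int: "integrable Q (\<lambda>A. (norm A)\<^sup>2)"
  shows "integrable Q (\<lambda>A. \<theta> \<bullet> (A *v \<theta>))" "integrable Q (\<lambda>A. (\<theta> \<bullet> (A *v \<theta>))\<^sup>2)" "integrable Q (\<lambda>A. (norm (A *v \<theta>))\<^sup>2)"
proof -
  interpret Q: prob_space Q by fact
  have m [measurable_cong]: "sets Q = sets borel" by fact
  have [measurable]: "(\<lambda>A. \<theta> \<bullet> (A *v \<theta>)) \<in> borel_measurable Q" "(\<lambda>A. (norm (A *v \<theta>))\<^sup>2) \<in> borel_measurable Q" by measurable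
  show 2: "integrable Q (\<lambda>A. (\<theta> \<bullet> (A *v \<theta>))\<^sup>2)"
  proof (rule Bochner_Integration.integrable_bound[OF integrable_mult_right[OF int, of "(norm \<theta>) ^ 4"]])
    have "(\<theta> \<bullet> (A *v \<theta>))\<^sup>2 \<le> (norm A * (norm \<theta>)\<^sup>2)\<^sup>2" for A
      using power_mono[OF quad_abs_le abs_ge_zero, of \<theta> A 2] by simp
    then show "AE A in Q. norm ((\<theta> \<bullet> (A *v \<theta>))\<^sup>2) \<le> norm (norm \<theta> ^ 4 * (norm A)\<^sup>2)"
      by (auto simp: power_mult_distrib power_mult[symmetric] mult_ac)
  qed measurable
  then show "integrable Q (\<lambda>A. \<theta> \<bullet> (A *v \<theta>))" by (rule Q.square_integrable_imp_integrable[rotated]) measurable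
  show "integrable Q (\<lambda>A. (norm (A *v \<theta>))\<^sup>2)"
  proof (rule Bochner_Integration.integrable_bound[OF integrable_mult_right[OF int, of "(norm \<theta>)\<^sup>2"]])
    have "(norm (A *v \<theta>))\<^sup>2 \<le> (norm A * norm \<theta>)\<^sup>2" for A :: "real^'d^'d" by (intro power_mono norm_matrix_vector_le) auto
    then show "AE A in Q. norm ((norm (A *v \<theta>))\<^sup>2) \<le> norm ((norm \<theta>)\<^sup>2 * (norm A)\<^sup>2)"
      by (auto simp: power_mult_distrib mult_ac)
  qed measurable
qed

lemma integrable_dev_term:
  fixes Q :: "(real^'d^'d) measure"
  assumes Q: "prob_space Q" and sets: "sets Q = sets borel" and int: "integrable Q (\<lambda>A. (norm A)\<^sup>2)"
  shows "integrable Q (dev_term s b l \<theta>)"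
    "integral\<^sup>L Q (dev_term s b l \<theta>) = s * ((\<integral>A. \<theta> \<bullet> (A *v \<theta>) \<partial>Q) - l) + ((\<integral>A. (\<theta> \<bullet> (A *v \<theta>))\<^sup>2 \<partial>Q) - 2 * l * (\<integral>A. \<theta> \<bullet> (A *v \<theta>) \<partial>Q) + l\<^sup>2) / 2
      + (2 + dev_cst) * (\<integral>A. (norm (A *v \<theta>))\<^sup>2 \<partial>Q) / b + (1 + 3 / 2 * dev_cst) * (\<integral>A. (norm A)\<^sup>2 \<partial>Q) / b\<^sup>2"
proof -
  interpret Q: prob_space Q by fact
  note i = integrable_square_norm_matrix[OF assms, of \<theta>]
  have eq: "dev_term s b l \<theta> = (\<lambda>A. s * (\<theta> \<bullet> (A *v \<theta>) - l) + ((\<theta> \<bullet> (A *v \<theta>))\<^sup>2 - 2 * l * (\<theta> \<bullet> (A *v \<theta>)) + l\<^sup>2) / 2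
        + (2 + dev_cst) * (norm (A *v \<theta>))\<^sup>2 / b + (1 + 3 / 2 * dev_cst) * (norm A)\<^sup>2 / b\<^sup>2)"
    by (simp add: dev_term_def fun_eq_iff power2_eq_square algebra_simps)
  show "integrable Q (dev_term s b l \<theta>)" unfolding eq using i int by simp
  show "integral\<^sup>L Q (dev_term s b l \<theta>) = s * ((\<integral>A. \<theta> \<bullet> (A *v \<theta>) \<partial>Q) - l) + ((\<integral>A. (\<theta> \<bullet> (A *v \<theta>))\<^sup>2 \<partial>Q) - 2 * l * (\<integral>A. \<theta> \<bullet> (A *v \<theta>) \<partial>Q) + l\<^sup>2) / 2
      + (2 + dev_cst) * (\<integral>A. (norm (A *v \<theta>))\<^sup>2 \<partial>Q) / b + (1 + 3 / 2 * dev_cst) * (\<integral>A. (norm A)\<^sup>2 \<partial>Q) / b\<^sup>2"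
    unfolding eq using i int by (simp add: Q.prob_space)
qed

lemma log_minorant_comp_measurable:
  fixes f :: "'z \<Rightarrow> real^'d^'d" and h :: "'z \<Rightarrow> real^'d"
  assumes "f \<in> borel_measurable N" "h \<in> borel_measurable N" "0 < b"
  shows "(\<lambda>x. log_minorant s b l (f x) (h x)) \<in> borel_measurable N"
proof -
  have "(\<lambda>p. log_minorant s b l (fst p) (snd p)) \<in> borel_measurable (borel \<Otimes>\<^sub>M borel)"
    unfolding borel_prod by (rule log_minorant_measurable_pair[OF assms(3)])
  from measurable_compose[OF measurable_Pair[OF assms(1,2)] this] show ?thesis by simp
qed

text \<open>The prior is N(0, I / b) and the posteriors are its translates N(theta, I / b), of
  relative entropy b |theta|^2 / 2. The exponential process is normalised by its exact Laplace
  transform \<open>g\<close>, so that it has mean one at every perturbed point, and Markov's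
  inequality is applied once, to its average under the prior.\<close>

theorem pac_bayes:
  fixes M :: "'w measure" and A :: "nat \<Rightarrow> 'w \<Rightarrow> real^'d^'d" and Q :: "(real^'d^'d) measure"
  assumes M: "prob_space M" and indep: "prob_space.indep_vars M (\<lambda>_. borel) A {1..m}"
    and law: "\<And>i. i \<in> {1..m} \<Longrightarrow> distr M borel (A i) = Q"
    and Q: "prob_space Q" and sets: "sets Q = sets borel" and int: "integrable Q (\<lambda>A. (norm A)\<^sup>2)"
    and symQ: "AE A in Q. transpose A = A"
    and sym: "\<And>i \<omega>. i \<in> {1..m} \<Longrightarrow> \<omega> \<in> space M \<Longrightarrow> transpose (A i \<omega>) = A i \<omega>"
    and b: "0 < b" and \<delta>: "0 < \<delta>" and s: "\<bar>s\<bar> = 1"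
  shows "\<exists>E\<in>sets M. 1 - \<delta> \<le> measure M E \<and> (\<forall>\<omega>\<in>E. \<forall>\<theta>. (\<Sum>i=1..m. psi (s * (\<theta> \<bullet> (A i \<omega> *v \<theta>) - l)))
    \<le> real m * integral\<^sup>L Q (dev_term s b l \<theta>) + b * (norm \<theta>)\<^sup>2 / 2 + ln (1 / \<delta>))"
proof -
  interpret M: prob_space M by fact
  interpret Q: prob_space Q by fact
  interpret MG: pair_sigma_finite M "gauss :: (real^'d) measure" ..
  interpret QG: pair_sigma_finite Q "gauss :: (real^'d) measure" ..
  have setsQ [measurable_cong]: "sets Q = sets borel" by fact
  have A_meas: "A i \<in> borel_measurable M" if "i \<in> {1..m}" for i
    using indep that by (auto simp: M.indep_vars_def)
  define c where "c = 1 / sqrt b"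
  define G where "G = (log_minorant s b l :: real^'d^'d \<Rightarrow> real^'d \<Rightarrow> real)"
  have Gb: "- ln 2 \<le> G B y" "G B y \<le> 6 * ln 2" for B y using log_minorant_bounds[OF b] by (auto simp: G_def)
  note G_comp [measurable] = log_minorant_comp_measurable[where 'd='d and s=s and l=l, OF _ _ b, folded G_def]
  have iG: "integrable Q (\<lambda>B. exp (G B y))" for y
    using Gb by (intro Q.integrable_const_bound[where B="exp (6 * ln 2)"]) auto
  define g where "g y = (\<integral>B. exp (G B y) \<partial>Q)" for y
  have g_lower: "exp (- ln 2) \<le> g y" for y
    unfolding g_def using Gb iG by (intro Q.integral_ge_const) auto
  have g_upper: "g y \<le> exp (6 * ln 2)" for y
    unfolding g_def using Gb iG by (intro Q.integral_le_const) auto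
  have g_pos: "0 < g y" for y using g_lower[of y] by (rule less_le_trans[rotated]) simp
  have ln_g: "- ln 2 \<le> ln (g y)" "ln (g y) \<le> 6 * ln 2" for y
    using ln_mono[OF g_lower[of y]] ln_mono[OF g_upper g_pos, of y] by auto
  have [measurable]: "g \<in> borel_measurable borel" unfolding g_def by measurable
  have l2: "0 < ln (2::real)" by simp
  have Gabs: "\<bar>G B y\<bar> \<le> 6 * ln 2" for B y using Gb[of B y] l2 unfolding abs_le_iff by linarith
  have lngabs: "\<bar>ln (g y)\<bar> \<le> 6 * ln 2" for y using ln_g[of y] l2 unfolding abs_le_iff by linarith
  define \<Psi> where "\<Psi> \<omega> y = (\<Sum>i=1..m. G (A i \<omega>) y) - real m * ln (g y)" for \<omega> y
  define W where "W \<omega> = (\<integral>\<^sup>+x. ennreal (exp (\<Psi> \<omega> (c *\<^sub>R x))) \<partial>gauss)" for \<omega>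
  have [measurable]: "(\<lambda>p. \<Psi> (fst p) (c *\<^sub>R snd p)) \<in> borel_measurable (M \<Otimes>\<^sub>M gauss)"
  proof -
    have [measurable]: "(\<lambda>p. A i (fst p)) \<in> borel_measurable (M \<Otimes>\<^sub>M (gauss :: (real^'d) measure))" if "i \<in> {1..m}" for i
      by (rule measurable_compose[OF measurable_fst A_meas[OF that]])
    have [measurable]: "(\<lambda>p. c *\<^sub>R snd p) \<in> borel_measurable (M \<Otimes>\<^sub>M (gauss :: (real^'d) measure))"
      by (rule measurable_compose[OF measurable_snd]) simp
    show ?thesis unfolding \<Psi>_def by measurable
  qed
  have [measurable]: "W \<in> borel_measurable M" unfolding W_def by measurable
  have "(\<integral>\<^sup>+\<omega>. W \<omega> \<partial>M) = (\<integral>\<^sup>+x. (\<integral>\<^sup>+\<omega>. ennreal (exp (\<Psi> \<omega> (c *\<^sub>R x))) \<partial>M) \<partial>gauss)"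
    unfolding W_def by (rule MG.Fubini'[symmetric]) measurable
  also have "\<dots> = (\<integral>\<^sup>+x. 1 \<partial>(gauss :: (real^'d) measure))"
  proof (intro nn_integral_cong)
    fix x :: "real^'d"
    define y where "y = c *\<^sub>R x"
    have "(\<integral>\<^sup>+\<omega>. ennreal (exp (\<Psi> \<omega> y)) \<partial>M) = (\<integral>\<^sup>+\<omega>. (\<Prod>i\<in>{1..m}. ennreal (exp (G (A i \<omega>) y - ln (g y)))) \<partial>M)"
      by (intro nn_integral_cong) (simp add: \<Psi>_def prod_ennreal exp_sum[symmetric] sum_subtractf)
    also have "\<dots> = (\<Prod>i\<in>{1..m}. (\<integral>\<^sup>+\<omega>. ennreal (exp (G (A i \<omega>) y - ln (g y))) \<partial>M))"
      by (intro M.indep_vars_nn_integral M.indep_vars_compose2[OF indep]) auto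
    also have "\<dots> = (\<Prod>i\<in>{1..m}. 1)"
    proof (intro prod.cong refl)
      fix i assume i: "i \<in> {1..m}"
      have [measurable]: "A i \<in> borel_measurable M" by (rule A_meas[OF i])
      have "(\<integral>\<^sup>+\<omega>. ennreal (exp (G (A i \<omega>) y - ln (g y))) \<partial>M) = (\<integral>\<^sup>+B. ennreal (exp (G B y - ln (g y))) \<partial>Q)"
        unfolding law[OF i, symmetric] by (subst nn_integral_distr) auto
      also have "\<dots> = ennreal (\<integral>B. exp (G B y) / g y \<partial>Q)"
        using iG[of y] g_pos[of y] by (subst nn_integral_eq_integral[symmetric]) (auto simp: exp_diff)
      also have "(\<integral>B. exp (G B y) / g y \<partial>Q) = 1" using g_pos[of y] by (simp add: g_def)
      finally show "(\<integral>\<^sup>+\<omega>. ennreal (exp (G (A i \<omega>) y - ln (g y))) \<partial>M) = 1" by simp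
    qed
    finally show "(\<integral>\<^sup>+\<omega>. ennreal (exp (\<Psi> \<omega> (c *\<^sub>R x))) \<partial>M) = 1" by (simp add: y_def)
  qed
  also have "\<dots> = 1" using gauss.emeasure_space_1 by simp
  finally have EW: "(\<integral>\<^sup>+\<omega>. W \<omega> \<partial>M) = 1" .
  \<comment> \<open>This event does not involve theta. Uniformity in theta holds because the
    translate of the prior is chosen only afterwards.\<close>
  define F where "F = {\<omega>\<in>space M. 1 \<le> ennreal \<delta> * W \<omega>}"
  have [measurable]: "F \<in> sets M" unfolding F_def by measurable
  have "emeasure M F \<le> ennreal \<delta> * (\<integral>\<^sup>+\<omega>. W \<omega> * indicator (space M) \<omega> \<partial>M)"
    unfolding F_def by (rule nn_integral_Markov_inequality) auto
  also have "(\<integral>\<^sup>+\<omega>. W \<omega> * indicator (space M) \<omega> \<partial>M) = 1" unfolding EW[symmetric] by (intro nn_integral_cong) simp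
  finally have "measure M F \<le> \<delta>" using \<delta> by (simp add: M.emeasure_eq_measure)
  then have "1 - \<delta> \<le> measure M (space M - F)" by (simp add: M.prob_compl)
  moreover have "(\<Sum>i=1..m. psi (s * (\<theta> \<bullet> (A i \<omega> *v \<theta>) - l)))
    \<le> real m * integral\<^sup>L Q (dev_term s b l \<theta>) + b * (norm \<theta>)\<^sup>2 / 2 + ln (1 / \<delta>)" if \<omega>: "\<omega> \<in> space M - F" for \<omega> \<theta>
  proof -
    have "ennreal \<delta> * W \<omega> \<le> 1" using \<omega> by (auto simp: F_def not_le less_imp_le)
    then have "ennreal (1 / \<delta>) * (ennreal \<delta> * W \<omega>) \<le> ennreal (1 / \<delta>) * 1" by (intro mult_left_mono) auto
    moreover have "ennreal (1 / \<delta>) * (ennreal \<delta> * W \<omega>) = W \<omega>"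
      unfolding mult.assoc[symmetric] using \<delta> by (simp add: ennreal_mult[symmetric])
    ultimately have W: "W \<omega> \<le> ennreal (exp (ln (1 / \<delta>)))" using \<delta> by simp
    have shift: "c *\<^sub>R (x + sqrt b *\<^sub>R \<theta>) = \<theta> + (1 / sqrt b) *\<^sub>R x" for x
      using b by (simp add: c_def scaleR_add_right)
    have iGx: "integrable gauss (\<lambda>x. G B (\<theta> + (1 / sqrt b) *\<^sub>R x))" for B
      by (rule gauss.integrable_const_bound[where B="6 * ln 2"]) (simp_all add: Gabs G_comp)
    have ig: "integrable gauss (\<lambda>x. ln (g (\<theta> + (1 / sqrt b) *\<^sub>R x)))"
      by (rule gauss.integrable_const_bound[where B="6 * ln 2"]) (simp_all add: lngabs)
    have i\<Psi>: "integrable gauss (\<lambda>x. \<Psi> \<omega> (\<theta> + (1 / sqrt b) *\<^sub>R x))"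
      unfolding \<Psi>_def using iGx ig by simp
    have "(\<integral>x. \<Psi> \<omega> (c *\<^sub>R (x + sqrt b *\<^sub>R \<theta>)) \<partial>gauss) \<le> ln (1 / \<delta>) + (norm (sqrt b *\<^sub>R \<theta>))\<^sup>2 / 2"
    proof (rule gauss_change_of_measure)
      show "(\<lambda>x. \<Psi> \<omega> (c *\<^sub>R x)) \<in> borel_measurable borel" unfolding \<Psi>_def by measurable
      show "integrable gauss (\<lambda>x. \<Psi> \<omega> (c *\<^sub>R (x + sqrt b *\<^sub>R \<theta>)))" unfolding shift by (rule i\<Psi>)
      show "(\<integral>\<^sup>+x. ennreal (exp (\<Psi> \<omega> (c *\<^sub>R x))) \<partial>gauss) \<le> ennreal (exp (ln (1 / \<delta>)))" using W unfolding W_def .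
    qed (rule gauss_linear)+
    then have 1: "(\<integral>x. \<Psi> \<omega> (\<theta> + (1 / sqrt b) *\<^sub>R x) \<partial>gauss) \<le> ln (1 / \<delta>) + b * (norm \<theta>)\<^sup>2 / 2"
      unfolding shift using b by (simp add: power_mult_distrib)
    have 2: "(\<integral>x. \<Psi> \<omega> (\<theta> + (1 / sqrt b) *\<^sub>R x) \<partial>gauss)
      = (\<Sum>i=1..m. \<integral>x. G (A i \<omega>) (\<theta> + (1 / sqrt b) *\<^sub>R x) \<partial>gauss) - real m * (\<integral>x. ln (g (\<theta> + (1 / sqrt b) *\<^sub>R x)) \<partial>gauss)"
      unfolding \<Psi>_def using iGx ig by simp
    have 3: "(\<Sum>i=1..m. psi (s * (\<theta> \<bullet> (A i \<omega> *v \<theta>) - l))) \<le> (\<Sum>i=1..m. \<integral>x. G (A i \<omega>) (\<theta> + (1 / sqrt b) *\<^sub>R x) \<partial>gauss)"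
      unfolding G_def using \<omega> by (intro sum_mono psi_le_integral_log_minorant sym b s) auto
    \<comment> \<open>The logarithm under the Gaussian average is removed by ln g <= g - 1. Fubini
      then allows the Gaussian moments to be computed for each fixed matrix.\<close>
    have 4: "(\<integral>x. ln (g (\<theta> + (1 / sqrt b) *\<^sub>R x)) \<partial>gauss) \<le> integral\<^sup>L Q (dev_term s b l \<theta>)"
    proof -
      have igg: "integrable gauss (\<lambda>x. g (\<theta> + (1 / sqrt b) *\<^sub>R x))"
        using g_upper g_pos by (intro gauss.integrable_const_bound[where B="exp (6 * ln 2)"]) (auto simp: less_imp_le)
      have "(\<integral>x. ln (g (\<theta> + (1 / sqrt b) *\<^sub>R x)) \<partial>gauss) \<le> (\<integral>x. g (\<theta> + (1 / sqrt b) *\<^sub>R x) - 1 \<partial>gauss)"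
        using ig igg g_pos by (intro integral_mono ln_le_minus_one) auto
      also have "\<dots> = (\<integral>x. g (\<theta> + (1 / sqrt b) *\<^sub>R x) \<partial>gauss) - 1" using igg by simp
      also have "(\<integral>x. g (\<theta> + (1 / sqrt b) *\<^sub>R x) \<partial>gauss) \<le> 1 + integral\<^sup>L Q (dev_term s b l \<theta>)"
      proof -
        note id = integrable_dev_term[OF Q sets int, of s b l \<theta>]
        have "ennreal (\<integral>x. g (\<theta> + (1 / sqrt b) *\<^sub>R x) \<partial>gauss) = (\<integral>\<^sup>+x. ennreal (g (\<theta> + (1 / sqrt b) *\<^sub>R x)) \<partial>gauss)"
          using igg g_pos by (subst nn_integral_eq_integral) (auto simp: less_imp_le)
        also have "\<dots> = (\<integral>\<^sup>+x. (\<integral>\<^sup>+B. ennreal (exp (G B (\<theta> + (1 / sqrt b) *\<^sub>R x))) \<partial>Q) \<partial>gauss)"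
          unfolding g_def using iG by (intro nn_integral_cong) (simp add: nn_integral_eq_integral)
        also have "\<dots> = (\<integral>\<^sup>+B. (\<integral>\<^sup>+x. ennreal (exp (G B (\<theta> + (1 / sqrt b) *\<^sub>R x))) \<partial>gauss) \<partial>Q)"
          by (rule QG.Fubini') measurable
        also have "\<dots> \<le> (\<integral>\<^sup>+B. ennreal (1 + dev_term s b l \<theta> B) \<partial>Q)"
          using symQ nn_integral_bound_shift[OF _ b s] unfolding G_def dev_term_def
          by (intro nn_integral_mono_AE) auto
        also have "\<dots> = ennreal (\<integral>B. 1 + dev_term s b l \<theta> B \<partial>Q)"
          using id dev_term_ge[OF s b] by (intro nn_integral_eq_integral) auto
        also have "(\<integral>B. 1 + dev_term s b l \<theta> B \<partial>Q) = 1 + integral\<^sup>L Q (dev_term s b l \<theta>)"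
          using id by (simp add: Q.prob_space)
        finally have "ennreal (\<integral>x. g (\<theta> + (1 / sqrt b) *\<^sub>R x) \<partial>gauss) \<le> ennreal (1 + integral\<^sup>L Q (dev_term s b l \<theta>))" .
        moreover have "0 \<le> (\<integral>B. 1 + dev_term s b l \<theta> B \<partial>Q)"
          using dev_term_ge[OF s b] by (intro Bochner_Integration.integral_nonneg_AE) auto
        then have "0 \<le> 1 + integral\<^sup>L Q (dev_term s b l \<theta>)" using id by (simp add: Q.prob_space)
        ultimately show ?thesis by (simp add: ennreal_le_iff)
      qed
      finally show ?thesis by simp
    qed
    have "real m * (\<integral>x. ln (g (\<theta> + (1 / sqrt b) *\<^sub>R x)) \<partial>gauss) \<le> real m * integral\<^sup>L Q (dev_term s b l \<theta>)"
      using 4 by (intro mult_left_mono) auto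
    with 1 2 3 show ?thesis by linarith
  qed
  ultimately show ?thesis by (intro bexI[of _ "space M - F"]) auto
qed

section \<open>Inversion of the empirical bounds\<close>

context
  fixes m :: nat and A :: "nat \<Rightarrow> real^'d^'d" and l :: real and \<theta> :: "real^'d"
  assumes m: "1 \<le> m" and psd: "\<And>i. i \<in> {1..m} \<Longrightarrow> sym_psd (A i)" and l: "0 < l"
begin

lemma r_emp_eq: "r_emp m A l (\<alpha> *\<^sub>R \<theta>) = (1 / real m) * (\<Sum>i = 1..m. psi (\<alpha>\<^sup>2 * (\<theta> \<bullet> (A i *v \<theta>)) - l))"
proof -
  have "(norm (psd_sqrt (A i) *v (\<alpha> *\<^sub>R \<theta>)))\<^sup>2 = \<alpha>\<^sup>2 * (\<theta> \<bullet> (A i *v \<theta>))" if "i \<in> {1..m}" for i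
    using norm_psd_sqrt[OF psd[OF that], of "\<alpha> *\<^sub>R \<theta>"]
    by (simp add: matrix_vector_mult_scaleR power2_eq_square)
  then show ?thesis unfolding r_emp_def by simp
qed

lemma quad_nonneg: "i \<in> {1..m} \<Longrightarrow> 0 \<le> \<theta> \<bullet> (A i *v \<theta>)"
  using psd by (auto simp: sym_psd_def)

lemma r_emp_mono:
  assumes "0 \<le> \<alpha>" "\<alpha> \<le> \<alpha>'" shows "r_emp m A l (\<alpha> *\<^sub>R \<theta>) \<le> r_emp m A l (\<alpha>' *\<^sub>R \<theta>)"
  unfolding r_emp_eq using assms
  by (intro mult_left_mono sum_mono psi_mono diff_right_mono mult_right_mono power_mono quad_nonneg) auto

lemma r_emp_cont: "continuous_on UNIV (\<lambda>\<alpha>. r_emp m A l (\<alpha> *\<^sub>R \<theta>))"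
  unfolding r_emp_eq by (intro continuous_intros continuous_on_compose2[OF psi_cont]) auto

lemma psi_pos: "0 < psi l"
proof (cases "l \<le> 1")
  case True
  have "0 < l * ln 2" using l by simp
  also have "\<dots> \<le> psi l" using psi_ge_linear[of l] l True by simp
  finally show ?thesis .
qed (simp add: psi_def)

lemma r_emp_zero: "r_emp m A l (0 *\<^sub>R \<theta>) < 0"
  unfolding r_emp_eq using m psi_pos by (simp add: psi_minus)

lemma alpha_hat_ge: "0 \<le> \<alpha> \<Longrightarrow> r_emp m A l (\<alpha> *\<^sub>R \<theta>) \<le> 0 \<Longrightarrow> ereal \<alpha> \<le> alpha_hat m A l \<theta>"
  unfolding alpha_hat_def by (intro Sup_upper) auto

text \<open>At a finite supremum a the criterion is nonnegative, as a limit of positive values from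
  the right. It is negative at 0, so a > 0. An infinite supremum corresponds to the estimate
  0.\<close>

lemma alpha_hat_cases:
  obtains "alpha_hat m A l \<theta> = \<infinity>" "N_tilde m A l \<theta> = 0"
  | a where "0 < a" "alpha_hat m A l \<theta> = ereal a" "a\<^sup>2 * N_tilde m A l \<theta> = l" "0 \<le> r_emp m A l (a *\<^sub>R \<theta>)" "0 < N_tilde m A l \<theta>"
proof (cases "alpha_hat m A l \<theta>")
  case (real a)
  have a0: "0 \<le> a" using alpha_hat_ge[of 0] r_emp_zero real by simp
  have pos: "0 < r_emp m A l (\<alpha> *\<^sub>R \<theta>)" if "a < \<alpha>" for \<alpha>
    using alpha_hat_ge[of \<alpha>] that a0 real by (cases "r_emp m A l (\<alpha> *\<^sub>R \<theta>) \<le> 0") auto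
  have "0 \<le> r_emp m A l (a *\<^sub>R \<theta>)"
  proof (rule tendsto_lowerbound[of "\<lambda>\<alpha>. r_emp m A l (\<alpha> *\<^sub>R \<theta>)" _ "at_right a"])
    have "isCont (\<lambda>\<alpha>. r_emp m A l (\<alpha> *\<^sub>R \<theta>)) a"
      using r_emp_cont by (simp add: continuous_on_eq_continuous_at)
    then show "((\<lambda>\<alpha>. r_emp m A l (\<alpha> *\<^sub>R \<theta>)) \<longlongrightarrow> r_emp m A l (a *\<^sub>R \<theta>)) (at_right a)"
      unfolding isCont_def by (rule filterlim_mono) (auto intro: at_le)
    show "\<forall>\<^sub>F \<alpha> in at_right a. 0 \<le> r_emp m A l (\<alpha> *\<^sub>R \<theta>)"
      by (rule eventually_at_right_less[THEN eventually_mono]) (use pos in \<open>auto intro: less_imp_le\<close>)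
  qed simp
  moreover have "a \<noteq> 0" using calculation r_emp_zero by auto
  ultimately show ?thesis using that(2)[of a] real a0 l by (auto simp: N_tilde_def)
next
  case PInf
  then show ?thesis using that(1) by (simp add: N_tilde_def)
next
  case MInf
  then show ?thesis using alpha_hat_ge[of 0] r_emp_zero by simp
qed

lemma N_tilde_nonneg: "0 \<le> N_tilde m A l \<theta>"
  by (rule alpha_hat_cases) auto

text \<open>Stated for every bound tau on the estimate: an infinite \<open>alpha_hat\<close> is then
  covered as well, and tau can later be the maximum of the estimate and the energy level.\<close>

lemma r_emp_nonpos:
  assumes \<alpha>: "0 \<le> \<alpha>" and \<tau>: "N_tilde m A l \<theta> \<le> \<tau>" "\<alpha>\<^sup>2 * \<tau> < l"
  shows "r_emp m A l (\<alpha> *\<^sub>R \<theta>) \<le> 0"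
proof -
  have "ereal \<alpha> < alpha_hat m A l \<theta>"
  proof (rule alpha_hat_cases)
    fix a assume a: "0 < a" "alpha_hat m A l \<theta> = ereal a" "a\<^sup>2 * N_tilde m A l \<theta> = l" "0 < N_tilde m A l \<theta>"
    have "\<alpha>\<^sup>2 * \<tau> < a\<^sup>2 * N_tilde m A l \<theta>" using \<tau> a by simp
    also have "\<dots> \<le> a\<^sup>2 * \<tau>" using \<tau> by (intro mult_left_mono) auto
    finally have "\<alpha>\<^sup>2 < a\<^sup>2" using a \<tau> by (simp add: mult_less_cancel_right)
    then have "\<alpha> < a" using a by (intro power_less_imp_less_base[of \<alpha> 2 a]) auto
    then show ?thesis using a by simp
  qed simp
  then obtain \<alpha>' where "\<alpha> < \<alpha>'" "r_emp m A l (\<alpha>' *\<^sub>R \<theta>) \<le> 0"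
    unfolding alpha_hat_def less_Sup_iff by auto
  then show ?thesis using r_emp_mono[of \<alpha> \<alpha>'] \<alpha> by simp
qed

lemma N_tilde_le:
  assumes \<alpha>: "0 \<le> \<alpha>" "\<alpha>\<^sup>2 * \<tau> = l" "0 < \<tau>" "r_emp m A l (\<alpha> *\<^sub>R \<theta>) \<le> 0"
  shows "N_tilde m A l \<theta> \<le> \<tau>"
proof (rule alpha_hat_cases)
  fix a assume a: "0 < a" "alpha_hat m A l \<theta> = ereal a" "a\<^sup>2 * N_tilde m A l \<theta> = l"
  have "\<alpha> \<le> a" using alpha_hat_ge[OF \<alpha>(1,4)] a by simp
  then have "\<alpha>\<^sup>2 \<le> a\<^sup>2" using \<alpha> by (intro power_mono)
  then have "a\<^sup>2 * N_tilde m A l \<theta> \<le> a\<^sup>2 * \<tau>" using \<alpha> a by (metis less_imp_le mult_right_mono)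
  then show ?thesis using a(1) by (simp only: mult_le_cancel_left_pos zero_less_power)
qed (use \<alpha> in auto)

end

text \<open>The inversion concerns real numbers only: \<open>r\<close> is the criterion along the
  ray of theta, \<open>Lo\<close> and \<open>Up\<close> are the two deviation bounds, with
  \<open>k\<close> the kurtosis, and \<open>H2\<close>, \<open>H3\<close> are what the estimate
  \<open>Nt\<close> retains of its definition. The level \<open>sg\<close> stands for sigma
  |theta|^2.\<close>

context
  fixes r :: "real \<Rightarrow> real" and N Nt l k p w d sg :: real
  assumes l: "0 < l" and k: "1 < k" and p: "0 \<le> p" and w: "0 \<le> w" and d: "0 \<le> d" and N: "0 \<le> N" and sg: "0 < sg"
    and Lo: "\<And>\<alpha>. 0 \<le> \<alpha> \<Longrightarrow> (\<alpha>\<^sup>2 * N - l) - ((k * (\<alpha>\<^sup>2 * N)\<^sup>2 - 2 * l * (\<alpha>\<^sup>2 * N) + l\<^sup>2) / 2 + p * (\<alpha>\<^sup>2 * N) + w + d * \<alpha>\<^sup>2) \<le> r \<alpha>"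
    and Up: "\<And>\<alpha>. 0 \<le> \<alpha> \<Longrightarrow> r \<alpha> \<le> (\<alpha>\<^sup>2 * N - l) + ((k * (\<alpha>\<^sup>2 * N)\<^sup>2 - 2 * l * (\<alpha>\<^sup>2 * N) + l\<^sup>2) / 2 + p * (\<alpha>\<^sup>2 * N) + w + d * \<alpha>\<^sup>2)"
    and H2: "\<And>\<alpha> \<tau>. 0 \<le> \<alpha> \<Longrightarrow> Nt \<le> \<tau> \<Longrightarrow> \<alpha>\<^sup>2 * \<tau> < l \<Longrightarrow> r \<alpha> \<le> 0"
    and H3: "0 < Nt \<Longrightarrow> \<exists>a\<ge>0. a\<^sup>2 * Nt = l \<and> 0 \<le> r a"
begin

text \<open>The bound \<open>Lo\<close> is evaluated at the scale where alpha^2 N = l (1 + y). This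
  scale lies below the root, so the criterion is nonpositive there, and division by l produces the
  combinations called xi, mu and gamma.\<close>

lemma lower_root:
  assumes y: "0 \<le> y" and big: "(1 + y) * max Nt sg < N"
  shows "y - l * (k - 1) / 2 - l * (k - 1) * y - k * l / 2 * y\<^sup>2 - p * (1 + y) - w / l - d * (1 + y) / N \<le> 0"
proof -
  have N0: "0 < N" using big y sg by (smt (verit) mult_nonneg_nonneg max.cobounded2)
  define \<alpha> where "\<alpha> = sqrt (l * (1 + y) / N)"
  have a0: "0 \<le> \<alpha>" and a2: "\<alpha>\<^sup>2 = l * (1 + y) / N" unfolding \<alpha>_def using l y N0 by auto
  have aN: "\<alpha>\<^sup>2 * N = l * (1 + y)" and ad: "d * \<alpha>\<^sup>2 = d * (l * (1 + y) / N)" using a2 N0 by simp_all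
  have "r \<alpha> \<le> 0"
  proof (rule H2[OF a0, of "max Nt sg"])
    have "l * ((1 + y) * max Nt sg) < l * N" using big l by (intro mult_strict_left_mono)
    then show "\<alpha>\<^sup>2 * max Nt sg < l" unfolding a2 using N0 by (simp add: pos_divide_less_eq mult.assoc)
  qed simp
  with Lo[OF a0] have "l * (1 + y) - l - ((k * (l * (1 + y))\<^sup>2 - 2 * l * (l * (1 + y)) + l\<^sup>2) / 2 + p * (l * (1 + y)) + w + d * (l * (1 + y) / N)) \<le> 0"
    unfolding aN ad by linarith
  then have "(l * (1 + y) - l - ((k * (l * (1 + y))\<^sup>2 - 2 * l * (l * (1 + y)) + l\<^sup>2) / 2 + p * (l * (1 + y)) + w + d * (l * (1 + y) / N))) / l \<le> 0"
    using l by (simp add: divide_le_0_iff)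
  also have "(l * (1 + y) - l - ((k * (l * (1 + y))\<^sup>2 - 2 * l * (l * (1 + y)) + l\<^sup>2) / 2 + p * (l * (1 + y)) + w + d * (l * (1 + y) / N))) / l
    = y - l * (k - 1) / 2 - l * (k - 1) * y - k * l / 2 * y\<^sup>2 - p * (1 + y) - w / l - d * (1 + y) / N"
    using l N0 by (simp add: field_simps power2_eq_square)
  finally show ?thesis .
qed

lemma upper_root:
  assumes "0 < Nt"
  shows "0 \<le> (N / Nt - 1) + l / 2 * (k * (N / Nt)\<^sup>2 - 2 * (N / Nt) + 1) + p * (N / Nt) + w / l + d / Nt"
proof -
  from H3[OF assms] obtain a where a: "0 \<le> a" "a\<^sup>2 * Nt = l" "0 \<le> r a" by blast
  define x where "x = N / Nt"
  have a2: "a\<^sup>2 = l / Nt" using a assms by (simp add: field_simps)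
  have aN: "a\<^sup>2 * N = l * x" and ad: "d * a\<^sup>2 = d * (l / Nt)" by (simp_all add: a2 x_def)
  have "0 \<le> l * x - l + ((k * (l * x)\<^sup>2 - 2 * l * (l * x) + l\<^sup>2) / 2 + p * (l * x) + w + d * (l / Nt))"
    using Up[OF a(1)] a(3) unfolding aN ad by linarith
  then have "0 \<le> (l * x - l + ((k * (l * x)\<^sup>2 - 2 * l * (l * x) + l\<^sup>2) / 2 + p * (l * x) + w + d * (l / Nt))) / l"
    using l by simp
  also have "\<dots> = (x - 1) + l / 2 * (k * x\<^sup>2 - 2 * x + 1) + p * x + w / l + d / Nt"
    using l assms by (simp add: field_simps power2_eq_square)
  finally show ?thesis by (simp add: x_def)
qed

text \<open>The denominator of y reserves gamma + 2 delta beyond the linear equation y (1 - mu) =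
  gamma + delta. The side condition gives xi y < gamma + delta, so this reserve covers the quadratic
  term xi y^2.\<close>

lemma root_condition:
  fixes \<xi> \<mu> \<gamma> \<delta> :: real
  assumes "0 \<le> \<xi>" "0 < \<gamma>" "0 \<le> \<delta>" "\<xi> + \<mu> + \<gamma> + 2 * \<delta> < 1" and y: "y = (\<gamma> + \<delta>) / (1 - \<mu> - \<gamma> - 2 * \<delta>)"
  shows "0 < y" "\<xi> * y < \<gamma> + \<delta>" "y * (1 - \<mu>) = (\<gamma> + \<delta>) + y * (\<gamma> + 2 * \<delta>)"
proof -
  have D: "0 < 1 - \<mu> - \<gamma> - 2 * \<delta>" "\<xi> < 1 - \<mu> - \<gamma> - 2 * \<delta>" using assms by linarith+
  show "0 < y" unfolding y using assms D by simp
  show "\<xi> * y < \<gamma> + \<delta>" unfolding y using D assms by (simp add: pos_divide_less_eq mult.commute)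
  have "y * (1 - \<mu> - \<gamma> - 2 * \<delta>) = \<gamma> + \<delta>" unfolding y using D by simp
  then show "y * (1 - \<mu>) = (\<gamma> + \<delta>) + y * (\<gamma> + 2 * \<delta>)" by (simp add: algebra_simps)
qed

text \<open>Two contradictions. A ratio above 1 + y forces N above the level \<open>sg\<close> and
  violates \<open>lower_root\<close>. A ratio below 1 - y forces the estimate above
  \<open>sg\<close>, so that it comes from a root, and violates \<open>upper_root\<close>.\<close>

lemma relative_error_bound:
  fixes \<xi> \<mu> \<gamma> \<delta> :: real
  defines "\<xi> \<equiv> k * l / 2" and "\<mu> \<equiv> l * (k - 1) + p" and "\<gamma> \<equiv> l / 2 * (k - 1) + p + w / l" and "\<delta> \<equiv> d / max Nt sg"
  assumes cond: "\<xi> + \<mu> + \<gamma> + 2 * \<delta> < 1"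
  shows "\<bar>max N sg / max Nt sg - 1\<bar> \<le> (\<gamma> + \<delta>) / (1 - \<mu> - \<gamma> - 2 * \<delta>)"
proof -
  define y where "y = (\<gamma> + \<delta>) / (1 - \<mu> - \<gamma> - 2 * \<delta>)"
  have T: "0 < max Nt sg" using sg by simp
  have xi0: "0 \<le> \<xi>" and g0: "0 < \<gamma>" and d0: "0 \<le> \<delta>"
    unfolding \<xi>_def \<gamma>_def \<delta>_def using l k p w d T by (auto intro!: add_pos_nonneg divide_nonneg_pos)
  note y = root_condition[OF xi0 g0 d0 cond y_def]
  have y1: "max N sg \<le> (1 + y) * max Nt sg"
  proof (rule ccontr)
    assume "\<not> ?thesis"
    then have *: "(1 + y) * max Nt sg < max N sg" by linarith
    have "sg \<le> (1 + y) * max Nt sg" using y(1) T by (smt (verit) mult_le_cancel_right1 max.cobounded2)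
    then have N': "(1 + y) * max Nt sg < N" using * by simp
    then have N0: "0 < N" using y(1) T by (smt (verit) mult_nonneg_nonneg)
    have "d * (1 + y) / N \<le> \<delta>"
    proof -
      have "d * ((1 + y) * max Nt sg) \<le> d * N" using N' d by (intro mult_left_mono) auto
      then show ?thesis unfolding \<delta>_def using T N0 by (simp add: field_simps)
    qed
    with lower_root[OF less_imp_le[OF y(1)] N']
    have "y * (1 - \<mu>) - \<gamma> - \<xi> * y\<^sup>2 - \<delta> \<le> 0" unfolding \<mu>_def \<gamma>_def \<xi>_def by (simp add: algebra_simps)
    then have "y * (\<gamma> + 2 * \<delta>) \<le> y * (\<xi> * y)" unfolding y(3) by (simp add: power2_eq_square algebra_simps)
    then have "\<gamma> + 2 * \<delta> \<le> \<xi> * y" using y(1) by simp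
    then show False using y(2) d0 by simp
  qed
  have y2: "(1 - y) * max Nt sg \<le> max N sg"
  proof (rule ccontr)
    assume "\<not> ?thesis"
    then have *: "max N sg < (1 - y) * max Nt sg" by linarith
    have "(1 - y) * max Nt sg \<le> max Nt sg" using y(1) T by (smt (verit) mult_le_cancel_right1)
    then have **: "max N sg < max Nt sg" using * by linarith
    then have Nt: "max Nt sg = Nt" "0 < Nt" using sg by (auto simp: max_def split: if_splits)
    define x where "x = N / Nt"
    have x0: "0 \<le> x" unfolding x_def using N Nt by simp
    have xy: "x < 1 - y" unfolding x_def using * Nt by (simp add: pos_divide_less_eq)
    have q: "0 \<le> (x - 1) + l / 2 * (k * x\<^sup>2 - 2 * x + 1) + p * x + w / l + \<delta>"
      using upper_root[OF Nt(2)] unfolding x_def \<delta>_def Nt(1) .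
    define t where "t = 1 - y"
    have t: "0 < t" "t < 1" "x < t" using x0 xy y(1) by (auto simp: t_def)
    \<comment> \<open>the right-hand side of \<open>q\<close> is convex in \<open>x\<close>, and negative at \<open>0\<close> and \<open>t\<close>\<close>
    have at0: "- 1 + l / 2 + w / l + \<delta> < 0"
    proof -
      have "l / 2 \<le> \<xi>" unfolding \<xi>_def using l k by simp
      moreover have "w / l \<le> \<gamma>" unfolding \<gamma>_def using l k p by simp
      moreover have "0 \<le> \<mu>" unfolding \<mu>_def using l k p by simp
      ultimately show ?thesis using cond d0 by linarith
    qed
    have att: "(t - 1) + l / 2 * (k * t\<^sup>2 - 2 * t + 1) + p * t + w / l + \<delta> < 0"
    proof -
      have "(t - 1) + l / 2 * (k * t\<^sup>2 - 2 * t + 1) + p * t + w / l + \<delta> = \<gamma> + \<delta> - y * (1 + \<mu>) + \<xi> * y\<^sup>2"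
        unfolding t_def \<gamma>_def \<mu>_def \<xi>_def by (simp add: field_simps power2_eq_square)
      moreover have "\<xi> * y\<^sup>2 < (\<gamma> + \<delta>) * y" using y(1,2) by (simp add: power2_eq_square mult.assoc[symmetric])
      moreover have "0 \<le> y * \<mu>" using y(1) l k p unfolding \<mu>_def by simp
      moreover have "0 \<le> y * \<delta>" using y(1) d0 by simp
      ultimately show ?thesis using y(3) by (simp add: algebra_simps)
    qed
    have conv: "(x - 1) + l / 2 * (k * x\<^sup>2 - 2 * x + 1) + p * x + w / l + \<delta>
      \<le> (1 - x / t) * (- 1 + l / 2 + w / l + \<delta>) + x / t * ((t - 1) + l / 2 * (k * t\<^sup>2 - 2 * t + 1) + p * t + w / l + \<delta>)"
    proof -
      have "l / 2 * k * x * (t - x) \<ge> 0" using l k x0 t by (intro mult_nonneg_nonneg) auto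
      moreover have "(1 - x / t) * (- 1 + l / 2 + w / l + \<delta>) + x / t * ((t - 1) + l / 2 * (k * t\<^sup>2 - 2 * t + 1) + p * t + w / l + \<delta>)
        - ((x - 1) + l / 2 * (k * x\<^sup>2 - 2 * x + 1) + p * x + w / l + \<delta>) = l / 2 * k * x * (t - x)"
        using t l by (simp add: field_simps power2_eq_square)
      ultimately show ?thesis by linarith
    qed
    have "(1 - x / t) * (- 1 + l / 2 + w / l + \<delta>) < 0" using at0 t x0 by (intro mult_pos_neg) auto
    moreover have "x / t * ((t - 1) + l / 2 * (k * t\<^sup>2 - 2 * t + 1) + p * t + w / l + \<delta>) \<le> 0"
      using att t x0 by (intro mult_nonneg_nonpos) auto
    ultimately show False using conv q by linarith
  qed
  have "max N sg / max Nt sg \<le> 1 + y" "1 - y \<le> max N sg / max Nt sg"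
    using y1 y2 T by (simp_all add: pos_divide_le_eq pos_le_divide_eq)
  then show ?thesis unfolding y_def[symmetric] by linarith
qed

text \<open>Unlike in \<open>relative_error_bound\<close>, delta is taken at the true energy. The
  result is an a priori lower bound on the estimate, which is what evaluates the data-dependent
  \<open>B_bound\<close> at a grid point chosen from the true energy. One of the two deltas in the
  denominator pays for the extra term y delta.\<close>

lemma estimate_lower_bound:
  fixes \<xi> \<mu> \<gamma> \<delta> :: real
  defines "\<xi> \<equiv> k * l / 2" and "\<mu> \<equiv> l * (k - 1) + p" and "\<gamma> \<equiv> l / 2 * (k - 1) + p + w / l" and "\<delta> \<equiv> d / max N sg"
  assumes cond: "\<xi> + \<mu> + \<gamma> + 2 * \<delta> < 1"
  shows "max N sg \<le> (1 + (\<gamma> + \<delta>) / (1 - \<mu> - \<gamma> - 2 * \<delta>)) * max Nt sg"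
proof (rule ccontr)
  define y where "y = (\<gamma> + \<delta>) / (1 - \<mu> - \<gamma> - 2 * \<delta>)"
  have T: "0 < max Nt sg" using sg by simp
  have xi0: "0 \<le> \<xi>" and g0: "0 < \<gamma>" and d0: "0 \<le> \<delta>"
    unfolding \<xi>_def \<gamma>_def \<delta>_def using l k p w d sg by (auto intro!: add_pos_nonneg divide_nonneg_pos)
  note y = root_condition[OF xi0 g0 d0 cond y_def]
  assume "\<not> ?thesis"
  then have *: "(1 + y) * max Nt sg < max N sg" unfolding y_def by linarith
  have "sg \<le> (1 + y) * max Nt sg" using y(1) T by (smt (verit) mult_le_cancel_right1 max.cobounded2)
  then have N': "(1 + y) * max Nt sg < N" "max N sg = N" using * by (auto simp: max_def split: if_splits)
  have "d * (1 + y) / N = (1 + y) * \<delta>" unfolding \<delta>_def N'(2) by simp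
  with lower_root[OF less_imp_le[OF y(1)] N'(1)]
  have "y * (1 - \<mu>) - \<gamma> - \<xi> * y\<^sup>2 - (1 + y) * \<delta> \<le> 0" unfolding \<mu>_def \<gamma>_def \<xi>_def by (simp add: algebra_simps)
  then have "y * (\<gamma> + \<delta>) \<le> y * (\<xi> * y)" unfolding y(3) by (simp add: power2_eq_square algebra_simps)
  then show False using y(1,2) by simp
qed

end

section \<open>Moments of the block matrices\<close>

lemma has_bochner_integral_PiM_insert_mult:
  fixes F :: "('i \<Rightarrow> 'a) \<Rightarrow> real" and g :: "'a \<Rightarrow> real"
  assumes P: "prob_space P" and i: "i \<notin> I"
    and F: "has_bochner_integral (Pi\<^sub>M I (\<lambda>_. P)) F a" and g: "has_bochner_integral P g c"
    and upd: "\<And>x u. F (x(i := u)) = F x"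
    and F': "F \<in> borel_measurable (Pi\<^sub>M (insert i I) (\<lambda>_. P))"
  shows "has_bochner_integral (Pi\<^sub>M (insert i I) (\<lambda>_. P)) (\<lambda>x. F x * g (x i)) (a * c)"
proof -
  interpret P: prob_space P by fact
  interpret I: prob_space "Pi\<^sub>M I (\<lambda>_. P)" by (intro prob_space_PiM P)
  interpret pair_sigma_finite P "Pi\<^sub>M I (\<lambda>_. P)" ..
  have [measurable]: "g \<in> borel_measurable P" "F \<in> borel_measurable (Pi\<^sub>M I (\<lambda>_. P))"
    using F g by (auto dest: borel_measurable_has_bochner_integral)
  have int: "integrable (Pi\<^sub>M I (\<lambda>_. P)) F" "integral\<^sup>L (Pi\<^sub>M I (\<lambda>_. P)) F = a" "integrable P g" "integral\<^sup>L P g = c"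
    using F g by (auto simp: has_bochner_integral_iff)
  have i2: "integrable (P \<Otimes>\<^sub>M Pi\<^sub>M I (\<lambda>_. P)) (\<lambda>p. F (snd p) * g (fst p))"
    by (rule Fubini_integrable) (use int in \<open>auto simp: abs_mult\<close>)
  have e2: "(\<integral>p. F (snd p) * g (fst p) \<partial>(P \<Otimes>\<^sub>M Pi\<^sub>M I (\<lambda>_. P))) = a * c"
    using integral_fst'[OF i2] int by simp
  have "has_bochner_integral (P \<Otimes>\<^sub>M Pi\<^sub>M I (\<lambda>_. P)) (\<lambda>p. F (snd p) * g (fst p)) (a * c)"
    using i2 e2 by (simp add: has_bochner_integral_iff)
  then have "has_bochner_integral (P \<Otimes>\<^sub>M Pi\<^sub>M I (\<lambda>_. P)) (\<lambda>p. (\<lambda>x. F x * g (x i)) ((\<lambda>(x, X). X(i := x)) p)) (a * c)"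
    by (simp add: upd case_prod_unfold)
  then have "has_bochner_integral (distr (P \<Otimes>\<^sub>M Pi\<^sub>M I (\<lambda>_. P)) (Pi\<^sub>M (insert i I) (\<lambda>_. P)) (\<lambda>(x, X). X(i := x))) (\<lambda>x. F x * g (x i)) (a * c)"
    by (subst has_bochner_integral_distr) (use F' in measurable)
  then show ?thesis using distr_pair_PiM_eq_PiM[of I "\<lambda>_. P" i] P by simp
qed

text \<open>Induction on the index set, splitting off one coordinate. The last two moments are only
  asserted to exist: in the formulas for the others they are multiplied by the zero mean of the new
  variable.\<close>

lemma iid_sum_moments:
  fixes P :: "'a measure" and y :: "'a \<Rightarrow> real"
  assumes P: "prob_space P" and y: "has_bochner_integral P y 0" "has_bochner_integral P (\<lambda>x. (y x)\<^sup>2) v"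
    "has_bochner_integral P (\<lambda>x. (y x) ^ 4) m4" and I: "finite (I :: 'i set)"
  shows "has_bochner_integral (Pi\<^sub>M I (\<lambda>_. P)) (\<lambda>x. \<Sum>i\<in>I. y (x i)) 0
    \<and> has_bochner_integral (Pi\<^sub>M I (\<lambda>_. P)) (\<lambda>x. (\<Sum>i\<in>I. y (x i))\<^sup>2) (real (card I) * v)
    \<and> has_bochner_integral (Pi\<^sub>M I (\<lambda>_. P)) (\<lambda>x. \<Sum>i\<in>I. (y (x i))\<^sup>2) (real (card I) * v)
    \<and> has_bochner_integral (Pi\<^sub>M I (\<lambda>_. P)) (\<lambda>x. (\<Sum>i\<in>I. (y (x i))\<^sup>2)\<^sup>2) (real (card I) * m4 + real (card I) * (real (card I) - 1) * v\<^sup>2)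
    \<and> has_bochner_integral (Pi\<^sub>M I (\<lambda>_. P)) (\<lambda>x. (\<Sum>i\<in>I. (y (x i))\<^sup>2) * (\<Sum>i\<in>I. y (x i))\<^sup>2) (real (card I) * m4 + real (card I) * (real (card I) - 1) * v\<^sup>2)
    \<and> has_bochner_integral (Pi\<^sub>M I (\<lambda>_. P)) (\<lambda>x. (\<Sum>i\<in>I. y (x i)) ^ 4) (real (card I) * m4 + 3 * real (card I) * (real (card I) - 1) * v\<^sup>2)
    \<and> (\<exists>w. has_bochner_integral (Pi\<^sub>M I (\<lambda>_. P)) (\<lambda>x. (\<Sum>i\<in>I. y (x i)) ^ 3) w)
    \<and> (\<exists>w. has_bochner_integral (Pi\<^sub>M I (\<lambda>_. P)) (\<lambda>x. (\<Sum>i\<in>I. (y (x i))\<^sup>2) * (\<Sum>i\<in>I. y (x i))) w)"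
  using I
proof (induction I)
  case empty
  show ?case by (auto intro: has_bochner_integral_zero)
next
  case (insert i I)
  interpret P: prob_space P by fact
  have [measurable]: "y \<in> borel_measurable P" using y by (auto dest: borel_measurable_has_bochner_integral)
  have y1: "has_bochner_integral P (\<lambda>_. 1) (1::real)" by (simp add: has_bochner_integral_iff P.prob_space)
  have "integrable P (\<lambda>x. (y x) ^ 3)"
  proof (rule Bochner_Integration.integrable_bound)
    show "integrable P (\<lambda>x. 1 + (y x) ^ 4)" using y(3) by (auto simp: has_bochner_integral_iff)
    have "\<bar>t ^ 3\<bar> \<le> 1 + t ^ 4" for t :: real
    proof -
      have "\<bar>t\<bar> ^ 3 \<le> 1 + \<bar>t\<bar> ^ 4"
      proof (cases "\<bar>t\<bar> \<le> 1")
        case True then show ?thesis using power_le_one[of "\<bar>t\<bar>" 3] by (simp add: add_increasing2)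
      next
        case False
        then have "\<bar>t\<bar> ^ 3 \<le> \<bar>t\<bar> ^ 4" by (intro power_increasing) auto
        then show ?thesis by simp
      qed
      then show ?thesis by (simp add: power_abs)
    qed
    then show "AE x in P. norm (y x ^ 3) \<le> norm (1 + y x ^ 4)" by auto
  qed measurable
  then obtain c3 where y3: "has_bochner_integral P (\<lambda>x. (y x) ^ 3) c3" by (auto simp: has_bochner_integral_iff)
  define A where "A x = (\<Sum>j\<in>I. y (x j))" for x :: "'i \<Rightarrow> 'a"
  define B where "B x = (\<Sum>j\<in>I. (y (x j))\<^sup>2)" for x :: "'i \<Rightarrow> 'a"
  let ?N = "Pi\<^sub>M (insert i I) (\<lambda>_. P)"
  define k where "k = real (card I)"
  from insert.IH obtain w3 w21 where IH: "has_bochner_integral (Pi\<^sub>M I (\<lambda>_. P)) A 0"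
    "has_bochner_integral (Pi\<^sub>M I (\<lambda>_. P)) (\<lambda>x. (A x)\<^sup>2) (k * v)"
    "has_bochner_integral (Pi\<^sub>M I (\<lambda>_. P)) B (k * v)"
    "has_bochner_integral (Pi\<^sub>M I (\<lambda>_. P)) (\<lambda>x. (B x)\<^sup>2) (k * m4 + k * (k - 1) * v\<^sup>2)"
    "has_bochner_integral (Pi\<^sub>M I (\<lambda>_. P)) (\<lambda>x. B x * (A x)\<^sup>2) (k * m4 + k * (k - 1) * v\<^sup>2)"
    "has_bochner_integral (Pi\<^sub>M I (\<lambda>_. P)) (\<lambda>x. (A x) ^ 4) (k * m4 + 3 * k * (k - 1) * v\<^sup>2)"
    "has_bochner_integral (Pi\<^sub>M I (\<lambda>_. P)) (\<lambda>x. (A x) ^ 3) w3"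
    "has_bochner_integral (Pi\<^sub>M I (\<lambda>_. P)) (\<lambda>x. B x * A x) w21"
    unfolding A_def[abs_def] B_def[abs_def] k_def by blast
  have one: "has_bochner_integral (Pi\<^sub>M I (\<lambda>_. P)) (\<lambda>_. 1) (1::real)"
  proof -
    interpret I: prob_space "Pi\<^sub>M I (\<lambda>_. P)" by (intro prob_space_PiM P)
    show ?thesis by (simp add: has_bochner_integral_iff I.prob_space)
  qed
  have [measurable]: "A \<in> borel_measurable ?N" "B \<in> borel_measurable ?N"
    unfolding A_def[abs_def] B_def[abs_def] by measurable
  have updA: "A (x(i := u)) = A x" and updB: "B (x(i := u)) = B x" for x u
    using insert.hyps by (auto simp: A_def B_def intro!: sum.cong)
  have M: "has_bochner_integral ?N (\<lambda>x. F x * g (x i)) (a * c)"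
    if "has_bochner_integral (Pi\<^sub>M I (\<lambda>_. P)) F a" "has_bochner_integral P g c" "\<And>x u. F (x(i := u)) = F x" "F \<in> borel_measurable ?N"
    for F :: "('i \<Rightarrow> 'a) \<Rightarrow> real" and g a c
    by (rule has_bochner_integral_PiM_insert_mult[OF P insert.hyps(2) that(1,2) _ that(4)]) (rule that(3))
  have cd: "real (card (insert i I)) = k + 1" using insert.hyps by (simp add: k_def)
  have sA: "(\<Sum>j\<in>insert i I. y (x j)) = A x + y (x i)" and sB: "(\<Sum>j\<in>insert i I. (y (x j))\<^sup>2) = B x + (y (x i))\<^sup>2" for x
    using insert.hyps by (simp_all add: A_def B_def)
  note mm = M[OF IH(1) y1] M[OF IH(2) y1]
  have t1: "has_bochner_integral ?N (\<lambda>x. A x * 1 + 1 * y (x i)) (0 * 1 + 1 * 0)"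
    by (intro has_bochner_integral_add M[OF IH(1) y1] M[OF one y(1)]) (simp_all add: updA)
  have t2: "has_bochner_integral ?N (\<lambda>x. (A x)\<^sup>2 * 1 + (2 * (A x * y (x i)) + 1 * (y (x i))\<^sup>2)) (k * v * 1 + (2 * (0 * 0) + 1 * v))"
    by (intro has_bochner_integral_add has_bochner_integral_mult_right M[OF IH(2) y1] M[OF IH(1) y(1)] M[OF one y(2)]) (simp_all add: updA)
  have t3: "has_bochner_integral ?N (\<lambda>x. B x * 1 + 1 * (y (x i))\<^sup>2) (k * v * 1 + 1 * v)"
    by (intro has_bochner_integral_add M[OF IH(3) y1] M[OF one y(2)]) (simp_all add: updB)
  have t4: "has_bochner_integral ?N (\<lambda>x. (B x)\<^sup>2 * 1 + (2 * (B x * (y (x i))\<^sup>2) + 1 * (y (x i)) ^ 4))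
      ((k * m4 + k * (k - 1) * v\<^sup>2) * 1 + (2 * (k * v * v) + 1 * m4))"
    by (intro has_bochner_integral_add has_bochner_integral_mult_right M[OF IH(4) y1] M[OF IH(3) y(2)] M[OF one y(3)]) (simp_all add: updB)
  have t5: "has_bochner_integral ?N (\<lambda>x. B x * (A x)\<^sup>2 * 1 + (2 * (B x * A x * y (x i)) + (B x * (y (x i))\<^sup>2
        + ((A x)\<^sup>2 * (y (x i))\<^sup>2 + (2 * (A x * (y (x i)) ^ 3) + 1 * (y (x i)) ^ 4)))))
      ((k * m4 + k * (k - 1) * v\<^sup>2) * 1 + (2 * (w21 * 0) + (k * v * v + (k * v * v + (2 * (0 * c3) + 1 * m4)))))"
    by (intro has_bochner_integral_add has_bochner_integral_mult_right M[OF IH(5) y1] M[OF IH(8) y(1)] M[OF IH(3) y(2)]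
        M[OF IH(2) y(2)] M[OF IH(1) y3] M[OF one y(3)]) (simp_all add: updA updB)
  have t6: "has_bochner_integral ?N (\<lambda>x. (A x) ^ 4 * 1 + (4 * ((A x) ^ 3 * y (x i)) + (6 * ((A x)\<^sup>2 * (y (x i))\<^sup>2)
        + (4 * (A x * (y (x i)) ^ 3) + 1 * (y (x i)) ^ 4))))
      ((k * m4 + 3 * k * (k - 1) * v\<^sup>2) * 1 + (4 * (w3 * 0) + (6 * (k * v * v) + (4 * (0 * c3) + 1 * m4))))"
    by (intro has_bochner_integral_add has_bochner_integral_mult_right M[OF IH(6) y1] M[OF IH(7) y(1)]
        M[OF IH(2) y(2)] M[OF IH(1) y3] M[OF one y(3)]) (simp_all add: updA)
  have t7: "has_bochner_integral ?N (\<lambda>x. (A x) ^ 3 * 1 + (3 * ((A x)\<^sup>2 * y (x i)) + (3 * (A x * (y (x i))\<^sup>2) + 1 * (y (x i)) ^ 3)))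
      (w3 * 1 + (3 * (k * v * 0) + (3 * (0 * v) + 1 * c3)))"
    by (intro has_bochner_integral_add has_bochner_integral_mult_right M[OF IH(7) y1] M[OF IH(2) y(1)]
        M[OF IH(1) y(2)] M[OF one y3]) (simp_all add: updA)
  have t8: "has_bochner_integral ?N (\<lambda>x. B x * A x * 1 + (B x * y (x i) + (A x * (y (x i))\<^sup>2 + 1 * (y (x i)) ^ 3)))
      (w21 * 1 + (k * v * 0 + (0 * v + 1 * c3)))"
    by (intro has_bochner_integral_add M[OF IH(8) y1] M[OF IH(3) y(1)] M[OF IH(1) y(2)] M[OF one y3]) (simp_all add: updA updB)
  show ?case unfolding sA sB cd
  proof (intro conjI)
    show "has_bochner_integral ?N (\<lambda>x. A x + y (x i)) 0" using t1 by simp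
    show "has_bochner_integral ?N (\<lambda>x. (A x + y (x i))\<^sup>2) ((k + 1) * v)"
      using t2 by (simp add: power2_eq_square algebra_simps)
    show "has_bochner_integral ?N (\<lambda>x. B x + (y (x i))\<^sup>2) ((k + 1) * v)" using t3 by (simp add: algebra_simps)
    show "has_bochner_integral ?N (\<lambda>x. (B x + (y (x i))\<^sup>2)\<^sup>2) ((k + 1) * m4 + (k + 1) * (k + 1 - 1) * v\<^sup>2)"
      using t4 by (simp add: power2_eq_square power4_eq_xxxx algebra_simps)
    show "has_bochner_integral ?N (\<lambda>x. (B x + (y (x i))\<^sup>2) * (A x + y (x i))\<^sup>2) ((k + 1) * m4 + (k + 1) * (k + 1 - 1) * v\<^sup>2)"
      using t5 by (simp add: power2_eq_square power3_eq_cube power4_eq_xxxx algebra_simps)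
    show "has_bochner_integral ?N (\<lambda>x. (A x + y (x i)) ^ 4) ((k + 1) * m4 + 3 * (k + 1) * (k + 1 - 1) * v\<^sup>2)"
      using t6 by (simp add: power2_eq_square power3_eq_cube power4_eq_xxxx algebra_simps)
    show "\<exists>w. has_bochner_integral ?N (\<lambda>x. (A x + y (x i)) ^ 3) w"
      using t7 by (intro exI[of _ "w3 + c3"]) (simp add: power2_eq_square power3_eq_cube algebra_simps)
    show "\<exists>w. has_bochner_integral ?N (\<lambda>x. (B x + (y (x i))\<^sup>2) * (A x + y (x i))) w"
      using t8 by (intro exI[of _ "w21 + c3"]) (simp add: power2_eq_square power3_eq_cube algebra_simps)
  qed
qed

text \<open>Reduces a block, which averages over pairs, to the two sums whose joint moments
  \<open>iid_sum_moments\<close> provides.\<close>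

lemma sum_pairs_square:
  fixes y :: "nat \<Rightarrow> real"
  shows "(\<Sum>k\<in>{0<..q}. \<Sum>j\<in>{0<..<k}. (y j - y k)\<^sup>2) = real q * (\<Sum>j\<in>{0<..q}. (y j)\<^sup>2) - (\<Sum>j\<in>{0<..q}. y j)\<^sup>2"
proof (induction q)
  case (Suc q)
  have s: "{0<..Suc q} = insert (Suc q) {0<..q}" by auto
  have s': "{0<..<Suc q} = {0<..q}" by auto
  have "(\<Sum>j\<in>{0<..q}. (y j - y (Suc q))\<^sup>2) = (\<Sum>j\<in>{0<..q}. (y j)\<^sup>2) - 2 * y (Suc q) * (\<Sum>j\<in>{0<..q}. y j) + real q * (y (Suc q))\<^sup>2"
    by (simp add: power2_eq_square algebra_simps sum.distrib sum_subtractf sum_distrib_left)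
  note 1 = this
  have 2: "(\<Sum>k\<in>{0<..Suc q}. \<Sum>j\<in>{0<..<k}. (y j - y k)\<^sup>2)
    = (\<Sum>j\<in>{0<..q}. (y j - y (Suc q))\<^sup>2) + (\<Sum>k\<in>{0<..q}. \<Sum>j\<in>{0<..<k}. (y j - y k)\<^sup>2)"
    unfolding s by (subst sum.insert) (simp_all add: s')
  have 3: "(\<Sum>j\<in>{0<..Suc q}. (y j)\<^sup>2) = (y (Suc q))\<^sup>2 + (\<Sum>j\<in>{0<..q}. (y j)\<^sup>2)"
    "(\<Sum>j\<in>{0<..Suc q}. y j) = y (Suc q) + (\<Sum>j\<in>{0<..q}. y j)" unfolding s by simp_all
  show ?case unfolding 2 3 1 Suc.IH by (simp add: power2_eq_square algebra_simps)
qed simp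

lemma Cauchy_Schwarz_integral:
  fixes f g :: "'a \<Rightarrow> real"
  assumes f: "integrable M (\<lambda>x. (f x)\<^sup>2)" and g: "integrable M (\<lambda>x. (g x)\<^sup>2)"
    and [measurable]: "f \<in> borel_measurable M" "g \<in> borel_measurable M"
  shows "integrable M (\<lambda>x. f x * g x)" "(\<integral>x. f x * g x \<partial>M) \<le> sqrt (\<integral>x. (f x)\<^sup>2 \<partial>M) * sqrt (\<integral>x. (g x)\<^sup>2 \<partial>M)"
proof -
  have le: "2 * \<bar>a * b\<bar> \<le> a\<^sup>2 + b\<^sup>2" for a b :: real
    using zero_le_power2[of "\<bar>a\<bar> - \<bar>b\<bar>"] by (simp add: power2_eq_square algebra_simps abs_mult)
  show i: "integrable M (\<lambda>x. f x * g x)"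
  proof (rule Bochner_Integration.integrable_bound[OF Bochner_Integration.integrable_add[OF f g]])
    have "\<bar>f x * g x\<bar> \<le> (f x)\<^sup>2 + (g x)\<^sup>2" for x using le[of "f x" "g x"] by linarith
    then show "AE x in M. norm (f x * g x) \<le> norm ((f x)\<^sup>2 + (g x)\<^sup>2)" by auto
  qed measurable
  define a where "a = (\<integral>x. (f x)\<^sup>2 \<partial>M)"
  define b where "b = (\<integral>x. (g x)\<^sup>2 \<partial>M)"
  define c where "c = (\<integral>x. f x * g x \<partial>M)"
  have a0: "0 \<le> a" and b0: "0 \<le> b" unfolding a_def b_def by auto
  have q: "2 * t * c \<le> t\<^sup>2 * a + b" for t
  proof -
    have "0 \<le> (\<integral>x. (t * f x - g x)\<^sup>2 \<partial>M)" by simp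
    also have "(\<lambda>x. (t * f x - g x)\<^sup>2) = (\<lambda>x. t\<^sup>2 * (f x)\<^sup>2 - 2 * t * (f x * g x) + (g x)\<^sup>2)"
      by (simp add: fun_eq_iff power2_eq_square algebra_simps)
    also have "(\<integral>x. t\<^sup>2 * (f x)\<^sup>2 - 2 * t * (f x * g x) + (g x)\<^sup>2 \<partial>M) = t\<^sup>2 * a - 2 * t * c + b"
      using f g i unfolding a_def b_def c_def by simp
    finally show ?thesis by simp
  qed
  show "(\<integral>x. f x * g x \<partial>M) \<le> sqrt (\<integral>x. (f x)\<^sup>2 \<partial>M) * sqrt (\<integral>x. (g x)\<^sup>2 \<partial>M)"
    unfolding a_def[symmetric] b_def[symmetric] c_def[symmetric]
  proof (cases "c \<le> 0")
    case False
    then have c: "c > 0" by simp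
    have apos: "a > 0"
    proof (rule ccontr)
      assume "\<not> ?thesis"
      then have "a = 0" using a0 by simp
      \<comment> \<open>With a = 0 the inequality \<open>q\<close> bounds a linear function of t by
        b, and this t makes the left side equal to b + 1.\<close>
      then show False using q[of "(b + 1) / (2 * c)"] c by simp
    qed
    have "c\<^sup>2 \<le> a * b" using q[of "c / a"] apos by (simp add: field_simps power2_eq_square)
    then have "c \<le> sqrt (a * b)" by (rule real_le_rsqrt)
    then show "c \<le> sqrt a * sqrt b" by (simp add: real_sqrt_mult)
  qed (use a0 b0 in \<open>auto intro: order_trans[of _ 0]\<close>)
qed

section \<open>Energy and kurtosis of the law of the sample\<close>

lemma outer_prod_quad: "\<theta> \<bullet> (outer_prod v *v \<theta>) = (\<theta> \<bullet> v)\<^sup>2"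
  unfolding quad_form_sum by (simp add: outer_prod_def inner_vec_def power2_eq_square sum_product mult_ac)

lemma norm_outer_prod: "norm (outer_prod v) = (norm (v::real^'d))\<^sup>2"
proof -
  have "(norm (outer_prod v))\<^sup>2 = ((norm v)\<^sup>2)\<^sup>2"
    unfolding power2_norm_eq_inner
    by (simp add: inner_vec_def outer_prod_def power2_eq_square sum_product mult_ac)
  then show ?thesis by (rule power2_eq_imp_eq) auto
qed

lemma outer_prod_continuous: "continuous_on UNIV (outer_prod :: real^'d \<Rightarrow> real^'d^'d)"
  unfolding outer_prod_def[abs_def] by (intro continuous_intros)

lemma outer_prod_measurable [measurable]: "outer_prod \<in> borel_measurable borel"
  by (rule borel_measurable_continuous_onI[OF outer_prod_continuous])

lemma bounded_linear_quad: "bounded_linear (\<lambda>B::real^'d^'d. \<theta> \<bullet> (B *v \<theta>))"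
proof (rule bounded_linear_intro[where K="(norm \<theta>)\<^sup>2"])
  show "norm (\<theta> \<bullet> (B *v \<theta>)) \<le> norm B * (norm \<theta>)\<^sup>2" for B :: "real^'d^'d" using quad_abs_le by simp
qed (simp_all add: matrix_vector_mult_add_rdistrib inner_add_right scaleR_matrix_vector_assoc[symmetric])

text \<open>In the theorem the trace is positive because it is at least sigma. This guarantees that
  the supremum defining the kurtosis runs over a nonempty set of directions.\<close>

locale kurtosis_law =
  fixes P :: "(real^'d) measure"
  assumes prob: "prob_space P" and setsP [measurable_cong]: "sets P = sets borel"
    and second: "integrable P (\<lambda>x. (norm x)\<^sup>2)" and kurt: "kurtosis P < \<infinity>"
    and trace_pos: "0 < trace (cov_mat P)"
begin

sublocale P: prob_space P by (rule prob)

definition "kurt_coeff = enn2real (kurtosis P)"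
definition "Y \<theta> x = \<theta> \<bullet> (x - mean_vec P)"

lemma Y_measurable [measurable]: "Y \<theta> \<in> borel_measurable P" "Y \<theta> \<in> borel_measurable borel"
  unfolding Y_def[abs_def] by measurable

lemma integrable_id: "integrable P (\<lambda>x. x)"
proof (rule Bochner_Integration.integrable_bound)
  show "integrable P (\<lambda>x. 1 + (norm x)\<^sup>2)" using second by simp
  have "t \<le> 1 + t\<^sup>2" for t :: real
  proof -
    have "2 * t \<le> 1 + t\<^sup>2" using zero_le_power2[of "t - 1"] by (simp add: power2_eq_square algebra_simps)
    then show ?thesis using zero_le_power2[of t] by linarith
  qed
  then show "AE x in P. norm x \<le> norm (1 + (norm x)\<^sup>2)" by auto
qed measurable

lemma integrable_centered: "integrable P (\<lambda>x. (norm (x - mean_vec P))\<^sup>2)"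
proof -
  have "(norm (x - mean_vec P))\<^sup>2 = (norm x)\<^sup>2 - 2 * (mean_vec P \<bullet> x) + (norm (mean_vec P))\<^sup>2" for x
    unfolding power2_norm_eq_inner by (simp add: inner_diff_left inner_diff_right inner_commute)
  then show ?thesis using second integrable_id by simp
qed

lemma integrable_outer: "integrable P (\<lambda>x. outer_prod (x - mean_vec P))"
  by (rule Bochner_Integration.integrable_bound[OF integrable_centered]) (auto simp: norm_outer_prod)

lemma energy_eq: "energy P \<theta> = (\<integral>x. (Y \<theta> x)\<^sup>2 \<partial>P)"
  unfolding energy_def cov_mat_def
  by (subst integral_bounded_linear[OF bounded_linear_quad integrable_outer, symmetric]) (simp add: outer_prod_quad Y_def)

lemma Y2_integrable: "integrable P (\<lambda>x. (Y \<theta> x)\<^sup>2)"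
  using integrable_bounded_linear[OF bounded_linear_quad integrable_outer, of \<theta>] by (simp add: outer_prod_quad Y_def)

lemma Y1: "has_bochner_integral P (Y \<theta>) 0"
  using integrable_id unfolding has_bochner_integral_iff Y_def[abs_def]
  by (simp add: inner_diff_right mean_vec_def P.prob_space)

lemma Y2: "has_bochner_integral P (\<lambda>x. (Y \<theta> x)\<^sup>2) (energy P \<theta>)"
  using Y2_integrable by (simp add: has_bochner_integral_iff energy_eq)

lemma energy_nonneg: "0 \<le> energy P \<theta>" unfolding energy_eq by simp

lemma trace_cov: "trace (cov_mat P) = (\<Sum>i\<in>UNIV. energy P (axis i 1))"
  by (simp add: trace_eq_sum_axis energy_def)

lemma energy_pos_exists: "\<exists>\<theta>. 0 < energy P \<theta>"
proof (rule ccontr)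
  assume "\<not> ?thesis"
  then have "energy P \<theta> = 0" for \<theta> using energy_nonneg[of \<theta>] less_eq_real_def by metis
  then show False using trace_pos by (simp add: trace_cov)
qed

lemma nn_Y2: "(\<integral>\<^sup>+x. ennreal ((\<theta> \<bullet> (x - mean_vec P)) ^ 2) \<partial>P) = ennreal (energy P \<theta>)"
  using Y2_integrable unfolding energy_eq Y_def by (intro nn_integral_eq_integral) auto

text \<open>A finite supremum controls the fourth moment only in directions of positive energy; in
  the remaining ones the centred projection vanishes almost surely.\<close>

lemma Y4_integrable: "integrable P (\<lambda>x. (Y \<theta> x) ^ 4)"
proof (cases "energy P \<theta> = 0")
  case True
  then have "AE x in P. (Y \<theta> x)\<^sup>2 = 0"
    using Y2_integrable unfolding energy_eq by (subst (asm) integral_nonneg_eq_0_iff_AE) auto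
  then have "AE x in P. (Y \<theta> x) ^ 4 = 0" by (rule AE_mp) auto
  then show ?thesis by (subst integrable_cong_AE[where g="\<lambda>_. 0"]) auto
next
  case False
  then have e: "0 < energy P \<theta>" using energy_nonneg[of \<theta>] by simp
  have "(\<integral>\<^sup>+x. ennreal ((\<theta> \<bullet> (x - mean_vec P)) ^ 4) \<partial>P) / (ennreal (energy P \<theta>))\<^sup>2 \<le> kurtosis P"
    unfolding kurtosis_def nn_Y2[symmetric] by (rule SUP_upper) (use e in simp)
  also have "\<dots> < \<infinity>" by (rule kurt)
  finally have "(\<integral>\<^sup>+x. ennreal ((\<theta> \<bullet> (x - mean_vec P)) ^ 4) \<partial>P) / (ennreal (energy P \<theta>))\<^sup>2 < \<infinity>" .
  then have "(\<integral>\<^sup>+x. ennreal ((\<theta> \<bullet> (x - mean_vec P)) ^ 4) \<partial>P) < \<infinity>"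
    using e by (auto simp: ennreal_power ennreal_divide_eq_top_iff less_top[symmetric] top_unique)
  then show ?thesis by (intro integrableI_nonneg) (auto simp: Y_def)
qed

definition "m4 \<theta> = (\<integral>x. (Y \<theta> x) ^ 4 \<partial>P)"

lemma Y4: "has_bochner_integral P (\<lambda>x. (Y \<theta> x) ^ 4) (m4 \<theta>)"
  using Y4_integrable by (simp add: has_bochner_integral_iff m4_def)

lemma nn_Y4: "(\<integral>\<^sup>+x. ennreal ((\<theta> \<bullet> (x - mean_vec P)) ^ 4) \<partial>P) = ennreal (m4 \<theta>)"
  using Y4_integrable unfolding m4_def Y_def by (intro nn_integral_eq_integral) auto

lemma m4_nonneg: "0 \<le> m4 \<theta>" unfolding m4_def by simp

lemma kurtosis_eq: "kurtosis P = (SUP \<theta>\<in>{\<theta>. 0 < energy P \<theta>}. ennreal (m4 \<theta> / (energy P \<theta>)\<^sup>2))"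
  unfolding kurtosis_def nn_Y2 nn_Y4
  by (intro SUP_cong refl) (auto simp: ennreal_power divide_ennreal m4_nonneg)

lemma kurtosis_kurt_coeff: "kurtosis P = ennreal kurt_coeff"
  unfolding kurt_coeff_def using kurt by simp

lemma m4_le: "m4 \<theta> \<le> kurt_coeff * (energy P \<theta>)\<^sup>2"
proof (cases "energy P \<theta> = 0")
  case True
  then have "AE x in P. (Y \<theta> x)\<^sup>2 = 0"
    using Y2_integrable unfolding energy_eq by (subst (asm) integral_nonneg_eq_0_iff_AE) auto
  then have "AE x in P. (Y \<theta> x) ^ 4 = 0" by (rule AE_mp) auto
  then have "m4 \<theta> = 0" unfolding m4_def by (intro integral_eq_zero_AE)
  then show ?thesis using True by simp
next
  case False
  then have e: "0 < energy P \<theta>" using energy_nonneg[of \<theta>] by simp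
  have "ennreal (m4 \<theta> / (energy P \<theta>)\<^sup>2) \<le> ennreal kurt_coeff"
    unfolding kurtosis_kurt_coeff[symmetric] kurtosis_eq by (rule SUP_upper) (use e in simp)
  then have "m4 \<theta> / (energy P \<theta>)\<^sup>2 \<le> kurt_coeff" using kurt_coeff_def by (subst (asm) ennreal_le_iff) auto
  then show ?thesis using e by (simp add: pos_divide_le_eq)
qed

lemma energy_square_le: "(energy P \<theta>)\<^sup>2 \<le> m4 \<theta>"
proof -
  have "0 \<le> (\<integral>x. ((Y \<theta> x)\<^sup>2 - energy P \<theta>)\<^sup>2 \<partial>P)" by simp
  also have "(\<lambda>x. ((Y \<theta> x)\<^sup>2 - energy P \<theta>)\<^sup>2) = (\<lambda>x. (Y \<theta> x) ^ 4 - 2 * energy P \<theta> * (Y \<theta> x)\<^sup>2 + (energy P \<theta>)\<^sup>2)"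
    by (simp add: fun_eq_iff power2_eq_square power4_eq_xxxx algebra_simps)
  also have "(\<integral>x. (Y \<theta> x) ^ 4 - 2 * energy P \<theta> * (Y \<theta> x)\<^sup>2 + (energy P \<theta>)\<^sup>2 \<partial>P) = m4 \<theta> - (energy P \<theta>)\<^sup>2"
    using Y4_integrable Y2_integrable by (simp add: P.prob_space m4_def energy_eq[symmetric]) (simp add: power2_eq_square)
  finally show ?thesis by simp
qed

lemma kurt_coeff_ge_1: "1 \<le> kurt_coeff"
proof -
  obtain \<theta> where e: "0 < energy P \<theta>" using energy_pos_exists by blast
  have "(energy P \<theta>)\<^sup>2 \<le> kurt_coeff * (energy P \<theta>)\<^sup>2" using energy_square_le m4_le by (rule order_trans)
  then show ?thesis using e by simp
qed

end


section \<open>The law of a block matrix\<close>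

lemma outer_prod_diff_quad: "\<theta> \<bullet> (outer_prod (u - v) *v \<theta>) = (\<theta> \<bullet> u - \<theta> \<bullet> v)\<^sup>2"
  by (simp add: outer_prod_quad inner_diff_right)

lemma block_mat_quad:
  fixes x :: "nat \<Rightarrow> real^'d"
  shows "\<theta> \<bullet> (block_mat q x i *v \<theta>) = 1 / (real q * (real q - 1)) *
     (\<Sum>k\<in>{(i - 1) * q<..i * q}. \<Sum>j\<in>{(i - 1) * q<..<k}. (\<theta> \<bullet> x j - \<theta> \<bullet> x k)\<^sup>2)"
proof -
  interpret bounded_linear "\<lambda>B::real^'d^'d. \<theta> \<bullet> (B *v \<theta>)" by (rule bounded_linear_quad)
  show ?thesis unfolding block_mat_def by (simp add: scaleR sum outer_prod_diff_quad)
qed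

lemma block_mat_sym_psd:
  fixes x :: "nat \<Rightarrow> real^'d"
  assumes "2 \<le> q" shows "sym_psd (block_mat q x i)"
  unfolding sym_psd_def
proof
  have "outer_prod v $ a $ b = outer_prod v $ b $ a" for v :: "real^'d" and a b by (simp add: outer_prod_def mult.commute)
  then show "transpose (block_mat q x i) = block_mat q x i"
    by (simp add: block_mat_def transpose_def vec_eq_iff)
  show "\<forall>v. 0 \<le> v \<bullet> (block_mat q x i *v v)"
    unfolding block_mat_quad using assms by (intro allI mult_nonneg_nonneg sum_nonneg) auto
qed

lemma block_mat_measurable:
  assumes I: "{(i - 1) * q<..i * q} \<subseteq> I" and P: "sets P = sets (borel :: (real^'d) measure)"
  shows "(\<lambda>x. block_mat q x i) \<in> borel_measurable (Pi\<^sub>M I (\<lambda>_. P))"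
proof -
  have "(\<lambda>x. x k) \<in> borel_measurable (Pi\<^sub>M I (\<lambda>_. P))" if "k \<in> I" for k
    using measurable_component_singleton[OF that, of "\<lambda>_. P"] P by (simp cong: measurable_cong_sets)
  then have "(\<lambda>x. outer_prod (x j - x k)) \<in> borel_measurable (Pi\<^sub>M I (\<lambda>_. P))" if "j \<in> I" "k \<in> I" for j k
    using that by (intro measurable_compose[OF _ outer_prod_measurable] borel_measurable_diff)
  then show ?thesis unfolding block_mat_def
    using I by (intro borel_measurable_scaleR borel_measurable_const borel_measurable_sum) (auto simp: subset_iff)
qed

locale block_kurtosis = kurtosis_law P for P :: "(real^'d) measure" +
  fixes q :: nat
  assumes q: "2 \<le> q"
begin

abbreviation "Q \<equiv> block_law q P"
definition "kurt_block = 1 + tau q kurt_coeff / real q"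
text \<open>The second moment of the unbiased sample variance of \<open>q\<close> real observations,
  which is what a block evaluated at theta is.\<close>

definition "quad2 \<theta> = m4 \<theta> / real q + ((real q - 1) / real q + 2 / (real q * (real q - 1))) * (energy P \<theta>)\<^sup>2"

lemma block_meas: "(\<lambda>x. block_mat q x 1) \<in> borel_measurable (Pi\<^sub>M {1..q} (\<lambda>_. P))"
  by (rule block_mat_measurable[OF _ setsP]) auto

lemma sets_Q [measurable_cong, simp]: "sets Q = sets borel" by (simp add: block_law_def)

lemma prob_Q: "prob_space Q"
  unfolding block_law_def
  by (intro prob_space.prob_space_distr prob_space_PiM prob block_meas)

sublocale Q: prob_space Q by (rule prob_Q)

lemma AE_psd: "AE A in Q. sym_psd A"
proof -
  \<comment> \<open>The cone is closed, hence Borel, as the transfer of the almost sure statement to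
    the image measure requires.\<close>
  have c: "closed {A :: real^'d^'d. sym_psd A}"
  proof -
    have "{A :: real^'d^'d. sym_psd A} = {A. transpose A = A} \<inter> (\<Inter>v. {A. 0 \<le> v \<bullet> (A *v v)})" by (auto simp: sym_psd_def)
    moreover have "closed {A :: real^'d^'d. transpose A = A}" unfolding transpose_def
      by (intro closed_Collect_eq continuous_intros)
    moreover have "closed {A :: real^'d^'d. 0 \<le> v \<bullet> (A *v v)}" for v
      by (intro closed_Collect_le continuous_intros bounded_linear.continuous_on[OF bounded_linear_quad])
    ultimately show ?thesis by (simp only:) (intro closed_Int closed_INT ballI)
  qed
  then have [measurable]: "{A :: real^'d^'d. sym_psd A} \<in> sets borel" by (rule borel_closed)
  show ?thesis unfolding block_law_def
    by (subst AE_distr_iff[OF block_meas]) (auto simp: block_mat_sym_psd[OF q])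
qed

text \<open>A block at theta is c (q S2 - S1^2), with S1 and S2 the sums of the projections and of
  their squares. Centring the projections is free because only differences occur.\<close>

lemma Q_moments:
  shows "has_bochner_integral Q (\<lambda>A. \<theta> \<bullet> (A *v \<theta>)) (energy P \<theta>)"
    and "has_bochner_integral Q (\<lambda>A. (\<theta> \<bullet> (A *v \<theta>))\<^sup>2) (quad2 \<theta>)"
proof -
  let ?N = "Pi\<^sub>M {1..q} (\<lambda>_. P)"
  define S1 where "S1 x = (\<Sum>j\<in>{1..q}. Y \<theta> (x j))" for x
  define S2 where "S2 x = (\<Sum>j\<in>{1..q}. (Y \<theta> (x j))\<^sup>2)" for x
  define c where "c = 1 / (real q * (real q - 1))"
  have qpos: "real q > 1" "real q \<noteq> 0" using q by auto
  have quad: "\<theta> \<bullet> (block_mat q x 1 *v \<theta>) = c * (real q * S2 x - (S1 x)\<^sup>2)" for x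
  proof -
    have "{0<..q} = {1..q}" by auto
    moreover have "\<theta> \<bullet> x j - \<theta> \<bullet> x k = Y \<theta> (x j) - Y \<theta> (x k)" for j k by (simp add: Y_def inner_diff_right)
    ultimately show ?thesis
      unfolding block_mat_quad c_def S1_def S2_def using sum_pairs_square[of "\<lambda>j. Y \<theta> (x j)" q] by simp
  qed
  have mom: "has_bochner_integral ?N (\<lambda>x. (S1 x)\<^sup>2) (real q * energy P \<theta>)"
    "has_bochner_integral ?N S2 (real q * energy P \<theta>)"
    "has_bochner_integral ?N (\<lambda>x. (S2 x)\<^sup>2) (real q * m4 \<theta> + real q * (real q - 1) * (energy P \<theta>)\<^sup>2)"
    "has_bochner_integral ?N (\<lambda>x. S2 x * (S1 x)\<^sup>2) (real q * m4 \<theta> + real q * (real q - 1) * (energy P \<theta>)\<^sup>2)"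
    "has_bochner_integral ?N (\<lambda>x. (S1 x) ^ 4) (real q * m4 \<theta> + 3 * real q * (real q - 1) * (energy P \<theta>)\<^sup>2)"
    using iid_sum_moments[OF prob Y1[of \<theta>] Y2 Y4, of "{1..q}"] unfolding S1_def S2_def by auto
  have mq: "(\<lambda>A. \<theta> \<bullet> (A *v \<theta>)) \<in> borel_measurable borel" by measurable
  have 1: "has_bochner_integral ?N (\<lambda>x. c * (real q * S2 x - (S1 x)\<^sup>2)) (c * (real q * (real q * energy P \<theta>) - real q * energy P \<theta>))"
    by (intro has_bochner_integral_mult_right has_bochner_integral_diff mom)
  have "c * (real q * (real q * energy P \<theta>) - real q * energy P \<theta>) = energy P \<theta>"
    unfolding c_def using qpos by (simp add: field_simps)
  with 1 have "has_bochner_integral ?N (\<lambda>x. \<theta> \<bullet> (block_mat q x 1 *v \<theta>)) (energy P \<theta>)" unfolding quad by metis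
  then show "has_bochner_integral Q (\<lambda>A. \<theta> \<bullet> (A *v \<theta>)) (energy P \<theta>)"
    unfolding block_law_def by (rule has_bochner_integral_distr[OF mq block_meas])
  have 2: "has_bochner_integral ?N (\<lambda>x. c\<^sup>2 * ((real q)\<^sup>2 * (S2 x)\<^sup>2 - 2 * real q * (S2 x * (S1 x)\<^sup>2) + (S1 x) ^ 4))
    (c\<^sup>2 * ((real q)\<^sup>2 * (real q * m4 \<theta> + real q * (real q - 1) * (energy P \<theta>)\<^sup>2)
       - 2 * real q * (real q * m4 \<theta> + real q * (real q - 1) * (energy P \<theta>)\<^sup>2)
       + (real q * m4 \<theta> + 3 * real q * (real q - 1) * (energy P \<theta>)\<^sup>2)))"
    by (intro has_bochner_integral_mult_right has_bochner_integral_diff has_bochner_integral_add mom)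
  have eq2: "c\<^sup>2 * ((real q)\<^sup>2 * (S2 x)\<^sup>2 - 2 * real q * (S2 x * (S1 x)\<^sup>2) + (S1 x) ^ 4) = (\<theta> \<bullet> (block_mat q x 1 *v \<theta>))\<^sup>2" for x
    unfolding quad by (simp add: power2_eq_square power4_eq_xxxx algebra_simps)
  have "c\<^sup>2 * ((real q)\<^sup>2 * (real q * m4 \<theta> + real q * (real q - 1) * (energy P \<theta>)\<^sup>2)
       - 2 * real q * (real q * m4 \<theta> + real q * (real q - 1) * (energy P \<theta>)\<^sup>2)
       + (real q * m4 \<theta> + 3 * real q * (real q - 1) * (energy P \<theta>)\<^sup>2)) = quad2 \<theta>"
  proof -
    have "(real q)\<^sup>2 * (real q * m4 \<theta> + real q * (real q - 1) * (energy P \<theta>)\<^sup>2)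
       - 2 * real q * (real q * m4 \<theta> + real q * (real q - 1) * (energy P \<theta>)\<^sup>2)
       + (real q * m4 \<theta> + 3 * real q * (real q - 1) * (energy P \<theta>)\<^sup>2)
       = (real q - 1)\<^sup>2 * real q * (m4 \<theta> + (real q - 1) * (energy P \<theta>)\<^sup>2) + 2 * real q * (real q - 1) * (energy P \<theta>)\<^sup>2"
      by (simp add: power2_eq_square algebra_simps)
    moreover have "c\<^sup>2 * ((real q - 1)\<^sup>2 * real q * (u + (real q - 1) * v) + 2 * real q * (real q - 1) * v)
      = u / real q + ((real q - 1) / real q + 2 / (real q * (real q - 1))) * v" for u v
    proof -
      define r where "r = real q - 1"
      have r: "r \<noteq> 0" "real q = r + 1" "r + 1 \<noteq> 0" using qpos by (auto simp: r_def)
      have "1 + r \<noteq> 0" using r by simp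
      then show ?thesis unfolding c_def r_def[symmetric] r(2) using r(1,3)
        by (simp add: divide_simps power2_eq_square) (simp add: algebra_simps)
    qed
    ultimately show ?thesis unfolding quad2_def by (simp only:)
  qed
  with 2 have "has_bochner_integral ?N (\<lambda>x. (\<theta> \<bullet> (block_mat q x 1 *v \<theta>))\<^sup>2) (quad2 \<theta>)" unfolding eq2 by metis
  then show "has_bochner_integral Q (\<lambda>A. (\<theta> \<bullet> (A *v \<theta>))\<^sup>2) (quad2 \<theta>)"
    unfolding block_law_def by (rule has_bochner_integral_distr[OF borel_measurable_power[OF mq] block_meas])
qed

lemma kurt_block_eq: "kurt_block = kurt_coeff / real q + ((real q - 1) / real q + 2 / (real q * (real q - 1)))"
proof -
  have "real q > 1" using q by auto
  then show ?thesis unfolding kurt_block_def tau_def by (simp add: field_simps)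
qed

lemma tau_pos: "0 < tau q kurt_coeff" using kurt_coeff_ge_1 q by (simp add: tau_def add_nonneg_pos)

lemma kurt_block_gt_1: "1 < kurt_block" using tau_pos q by (simp add: kurt_block_def)

lemma quad2_le: "quad2 \<theta> \<le> kurt_block * (energy P \<theta>)\<^sup>2"
proof -
  have "m4 \<theta> / real q \<le> kurt_coeff * (energy P \<theta>)\<^sup>2 / real q" using m4_le by (intro divide_right_mono) auto
  then show ?thesis unfolding quad2_def kurt_block_eq by (simp add: algebra_simps)
qed

lemma quad2_nonneg: "0 \<le> quad2 \<theta>"
proof -
  have "real q > 1" using q by auto
  then show ?thesis unfolding quad2_def using m4_nonneg by auto
qed

lemma nn_sqrt2: "(\<integral>\<^sup>+A. ennreal (norm (psd_sqrt A *v \<theta>) ^ 2) \<partial>Q) = ennreal (energy P \<theta>)"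
proof -
  have "(\<integral>\<^sup>+A. ennreal (norm (psd_sqrt A *v \<theta>) ^ 2) \<partial>Q) = (\<integral>\<^sup>+A. ennreal (\<theta> \<bullet> (A *v \<theta>)) \<partial>Q)"
    using AE_psd by (intro nn_integral_cong_AE) (auto simp: norm_psd_sqrt)
  also have "\<dots> = ennreal (energy P \<theta>)"
    using Q_moments(1)[of \<theta>] AE_psd
    by (subst nn_integral_eq_integral) (auto simp: has_bochner_integral_iff sym_psd_def)
  finally show ?thesis .
qed

lemma nn_sqrt4: "(\<integral>\<^sup>+A. ennreal (norm (psd_sqrt A *v \<theta>) ^ 4) \<partial>Q) = ennreal (quad2 \<theta>)"
proof -
  have "(norm (psd_sqrt A *v \<theta>)) ^ 4 = (\<theta> \<bullet> (A *v \<theta>))\<^sup>2" if "sym_psd A" for A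
    unfolding norm_psd_sqrt[OF that, symmetric] by simp
  then have "(\<integral>\<^sup>+A. ennreal (norm (psd_sqrt A *v \<theta>) ^ 4) \<partial>Q) = (\<integral>\<^sup>+A. ennreal ((\<theta> \<bullet> (A *v \<theta>))\<^sup>2) \<partial>Q)"
    using AE_psd by (intro nn_integral_cong_AE) auto
  also have "\<dots> = ennreal (quad2 \<theta>)"
    using Q_moments(2)[of \<theta>] by (subst nn_integral_eq_integral) (auto simp: has_bochner_integral_iff)
  finally show ?thesis .
qed

text \<open>In each direction the ratio for a block is an increasing affine function of the ratio
  for the sample, so the supremum passes through and the result is an equality.\<close>

lemma kurtosis_mat_eq: "kurtosis_mat Q = ennreal kurt_block"
proof -
  define e where "e = (real q - 1) / real q + 2 / (real q * (real q - 1))"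
  have qpos: "real q > 1" using q by auto
  have e0: "0 \<le> e" unfolding e_def using qpos by auto
  have "kurtosis_mat Q = (SUP \<theta>\<in>{\<theta>. 0 < energy P \<theta>}. ennreal (m4 \<theta> / (energy P \<theta>)\<^sup>2) / ennreal (real q) + ennreal e)"
    unfolding kurtosis_mat_def nn_sqrt2 nn_sqrt4
  proof (intro SUP_cong)
    show "{\<theta>. 0 < ennreal (energy P \<theta>)} = {\<theta>. 0 < energy P \<theta>}" by auto
    fix \<theta> assume "\<theta> \<in> {\<theta>. 0 < energy P \<theta>}"
    then have p: "0 < energy P \<theta>" by simp
    have "ennreal (quad2 \<theta>) / (ennreal (energy P \<theta>))\<^sup>2 = ennreal (quad2 \<theta> / (energy P \<theta>)\<^sup>2)"
      using p quad2_nonneg by (simp add: ennreal_power divide_ennreal)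
    also have "quad2 \<theta> / (energy P \<theta>)\<^sup>2 = m4 \<theta> / (energy P \<theta>)\<^sup>2 / real q + e"
      using p by (simp add: quad2_def e_def add_divide_distrib)
    also have "ennreal \<dots> = ennreal (m4 \<theta> / (energy P \<theta>)\<^sup>2) / ennreal (real q) + ennreal e"
      using p e0 m4_nonneg[of \<theta>] qpos by (simp add: divide_ennreal ennreal_plus)
    finally show "ennreal (quad2 \<theta>) / (ennreal (energy P \<theta>))\<^sup>2 = \<dots>" .
  qed
  also have "\<dots> = (SUP \<theta>\<in>{\<theta>. 0 < energy P \<theta>}. ennreal (m4 \<theta> / (energy P \<theta>)\<^sup>2) / ennreal (real q)) + ennreal e"
    using energy_pos_exists by (intro ennreal_SUP_add_left) auto
  also have "(SUP \<theta>\<in>{\<theta>. 0 < energy P \<theta>}. ennreal (m4 \<theta> / (energy P \<theta>)\<^sup>2) / ennreal (real q)) = kurtosis P / ennreal (real q)"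
    unfolding kurtosis_eq by (simp add: divide_ennreal_def SUP_mult_right_ennreal)
  also have "kurtosis P / ennreal (real q) + ennreal e = ennreal kurt_block"
    unfolding kurtosis_kurt_coeff kurt_block_eq e_def[symmetric] using kurt_coeff_ge_1 qpos e0 by (simp add: divide_ennreal ennreal_plus)
  finally show ?thesis .
qed


section \<open>Moments of the operator norm and of the trace of a block\<close>

definition "M2 = (\<integral>A. (op_norm A)\<^sup>2 \<partial>Q)"
definition "V2 = (\<integral>A. trace (A ** A) \<partial>Q)"
definition "Tr = trace (cov_mat P)"

lemma op_norm_measurable [measurable]: "op_norm \<in> borel_measurable (borel :: (real^'d^'d) measure)"
  by (rule borel_measurable_continuous_onI[OF op_norm_continuous])

lemma trace_measurable [measurable]: "trace \<in> borel_measurable (borel :: (real^'d^'d) measure)"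
  by (rule borel_measurable_continuous_onI[OF continuous_on_trace])

lemma quad_integrable: "integrable Q (\<lambda>A. \<theta> \<bullet> (A *v \<theta>))" "integrable Q (\<lambda>A. (\<theta> \<bullet> (A *v \<theta>))\<^sup>2)"
  "(\<integral>A. \<theta> \<bullet> (A *v \<theta>) \<partial>Q) = energy P \<theta>" "(\<integral>A. (\<theta> \<bullet> (A *v \<theta>))\<^sup>2 \<partial>Q) \<le> kurt_block * (energy P \<theta>)\<^sup>2"
  using Q_moments[of \<theta>] quad2_le[of \<theta>] by (auto simp: has_bochner_integral_iff)

text \<open>The trace is a sum of quadratic forms along the axes. Cauchy-Schwarz for each pair of
  axes costs only the kurtosis, and the energies recombine into the squared trace of the
  covariance.\<close>

lemma trace_square_moment:
  "integrable Q (\<lambda>A. (trace A)\<^sup>2)" "(\<integral>A. (trace A)\<^sup>2 \<partial>Q) \<le> kurt_block * Tr\<^sup>2"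
proof -
  have eq: "(trace A)\<^sup>2 = (\<Sum>i\<in>UNIV. \<Sum>j\<in>UNIV. (axis i 1 \<bullet> (A *v axis i 1)) * (axis j 1 \<bullet> (A *v axis j 1)))" for A :: "real^'d^'d"
    by (simp add: trace_eq_sum_axis power2_eq_square sum_product)
  have cs: "integrable Q (\<lambda>A. (u \<bullet> (A *v u)) * (v \<bullet> (A *v v)))"
    "(\<integral>A. (u \<bullet> (A *v u)) * (v \<bullet> (A *v v)) \<partial>Q) \<le> kurt_block * (energy P u * energy P v)" for u v :: "real^'d"
  proof -
    note c = Cauchy_Schwarz_integral[OF quad_integrable(2)[of u] quad_integrable(2)[of v]]
    show "integrable Q (\<lambda>A. (u \<bullet> (A *v u)) * (v \<bullet> (A *v v)))" by (rule c(1)) measurable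
    have "(\<integral>A. (u \<bullet> (A *v u)) * (v \<bullet> (A *v v)) \<partial>Q) \<le> sqrt (\<integral>A. (u \<bullet> (A *v u))\<^sup>2 \<partial>Q) * sqrt (\<integral>A. (v \<bullet> (A *v v))\<^sup>2 \<partial>Q)"
      by (rule c(2)) measurable
    also have "\<dots> \<le> sqrt (kurt_block * (energy P u)\<^sup>2) * sqrt (kurt_block * (energy P v)\<^sup>2)"
      using kurt_block_gt_1 by (intro mult_mono real_sqrt_le_mono quad_integrable(4)) auto
    also have "\<dots> = kurt_block * (energy P u * energy P v)"
      using kurt_block_gt_1 energy_nonneg by (simp add: real_sqrt_mult)
    finally show "(\<integral>A. (u \<bullet> (A *v u)) * (v \<bullet> (A *v v)) \<partial>Q) \<le> kurt_block * (energy P u * energy P v)" .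
  qed
  show "integrable Q (\<lambda>A. (trace A)\<^sup>2)" unfolding eq by (intro Bochner_Integration.integrable_sum cs)
  have "(\<integral>A. (trace A)\<^sup>2 \<partial>Q) = (\<Sum>i\<in>UNIV. \<Sum>j\<in>UNIV. (\<integral>A. (axis i 1 \<bullet> (A *v axis i 1)) * (axis j 1 \<bullet> (A *v axis j 1)) \<partial>Q))"
    unfolding eq using cs(1) by (simp add: Bochner_Integration.integral_sum)
  also have "\<dots> \<le> (\<Sum>i\<in>UNIV. \<Sum>j\<in>UNIV. kurt_block * (energy P (axis i 1) * energy P (axis j 1)))"
    by (intro sum_mono cs)
  also have "\<dots> = kurt_block * Tr\<^sup>2" unfolding Tr_def trace_cov power2_eq_square sum_product by (simp add: sum_distrib_left)
  finally show "(\<integral>A. (trace A)\<^sup>2 \<partial>Q) \<le> kurt_block * Tr\<^sup>2" .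
qed

lemma Tr_pos: "0 < Tr" using trace_pos by (simp add: Tr_def)

lemma psd_bounds:
  assumes "sym_psd (A :: real^'d^'d)"
  shows "0 \<le> trace A" "(op_norm A)\<^sup>2 \<le> (trace A)\<^sup>2" "(norm A)\<^sup>2 \<le> (trace A)\<^sup>2" "trace (A ** A) = (norm A)\<^sup>2"
proof -
  show t: "0 \<le> trace A" unfolding trace_eq_sum_axis using assms by (auto simp: sym_psd_def intro: sum_nonneg)
  show "(op_norm A)\<^sup>2 \<le> (trace A)\<^sup>2" using psd_op_norm_le_trace[OF assms] op_norm_nonneg[of A] by (intro power_mono)
  show e: "trace (A ** A) = (norm A)\<^sup>2" using assms trace_square_sym[of A] unfolding sym_psd_def by blast
  have "trace (A ** A) \<le> op_norm A * trace A" by (rule psd_trace_square_le[OF assms])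
  also have "\<dots> \<le> trace A * trace A" using psd_op_norm_le_trace[OF assms] t by (intro mult_right_mono)
  finally show "(norm A)\<^sup>2 \<le> (trace A)\<^sup>2" unfolding e by (simp add: power2_eq_square)
qed

lemma norm_square_integrable: "integrable Q (\<lambda>A. (norm A)\<^sup>2)"
  using AE_psd psd_bounds by (intro Bochner_Integration.integrable_bound[OF trace_square_moment(1)]) auto

lemma op_norm_square_integrable: "integrable Q (\<lambda>A. (op_norm A)\<^sup>2)"
  using AE_psd psd_bounds by (intro Bochner_Integration.integrable_bound[OF trace_square_moment(1)]) auto

lemma V2_eq: "V2 = (\<integral>A. (norm A)\<^sup>2 \<partial>Q)"
  unfolding V2_def
proof (rule integral_cong_AE)
  have "continuous_on UNIV (\<lambda>A::real^'d^'d. A ** A)" unfolding matrix_matrix_mult_def by (intro continuous_intros)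
  then have "(\<lambda>A::real^'d^'d. trace (A ** A)) \<in> borel_measurable borel"
    using measurable_compose[OF borel_measurable_continuous_onI trace_measurable] by blast
  then show "(\<lambda>A. trace (A ** A)) \<in> borel_measurable Q" by simp
  show "AE A in Q. trace (A ** A) = (norm A)\<^sup>2" using AE_psd psd_bounds(4) by auto
qed measurable

lemma M2_le_V2: "M2 \<le> V2"
  unfolding V2_eq M2_def
  using AE_psd op_norm_square_le_trace_square psd_bounds(4) op_norm_square_integrable norm_square_integrable
  by (intro integral_mono_AE) (auto, fastforce)

lemma M2_nonneg: "0 \<le> M2" unfolding M2_def by simp

lemma M2_le: "M2 \<le> kurt_block * Tr\<^sup>2"
proof -
  have "M2 \<le> (\<integral>A. (trace A)\<^sup>2 \<partial>Q)"
    unfolding M2_def using AE_psd psd_bounds(2) op_norm_square_integrable trace_square_moment(1) by (intro integral_mono_AE) auto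
  then show ?thesis using trace_square_moment(2) by simp
qed

text \<open>From Tr(A^2) <= |A| Tr(A) and Cauchy-Schwarz. Keeping one factor sqrt \<open>M2\<close>
  = s4^2 matters: it cancels against the normalisation of the grid in
  \<open>Wc_bounds\<close>.\<close>

lemma V2_le: "V2 \<le> sqrt M2 * (sqrt kurt_block * Tr)"
proof -
  note c = Cauchy_Schwarz_integral[OF op_norm_square_integrable trace_square_moment(1)]
  have i: "integrable Q (\<lambda>A. op_norm A * trace A)" by (rule c(1)) measurable
  have "V2 \<le> (\<integral>A. op_norm A * trace A \<partial>Q)"
    unfolding V2_eq using AE_psd psd_trace_square_le psd_bounds(4) i norm_square_integrable
    by (intro integral_mono_AE) (auto, fastforce)
  also have "\<dots> \<le> sqrt M2 * sqrt (\<integral>A. (trace A)\<^sup>2 \<partial>Q)" unfolding M2_def by (rule c(2)) measurable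
  also have "\<dots> \<le> sqrt M2 * sqrt (kurt_block * Tr\<^sup>2)"
    using M2_nonneg by (intro mult_left_mono real_sqrt_le_mono trace_square_moment) auto
  also have "\<dots> = sqrt M2 * (sqrt kurt_block * Tr)" using Tr_pos by (simp add: real_sqrt_mult)
  finally show ?thesis .
qed

lemma energy_le: "energy P \<theta> \<le> sqrt M2 * (norm \<theta>)\<^sup>2"
proof -
  have o1: "(\<lambda>_::real^'d^'d. 1 :: real) \<in> borel_measurable Q" by simp
  have "integrable Q (\<lambda>A. (1::real)\<^sup>2)" by simp
  note c = Cauchy_Schwarz_integral[OF op_norm_square_integrable this]
  have i: "integrable Q (\<lambda>A. op_norm A * 1)" by (rule c(1)) measurable
  have "energy P \<theta> \<le> (\<integral>A. op_norm A * 1 * (norm \<theta>)\<^sup>2 \<partial>Q)"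
    unfolding quad_integrable(3)[symmetric] using i quad_integrable quad_le_op_norm by (intro integral_mono) auto
  also have "\<dots> = (\<integral>A. op_norm A * 1 \<partial>Q) * (norm \<theta>)\<^sup>2" using i by simp
  also have "(\<integral>A. op_norm A * 1 \<partial>Q) \<le> sqrt M2 * sqrt (\<integral>A. 1\<^sup>2 \<partial>Q)" unfolding M2_def by (rule c(2)) measurable
  finally show ?thesis by (simp add: Q.prob_space mult_right_mono)
qed

lemma M2_pos: "0 < M2"
proof (rule ccontr)
  assume "\<not> ?thesis"
  then have "M2 = 0" using M2_nonneg by simp
  then have "energy P \<theta> \<le> 0" for \<theta> using energy_le[of \<theta>] by simp
  then show False using energy_pos_exists by (meson not_le)
qed

lemma quad_square_le: "(\<integral>A. (\<theta> \<bullet> (A *v \<theta>))\<^sup>2 \<partial>Q) \<le> M2 * ((norm \<theta>)\<^sup>2)\<^sup>2"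
proof -
  have "(\<theta> \<bullet> (A *v \<theta>))\<^sup>2 \<le> (op_norm A)\<^sup>2 * ((norm \<theta>)\<^sup>2)\<^sup>2" if "sym_psd A" for A
    using power_mono[OF quad_le_op_norm[of \<theta> A], of 2] that by (auto simp: sym_psd_def power_mult_distrib)
  then have "(\<integral>A. (\<theta> \<bullet> (A *v \<theta>))\<^sup>2 \<partial>Q) \<le> (\<integral>A. (op_norm A)\<^sup>2 * ((norm \<theta>)\<^sup>2)\<^sup>2 \<partial>Q)"
    using AE_psd quad_integrable op_norm_square_integrable by (intro integral_mono_AE) auto
  also have "\<dots> = M2 * ((norm \<theta>)\<^sup>2)\<^sup>2" unfolding M2_def by simp
  finally show ?thesis .
qed

text \<open>The first bound is proportional to the energy and serves at moderate levels; the second,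
  proportional to |theta|^2, serves at high levels.\<close>

lemma image_square_le:
  "(\<integral>A. (norm (A *v \<theta>))\<^sup>2 \<partial>Q) \<le> sqrt M2 * (sqrt kurt_block * energy P \<theta>)"
  "(\<integral>A. (norm (A *v \<theta>))\<^sup>2 \<partial>Q) \<le> M2 * (norm \<theta>)\<^sup>2"
proof -
  note c = Cauchy_Schwarz_integral[OF op_norm_square_integrable quad_integrable(2)[of \<theta>]]
  have i: "integrable Q (\<lambda>A. op_norm A * (\<theta> \<bullet> (A *v \<theta>)))" by (rule c(1)) measurable
  note ii = integrable_square_norm_matrix(3)[OF prob_Q sets_Q norm_square_integrable, of \<theta>]
  have "(\<integral>A. (norm (A *v \<theta>))\<^sup>2 \<partial>Q) \<le> (\<integral>A. op_norm A * (\<theta> \<bullet> (A *v \<theta>)) \<partial>Q)"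
    using AE_psd psd_norm_image_le i ii by (intro integral_mono_AE) auto
  also have "\<dots> \<le> sqrt M2 * sqrt (\<integral>A. (\<theta> \<bullet> (A *v \<theta>))\<^sup>2 \<partial>Q)" unfolding M2_def by (rule c(2)) measurable
  also have "\<dots> \<le> sqrt M2 * sqrt (kurt_block * (energy P \<theta>)\<^sup>2)"
    using M2_nonneg by (intro mult_left_mono real_sqrt_le_mono quad_integrable) auto
  also have "\<dots> = sqrt M2 * (sqrt kurt_block * energy P \<theta>)" using energy_nonneg by (simp add: real_sqrt_mult)
  finally show "(\<integral>A. (norm (A *v \<theta>))\<^sup>2 \<partial>Q) \<le> sqrt M2 * (sqrt kurt_block * energy P \<theta>)" .
  have "(norm (A *v \<theta>))\<^sup>2 \<le> (op_norm A)\<^sup>2 * (norm \<theta>)\<^sup>2" for A :: "real^'d^'d"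
    using power_mono[OF op_norm_le[of A \<theta>], of 2] by (simp add: power_mult_distrib)
  then have "(\<integral>A. (norm (A *v \<theta>))\<^sup>2 \<partial>Q) \<le> (\<integral>A. (op_norm A)\<^sup>2 * (norm \<theta>)\<^sup>2 \<partial>Q)"
    using ii op_norm_square_integrable by (intro integral_mono) auto
  then show "(\<integral>A. (norm (A *v \<theta>))\<^sup>2 \<partial>Q) \<le> M2 * (norm \<theta>)\<^sup>2" unfolding M2_def by simp
qed

lemma s4_square: "(s4 Q)\<^sup>2 = sqrt M2"
proof -
  have "s4 Q = M2 powr (1/4)" by (simp add: s4_def M2_def)
  then have "(s4 Q)\<^sup>2 = M2 powr (1/4 + 1/4)" unfolding power2_eq_square by (simp only: powr_add)
  then show ?thesis using M2_nonneg by (simp add: powr_half_sqrt)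
qed


section \<open>Independence and common law of the blocks\<close>

lemma block_mat_cong:
  assumes "\<And>j. j \<in> {(i - 1) * q<..i * q} \<Longrightarrow> x j = y j" shows "block_mat q x i = block_mat q y i"
  unfolding block_mat_def using assms by (intro arg_cong[where f="scaleR _"] sum.cong refl) auto

lemma block_mat_shift:
  assumes i: "1 \<le> i" and eq: "\<And>j. j \<in> {1..q} \<Longrightarrow> y j = x (j + (i - 1) * q)"
  shows "block_mat q y 1 = block_mat q x i"
proof -
  define c where "c = (i - 1) * q"
  have iq: "i * q = q + c" using i by (simp add: c_def algebra_simps)
  have "(\<Sum>k\<in>{c<..q + c}. \<Sum>j\<in>{c<..<k}. outer_prod (x j - x k)) = (\<Sum>k\<in>{0<..q}. \<Sum>j\<in>{0<..<k}. outer_prod (y j - y k))"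
  proof (rule sum.reindex_cong[of "\<lambda>k. k + c"])
    show "{c<..q + c} = (\<lambda>k. k + c) ` {0<..q}"
    proof (intro equalityI subsetI)
      fix k assume "k \<in> {c<..q + c}"
      then show "k \<in> (\<lambda>k. k + c) ` {0<..q}" by (intro image_eqI[of _ _ "k - c"]) auto
    qed auto
    fix k assume k: "k \<in> {0<..q}"
    show "(\<Sum>j\<in>{c<..<k + c}. outer_prod (x j - x (k + c))) = (\<Sum>j\<in>{0<..<k}. outer_prod (y j - y k))"
    proof (rule sum.reindex_cong[of "\<lambda>k. k + c"])
      show "{c<..<k + c} = (\<lambda>k. k + c) ` {0<..<k}"
      proof (intro equalityI subsetI)
        fix j assume "j \<in> {c<..<k + c}"
        then show "j \<in> (\<lambda>k. k + c) ` {0<..<k}" by (intro image_eqI[of _ _ "j - c"]) auto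
      qed auto
      fix j assume "j \<in> {0<..<k}"
      then show "outer_prod (x (j + c) - x (k + c)) = outer_prod (y j - y k)"
        using eq[of j] eq[of k] k by (simp add: c_def)
    qed auto
  qed auto
  then show ?thesis unfolding block_mat_def c_def[symmetric] iq by simp
qed

text \<open>The blocks depend on disjoint ranges of indices. A shift maps {1..q} onto each range and
  carries the product measure there to the one in \<open>block_law\<close>.\<close>

lemma blocks_iid:
  fixes M :: "'w measure" and X :: "nat \<Rightarrow> 'w \<Rightarrow> real^'d"
  assumes M: "prob_space M" and indep: "prob_space.indep_vars M (\<lambda>_. borel) X {1..n}"
    and identical: "\<And>i. i \<in> {1..n} \<Longrightarrow> distr M borel (X i) = P"
  shows "prob_space.indep_vars M (\<lambda>_. borel) (\<lambda>i \<omega>. block_mat q (\<lambda>j. X j \<omega>) i) {1..n div q}"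
    and "\<And>i. i \<in> {1..n div q} \<Longrightarrow> distr M borel (\<lambda>\<omega>. block_mat q (\<lambda>j. X j \<omega>) i) = Q"
proof -
  interpret M: prob_space M by fact
  define I where "I i = {(i - 1) * q<..i * q}" for i
  have sub: "I i \<subseteq> {1..n}" if "i \<in> {1..n div q}" for i
  proof -
    have "i * q \<le> n" using that q by (metis atLeastAtMost_iff div_times_less_eq_dividend le_trans mult_le_mono1)
    then show ?thesis by (auto simp: I_def)
  qed
  have disj: "disjoint_family_on I {1..n div q}"
    unfolding disjoint_family_on_def
  proof (intro ballI impI)
    fix a b assume ab: "a \<in> {1..n div q}" "b \<in> {1..n div q}" "a \<noteq> b"
    have *: "I a \<inter> I b = {}" if "a < b" for a b
    proof -
      have "a * q \<le> (b - 1) * q" using that by (intro mult_le_mono1) auto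
      then show ?thesis by (auto simp: I_def)
    qed
    show "I a \<inter> I b = {}" using *[of a b] *[of b a] ab by (cases "a < b") auto
  qed
  have XM: "X j \<in> borel_measurable M" if "j \<in> {1..n}" for j
    using indep that by (auto simp: M.indep_vars_def)
  have restr: "block_mat q (restrict (\<lambda>j. X j \<omega>) (I i)) i = block_mat q (\<lambda>j. X j \<omega>) i" for i \<omega>
    by (rule block_mat_cong) (auto simp: I_def)
  have bm: "(\<lambda>x. block_mat q x i) \<in> borel_measurable (Pi\<^sub>M (I i) (\<lambda>_. borel))" for i
    by (rule block_mat_measurable) (auto simp: I_def)
  have "M.indep_vars (\<lambda>_. borel) (\<lambda>i \<omega>. block_mat q (restrict (\<lambda>j. X j \<omega>) (I i)) i) {1..n div q}"
    by (rule M.indep_vars_compose2[OF M.indep_vars_restrict[OF indep sub disj]]) (auto intro: bm)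
  then show "M.indep_vars (\<lambda>_. borel) (\<lambda>i \<omega>. block_mat q (\<lambda>j. X j \<omega>) i) {1..n div q}" unfolding restr .
  fix i assume i: "i \<in> {1..n div q}"
  then have i1: "1 \<le> i" by simp
  have ne: "I i \<noteq> {}"
  proof -
    have "(i - 1) * q < i * q" using i1 q by (intro mult_strict_right_mono) auto
    then show ?thesis by (auto simp: I_def)
  qed
  have "M.indep_vars (\<lambda>_. borel) X (I i)" by (rule M.indep_vars_subset[OF indep sub[OF i]])
  then have "distr M (Pi\<^sub>M (I i) (\<lambda>_. borel)) (\<lambda>\<omega>. \<lambda>j\<in>I i. X j \<omega>) = Pi\<^sub>M (I i) (\<lambda>j. distr M borel (X j))"
    using XM sub[OF i] by (subst (asm) M.indep_vars_iff_distr_eq_PiM'[OF ne]) auto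
  also have "\<dots> = Pi\<^sub>M (I i) (\<lambda>_. P)" using identical sub[OF i] by (intro PiM_cong refl) auto
  finally have law: "distr M (Pi\<^sub>M (I i) (\<lambda>_. borel)) (\<lambda>\<omega>. \<lambda>j\<in>I i. X j \<omega>) = Pi\<^sub>M (I i) (\<lambda>_. P)" .
  have Xr: "(\<lambda>\<omega>. \<lambda>j\<in>I i. X j \<omega>) \<in> measurable M (Pi\<^sub>M (I i) (\<lambda>_. borel))"
    using XM sub[OF i] by (intro measurable_restrict) auto
  have "distr M borel (\<lambda>\<omega>. block_mat q (\<lambda>j. X j \<omega>) i) = distr M borel (\<lambda>\<omega>. block_mat q (\<lambda>j\<in>I i. X j \<omega>) i)"
    unfolding restr ..
  also have "\<dots> = distr (distr M (Pi\<^sub>M (I i) (\<lambda>_. borel)) (\<lambda>\<omega>. \<lambda>j\<in>I i. X j \<omega>)) borel (\<lambda>x. block_mat q x i)"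
    by (subst distr_distr[OF bm Xr]) (simp add: comp_def)
  also have "\<dots> = distr (Pi\<^sub>M (I i) (\<lambda>_. P)) borel (\<lambda>x. block_mat q x i)" unfolding law ..
  finally have 1: "distr M borel (\<lambda>\<omega>. block_mat q (\<lambda>j. X j \<omega>) i) = distr (Pi\<^sub>M (I i) (\<lambda>_. P)) borel (\<lambda>x. block_mat q x i)" .
  define f where "f j = j + (i - 1) * q" for j
  have iq: "i * q = q + (i - 1) * q" using i1 by (metis add.commute le_add_diff_inverse mult_Suc plus_1_eq_Suc)
  have f: "inj_on f {1..q}" "f \<in> {1..q} \<rightarrow> I i" by (auto simp: f_def I_def iq inj_on_def)
  have "Pi\<^sub>M {1..q} (\<lambda>_. P) = distr (Pi\<^sub>M (I i) (\<lambda>_. P)) (Pi\<^sub>M {1..q} (\<lambda>_. P)) (\<lambda>x. \<lambda>j\<in>{1..q}. x (f j))"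
    by (rule distr_PiM_reindex[OF _ f, of "\<lambda>_. P", symmetric]) (rule prob)
  then have "Q = distr (distr (Pi\<^sub>M (I i) (\<lambda>_. P)) (Pi\<^sub>M {1..q} (\<lambda>_. P)) (\<lambda>x. \<lambda>j\<in>{1..q}. x (f j))) borel (\<lambda>x. block_mat q x 1)"
    unfolding block_law_def by simp
  also have "\<dots> = distr (Pi\<^sub>M (I i) (\<lambda>_. P)) borel (\<lambda>x. block_mat q (\<lambda>j\<in>{1..q}. x (f j)) 1)"
    using f by (subst distr_distr[OF block_meas]) (auto simp: comp_def intro!: measurable_restrict measurable_component_singleton)
  also have "(\<lambda>x. block_mat q (\<lambda>j\<in>{1..q}. x (f j)) 1) = (\<lambda>x. block_mat q x i)"
    by (intro ext block_mat_shift[OF i1]) (simp add: f_def)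
  finally show "distr M borel (\<lambda>\<omega>. block_mat q (\<lambda>j. X j \<omega>) i) = Q" using 1 by simp
qed

lemma energy_le_Tr: "energy P \<theta> \<le> Tr * (norm \<theta>)\<^sup>2"
proof -
  have t: "trace = (\<lambda>A::real^'d^'d. \<Sum>i\<in>UNIV. axis i 1 \<bullet> (A *v axis i 1))"
    by (rule ext) (rule trace_eq_sum_axis)
  have "integrable Q trace" "integral\<^sup>L Q trace = (\<Sum>i\<in>UNIV. energy P (axis i 1))"
    unfolding t using quad_integrable(1,3) by auto
  then have i: "integrable Q trace" "integral\<^sup>L Q trace = Tr" by (simp_all add: Tr_def trace_cov)
  have "\<theta> \<bullet> (A *v \<theta>) \<le> trace A * (norm \<theta>)\<^sup>2" if "sym_psd A" for A
    using quad_le_op_norm[of \<theta> A] mult_right_mono[OF psd_op_norm_le_trace[OF that], of "(norm \<theta>)\<^sup>2"] by simp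
  then have "energy P \<theta> \<le> (\<integral>A. trace A * (norm \<theta>)\<^sup>2 \<partial>Q)"
    unfolding quad_integrable(3)[symmetric] using AE_psd i quad_integrable(1) by (intro integral_mono_AE) auto
  then show ?thesis using i by simp
qed

end

section \<open>Numerical estimates for the grid\<close>

lemma exp_upper:
  fixes x :: real assumes "0 \<le> x" "x \<le> 1"
  shows "exp x \<le> 1 + x + x^2 / 2 + x^3 / 6 + x^4 / 24 + x^5 / 120 + x^6 / 240"
proof -
  obtain t where t: "\<bar>t\<bar> \<le> \<bar>x\<bar>" "exp x = (\<Sum>m<6. x ^ m / fact m) + exp t / fact 6 * x ^ 6"
    using Maclaurin_exp_le[of x 6] by blast
  have "exp t \<le> exp 1" using t assms by simp
  also have "\<dots> \<le> 3" by (rule exp_le)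
  finally have "exp t / fact 6 * x ^ 6 \<le> 3 / fact 6 * x ^ 6" using assms by (intro mult_right_mono divide_right_mono) auto
  then show ?thesis using t(2) by (simp add: eval_nat_numeral fact_numeral)
qed

lemma exp_lower:
  fixes x :: real assumes "0 \<le> x" shows "1 + x + x^2 / 2 + x^3 / 6 + x^4 / 24 \<le> exp x"
proof -
  obtain t where t: "\<bar>t\<bar> \<le> \<bar>x\<bar>" "exp x = (\<Sum>m<5. x ^ m / fact m) + exp t / fact 5 * x ^ 5"
    using Maclaurin_exp_le[of x 5] by blast
  have "0 \<le> exp t / fact 5 * x ^ 5" using assms by (intro mult_nonneg_nonneg) auto
  then show ?thesis using t(2) by (simp add: eval_nat_numeral fact_numeral)
qed

lemma exp_half_le: "exp (1/2 :: real) \<le> 16488/10000"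
  by (rule order_trans[OF exp_upper]) (simp_all add: eval_nat_numeral)

lemma exp_quarter_bounds: "exp (1/4 :: real) \<le> 1285/1000" "1284/1000 \<le> exp (1/4 :: real)"
   apply (rule order_trans[OF exp_upper]; simp add: eval_nat_numeral)
  apply (rule order_trans[OF _ exp_lower]; simp add: eval_nat_numeral)
  done

lemma exp_quarter_square: "exp (1/4 :: real) * exp (1/4) = exp (1/2)"
  by (simp add: exp_add[symmetric])

lemma sqrt2_bounds: "141421/100000 \<le> sqrt 2" "sqrt 2 \<le> 141422/100000"
  by (rule real_le_rsqrt real_le_lsqrt; simp add: power2_eq_square)+

text \<open>The exponent is about 1.91; taking an eighth brings it into the range where the Taylor
  polynomials are accurate. The upper bound is behind the constants 0.73 and 98.5 of the theorem,
  and the lower one gives \<open>cst_c\<close> - \<open>dev_cst\<close> >= 22.3.\<close>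

lemma cst_c_bounds: "44 \<le> cst_c" "cst_c \<le> 4429/100"
proof -
  define x where "x = (1 + 2 * sqrt 2) / 2"
  have x: "191421/100000 \<le> x" "x \<le> 191422/100000" unfolding x_def using sqrt2_bounds by auto
  have e8: "exp x = (exp (x / 8)) ^ 8" by (simp add: exp_of_nat_mult[symmetric])
  have up: "exp x \<le> 67817/10000"
  proof -
    have "exp (x / 8) \<le> exp (2392775/10000000)" using x by simp
    also have "\<dots> \<le> 1270332/1000000" by (rule order_trans[OF exp_upper]) (simp_all add: eval_nat_numeral)
    finally have "exp (x / 8) ^ 8 \<le> (1270332/1000000) ^ 8" by (intro power_mono) auto
    also have "\<dots> \<le> 67817/10000" by (simp add: eval_nat_numeral)
    finally show ?thesis unfolding e8 .
  qed
  have lo: "677/100 \<le> exp x"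
  proof -
    have "127015/100000 \<le> exp (23927/100000 :: real)" by (rule order_trans[OF _ exp_lower]) (simp_all add: eval_nat_numeral)
    also have "\<dots> \<le> exp (x / 8)" using x by simp
    finally have "(127015/100000) ^ 8 \<le> exp (x / 8) ^ 8" by (intro power_mono) auto
    moreover have "(677/100 :: real) \<le> (127015/100000) ^ 8" by (simp add: eval_nat_numeral)
    ultimately show ?thesis unfolding e8 by linarith
  qed
  define d where "d = 8 * ln 2 * (sqrt 2 - 1)"
  have "ln 2 * (sqrt 2 - 1) \<le> (69315/100000) * (41422/100000)" using ln2_bounds sqrt2_bounds by (intro mult_mono) auto
  then have d2: "d \<le> 229697/100000" unfolding d_def by simp
  have "(69314/100000) * (41421/100000) \<le> ln 2 * (sqrt 2 - 1)" using ln2_bounds sqrt2_bounds by (intro mult_mono) auto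
  then have d1: "229684/100000 \<le> d" unfolding d_def by simp
  have c: "cst_c = 15 / d * exp x" unfolding cst_c_def d_def x_def by simp
  have "15 / d * exp x \<le> 15 / (229684/100000) * (67817/10000)"
    using d1 up by (intro mult_mono divide_left_mono) auto
  then show "cst_c \<le> 4429/100" unfolding c by simp
  have "15 / (229697/100000) * (677/100) \<le> 15 / d * exp x"
    using d1 d2 lo by (intro mult_mono divide_left_mono mult_pos_pos) auto
  then show "44 \<le> cst_c" unfolding c by simp
qed

lemma dev_cst_le: "dev_cst \<le> 217/10"
  unfolding dev_cst_def using ln2_bounds by (simp add: pos_divide_le_eq)

text \<open>The bound is stated with \<open>K\<close>, whose logarithm carries the factor \<open>1/2\<close>, whereas the grid has
  \<open>K'\<close> points, with the factor \<open>2\<close>. The loss \<open>ln (K' / K)\<close> is recovered later from \<open>dev_cst < cst_c\<close>.\<close>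

lemma log_gap:
  fixes K K' :: int and x y :: real
  assumes K: "K = 1 + \<lceil>1 / 2 * x\<rceil>" and K': "K' = 1 + \<lceil>2 * x\<rceil>" and pos: "1 \<le> K" "1 \<le> K'"
    and y: "73/100 + ln (real_of_int K) \<le> y"
  shows "ln (real_of_int K' / real_of_int K) \<le> 2 * ln 2"
    "sqrt (y + ln (real_of_int K' / real_of_int K)) \<le> sqrt y + 45/100"
proof -
  define r where "r = ln (real_of_int K' / real_of_int K)"
  have Kr: "1 \<le> real_of_int K" "1 \<le> real_of_int K'" using pos by auto
  \<comment> \<open>Rounding up turns 2 x = 4 (x / 2) into K' - 1 <= 4 (K - 1).\<close>
  have le: "K' \<le> 4 * K - 3"
  proof -
    have "1 / 2 * x \<le> of_int (K - 1)" using K by linarith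
    then have "2 * x \<le> of_int (4 * (K - 1))" by simp
    then have "\<lceil>2 * x\<rceil> \<le> 4 * (K - 1)" by (simp only: ceiling_le_iff)
    then have "K' - 1 \<le> 4 * (K - 1)" unfolding K' by simp
    then show ?thesis by presburger
  qed
  have r1: "r \<le> ln (real_of_int (4 * K - 3) / real_of_int K)" unfolding r_def using Kr le
    by (intro ln_mono divide_right_mono divide_pos_pos) auto
  have "real_of_int (4 * K - 3) / real_of_int K \<le> 4" using Kr by (simp add: pos_divide_le_eq)
  then have "ln (real_of_int (4 * K - 3) / real_of_int K) \<le> ln 4" using Kr by (intro ln_mono divide_pos_pos) auto
  also have "ln (4::real) = ln (2 ^ 2)" by simp
  also have "\<dots> = 2 * ln 2" by (simp only: ln_realpow)
  finally have r2: "r \<le> 2 * ln 2" using r1 by simp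
  then show "ln (real_of_int K' / real_of_int K) \<le> 2 * ln 2" by (simp add: r_def)
  have y0: "73/100 \<le> y" using y Kr ln_ge_zero[of "real_of_int K"] by linarith
  \<comment> \<open>The claim squared: 0.2025 is the square of 0.45 and 0.9 its double. For K = 1
    there is no loss, and for larger K the summand ln K in y makes the square root large
    enough.\<close>
  have main: "r \<le> 2025/10000 + 9/10 * sqrt y"
  proof -
    consider "K = 1" | "K = 2" | "3 \<le> K" using pos by linarith
    then show ?thesis
    proof cases
      case 1
      then have "r \<le> 0" using r1 by simp
      moreover have "0 \<le> sqrt y" using y0 by simp
      ultimately show ?thesis by linarith
    next
      case 2
      then have "r \<le> ln (5/2)" using r1 by simp
      also have "ln (5/2 :: real) = ln 2 + ln (5/4)" using ln_mult[of 2 "5/4::real"] by simp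
      also have "ln (5/4 :: real) \<le> 5/4 - 1" by (rule ln_le_minus_one) simp
      finally have "r \<le> 95/100" using ln2_bounds by simp
      moreover have "142/100 \<le> y" using y 2 ln2_bounds by simp
      then have "119/100 \<le> sqrt y" by (intro real_le_rsqrt) (simp add: power2_eq_square)
      ultimately show ?thesis by simp
    next
      case 3
      have "ln 2 + ln (3/2) = ln (3::real)" using ln_mult[of 2 "3/2::real"] by simp
      moreover have "1 / 3 \<le> ln (3/2 :: real)" using ln_le_minus_one[of "2/3::real"] by (simp add: ln_div)
      moreover have "ln 3 \<le> ln (real_of_int K)" using 3 by (intro ln_mono) auto
      ultimately have "1756/1000 \<le> y" using y ln2_bounds by simp
      then have "1325/1000 \<le> sqrt y" by (intro real_le_rsqrt) (simp add: power2_eq_square)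
      then show ?thesis using r2 ln2_bounds by simp
    qed
  qed
  have "y + r \<le> (sqrt y + 45/100)\<^sup>2" using main y0 by (simp add: power2_sum) (simp add: power2_eq_square)
  then show "sqrt (y + ln (real_of_int K' / real_of_int K)) \<le> sqrt y + 45/100"
    unfolding r_def using y0 by (intro real_le_lsqrt) auto
qed

lemma sum_recip_le:
  fixes x b :: real assumes "1 / b \<le> x" "x \<le> b" "1 \<le> b" shows "x + 1 / x \<le> b + 1 / b"
proof -
  have b: "0 < b" "0 < 1 / b" using assms by auto
  then have x: "0 < x" using assms by linarith
  have "0 \<le> (b - x) * (x - 1 / b)" using assms by (intro mult_nonneg_nonneg) auto
  then have "x * (x + 1 / x) \<le> x * (b + 1 / b)" using x b by (simp add: algebra_simps diff_divide_distrib)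
  then show ?thesis using x by simp
qed

text \<open>\<open>Ej\<close> stands for \<open>exp (j a)\<close>, \<open>A4\<close> for \<open>s4\<^sup>2\<close> and \<open>V\<close> for the expectation of \<open>Tr(A\<^sup>2)\<close>; then
  \<open>\<gamma> = t1 + t2 + t3\<close>, \<open>\<mu> = 2 t1 + t2\<close>, and \<open>t4\<close> is the term \<open>\<lambda> \<delta> / t\<close>.\<close>

locale grid_numerics =
  fixes k m T t A4 V L Ej :: real
  assumes k: "1 < k" and m: "0 < m" and t: "0 < t" "t \<le> T" and A4: "0 < A4" "A4 \<le> sqrt k * T"
    and V: "A4\<^sup>2 \<le> V" "V \<le> A4 * (sqrt k * T)" and L: "0 \<le> L" and Ej: "1 \<le> Ej"
begin

definition "Wc = (2 + 3 * cst_c) * V / (4 * (2 + cst_c) * sqrt k * A4\<^sup>2)"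
definition "lc = sqrt (2 / ((k - 1) * m) * (Wc * Ej + L))"
definition "bc = sqrt (2 * (2 + cst_c) * sqrt k * A4\<^sup>2 * m * (exp (1/4) / Ej))"
definition "t1 = lc / 2 * (k - 1)"
definition "t2 = (2 + cst_c) * sqrt k * A4 / bc"
definition "t3 = (2 + 3 * cst_c) * V / (2 * bc\<^sup>2 * lc) + L / (m * lc)"
definition "t4 = bc / (2 * m * t)"

lemma c_pos: "0 < cst_c" using cst_c_bounds by linarith

text \<open>Origin of the constant 0.73: an upper bound for (2 + 3 c) / (4 (2 + c)).\<close>

lemma Wc_bounds: "7/10 \<le> Wc * sqrt k" "Wc * A4 \<le> 73/100 * T"
proof -
  have sk: "0 < sqrt k" using k by simp
  have D: "0 < 2 + cst_c" using c_pos by simp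
  have eq: "Wc * sqrt k = (2 + 3 * cst_c) / (4 * (2 + cst_c)) * (V / A4\<^sup>2)"
  proof -
    have "(x * V) / (4 * D * s * a) * s = x / (4 * D) * (V / a)" if "s \<noteq> 0" for x D s a :: real
      using that by (simp add: field_simps)
    then show ?thesis unfolding Wc_def using sk by simp
  qed
  have "7/10 \<le> (2 + 3 * cst_c) / (4 * (2 + cst_c))" using cst_c_bounds D by (simp add: pos_le_divide_eq)
  moreover have "1 \<le> V / A4\<^sup>2" using V A4 by (simp add: pos_le_divide_eq)
  ultimately have "7/10 * 1 \<le> (2 + 3 * cst_c) / (4 * (2 + cst_c)) * (V / A4\<^sup>2)"
    using c_pos by (intro mult_mono) auto
  then show "7/10 \<le> Wc * sqrt k" unfolding eq by linarith
  have eq2: "Wc * A4 = (2 + 3 * cst_c) / (4 * (2 + cst_c)) * (V / (A4 * sqrt k))"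
  proof -
    have aux: "(x * V) / (4 * D * s * a\<^sup>2) * a = x / (4 * D) * (V / (a * s))" if "a \<noteq> 0" for x D s a :: real
      using that by (simp add: field_simps power2_eq_square)
    show ?thesis unfolding Wc_def by (rule aux) (use A4 in simp)
  qed
  have "(2 + 3 * cst_c) / (4 * (2 + cst_c)) \<le> 73/100" using cst_c_bounds D by (simp add: pos_divide_le_eq)
  moreover have "V / (A4 * sqrt k) \<le> T" using V A4 sk by (simp add: pos_divide_le_eq mult_ac)
  ultimately show "Wc * A4 \<le> 73/100 * T" unfolding eq2 using t A4 sk V c_pos
    by (intro mult_mono) (auto intro!: divide_nonneg_pos order_trans[OF _ V(1)])
qed

lemma Wc_pos: "0 < Wc"
proof -
  have "0 < Wc * sqrt k" using Wc_bounds(1) by linarith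
  then show ?thesis using k by (simp add: zero_less_mult_iff)
qed

definition "Gc = Wc * Ej + L"

lemma Gc_pos: "0 < Gc" unfolding Gc_def using Wc_pos Ej L by (intro add_pos_nonneg mult_pos_pos) auto

lemma lc_pos: "0 < lc" unfolding lc_def Gc_def[symmetric] using Gc_pos k m by simp
lemma lc_square: "lc\<^sup>2 = 2 / ((k - 1) * m) * Gc" unfolding lc_def Gc_def[symmetric] using Gc_pos k m by simp
lemma bc_pos: "0 < bc" unfolding bc_def using k m A4 Ej c_pos by simp
lemma bc_square: "bc\<^sup>2 = 2 * (2 + cst_c) * sqrt k * A4\<^sup>2 * m * (exp (1/4) / Ej)"
  unfolding bc_def using k m A4 Ej c_pos by simp

lemma t1_pos: "0 < t1" unfolding t1_def using lc_pos k by simp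
lemma t1_square: "m * t1\<^sup>2 = (k - 1) / 2 * Gc"
proof -
  have "m * t1\<^sup>2 = m * (k - 1)\<^sup>2 / 4 * lc\<^sup>2" unfolding t1_def by (simp add: power2_eq_square)
  also have "\<dots> = (k - 1) / 2 * Gc" unfolding lc_square using k m by (simp add: power2_eq_square field_simps)
  finally show ?thesis .
qed

text \<open>The choice of lambda amounts to \<open>t1\<close> m \<open>lc\<close> =
  \<open>Gc\<close>, which balances \<open>t1\<close> against the terms in 1 / lambda. The balance
  is exact for the part in \<open>L\<close> and off by exp (1/4) for the part that depends on
  beta.\<close>

lemma t3_eq: "t3 = t1 * ((Wc * Ej / exp (1/4) + L) / Gc)"
proof -
  have D: "0 < 2 + cst_c" using c_pos by simp
  have a: "(2 + 3 * cst_c) * V / (2 * bc\<^sup>2) = Wc * Ej / exp (1/4) / m"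
    unfolding bc_square Wc_def using D k A4 m Ej by (simp add: field_simps)
  have "t3 = ((2 + 3 * cst_c) * V / (2 * bc\<^sup>2)) / lc + L / m / lc" unfolding t3_def by simp
  also have "\<dots> = (Wc * Ej / exp (1/4) + L) / (m * lc)" unfolding a by (simp add: add_divide_distrib)
  also have "1 / (m * lc) = t1 / Gc"
  proof -
    have "t1 * (m * lc) = (k - 1) * m / 2 * lc\<^sup>2" unfolding t1_def by (simp add: power2_eq_square)
    also have "\<dots> = Gc" unfolding lc_square using k m by simp
    finally show ?thesis using Gc_pos lc_pos m by (simp add: field_simps)
  qed
  then have "(Wc * Ej / exp (1/4) + L) / (m * lc) = (Wc * Ej / exp (1/4) + L) * (t1 / Gc)"
    by (metis mult.right_neutral times_divide_eq_right)
  finally show ?thesis by simp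
qed

lemma t3_bounds: "t3 \<le> t1" "t1 \<le> 1285/1000 * t3"
proof -
  have E: "1 \<le> exp (1/4 :: real)" "exp (1/4 :: real) \<le> 1285/1000" using exp_quarter_bounds by auto
  define w where "w = Wc * Ej"
  have w: "0 < w" unfolding w_def using Wc_pos Ej by simp
  have w1: "w / exp (1/4) \<le> w" using w E by (simp add: pos_divide_le_eq)
  have "(w / exp (1/4) + L) / Gc \<le> 1" using Gc_pos w1 unfolding Gc_def w_def by simp
  then have "t1 * ((w / exp (1/4) + L) / Gc) \<le> t1 * 1" using t1_pos by (intro mult_left_mono) auto
  then show "t3 \<le> t1" unfolding t3_eq w_def[symmetric] by linarith
  have "w \<le> 1285/1000 * (w / exp (1/4))"
  proof -
    have "w * exp (1/4) \<le> w * (1285/1000)" using w E by (intro mult_left_mono) auto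
    then show ?thesis by (simp add: pos_le_divide_eq mult.commute)
  qed
  then have "Gc \<le> 1285/1000 * (w / exp (1/4) + L)" unfolding Gc_def w_def using L by (simp add: distrib_left)
  then have "1 \<le> 1285/1000 * ((w / exp (1/4) + L) / Gc)" using Gc_pos by (simp add: pos_le_divide_eq)
  then show "t1 \<le> 1285/1000 * t3" unfolding t3_eq w_def[symmetric] using t1_pos
    using mult_left_mono[of 1 "1285/1000 * ((w / exp (1/4) + L) / Gc)" t1] by (simp add: mult_ac)
qed

lemma t2_pos: "0 < t2" unfolding t2_def using c_pos k A4 bc_pos by simp

text \<open>Beta cancels in this product. The grid point only influences the ratio of
  \<open>t4\<close> to \<open>t2\<close>, which is computed in \<open>t4_eq\<close>.\<close>

lemma t2_t4: "t2 * t4 = (2 + cst_c) * sqrt k * A4 / (2 * m * t)"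
  unfolding t2_def t4_def using bc_pos by simp

lemma t4_eq: "t4 = t2 * (exp (1/4) * A4 / (t * Ej))"
proof -
  have "t4 * (2 * m * t * bc) = bc\<^sup>2" unfolding t4_def using m t by (simp add: power2_eq_square)
  moreover have "t2 * (exp (1/4) * A4 / (t * Ej)) * (2 * m * t * bc) = 2 * (2 + cst_c) * sqrt k * A4\<^sup>2 * m * (exp (1/4) / Ej)"
    unfolding t2_def using bc_pos t Ej by (simp add: field_simps power2_eq_square)
  ultimately have "t4 * (2 * m * t * bc) = t2 * (exp (1/4) * A4 / (t * Ej)) * (2 * m * t * bc)" by (simp add: bc_square)
  moreover have "2 * m * t * bc \<noteq> 0" using m t bc_pos by simp
  ultimately show ?thesis by (metis mult_right_cancel)
qed

text \<open>Origin of 2.032 and 98.5. The premise says that the grid value is within half a step, a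
  factor exp (1/4), of s4^2 / t. Then t1 + t3 brings in half of x + 1/x + 2 with x between exp
  (-1/4) and exp (1/4), at most 2.032. For t2 + t4 the factor is (2 + c) / 2 times y + 1/y + 2 with
  y between 1 and exp (1/2), at most 98.5.\<close>

lemma balanced_terms:
  assumes v: "A4 / t \<le> Ej * exp (1/4)" "Ej \<le> A4 / t * exp (1/4)"
  shows "sqrt m * (t1 + t3) \<le> sqrt (2032/1000 * (k - 1) * (73/100 * (T / t) + L))"
    "sqrt m * (t2 + t4) \<le> sqrt (985/10 * (sqrt k * A4 / t))"
    "t4 \<le> 165/100 * t2"
proof -
  define \<rho> where "\<rho> = A4 / t"
  have \<rho>: "0 < \<rho>" unfolding \<rho>_def using A4 t by simp
  have E: "1 \<le> exp (1/4 :: real)" "exp (1/4 :: real) \<le> 1285/1000" using exp_quarter_bounds by auto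
  define G0 where "G0 = Wc * \<rho> + L"
  have G0: "0 < G0" unfolding G0_def using Wc_pos \<rho> L by (intro add_pos_nonneg mult_pos_pos) auto
  have W\<rho>: "Wc * \<rho> \<le> 73/100 * (T / t)" unfolding \<rho>_def using Wc_bounds(2) t by (simp add: field_simps)
  define x where "x = Gc / G0"
  have x0: "0 < x" unfolding x_def using Gc_pos G0 by simp
  have a1: "Wc * Ej \<le> Wc * (\<rho> * exp (1/4))" and a2: "Wc * \<rho> \<le> Wc * (Ej * exp (1/4))"
    unfolding \<rho>_def by (rule mult_left_mono; use v Wc_pos in simp)+
  have LE: "L \<le> L * exp (1/4)" using L E by (simp add: mult_le_cancel_left1)
  have xb: "x \<le> exp (1/4)" "1 / exp (1/4) \<le> x"
  proof -
    have "Gc \<le> exp (1/4) * G0" unfolding Gc_def G0_def using a1 LE by (simp add: algebra_simps)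
    then show "x \<le> exp (1/4)" unfolding x_def using G0 by (simp add: pos_divide_le_eq)
    have "G0 \<le> Gc * exp (1/4)" unfolding Gc_def G0_def using a2 LE by (simp add: algebra_simps)
    then show "1 / exp (1/4) \<le> x" unfolding x_def using G0 Gc_pos by (simp add: field_simps)
  qed
  have xs: "x + 1 / x \<le> 2064/1000"
  proof -
    have "1 / (1285/1000) \<le> 1 / exp (1/4 :: real)" using E by (intro divide_left_mono) auto
    then have "x + 1 / x \<le> 1285/1000 + 1 / (1285/1000)"
      using xb E divide_left_mono[OF E(2), of 1]
      by (intro sum_recip_le) (auto intro: order_trans)
    then show ?thesis by simp
  qed
  have t3le: "t3 \<le> t1 * (1 / x)"
  proof -
    have "Wc * Ej / exp (1/4) + L \<le> G0" unfolding G0_def using a1 by (simp add: pos_divide_le_eq mult.assoc)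
    then have "(Wc * Ej / exp (1/4) + L) / Gc \<le> 1 / x" unfolding x_def using Gc_pos by (simp add: divide_right_mono)
    then show ?thesis unfolding t3_eq using t1_pos by (intro mult_left_mono) auto
  qed
  have t3p: "0 \<le> t3" using t3_bounds(2) t1_pos by linarith
  have "m * (t1 + t3)\<^sup>2 \<le> 2032/1000 * (k - 1) * (73/100 * (T / t) + L)"
  proof -
    have "m * (t1 + t3)\<^sup>2 \<le> m * (t1 + t1 * (1 / x))\<^sup>2"
      using m t3le t3p t1_pos by (intro mult_left_mono power_mono) auto
    also have "\<dots> = m * t1\<^sup>2 * ((1 + 1 / x)\<^sup>2)" by (simp add: power2_eq_square algebra_simps)
    also have "\<dots> = (k - 1) / 2 * G0 * (x * (1 + 1 / x)\<^sup>2)" unfolding t1_square using G0 by (simp add: x_def)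
    also have "x * (1 + 1 / x)\<^sup>2 = x + 1 / x + 2" using x0 by (simp add: power2_eq_square field_simps)
    also have "(k - 1) / 2 * G0 * (x + 1 / x + 2) \<le> (k - 1) / 2 * G0 * (2064/1000 + 2)"
      using xs k G0 by (intro mult_left_mono) auto
    also have "\<dots> = 2032/1000 * (k - 1) * G0" by simp
    also have "\<dots> \<le> 2032/1000 * (k - 1) * (73/100 * (T / t) + L)"
      using W\<rho> k unfolding G0_def by (intro mult_left_mono) auto
    finally show ?thesis .
  qed
  then show "sqrt m * (t1 + t3) \<le> sqrt (2032/1000 * (k - 1) * (73/100 * (T / t) + L))"
    using m by (intro real_le_rsqrt) (simp add: power_mult_distrib)
  define y where "y = exp (1/4) * A4 / (t * Ej)"
  have y0: "0 < y" unfolding y_def using A4 t Ej by simp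
  have y: "1 \<le> y" "y \<le> 16488/10000"
  proof -
    have "Ej * t \<le> A4 * exp (1/4)" using v(2) t by (simp add: field_simps)
    then show "1 \<le> y" unfolding y_def using t Ej by (simp add: pos_le_divide_eq mult_ac)
    have "A4 \<le> Ej * exp (1/4) * t" using v(1) t by (simp add: pos_divide_le_eq)
    then have "exp (1/4) * A4 \<le> exp (1/4) * (Ej * exp (1/4) * t)" by (intro mult_left_mono) auto
    also have "\<dots> = exp (1/2) * (t * Ej)" unfolding exp_quarter_square[symmetric] by (simp add: mult_ac)
    finally have "y \<le> exp (1/2)" unfolding y_def using t Ej by (simp add: pos_divide_le_eq)
    then show "y \<le> 16488/10000" using exp_half_le by simp
  qed
  have t4y: "t4 = t2 * y" unfolding t4_eq y_def by simp
  show "t4 \<le> 165/100 * t2" unfolding t4y using y t2_pos by simp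
  have ys: "y + 1 / y \<le> 22554/10000"
  proof -
    have "y + 1 / y \<le> 16488/10000 + 1 / (16488/10000)" using y by (intro sum_recip_le) auto
    then show ?thesis by simp
  qed
  have "m * (t2 + t4)\<^sup>2 \<le> 985/10 * (sqrt k * A4 / t)"
  proof -
    have "m * (t2 + t4)\<^sup>2 = m * (t2 * t4) * (y + 1 / y + 2)"
      unfolding t4y using y0 by (simp add: field_simps power2_eq_square)
    also have "\<dots> = (2 + cst_c) / 2 * (sqrt k * A4 / t) * (y + 1 / y + 2)"
    proof -
      have "m * (u / (2 * m * t)) = u / (2 * t)" for u using m by simp
      then show ?thesis unfolding t2_t4 by simp
    qed
    also have "\<dots> \<le> (2 + 4429/100) / 2 * (sqrt k * A4 / t) * (22554/10000 + 2)"
      using ys y0 cst_c_bounds k A4 t by (intro mult_mono mult_nonneg_nonneg) auto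
    also have "\<dots> \<le> 985/10 * (sqrt k * A4 / t)"
    proof -
      have "0 \<le> sqrt k * A4 / t" using k A4 t by simp
      then show ?thesis by simp
    qed
    finally show ?thesis .
  qed
  then show "sqrt m * (t2 + t4) \<le> sqrt (985/10 * (sqrt k * A4 / t))"
    using m by (intro real_le_rsqrt) (simp add: power_mult_distrib)
qed


text \<open>For t above s4^2 exp (1/4) a balanced point would have a negative index, and j = 0 takes
  its place. The excess of t1 + t3, measured by \<open>X\<close>, and the loss 0.45 from
  \<open>log_gap\<close> are both paid by comparing with k T / t instead of the smaller sqrt k s4^2
  / t.\<close>

lemma unbalanced_terms:
  assumes Ej1: "Ej = 1" and \<rho>: "t \<le> 4 * A4" "A4 * exp (1/4) \<le> t"
    and y: "0 \<le> y" "sqrt (73/100 * (T / t) + L) \<le> sqrt y + 45/100"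
  shows "sqrt m * (t1 + t2 + t3 + t4) \<le> sqrt (2032/1000 * (k - 1) * y) + sqrt (985/10 * (k * (T / t)))"
    "t4 \<le> t2"
proof -
  define r where "r = A4 / t"
  have E: "1284/1000 \<le> exp (1/4 :: real)" "exp (1/4 :: real) \<le> 1285/1000" using exp_quarter_bounds by auto
  have r: "1/4 \<le> r" "r * exp (1/4) \<le> 1" "0 < r" unfolding r_def using \<rho> t A4 by (auto simp: field_simps)
  have r779: "r \<le> 779/1000"
  proof -
    have "r * (1284/1000) \<le> r * exp (1/4)" using E r by (intro mult_left_mono) auto
    then show ?thesis using r by linarith
  qed
  define T' where "T' = T / t"
  have T': "1 \<le> T'" unfolding T'_def using t by simp
  have t4r: "t4 = t2 * (r * exp (1/4))" using t4_eq unfolding r_def Ej1 by (simp add: mult_ac)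
  then show "t4 \<le> t2" using r t2_pos by (simp add: mult_le_cancel_left1)
  define X where "X = 73/100 * (1 / r - 1)"
  have r1: "1 \<le> 1 / r" using r r779 by (simp add: pos_le_divide_eq)
  have X0: "0 \<le> X" unfolding X_def using r1 by simp
  \<comment> \<open>Arithmetic-geometric mean, sharp at X = 0.36. The summand 0.3 joins the 0.45
    lost in \<open>log_gap\<close>.\<close>
  have sX: "sqrt X \<le> X / (12/10) + 3/10"
  proof -
    have "X \<le> (X / (12/10) + 3/10)\<^sup>2" using zero_le_power2[of "X / (12/10) - 3/10"] by (simp add: power2_eq_square field_simps)
    then show ?thesis using X0 by (intro real_le_lsqrt) auto
  qed
  have W: "Wc \<le> 73/100 * T' + T' * X"
  proof -
    have "Wc \<le> 73/100 * T / A4" using Wc_bounds(2) A4 by (simp add: pos_le_divide_eq)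
    also have "\<dots> = 73/100 * (T' / r)" unfolding T'_def r_def using t A4 by simp
    also have "\<dots> = 73/100 * T' + T' * X" unfolding X_def by (simp add: field_simps)
    finally show ?thesis .
  qed
  have s1: "sqrt (Gc) \<le> sqrt y + 45/100 + sqrt T' * sqrt X"
  proof -
    have "Gc = Wc + L" unfolding Gc_def using Ej1 by simp
    then have "sqrt Gc \<le> sqrt ((73/100 * T' + L) + T' * X)" using W by (intro real_sqrt_le_mono) linarith
    also have "\<dots> \<le> sqrt (73/100 * T' + L) + sqrt (T' * X)" using T' X0 L by (intro sqrt_add_le_add_sqrt) auto
    finally show ?thesis using y(2) unfolding T'_def[symmetric] real_sqrt_mult by linarith
  qed
  have p13: "sqrt m * (t1 + t3) \<le> sqrt (2 * (k - 1)) * sqrt Gc"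
  proof -
    have "sqrt m * (t1 + t3) \<le> sqrt m * (2 * t1)" using t3_bounds m by (intro mult_left_mono) auto
    also have "\<dots> \<le> sqrt (2 * (k - 1) * Gc)"
      using t1_square m by (intro real_le_rsqrt) (simp add: power_mult_distrib field_simps)
    finally show ?thesis by (simp add: real_sqrt_mult)
  qed
  have p2: "sqrt m * t2 \<le> 42458/10000 * sqrt (sqrt k)"
  proof -
    have "m * t2\<^sup>2 = (2 + cst_c) / (2 * exp (1/4)) * sqrt k"
    proof -
      have "m * t2\<^sup>2 = m * ((2 + cst_c) * sqrt k * A4)\<^sup>2 / bc\<^sup>2" unfolding t2_def by (simp add: power_divide)
      also have "\<dots> = m * ((2 + cst_c) * sqrt k * A4)\<^sup>2 / ((2 + cst_c) * sqrt k * A4 * (A4 * (2 * m * exp (1/4))))"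
      proof -
        have "bc\<^sup>2 = (2 + cst_c) * sqrt k * A4 * (A4 * (2 * m * exp (1/4)))"
          unfolding bc_square by (simp add: Ej1 power2_eq_square mult_ac)
        then show ?thesis by (simp only:)
      qed
      also have "\<dots> = m * ((2 + cst_c) * sqrt k * A4) / (A4 * (2 * m * exp (1/4)))"
        using c_pos k A4 by (simp add: power2_eq_square)
      also have "\<dots> = (2 + cst_c) / (2 * exp (1/4)) * sqrt k" using m A4 by (simp add: field_simps)
      finally show ?thesis .
    qed
    also have "\<dots> \<le> (2 + 4429/100) / (2 * (1284/1000)) * sqrt k"
      using cst_c_bounds E k by (intro mult_right_mono frac_le) auto
    also have "\<dots> \<le> (42458/10000)\<^sup>2 * sqrt k" using k by (intro mult_right_mono) (auto simp: power2_eq_square)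
    finally have "(sqrt m * t2)\<^sup>2 \<le> (42458/10000 * sqrt (sqrt k))\<^sup>2" using m k by (simp add: power_mult_distrib power_divide)
    then show ?thesis using k by (intro power2_le_imp_le[of "sqrt m * t2"]) auto
  qed
  have kk: "sqrt (sqrt k) \<le> sqrt k" using k by (intro real_sqrt_le_mono) (simp add: real_le_lsqrt power2_eq_square)
  have sT: "1 \<le> sqrt T'" using T' by simp
  have p24: "sqrt m * (t2 + t4) \<le> 42458/10000 * (1 + 1285/1000 * r) * (sqrt k * sqrt T')"
  proof -
    have "sqrt m * (t2 + t4) = sqrt m * t2 * (1 + r * exp (1/4))" unfolding t4r by (simp add: algebra_simps)
    also have "\<dots> \<le> (42458/10000 * sqrt (sqrt k)) * (1 + 1285/1000 * r)"
    proof (rule mult_mono[OF p2])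
      show "1 + r * exp (1/4) \<le> 1 + 1285/1000 * r" using mult_left_mono[OF E(2), of r] r by simp
    qed (use r m t2_pos k in auto)
    also have "\<dots> = 42458/10000 * (1 + 1285/1000 * r) * sqrt (sqrt k)" by simp
    also have "\<dots> \<le> 42458/10000 * (1 + 1285/1000 * r) * (sqrt k * sqrt T')"
    proof (rule mult_left_mono)
      have "sqrt (sqrt k) * 1 \<le> sqrt k * sqrt T'" using kk sT k by (intro mult_mono) auto
      then show "sqrt (sqrt k) \<le> sqrt k * sqrt T'" by simp
    qed (use r in auto)
    finally show ?thesis .
  qed
  have k2: "sqrt (2 * (k - 1)) \<le> 141422/100000 * sqrt k"
  proof -
    have "sqrt (2 * (k - 1)) \<le> sqrt 2 * sqrt k" unfolding real_sqrt_mult[symmetric] by (intro real_sqrt_le_mono) simp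
    also have "\<dots> \<le> 141422/100000 * sqrt k" using sqrt2_bounds k by (intro mult_right_mono) auto
    finally show ?thesis .
  qed
  have "sqrt (2 * (k - 1)) * sqrt Gc \<le> sqrt (2 * (k - 1)) * (sqrt y + 45/100 + sqrt T' * sqrt X)"
    using s1 k by (intro mult_left_mono) auto
  also have "\<dots> = sqrt (2 * (k - 1) * y) + sqrt (2 * (k - 1)) * (45/100 + sqrt T' * sqrt X)"
    by (simp only: real_sqrt_mult[of "2 * (k - 1)" y] distrib_left add.assoc)
  also have "sqrt (2 * (k - 1)) * (45/100 + sqrt T' * sqrt X) \<le> (141422/100000 * sqrt k) * (sqrt T' * (75/100 + X / (12/10)))"
  proof (rule mult_mono[OF k2])
    have "45/100 + sqrt T' * sqrt X \<le> sqrt T' * (45/100) + sqrt T' * (X / (12/10) + 3/10)"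
      using sT sX by (intro add_mono mult_left_mono) auto
    then show "45/100 + sqrt T' * sqrt X \<le> sqrt T' * (75/100 + X / (12/10))" by (simp add: algebra_simps)
  qed (use X0 k T' in auto)
  also have "sqrt (2 * (k - 1) * y) \<le> sqrt (2032/1000 * (k - 1) * y)"
    using k y by (intro real_sqrt_le_mono mult_right_mono) auto
  finally have p13': "sqrt m * (t1 + t3) \<le> sqrt (2032/1000 * (k - 1) * y) + (141422/100000 * (75/100 + X / (12/10))) * (sqrt k * sqrt T')"
    using p13 by (simp add: mult_ac)
  \<comment> \<open>Multiplied by r this is a convex quadratic inequality in r, hence a matter of
    the endpoints 1/4 and 0.779 of its range. The right side is chosen because 9.92^2 <
    98.5.\<close>
  have poly: "141422/100000 * (75/100 + X / (12/10)) + 42458/10000 * (1 + 1285/1000 * r) \<le> 992/100"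
  proof -
    have "(r - 1/4) * (r - 779/1000) \<le> 0" using r r779 by (intro mult_nonneg_nonpos) auto
    moreover have "(r - 1/4) * (r - 779/1000) = r * r - 1029/1000 * r + 19475/100000" by (simp add: field_simps)
    ultimately have "r * r \<le> 1029/1000 * r - 19475/100000" by linarith
    then have "42458/10000 * (1285/1000) * (r * r) + (141422/100000 * (75/100 - 73/100 / (12/10)) + 42458/10000 - 992/100) * r
        + 141422/100000 * (73/100) / (12/10) \<le> 0"
      using r779 r by simp
    moreover have "r * (141422/100000 * (75/100 - 73/100 / (12/10)) + 42458/10000 * (1 + 1285/1000 * r) - 992/100)
       = 42458/10000 * (1285/1000) * (r * r) + (141422/100000 * (75/100 - 73/100 / (12/10)) + 42458/10000 - 992/100) * r"
      by (simp add: field_simps)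
    ultimately have "r * (141422/100000 * (75/100 - 73/100 / (12/10)) + 42458/10000 * (1 + 1285/1000 * r) - 992/100)
        + 141422/100000 * (73/100) / (12/10) \<le> 0" by linarith
    then have "141422/100000 * (75/100 - 73/100 / (12/10)) + 42458/10000 * (1 + 1285/1000 * r) - 992/100
        + 141422/100000 * (73/100) / (12/10) / r \<le> 0"
      using r by (simp add: field_simps)
    then show ?thesis unfolding X_def by (simp add: field_simps)
  qed
  have "sqrt m * (t1 + t2 + t3 + t4) = sqrt m * (t1 + t3) + sqrt m * (t2 + t4)" by (simp add: algebra_simps)
  also have "\<dots> \<le> sqrt (2032/1000 * (k - 1) * y)
     + (141422/100000 * (75/100 + X / (12/10)) + 42458/10000 * (1 + 1285/1000 * r)) * (sqrt k * sqrt T')"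
    using add_mono[OF p13' p24] by (simp only: distrib_right add.assoc)
  also have "(141422/100000 * (75/100 + X / (12/10)) + 42458/10000 * (1 + 1285/1000 * r)) * (sqrt k * sqrt T')
      \<le> 992/100 * (sqrt k * sqrt T')"
    using poly k T' by (intro mult_right_mono) auto
  also have "992/100 * (sqrt k * sqrt T') \<le> sqrt (985/10 * (k * (T / t)))"
    using k T' by (intro real_le_rsqrt) (simp add: power_mult_distrib T'_def[symmetric] power_divide)
  finally show "sqrt m * (t1 + t2 + t3 + t4) \<le> sqrt (2032/1000 * (k - 1) * y) + sqrt (985/10 * (k * (T / t)))" by simp
qed

end

text \<open>Bounds the criterion at a balanced grid point in terms of G alone, although it is
  evaluated at the estimate (through d) and not at the true energy (through t4). The number b comes
  from \<open>estimate_lower_bound\<close>, and d exceeds t4 by at most the factor 1 + b. The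
  premise on d is conditional so that a first application with d = 0 can supply what is needed to
  establish it for the real d.\<close>

lemma selection_bound:
  fixes t1 t2 t3 t4 k z G b d :: real
  assumes pos: "0 < t1" "0 < t2" "0 \<le> t4" "1 < k" "0 < z"
    and t: "t3 \<le> t1" "t1 \<le> 1285/1000 * t3" "t4 \<le> 165/100 * t2"
    and G: "G = t1 + t2 + t3 + t4" "G \<le> 11/10 * z" and z: "(6 + 1 / (k - 1)) * z \<le> 1"
    and b: "b = G / (1 - (2 * t1 + t2) - (t1 + t2 + t3) - 2 * t4)"
    and d: "0 \<le> d" "0 \<le> b \<Longrightarrow> d \<le> (1 + b) * t4"
  shows "k / (k - 1) * t1 + (2 * t1 + t2) + (t1 + t2 + t3) + 2 * t4 < 1"
    and "0 \<le> b"
    and "k / (k - 1) * t1 + (2 * t1 + t2) + (t1 + t2 + t3) + 2 * d < 1"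
    and "(t1 + t2 + t3 + d) / (1 - (2 * t1 + t2) - (t1 + t2 + t3) - 2 * d) \<le> G / (1 - 3 * G)"
proof -
  define a where "a = 1 / (k - 1)"
  have a0: "0 < a" unfolding a_def using pos by simp
  have ka: "k / (k - 1) = 1 + a" unfolding a_def using pos by (simp add: field_simps)
  have t30: "0 < t3" using t pos by linarith
  have G0: "0 < G" using G pos t30 by linarith
  have z6: "6 * z + a * z \<le> 1" using z unfolding a_def by (simp add: algebra_simps)
  have az: "0 < a * z" using a0 pos by simp
  \<comment> \<open>The value 1.1 / 6 rounded up. Of the fractions below, 0.563 comes from t1 <=
    1.285 t3, then 0.623 from t4 <= 1.65 t2, and 2.125 from s = 2 G + t1 - t3.\<close>
  have Gz: "G \<le> 1834/10000" using G z6 az by linarith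
  have aG: "a * G \<le> 11/10 * (a * z)" using mult_left_mono[OF G(2), of a] a0 by simp
  have t1G: "t1 \<le> 563/1000 * G" using G t pos by linarith
  have t4G: "t4 \<le> 623/1000 * G" using G t pos t30 by linarith
  define s where "s = (2 * t1 + t2) + (t1 + t2 + t3) + 2 * t4"
  have sG: "s \<le> 2125/1000 * G" unfolding s_def using G t pos t30 by linarith
  have at1: "a * t1 \<le> 563/1000 * (a * G)" using mult_left_mono[OF t1G, of a] a0 by simp
  have xi: "k / (k - 1) * t1 \<le> 563/1000 * G + 563/1000 * (a * G)" unfolding ka using t1G at1 by (simp add: algebra_simps)
  have den: "0 < 1 - s" using sG Gz by linarith
  have b_eq: "b = G / (1 - s)" unfolding b s_def by (simp add: algebra_simps)
  show b0: "0 \<le> b" unfolding b_eq using G0 den by simp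
  have bs: "b * (1 - s) = G" unfolding b_eq using den by simp
  have b_up: "b * (1 - 2125/1000 * G) \<le> G"
    unfolding bs[symmetric] using b0 sG bs by (metis bs diff_left_mono mult_left_mono)
  have b3: "b \<le> 302/1000"
  proof (rule ccontr)
    assume "\<not> ?thesis"
    then have "302/1000 * (1 - 2125/1000 * G) < b * (1 - 2125/1000 * G)" using Gz by (intro mult_strict_right_mono) auto
    then show False using b_up Gz by simp
  qed
  have "k / (k - 1) * t1 + s < 1" using xi sG G(2) aG z6 az pos by linarith
  then show "k / (k - 1) * t1 + (2 * t1 + t2) + (t1 + t2 + t3) + 2 * t4 < 1" unfolding s_def by linarith
  have bt4: "b * t4 \<le> 302/1000 * (623/1000 * G)" using b3 b0 t4G pos by (intro mult_mono) auto
  have d': "d \<le> t4 + b * t4" using d b0 by (simp add: algebra_simps)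
  have "k / (k - 1) * t1 + (s - 2 * t4 + 2 * d) < 1" using xi sG G(2) aG z6 az pos bt4 d' by linarith
  then show c2: "k / (k - 1) * t1 + (2 * t1 + t2) + (t1 + t2 + t3) + 2 * d < 1" unfolding s_def by linarith
  have den2: "0 < 1 - (2 * t1 + t2) - (t1 + t2 + t3) - 2 * d"
  proof -
    have "0 < k / (k - 1) * t1" using pos by simp
    then show ?thesis using c2 by linarith
  qed
  define e where "e = b * t4"
  have e: "0 \<le> e" "e \<le> 623/1000 * (b * G)"
    unfolding e_def using b0 pos t4G mult_left_mono[OF t4G b0] by (auto simp: mult_ac)
  have den3: "0 < 1 - s - 2 * e" using bt4 sG Gz unfolding e_def by linarith
  have "(t1 + t2 + t3 + d) / (1 - (2 * t1 + t2) - (t1 + t2 + t3) - 2 * d) \<le> (G + e) / (1 - s - 2 * e)"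
    using den3 den2 d' pos t30 d unfolding G e_def s_def by (intro frac_le) auto
  also have "\<dots> \<le> G / (1 - 3 * G)"
  proof -
    have "(G + e) * (1 - 3 * G) \<le> G * (1 - s - 2 * e)"
    proof -
      have bG: "623/1000 * (b * (1 - G)) \<le> 875/1000 * G"
      proof -
        have "b * (1 - G) * (1 - 2125/1000 * G) \<le> G * (1 - G)" using mult_right_mono[OF b_up, of "1 - G"] Gz by (simp add: mult_ac)
        \<comment> \<open>The factor 1.404 is chosen because 0.623 times 1.404 is just below 0.875 =
          3 - 2.125, the margin of 3 G over s.\<close>
        also have "\<dots> \<le> G * (1404/1000 * (1 - 2125/1000 * G))" using G0 Gz by (intro mult_left_mono) auto
        finally have "b * (1 - G) * (1 - 2125/1000 * G) \<le> (1404/1000 * G) * (1 - 2125/1000 * G)" by (simp add: mult_ac)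
        then have "b * (1 - G) \<le> 1404/1000 * G" by (rule mult_right_le_imp_le) (use Gz in simp)
        then show ?thesis using G0 by simp
      qed
      have "(G + e) * (1 - 3 * G) - G * (1 - s - 2 * e) = e * (1 - G) + G * s - 3 * (G * G)" by (simp add: algebra_simps)
      also have "\<dots> \<le> 623/1000 * (b * G) * (1 - G) + G * (2125/1000 * G) - 3 * (G * G)"
        using e sG G0 Gz by (intro diff_right_mono add_mono mult_right_mono mult_left_mono) auto
      also have "\<dots> = G * (623/1000 * (b * (1 - G)) - 875/1000 * G)" by (simp add: algebra_simps)
      also have "\<dots> \<le> 0" using bG G0 by (intro mult_nonneg_nonpos) auto
      finally show ?thesis by simp
    qed
    then show ?thesis using den3 Gz by (simp add: divide_simps mult.commute)
  qed
  finally show "(t1 + t2 + t3 + d) / (1 - (2 * t1 + t2) - (t1 + t2 + t3) - 2 * d) \<le> G / (1 - 3 * G)" .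
qed

text \<open>Passing from \<open>(\<mu>, \<gamma>)\<close> to \<open>(\<mu>', \<gamma>')\<close> gains \<open>s\<close>, which pays for the excess of \<open>G\<close> over \<open>z\<close>.\<close>

lemma final_error:
  fixes \<mu> \<gamma> \<delta> \<mu>' \<gamma>' s \<Omega> b y z G :: real
  assumes pos: "0 \<le> \<mu>" "0 < \<gamma>" "0 < \<delta>" "0 \<le> \<gamma>'" "0 \<le> \<Omega>" "0 < z" "z \<le> 1/6"
    and den: "\<mu> + \<gamma> + 2 * \<delta> < 1" and le: "\<mu>' \<le> \<mu>" "\<gamma>' \<le> \<gamma> - s" "0 \<le> s"
    and b: "b = (\<gamma> + \<delta>) / (1 - \<mu> - \<gamma> - 2 * \<delta>)" "b \<le> G / (1 - 3 * G)"
    and y: "y \<le> (\<gamma>' + \<delta>) / (1 - \<mu>' - \<gamma>' - 2 * \<delta>)"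
    and s: "\<Omega> * (1 - b) \<le> s * \<delta>"
    and G: "0 < G" "G \<le> 11/10 * z" "z < G \<Longrightarrow> G * (G - z) \<le> \<Omega>"
  shows "y \<le> z / (1 - 4 * z)"
proof -
  define g where "g = \<gamma> + \<delta>"
  define D where "D = 1 - \<mu> - \<gamma> - 2 * \<delta>"
  have D: "0 < D" unfolding D_def using den by simp
  have g0: "0 < g" unfolding g_def using pos by simp
  have bD: "b * D = g" unfolding b(1) g_def D_def using den by simp
  have b0: "0 < b" unfolding b(1) using pos den by simp
  have Gz: "G \<le> 1834/10000" using G pos by linarith
  have b41: "b \<le> 41/100"
  proof -
    have "G \<le> 41/100 * (1 - 3 * G)" using Gz by simp
    then have "G / (1 - 3 * G) \<le> 41/100" using Gz by (simp add: pos_divide_le_eq)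
    then show ?thesis using b(2) by linarith
  qed
  have y1: "y \<le> b - s / D"
  proof -
    have "(\<gamma>' + \<delta>) / (1 - \<mu>' - \<gamma>' - 2 * \<delta>) \<le> (g - s) / D"
      unfolding g_def D_def using le pos den by (intro frac_le) auto
    also have "\<dots> = b - s / D" using bD D by (simp add: field_simps)
    finally show ?thesis using y by simp
  qed
  have gb: "g * (1 + b) \<le> b"
  proof -
    have "D \<le> 1 - g" unfolding D_def g_def using pos by simp
    then have "b * D \<le> b * (1 - g)" using b0 by (intro mult_left_mono) auto
    then show ?thesis unfolding bD by (simp add: algebra_simps)
  qed
  \<comment> \<open>Multiplying by (1 + b)^2 allows g (1 + b) <= b to be used twice. In return (1 -
    b) (1 + b)^2 >= 1, which holds as long as b + b^2 <= 1 and hence for b <= 0.41.\<close>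
  have sD: "\<Omega> / b \<le> s / D"
  proof -
    have "\<Omega> * (1 - b) \<le> s * g" using s mult_left_mono[of \<delta> g s] le pos unfolding g_def by (smt (verit))
    then have "\<Omega> * (1 - b) * (1 + b)\<^sup>2 \<le> s * g * (1 + b)\<^sup>2" by (intro mult_right_mono) auto
    also have "\<dots> = s * (1 + b) * (g * (1 + b))" by (simp add: power2_eq_square mult_ac)
    also have "\<dots> \<le> s * (1 + b) * b" using gb le b0 by (intro mult_left_mono) auto
    finally have 1: "\<Omega> * (1 - b) * (1 + b)\<^sup>2 \<le> s * b * (1 + b)" by (simp add: mult_ac)
    have "\<Omega> * ((1 - b) * (1 + b)\<^sup>2) * g \<le> s * b * (g * (1 + b))"
      using mult_right_mono[OF 1, of g] g0 by (simp add: mult_ac)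
    also have "\<dots> \<le> s * b * b" using gb le b0 by (intro mult_left_mono) auto
    finally have 2: "\<Omega> * ((1 - b) * (1 + b)\<^sup>2) * g \<le> s * b * b" .
    have "b * (1 + b) \<le> 41/100 * (1 + 41/100)" using b0 b41 by (intro mult_mono) auto
    then have "b * (b * (1 + b)) \<le> b * 1" using b0 by (intro mult_left_mono) auto
    then have "1 \<le> (1 - b) * (1 + b)\<^sup>2" by (simp add: power2_eq_square algebra_simps)
    then have "\<Omega> * 1 * g \<le> \<Omega> * ((1 - b) * (1 + b)\<^sup>2) * g" using pos g0 by (intro mult_right_mono mult_left_mono) auto
    then have "\<Omega> * g \<le> s * b * b" using 2 by simp
    then have "\<Omega> * D * b \<le> s * b * b" unfolding bD[symmetric] by (simp add: mult_ac)
    then have "\<Omega> * D \<le> s * b" using b0 by simp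
    then show ?thesis using b0 D by (simp add: field_simps)
  qed
  define B where "B = G / (1 - 3 * G)"
  have B0: "0 < B" unfolding B_def using G Gz by simp
  \<comment> \<open>The function x - Omega / x is increasing, so the criterion b of the selected
    point may be replaced by its upper bound B.\<close>
  have "y \<le> B - \<Omega> / B"
  proof -
    have "\<Omega> / B \<le> \<Omega> / b" using b(2) b0 B0 pos unfolding B_def[symmetric] by (intro divide_left_mono) auto
    then show ?thesis using y1 sD b(2) unfolding B_def[symmetric] by linarith
  qed
  also have "B - \<Omega> / B \<le> z / (1 - 4 * z)"
  proof (cases "G \<le> z")
    case True
    have "B \<le> z / (1 - 4 * z)" unfolding B_def using True G pos by (intro frac_le) auto
    moreover have "0 \<le> \<Omega> / B" using pos B0 by simp
    ultimately show ?thesis by linarith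
  next
    case False
    define e where "e = G - z"
    have e: "0 < e" "e \<le> z / 10" unfolding e_def using False G by auto
    have "e * (1 - 3 * G) \<le> \<Omega> / B"
    proof -
      have "G * e * (1 - 3 * G) \<le> \<Omega> * (1 - 3 * G)" using G(3) False Gz unfolding e_def by (intro mult_right_mono) auto
      then show ?thesis unfolding B_def using G Gz by (simp add: pos_le_divide_eq mult_ac)
    qed
    moreover have "B \<le> z / (1 - 4 * z) + e * (1 - 3 * G)"
    proof -
      have q: "e * (1 - (1 - 3 * G)\<^sup>2 * (1 - 4 * z)) \<le> z * G"
      proof -
        have "1 - 6 * G - 4 * z \<le> (1 - 6 * G) * (1 - 4 * z)" using G pos by (simp add: algebra_simps)
        also have "\<dots> \<le> (1 - 3 * G)\<^sup>2 * (1 - 4 * z)" using pos by (intro mult_right_mono) (auto simp: power2_eq_square algebra_simps)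
        finally have "1 - (1 - 3 * G)\<^sup>2 * (1 - 4 * z) \<le> 10 * G" using False by simp
        then have "e * (1 - (1 - 3 * G)\<^sup>2 * (1 - 4 * z)) \<le> e * (10 * G)" using e by (intro mult_left_mono) auto
        also have "\<dots> \<le> z / 10 * (10 * G)" using e G by (intro mult_right_mono) auto
        finally show ?thesis by simp
      qed
      have "G * (1 - 4 * z) \<le> z * (1 - 3 * G) + e * (1 - 3 * G)\<^sup>2 * (1 - 4 * z)"
        using q unfolding e_def by (simp add: algebra_simps)
      then have "G \<le> (z / (1 - 4 * z) + e * (1 - 3 * G)) * (1 - 3 * G)"
        using pos by (simp add: field_simps power2_eq_square)
      then show ?thesis unfolding B_def using Gz by (simp add: pos_divide_le_eq)
    qed
    ultimately show ?thesis by linarith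
  qed
  finally show ?thesis .
qed

text \<open>Finds, from the true energy, the grid point with which the selected one is compared. The
  overshoot of G over z is caused by ln (K' / K); the factor 22.3 in its bound is a lower bound for
  \<open>cst_c\<close> - \<open>dev_cst\<close>.\<close>

lemma grid_choice:
  fixes k m T t A4 V \<epsilon> z y :: real and K K' :: int
  assumes k: "1 < k" and m: "0 < m" and t: "0 < t" "t \<le> T" and A4: "0 < A4" "A4 \<le> sqrt k * T"
    and V: "A4\<^sup>2 \<le> V" "V \<le> A4 * (sqrt k * T)" and eps: "0 < \<epsilon>" "\<epsilon> < 1"
    and K: "K = 1 + \<lceil>1 / 2 * ln (m / (72 * (2 + cst_c) * sqrt k))\<rceil>" "1 \<le> K"
    and K': "K' = 1 + \<lceil>2 * ln (m / (72 * (2 + cst_c) * sqrt k))\<rceil>" "1 \<le> K'"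
    and y: "y = 73/100 * (T / t) + ln (real_of_int K) + ln (1 / \<epsilon>)"
    and z: "z = (sqrt (2032/1000 * (k - 1) * y) + sqrt (985/10 * (k * (T / t)))) / sqrt m"
    and cond: "(6 + 1 / (k - 1)) * z \<le> 1" and t4A: "t \<le> 4 * A4"
  defines "L \<equiv> ln (real_of_int K' / \<epsilon>)" and "E \<equiv> \<lambda>j::nat. exp (real j / 2)"
  obtains j G where "int j < K'" "grid_numerics k m T t A4 V L (E j)"
    "G = grid_numerics.t1 k m A4 V L (E j) + grid_numerics.t2 k m A4 (E j) + grid_numerics.t3 k m A4 V L (E j)
      + grid_numerics.t4 k m t A4 (E j)"
    "grid_numerics.t4 k m t A4 (E j) \<le> 165/100 * grid_numerics.t2 k m A4 (E j)"
    "G \<le> 11/10 * z" "z < G \<Longrightarrow> G * (G - z) \<le> 223/10 * (sqrt k * A4 / (2 * m * t))"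
proof -
  define T' where "T' = T / t"
  have T': "1 \<le> T'" unfolding T'_def using t by simp
  have c: "44 \<le> cst_c" "cst_c \<le> 4429/100" by (rule cst_c_bounds)+
  define r where "r = ln (real_of_int K' / real_of_int K)"
  have Kr: "1 \<le> real_of_int K" "1 \<le> real_of_int K'" using K K' by auto
  have l1: "0 \<le> ln (1 / \<epsilon>)" using eps by simp
  have lK: "0 \<le> ln (real_of_int K)" using Kr by simp
  have y0: "73/100 \<le> y" using y lK l1 T' unfolding T'_def by linarith
  have Lr: "73/100 * T' + L = y + r"
    unfolding L_def y r_def T'_def using Kr eps by (simp add: ln_div)
  have L0: "0 \<le> L" unfolding L_def using Kr eps by (intro ln_ge_zero) (simp add: pos_le_divide_eq)
  have "73/100 + ln (real_of_int K) \<le> y" using y l1 T' unfolding T'_def by linarith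
  note gap = log_gap[OF K(1) K'(1) K(2) K'(2) this, folded r_def]
  define a1 where "a1 = sqrt (2032/1000 * (k - 1) * y)"
  define a1' where "a1' = sqrt (2032/1000 * (k - 1) * (y + r))"
  define b1 where "b1 = sqrt (985/10 * (k * T'))"
  have zm: "sqrt m * z = a1 + b1" unfolding z a1_def b1_def T'_def using m by simp
  have z0: "0 < z" unfolding z using m k y0 t by (intro divide_pos_pos add_nonneg_pos) auto
  have kT: "1 < k * T'" using k T' by (smt (verit) mult_le_cancel_left1)
  have b1_pos: "0 < b1" unfolding b1_def using kT by simp
  have b1_sq: "b1\<^sup>2 = 985/10 * (k * T')" unfolding b1_def using kT by simp
  have a1_pos: "0 \<le> a1" unfolding a1_def using k y0 by simp
  define \<phi> where "\<phi> = A4 / (sqrt k * T)"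
  have sk: "1 < sqrt k" using k by simp
  have T0: "0 < T" using t by simp
  have \<phi>: "0 < \<phi>" "\<phi> \<le> 1" unfolding \<phi>_def using A4 sk T0 by (auto simp: pos_divide_le_eq)
  have \<phi>kT: "\<phi> * (k * T') = sqrt k * A4 / t"
  proof -
    have "k = sqrt k * sqrt k" using k by simp
    then have "\<phi> * (k * T') = A4 / (sqrt k * T) * (sqrt k * sqrt k * (T / t))" unfolding \<phi>_def T'_def by simp
    also have "\<dots> = sqrt k * A4 / t"
    proof -
      have aux: "A / (s * T) * (s * s * (T / t)) = s * A / t" if "s \<noteq> 0" "T \<noteq> 0" for A s T :: real using that by simp
      show ?thesis by (rule aux) (use sk T0 in auto)
    qed
    finally show ?thesis .
  qed
  have G: "grid_numerics k m T t A4 V L (E j)" for j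
    unfolding E_def by unfold_locales (use k m t A4 V L0 in auto)
  define e where "e = a1' - a1"
  have e: "e \<le> 6416/10000 * sqrt (k - 1)"
  proof -
    have "a1' \<le> a1 + sqrt (2032/1000 * (k - 1)) * (45/100)"
    proof -
      have "a1' = sqrt (2032/1000 * (k - 1)) * sqrt (y + r)" unfolding a1'_def by (rule real_sqrt_mult)
      also have "\<dots> \<le> sqrt (2032/1000 * (k - 1)) * (sqrt y + 45/100)" using gap(2) k by (intro mult_left_mono) auto
      also have "\<dots> = a1 + sqrt (2032/1000 * (k - 1)) * (45/100)"
        unfolding a1_def real_sqrt_mult[of "2032/1000 * (k - 1)" y] by (rule distrib_left)
      finally show ?thesis .
    qed
    moreover have "sqrt (2032/1000 * (k - 1)) \<le> 14257/10000 * sqrt (k - 1)"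
      unfolding real_sqrt_mult using k by (intro mult_right_mono real_le_lsqrt) (auto simp: power_divide)
    moreover have "0 \<le> sqrt (k - 1)" using k by simp
    ultimately show ?thesis unfolding e_def by linarith
  qed
  have sk1: "sqrt (k - 1) \<le> sqrt (k * T')"
    using k T' by (intro real_sqrt_le_mono) (smt (verit) mult_le_cancel_left1)
  have b1_lo: "9924/1000 * sqrt (k * T') \<le> b1"
    unfolding b1_def real_sqrt_mult[of "985/10"] using kT by (intro mult_right_mono real_le_rsqrt) (auto simp: power_divide)
  have b1_up: "b1 \<le> 9925/1000 * sqrt (k * T')"
    unfolding b1_def real_sqrt_mult[of "985/10"] using kT by (intro mult_right_mono real_le_lsqrt) (auto simp: power_divide)
  have eb: "10 * e \<le> b1" 
  proof -
    have "0 \<le> sqrt (k * T')" using kT by simp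
    then show ?thesis using e sk1 b1_lo by linarith
  qed
  \<comment> \<open>Here e a1' is at most a1'^2 - a1^2, which is linear in the logarithmic gap, and
    e b1 is bounded directly. The two contributions, about 2.82 and 6.37, stay below 9.2.\<close>
  have loss: "e * (a1' + b1) \<le> 92/10 * (k * T')" if "0 \<le> e"
  proof -
    have yr: "0 \<le> y + r" using Lr L0 T' by linarith
    have "e * a1' \<le> (a1' - a1) * (a1' + a1)" unfolding e_def[symmetric] using that a1_pos by (intro mult_left_mono) auto
    also have "\<dots> = a1'\<^sup>2 - a1\<^sup>2" by (simp add: power2_eq_square algebra_simps)
    also have "\<dots> = 2032/1000 * (k - 1) * r"
    proof -
      have "a1'\<^sup>2 = 2032/1000 * (k - 1) * (y + r)" unfolding a1'_def by (rule real_sqrt_pow2) (use k yr in simp)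
      moreover have "a1\<^sup>2 = 2032/1000 * (k - 1) * y" unfolding a1_def by (rule real_sqrt_pow2) (use k y0 in simp)
      ultimately show ?thesis by (simp add: algebra_simps)
    qed
    also have "\<dots> \<le> 2032/1000 * (k - 1) * (2 * ln 2)" using gap(1) k by (intro mult_left_mono) auto
    also have "\<dots> \<le> 2032/1000 * (k * T') * (13863/10000)"
      using ln2_bounds k T' by (intro mult_mono) (auto, smt (verit) mult_le_cancel_left1)
    finally have 1: "e * a1' \<le> 2032/1000 * (k * T') * (13863/10000)" .
    have "e * b1 \<le> (6416/10000 * sqrt (k * T')) * (9925/1000 * sqrt (k * T'))"
    proof (intro mult_mono)
      show "e \<le> 6416/10000 * sqrt (k * T')" using e sk1 by linarith
    qed (use b1_up b1_pos kT in auto)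
    also have "\<dots> = 6416/10000 * (9925/1000) * (k * T')" using kT by simp
    finally have 2: "e * b1 \<le> 6416/10000 * (9925/1000) * (k * T')" .
    show ?thesis unfolding distrib_left using 1 2 kT by linarith
  qed
  show ?thesis
  proof (cases "t \<le> A4 * exp (1/4)")
    case True
    define x where "x = 2 * ln (A4 / t)"
    have At: "0 < A4 / t" using A4 t by simp
    have ex: "exp (x / 2) = A4 / t" unfolding x_def using At by simp
    have x_lo: "- (1/2) \<le> x"
    proof -
      have "1 / exp (1/4) \<le> A4 / t" using True t by (simp add: field_simps)
      then have "ln (1 / exp (1/4)) \<le> ln (A4 / t)" using t by (intro ln_mono) auto
      then show ?thesis unfolding x_def by (simp add: ln_div)
    qed
    \<comment> \<open>The integer nearest to 2 ln (s4^2 / t); it is not negative because x >=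
      -1/2.\<close>
    define j where "j = nat \<lfloor>x + 1/2\<rfloor>"
    have j: "real j \<le> x + 1/2" "x - 1/2 \<le> real j"
      unfolding j_def using x_lo by (simp_all add: of_nat_nat) linarith+
    \<comment> \<open>The index stays inside the grid because of the side condition of
      \<open>B_star\<close>: 6 z <= 1 gives m >= 3546 k T' with 3546 = 36 times 98.5, and 72 (2 + c)
      is at most 3333.\<close>
    have jK: "int j < K'"
    proof -
      have "36 * b1\<^sup>2 \<le> m"
      proof -
        have "0 < 1 / (k - 1) * z" using k z0 by simp
        then have "6 * z \<le> 1" using cond by (simp add: distrib_right)
        then have "sqrt m * (6 * z) \<le> sqrt m * 1" using m by (intro mult_left_mono) auto
        then have "6 * b1 \<le> sqrt m" using zm a1_pos by simp
        then have "(6 * b1)\<^sup>2 \<le> (sqrt m)\<^sup>2" using b1_pos by (intro power_mono) auto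
        then show ?thesis using m by (simp add: power_mult_distrib)
      qed
      then have mk: "3546 * (k * T') \<le> m" unfolding b1_sq by linarith
      have "A4 / t \<le> sqrt k * T'" unfolding T'_def using A4(2) t by (simp add: divide_right_mono)
      also have "\<dots> \<le> m / (72 * (2 + cst_c) * sqrt k)"
      proof -
        have "sqrt k * T' * (72 * (2 + cst_c) * sqrt k) = 72 * (2 + cst_c) * (k * T')" using k by simp
        also have "\<dots> \<le> 3546 * (k * T')" using c kT by (intro mult_right_mono) auto
        finally show ?thesis using mk c sk by (simp add: pos_le_divide_eq)
      qed
      finally have "x \<le> 2 * ln (m / (72 * (2 + cst_c) * sqrt k))" unfolding x_def using At by simp
      then have "x \<le> real_of_int (K' - 1)" using K'(1) by linarith
      then have "\<lfloor>x + 1/2\<rfloor> \<le> K' - 1" by linarith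
      then show ?thesis unfolding j_def using K'(2) by linarith
    qed
    interpret g: grid_numerics k m T t A4 V L "E j" by (rule G)
    have Ej: "A4 / t \<le> E j * exp (1/4)" "E j \<le> A4 / t * exp (1/4)"
      unfolding ex[symmetric] E_def exp_add[symmetric] using j by simp_all
    note bal = g.balanced_terms[OF Ej]
    define G where "G = g.t1 + g.t2 + g.t3 + g.t4"
    have b\<phi>: "sqrt (985/10 * (sqrt k * A4 / t)) = b1 * sqrt \<phi>"
      unfolding \<phi>kT[symmetric] b1_def real_sqrt_mult[symmetric] by (simp add: mult_ac)
    have mG: "sqrt m * G \<le> a1' + b1 * sqrt \<phi>"
    proof -
      have "sqrt m * G = sqrt m * (g.t1 + g.t3) + sqrt m * (g.t2 + g.t4)" unfolding G_def by (simp add: algebra_simps)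
      then show ?thesis using bal(1,2) unfolding b\<phi> T'_def[symmetric] Lr a1'_def by linarith
    qed
    have s\<phi>: "0 \<le> sqrt \<phi>" "sqrt \<phi> \<le> 1" "2 * sqrt \<phi> - 1 \<le> \<phi>" using \<phi> zero_le_power2[of "sqrt \<phi> - 1"] by (auto simp: power2_diff)
    have b\<phi>1: "b1 * sqrt \<phi> \<le> b1" using s\<phi> b1_pos by (simp add: mult_le_cancel_left1)
    have dG: "sqrt m * (G - z) \<le> e - b1 * (1 - sqrt \<phi>)"
      using mG zm unfolding e_def by (simp add: algebra_simps)
    have G1: "G \<le> 11/10 * z"
    proof -
      have "sqrt m * G \<le> a1 + e + b1" using mG b\<phi>1 unfolding e_def by linarith
      also have "\<dots> \<le> 11/10 * (a1 + b1)" using eb a1_pos by (simp add: field_simps)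
      finally have "sqrt m * G \<le> sqrt m * (11/10 * z)" using zm by simp
      then show ?thesis using m by simp
    qed
    have G2: "G * (G - z) \<le> 223/10 * (sqrt k * A4 / (2 * m * t))" if zG: "z < G"
    proof -
      have G0: "0 < G" using zG z0 by simp
      have "0 < sqrt m * (G - z)" using zG m by simp
      then have e0: "0 \<le> e" using dG s\<phi>(2) b1_pos mult_nonneg_nonneg[of b1 "1 - sqrt \<phi>"] by linarith
      have "2 * e * (1 - sqrt \<phi>) \<le> b1 * (1 - sqrt \<phi>)" using eb e0 s\<phi> by (intro mult_right_mono) auto
      then have "sqrt m * (G - z) \<le> e * (2 * sqrt \<phi> - 1)" using dG by (simp add: algebra_simps)
      also have "\<dots> \<le> e * \<phi>" using s\<phi> e0 by (intro mult_left_mono) auto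
      finally have 1: "sqrt m * (G - z) \<le> e * \<phi>" .
      have "m * (G * (G - z)) = (sqrt m * G) * (sqrt m * (G - z))" using m by simp
      also have "\<dots> \<le> (a1' + b1) * (e * \<phi>)"
      proof (rule mult_mono[OF _ 1])
        show "sqrt m * G \<le> a1' + b1" using mG b\<phi>1 by linarith
        have "0 \<le> sqrt m * G" using m G0 by simp
        then show "0 \<le> a1' + b1" using mG b\<phi>1 by linarith
      qed (use zG m in simp)
      also have "\<dots> = \<phi> * (e * (a1' + b1))" by simp
      also have "\<dots> \<le> \<phi> * (92/10 * (k * T'))" using loss[OF e0] \<phi> by (intro mult_left_mono) auto
      also have "\<dots> = 92/10 * (sqrt k * A4 / t)" unfolding \<phi>kT[symmetric] by simp
      also have "\<dots> \<le> 223/20 * (sqrt k * A4 / t)" using A4 t sk by (intro mult_right_mono) auto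
      finally have "m * (G * (G - z)) \<le> m * (223/10 * (sqrt k * A4 / (2 * m * t)))" using m by simp
      then show ?thesis by (rule mult_left_le_imp_le) (use m in simp)
    qed
    show ?thesis by (rule that[OF jK g.grid_numerics_axioms G_def bal(3) G1 G2])
  next
    case False
    interpret g: grid_numerics k m T t A4 V L "E 0" by (rule G)
    have gap': "sqrt (73/100 * (T / t) + L) \<le> sqrt y + 45/100" using gap(2) unfolding T'_def[symmetric] Lr .
    have A: "A4 * exp (1/4) \<le> t" "E 0 = 1" "0 \<le> y" using False y0 by (auto simp: E_def)
    note u = g.unbalanced_terms[OF A(2) t4A A(1) A(3) gap']
    define G where "G = g.t1 + g.t2 + g.t3 + g.t4"
    have "sqrt m * G \<le> sqrt m * z" using u(1) unfolding zm G_def a1_def b1_def T'_def .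
    then have Gz: "G \<le> z" using m by simp
    have t4: "g.t4 \<le> 165/100 * g.t2" using u(2) g.t2_pos by linarith
    have "int 0 < K'" using K'(2) by simp
    then show ?thesis by (rule that[OF _ g.grid_numerics_axioms G_def t4]) (use Gz z0 in auto)
  qed
qed

section \<open>Deviations of the estimators\<close>

lemma (in prob_space) finite_intersection_event:
  assumes "finite J" and "\<And>j. j \<in> J \<Longrightarrow> \<exists>E\<in>sets M. 1 - \<delta> j \<le> measure M E \<and> (\<forall>\<omega>\<in>E. \<phi> j \<omega>)"
  shows "\<exists>E\<in>sets M. 1 - sum \<delta> J \<le> measure M E \<and> (\<forall>\<omega>\<in>E. \<forall>j\<in>J. \<phi> j \<omega>)"
  using assms
proof (induction J rule: finite_induct)
  case empty
  then show ?case by (intro bexI[of _ "space M"]) (auto simp: prob_space)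
next
  case (insert i J)
  obtain E where E: "E \<in> sets M" "1 - sum \<delta> J \<le> measure M E" "\<forall>\<omega>\<in>E. \<forall>j\<in>J. \<phi> j \<omega>"
    using insert.IH insert.prems by (metis insertCI)
  obtain F where F: "F \<in> sets M" "1 - \<delta> i \<le> measure M F" "\<forall>\<omega>\<in>F. \<phi> i \<omega>"
    using insert.prems by blast
  have "measure M (E \<union> F) = measure M E + measure M F - measure M (E \<inter> F)"
    by (rule measure_Un3) (use E F in \<open>auto simp: fmeasurable_eq_sets\<close>)
  moreover have "measure M (E \<union> F) \<le> 1" by simp
  ultimately have "1 - sum \<delta> (insert i J) \<le> measure M (E \<inter> F)" using E F insert.hyps by simp
  then show ?case using E F by (intro bexI[of _ "E \<inter> F"]) auto
qed

locale robust_estimation = block_kurtosis P q for P :: "(real^'d) measure" and q +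
  fixes M :: "'w measure" and X :: "nat \<Rightarrow> 'w \<Rightarrow> real^'d" and n :: nat and \<epsilon> \<sigma> :: real
  assumes M: "prob_space M" and indep: "prob_space.indep_vars M (\<lambda>_. borel) X {1..n}"
    and ident: "\<And>i. i \<in> {1..n} \<Longrightarrow> distr M borel (X i) = P"
    and eps: "0 < \<epsilon>" "\<epsilon> < 1" and sg: "0 < \<sigma>" "\<sigma> \<le> trace (cov_mat P)"
    and K_ge: "1 \<le> K q kurt_coeff n" and K'_ge: "1 \<le> K' (block_law q P) (n div q)"
    and m_pos: "1 \<le> n div q"
begin

abbreviation "m \<equiv> n div q"
definition "A \<omega> = block_mat q (\<lambda>j. X j \<omega>)"
definition "A4 = sqrt M2"
definition "L = ln (real_of_int (K' Q m) / \<epsilon>)"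
abbreviation "lj \<equiv> lam_grid Q m \<epsilon>"
abbreviation "bj \<equiv> beta_grid Q m"

lemma A4_pos: "0 < A4" using M2_pos by (simp add: A4_def)
lemma A4_square: "A4\<^sup>2 = M2" using M2_nonneg by (simp add: A4_def)
lemma A4_le: "A4 \<le> sqrt kurt_block * Tr"
  unfolding A4_def using M2_le Tr_pos by (metis real_sqrt_le_mono real_sqrt_mult real_sqrt_unique less_imp_le)
lemma L_nonneg: "0 \<le> L"
  unfolding L_def using K'_ge eps by (intro ln_ge_zero) (auto simp: pos_le_divide_eq)

lemma kurt_block_enn: "enn2real (kurtosis_mat Q) = kurt_block" using kurtosis_mat_eq kurt_block_gt_1 by simp

lemma grid: "0 < t \<Longrightarrow> t \<le> Tr \<Longrightarrow> grid_numerics kurt_block (real m) Tr t A4 V2 L (exp (real j / 2))"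
  by unfold_locales (use kurt_block_gt_1 m_pos A4_pos A4_le M2_le_V2 V2_le L_nonneg in \<open>auto simp: A4_square A4_def\<close>)

lemma lj_eq: "lj j = grid_numerics.lc kurt_block (real m) A4 V2 L (exp (real j / 2))"
proof -
  interpret g: grid_numerics kurt_block "real m" Tr Tr A4 V2 L "exp (real j / 2)" by (rule grid) (use Tr_pos in auto)
  show ?thesis unfolding lam_grid_def Let_def kurt_block_enn g.lc_def g.Wc_def M2_def[symmetric] V2_def[symmetric] L_def[symmetric] A4_square mesh_def
    by simp
qed

lemma bj_eq: "bj j = grid_numerics.bc kurt_block (real m) A4 (exp (real j / 2))"
proof -
  interpret g: grid_numerics kurt_block "real m" Tr Tr A4 V2 L "exp (real j / 2)" by (rule grid) (use Tr_pos in auto)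
  have "exp (- ((real j - 1 / 2) * mesh)) = exp (1/4) / exp (real j / 2)"
    unfolding mesh_def exp_diff[symmetric] by (simp add: algebra_simps)
  then show ?thesis unfolding beta_grid_def Let_def kurt_block_enn g.bc_def M2_def[symmetric] A4_square by simp
qed

lemma lj_pos: "0 < lj j"
proof -
  interpret g: grid_numerics kurt_block "real m" Tr Tr A4 V2 L "exp (real j / 2)" by (rule grid) (use Tr_pos in auto)
  show ?thesis unfolding lj_eq by (rule g.lc_pos)
qed

lemma bj_pos: "0 < bj j"
proof -
  interpret g: grid_numerics kurt_block "real m" Tr Tr A4 V2 L "exp (real j / 2)" by (rule grid) (use Tr_pos in auto)
  show ?thesis unfolding bj_eq by (rule g.bc_pos)
qed

text \<open>Distinct indices give distinct pairs, so the cardinality of \<open>Lam\<close> is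
  \<open>K'\<close> and the logarithm in \<open>B_bound\<close> is the same \<open>L\<close> as in
  lambda.\<close>

lemma bj_inj: "inj bj"
proof (rule injI)
  fix i j assume "bj i = bj j"
  then have "(bj i)\<^sup>2 = (bj j)\<^sup>2" by simp
  moreover have "(bj i)\<^sup>2 = 2 * (2 + cst_c) * sqrt kurt_block * M2 * real m * (exp (1/4) / exp (real i / 2))" for i
  proof -
    interpret g: grid_numerics kurt_block "real m" Tr Tr A4 V2 L "exp (real i / 2)" by (rule grid) (use Tr_pos in auto)
    show ?thesis unfolding bj_eq g.bc_square A4_square ..
  qed
  moreover have "2 * (2 + cst_c) * sqrt kurt_block * M2 * real m \<noteq> 0" using cst_c_bounds kurt_block_gt_1 M2_pos m_pos by simp
  ultimately have "exp (1/4 :: real) / exp (real i / 2) = exp (1/4) / exp (real j / 2)" by (metis mult_left_cancel)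
  then show "i = j" unfolding exp_diff[symmetric] by simp
qed

lemma Lam_eq: "Lam Q m \<epsilon> = (\<lambda>j. (lj j, bj j)) ` {..<nat (K' Q m)}"
  unfolding Lam_def by (auto simp: zless_nat_eq_int_zless)

lemma card_Lam: "card (Lam Q m \<epsilon>) = nat (K' Q m)"
  unfolding Lam_eq using bj_inj by (subst card_image) (auto intro!: inj_onI dest: injD)

lemma ln_card_Lam: "ln (real (card (Lam Q m \<epsilon>)) / \<epsilon>) = L"
  unfolding card_Lam L_def using K'_ge by simp

lemma A_psd: "sym_psd (A \<omega> i)"
  unfolding A_def by (rule block_mat_sym_psd[OF q])

definition "dev_p b = (2 + dev_cst) * (sqrt kurt_block * A4) / b"
definition "dev_w b = (2 + 3 * dev_cst) * V2 / (2 * b\<^sup>2)"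

lemma deviation_event:
  fixes l b \<delta> s :: real
  assumes b: "0 < b" and \<delta>: "0 < \<delta>" and s: "\<bar>s\<bar> = 1"
  shows "\<exists>E\<in>sets M. 1 - \<delta> \<le> measure M E \<and> (\<forall>\<omega>\<in>E. \<forall>\<theta>. (\<Sum>i=1..m. psi (s * (\<theta> \<bullet> (A \<omega> i *v \<theta>) - l)))
    \<le> real m * (s * (energy P \<theta> - l) + ((\<integral>A. (\<theta> \<bullet> (A *v \<theta>))\<^sup>2 \<partial>Q) - 2 * l * energy P \<theta> + l\<^sup>2) / 2
         + (2 + dev_cst) * (\<integral>A. (norm (A *v \<theta>))\<^sup>2 \<partial>Q) / b + dev_w b)
      + b * (norm \<theta>)\<^sup>2 / 2 + ln (1 / \<delta>))"
proof -
  have symQ: "AE A in Q. transpose A = A" using AE_psd by eventually_elim (simp add: sym_psd_def)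
  have sym: "transpose (A \<omega> i) = A \<omega> i" for \<omega> i using A_psd[of \<omega> i] by (simp add: sym_psd_def)
  have iid: "prob_space.indep_vars M (\<lambda>_. borel) (\<lambda>i \<omega>. A \<omega> i) {1..m}" "\<And>i. i \<in> {1..m} \<Longrightarrow> distr M borel (\<lambda>\<omega>. A \<omega> i) = Q"
    unfolding A_def using blocks_iid[OF M indep ident] by auto
  have eq: "integral\<^sup>L Q (dev_term s b l \<theta>) = s * (energy P \<theta> - l) + ((\<integral>A. (\<theta> \<bullet> (A *v \<theta>))\<^sup>2 \<partial>Q) - 2 * l * energy P \<theta> + l\<^sup>2) / 2
         + (2 + dev_cst) * (\<integral>A. (norm (A *v \<theta>))\<^sup>2 \<partial>Q) / b + dev_w b" for \<theta>
    unfolding integrable_dev_term(2)[OF prob_Q sets_Q norm_square_integrable] quad_integrable(3) V2_eq[symmetric] dev_w_def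
    by (simp add: field_simps)
  from pac_bayes[OF M iid prob_Q sets_Q norm_square_integrable symQ sym b \<delta> s, of l]
  show ?thesis unfolding eq .
qed

text \<open>A union bound over 2 K' events, one for each grid point and sign, each failing with
  probability at most epsilon / K'.\<close>

lemma good_event:
  "\<exists>E\<in>sets M. 1 - 2 * \<epsilon> \<le> measure M E \<and> (\<forall>\<omega>\<in>E. \<forall>j<nat (K' Q m). \<forall>s\<in>{1, -1}. \<forall>\<theta>.
    (\<Sum>i=1..m. psi (s * (\<theta> \<bullet> (A \<omega> i *v \<theta>) - lj j)))
    \<le> real m * (s * (energy P \<theta> - lj j) + (kurt_block * (energy P \<theta>)\<^sup>2 - 2 * lj j * energy P \<theta> + (lj j)\<^sup>2) / 2
         + dev_p (bj j) * energy P \<theta> + (dev_w (bj j) + L / real m)) + bj j * (norm \<theta>)\<^sup>2 / 2)"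
proof -
  interpret M: prob_space M by (rule M)
  define J where "J = {..<nat (K' Q m)} \<times> {1, -1 :: real}"
  define \<delta> where "\<delta> = \<epsilon> / real_of_int (K' Q m)"
  have K0: "0 < real_of_int (K' Q m)" using K'_ge by simp
  have \<delta>0: "0 < \<delta>" unfolding \<delta>_def using K0 eps by simp
  have ln\<delta>: "ln (1 / \<delta>) = L" unfolding \<delta>_def L_def by simp
  define \<phi> where "\<phi> = (\<lambda>p \<omega>. \<forall>\<theta>. (\<Sum>i=1..m. psi (snd p * (\<theta> \<bullet> (A \<omega> i *v \<theta>) - lj (fst p))))
    \<le> real m * (snd p * (energy P \<theta> - lj (fst p)) + ((\<integral>A. (\<theta> \<bullet> (A *v \<theta>))\<^sup>2 \<partial>Q) - 2 * lj (fst p) * energy P \<theta> + (lj (fst p))\<^sup>2) / 2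
         + (2 + dev_cst) * (\<integral>A. (norm (A *v \<theta>))\<^sup>2 \<partial>Q) / bj (fst p) + dev_w (bj (fst p)))
      + bj (fst p) * (norm \<theta>)\<^sup>2 / 2 + ln (1 / \<delta>))"
  have fin: "finite J" unfolding J_def by simp
  have "\<And>p. p \<in> J \<Longrightarrow> \<exists>E\<in>sets M. 1 - \<delta> \<le> measure M E \<and> (\<forall>\<omega>\<in>E. \<phi> p \<omega>)"
    unfolding \<phi>_def by (rule deviation_event[OF bj_pos \<delta>0]) (auto simp: J_def)
  then have "\<exists>E\<in>sets M. 1 - (\<Sum>p\<in>J. \<delta>) \<le> measure M E \<and> (\<forall>\<omega>\<in>E. \<forall>p\<in>J. \<phi> p \<omega>)"
    by (rule M.finite_intersection_event[OF fin])
  then obtain E where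
    E: "E \<in> sets M" "1 - (\<Sum>p\<in>J. \<delta>) \<le> measure M E" "\<forall>\<omega>\<in>E. \<forall>p\<in>J. \<phi> p \<omega>" by (elim bexE conjE)
  have "card J = 2 * nat (K' Q m)" unfolding J_def by (simp add: card_cartesian_product)
  then have "(\<Sum>p\<in>J. \<delta>) = 2 * \<epsilon>" unfolding \<delta>_def using K0 K'_ge by simp
  moreover have "(\<Sum>i=1..m. psi (s * (\<theta> \<bullet> (A \<omega> i *v \<theta>) - lj j)))
    \<le> real m * (s * (energy P \<theta> - lj j) + (kurt_block * (energy P \<theta>)\<^sup>2 - 2 * lj j * energy P \<theta> + (lj j)\<^sup>2) / 2
         + dev_p (bj j) * energy P \<theta> + (dev_w (bj j) + L / real m)) + bj j * (norm \<theta>)\<^sup>2 / 2"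
    if "\<omega> \<in> E" "j < nat (K' Q m)" "s \<in> {1, -1}" for \<omega> j s \<theta>
  proof -
    have "(j, s) \<in> J" using that by (auto simp: J_def)
    then have "\<phi> (j, s) \<omega>" using E(3) that(1) by blast
    then have "(\<Sum>i=1..m. psi (s * (\<theta> \<bullet> (A \<omega> i *v \<theta>) - lj j)))
      \<le> real m * (s * (energy P \<theta> - lj j) + ((\<integral>A. (\<theta> \<bullet> (A *v \<theta>))\<^sup>2 \<partial>Q) - 2 * lj j * energy P \<theta> + (lj j)\<^sup>2) / 2
         + (2 + dev_cst) * (\<integral>A. (norm (A *v \<theta>))\<^sup>2 \<partial>Q) / bj j + dev_w (bj j))
      + bj j * (norm \<theta>)\<^sup>2 / 2 + L" unfolding \<phi>_def ln\<delta> fst_conv snd_conv by blast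
    also have "\<dots> = real m * (s * (energy P \<theta> - lj j) + ((\<integral>A. (\<theta> \<bullet> (A *v \<theta>))\<^sup>2 \<partial>Q) - 2 * lj j * energy P \<theta> + (lj j)\<^sup>2) / 2
         + (2 + dev_cst) * (\<integral>A. (norm (A *v \<theta>))\<^sup>2 \<partial>Q) / bj j + (dev_w (bj j) + L / real m))
      + bj j * (norm \<theta>)\<^sup>2 / 2" using m_pos by (simp add: distrib_left)
    also have "\<dots> \<le> real m * (s * (energy P \<theta> - lj j) + (kurt_block * (energy P \<theta>)\<^sup>2 - 2 * lj j * energy P \<theta> + (lj j)\<^sup>2) / 2
         + dev_p (bj j) * energy P \<theta> + (dev_w (bj j) + L / real m)) + bj j * (norm \<theta>)\<^sup>2 / 2"
    proof -
      have "(2 + dev_cst) * (\<integral>A. (norm (A *v \<theta>))\<^sup>2 \<partial>Q) / bj j \<le> (2 + dev_cst) * (A4 * (sqrt kurt_block * energy P \<theta>)) / bj j"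
        unfolding A4_def using image_square_le(1)[of \<theta>] dev_cst_pos bj_pos[of j] by (intro divide_right_mono mult_left_mono) auto
      also have "\<dots> = dev_p (bj j) * energy P \<theta>" unfolding dev_p_def by simp
      finally have "(2 + dev_cst) * (\<integral>A. (norm (A *v \<theta>))\<^sup>2 \<partial>Q) / bj j \<le> dev_p (bj j) * energy P \<theta>" .
      then show ?thesis using quad_integrable(4)[of \<theta>] by (intro order_refl add_mono mult_left_mono divide_right_mono diff_right_mono) auto
    qed
    finally show ?thesis .
  qed
  ultimately show ?thesis using E(1,2) by (intro bexI[of _ E]) auto
qed

definition "two_sided_bounds \<omega> \<longleftrightarrow> (\<forall>j<nat (K' Q m). \<forall>s\<in>{1, -1}. \<forall>\<theta>.
    (\<Sum>i=1..m. psi (s * (\<theta> \<bullet> (A \<omega> i *v \<theta>) - lj j)))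
    \<le> real m * (s * (energy P \<theta> - lj j) + (kurt_block * (energy P \<theta>)\<^sup>2 - 2 * lj j * energy P \<theta> + (lj j)\<^sup>2) / 2
         + dev_p (bj j) * energy P \<theta> + (dev_w (bj j) + L / real m)) + bj j * (norm \<theta>)\<^sup>2 / 2)"

lemma energy_scaleR: "energy P (\<alpha> *\<^sub>R \<theta>) = \<alpha>\<^sup>2 * energy P \<theta>"
  by (simp add: energy_def matrix_vector_mult_scaleR power2_eq_square)

lemma empirical_bounds:
  fixes \<theta> :: "real^'d"
  assumes \<Delta>: "two_sided_bounds \<omega>" and j: "j < nat (K' Q m)" and p: "dev_p (bj j) \<le> p" and w: "dev_w (bj j) + L / real m \<le> w"
  defines "N \<equiv> energy P \<theta>" and "l \<equiv> lj j" and "d \<equiv> bj j * (norm \<theta>)\<^sup>2 / (2 * real m)"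
  shows "(\<alpha>\<^sup>2 * N - l) - ((kurt_block * (\<alpha>\<^sup>2 * N)\<^sup>2 - 2 * l * (\<alpha>\<^sup>2 * N) + l\<^sup>2) / 2 + p * (\<alpha>\<^sup>2 * N) + w + d * \<alpha>\<^sup>2) \<le> r_emp m (A \<omega>) l (\<alpha> *\<^sub>R \<theta>)"
    "r_emp m (A \<omega>) l (\<alpha> *\<^sub>R \<theta>) \<le> (\<alpha>\<^sup>2 * N - l) + ((kurt_block * (\<alpha>\<^sup>2 * N)\<^sup>2 - 2 * l * (\<alpha>\<^sup>2 * N) + l\<^sup>2) / 2 + p * (\<alpha>\<^sup>2 * N) + w + d * \<alpha>\<^sup>2)"
proof -
  define S where "S = (\<Sum>i=1..m. psi (\<alpha>\<^sup>2 * (\<theta> \<bullet> (A \<omega> i *v \<theta>)) - l))"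
  have r: "r_emp m (A \<omega>) l (\<alpha> *\<^sub>R \<theta>) = S / real m"
    unfolding S_def by (subst r_emp_eq[OF m_pos A_psd]) (auto simp: l_def lj_pos)
  have e: "0 \<le> \<alpha>\<^sup>2 * N" unfolding N_def using energy_nonneg by simp
  have b: "s * S \<le> real m * (s * (\<alpha>\<^sup>2 * N - l) + ((kurt_block * (\<alpha>\<^sup>2 * N)\<^sup>2 - 2 * l * (\<alpha>\<^sup>2 * N) + l\<^sup>2) / 2 + p * (\<alpha>\<^sup>2 * N) + w + d * \<alpha>\<^sup>2))"
    if s: "s \<in> {1, -1}" for s
  proof -
    have "psi (s * x) = s * psi x" for x using s by (auto simp: psi_minus)
    then have "s * S = (\<Sum>i=1..m. psi (s * ((\<alpha> *\<^sub>R \<theta>) \<bullet> (A \<omega> i *v (\<alpha> *\<^sub>R \<theta>)) - l)))"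
      unfolding S_def sum_distrib_left by (simp add: matrix_vector_mult_scaleR power2_eq_square mult.assoc)
    also have "\<dots> \<le> real m * (s * (energy P (\<alpha> *\<^sub>R \<theta>) - l) + (kurt_block * (energy P (\<alpha> *\<^sub>R \<theta>))\<^sup>2 - 2 * l * energy P (\<alpha> *\<^sub>R \<theta>) + l\<^sup>2) / 2
         + dev_p (bj j) * energy P (\<alpha> *\<^sub>R \<theta>) + (dev_w (bj j) + L / real m)) + bj j * (norm (\<alpha> *\<^sub>R \<theta>))\<^sup>2 / 2"
      using \<Delta> j s unfolding two_sided_bounds_def l_def by blast
    also have "\<dots> = real m * (s * (\<alpha>\<^sup>2 * N - l) + (kurt_block * (\<alpha>\<^sup>2 * N)\<^sup>2 - 2 * l * (\<alpha>\<^sup>2 * N) + l\<^sup>2) / 2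
         + dev_p (bj j) * (\<alpha>\<^sup>2 * N) + (dev_w (bj j) + L / real m)) + real m * (d * \<alpha>\<^sup>2)"
      unfolding energy_scaleR N_def[symmetric] d_def using m_pos by (simp add: power_mult_distrib)
    also have "\<dots> \<le> real m * (s * (\<alpha>\<^sup>2 * N - l) + (kurt_block * (\<alpha>\<^sup>2 * N)\<^sup>2 - 2 * l * (\<alpha>\<^sup>2 * N) + l\<^sup>2) / 2
         + p * (\<alpha>\<^sup>2 * N) + w) + real m * (d * \<alpha>\<^sup>2)"
      using p w e by (intro order_refl add_mono mult_left_mono mult_right_mono) auto
    finally show ?thesis by (simp add: algebra_simps)
  qed
  have m0: "0 < real m" using m_pos by simp
  show "r_emp m (A \<omega>) l (\<alpha> *\<^sub>R \<theta>) \<le> (\<alpha>\<^sup>2 * N - l) + ((kurt_block * (\<alpha>\<^sup>2 * N)\<^sup>2 - 2 * l * (\<alpha>\<^sup>2 * N) + l\<^sup>2) / 2 + p * (\<alpha>\<^sup>2 * N) + w + d * \<alpha>\<^sup>2)"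
    unfolding r using b[of 1] m0 by (simp only: pos_divide_le_eq) (simp add: mult.commute)
  have "- S \<le> real m * (- ((\<alpha>\<^sup>2 * N - l) - ((kurt_block * (\<alpha>\<^sup>2 * N)\<^sup>2 - 2 * l * (\<alpha>\<^sup>2 * N) + l\<^sup>2) / 2 + p * (\<alpha>\<^sup>2 * N) + w + d * \<alpha>\<^sup>2)))"
    using b[of "-1"] by (simp add: algebra_simps)
  then have "((\<alpha>\<^sup>2 * N - l) - ((kurt_block * (\<alpha>\<^sup>2 * N)\<^sup>2 - 2 * l * (\<alpha>\<^sup>2 * N) + l\<^sup>2) / 2 + p * (\<alpha>\<^sup>2 * N) + w + d * \<alpha>\<^sup>2)) * real m \<le> S"
    unfolding mult_minus_right by (simp only: mult.commute neg_le_iff_le)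
  then show "(\<alpha>\<^sup>2 * N - l) - ((kurt_block * (\<alpha>\<^sup>2 * N)\<^sup>2 - 2 * l * (\<alpha>\<^sup>2 * N) + l\<^sup>2) / 2 + p * (\<alpha>\<^sup>2 * N) + w + d * \<alpha>\<^sup>2) \<le> r_emp m (A \<omega>) l (\<alpha> *\<^sub>R \<theta>)"
    unfolding r using m0 by (simp only: pos_le_divide_eq)
qed

abbreviation "Nt \<omega> j \<theta> \<equiv> N_tilde m (A \<omega>) (lj j) \<theta>"

lemma N_tilde_root:
  shows "0 \<le> Nt \<omega> j \<theta>"
    and "\<And>\<alpha> \<tau>. 0 \<le> \<alpha> \<Longrightarrow> Nt \<omega> j \<theta> \<le> \<tau> \<Longrightarrow> \<alpha>\<^sup>2 * \<tau> < lj j \<Longrightarrow> r_emp m (A \<omega>) (lj j) (\<alpha> *\<^sub>R \<theta>) \<le> 0"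
    and "0 < Nt \<omega> j \<theta> \<Longrightarrow> \<exists>a\<ge>0. a\<^sup>2 * Nt \<omega> j \<theta> = lj j \<and> 0 \<le> r_emp m (A \<omega>) (lj j) (a *\<^sub>R \<theta>)"
proof -
  show "0 \<le> Nt \<omega> j \<theta>" by (rule N_tilde_nonneg[OF m_pos A_psd lj_pos])
  show "r_emp m (A \<omega>) (lj j) (\<alpha> *\<^sub>R \<theta>) \<le> 0" if "0 \<le> \<alpha>" "Nt \<omega> j \<theta> \<le> \<tau>" "\<alpha>\<^sup>2 * \<tau> < lj j" for \<alpha> \<tau>
    by (rule r_emp_nonpos[OF m_pos A_psd lj_pos that])
  show "\<exists>a\<ge>0. a\<^sup>2 * Nt \<omega> j \<theta> = lj j \<and> 0 \<le> r_emp m (A \<omega>) (lj j) (a *\<^sub>R \<theta>)" if "0 < Nt \<omega> j \<theta>"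
    by (rule alpha_hat_cases[of m "A \<omega>" "lj j" \<theta>, OF m_pos A_psd lj_pos]) (use that in \<open>auto intro: less_imp_le\<close>)
qed

text \<open>With \<open>c = cst_c\<close> the parameters of the grid point \<open>j\<close> are \<open>\<gamma> = u1 + u2 + u3\<close> and \<open>\<mu> = 2 u1 + u2\<close>.\<close>

definition "u1 j = lj j / 2 * (kurt_block - 1)"
definition "u2 c j = (2 + c) * sqrt kurt_block * A4 / bj j"
definition "u3 c j = (2 + 3 * c) * V2 / (2 * (bj j)\<^sup>2 * lj j) + L / (real m * lj j)"

lemma u_nonneg: "0 \<le> c \<Longrightarrow> 0 < u1 j" "0 \<le> c \<Longrightarrow> 0 < u2 c j" "0 \<le> c \<Longrightarrow> 0 < u3 c j"
proof -
  assume c: "0 \<le> c"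
  show "0 < u1 j" unfolding u1_def using lj_pos kurt_block_gt_1 by simp
  show "0 < u2 c j" unfolding u2_def using c kurt_block_gt_1 A4_pos bj_pos by simp
  have "0 < V2" using M2_le_V2 M2_pos by linarith
  then show "0 < u3 c j" unfolding u3_def using c lj_pos[of j] bj_pos[of j] L_nonneg m_pos
    by (intro add_pos_nonneg divide_pos_pos mult_pos_pos divide_nonneg_pos) auto
qed

text \<open>Generic in c >= \<open>dev_cst\<close>: with \<open>cst_c\<close> it speaks of the
  criterion that the data minimise, with \<open>dev_cst\<close> of the error actually made.\<close>

lemma error_bounds:
  assumes \<Delta>: "two_sided_bounds \<omega>" and j: "j < nat (K' Q m)" and c: "dev_cst \<le> c" and \<theta>: "\<theta> \<noteq> 0"
  defines "\<rho> \<equiv> (norm \<theta>)\<^sup>2"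
  defines "t \<equiv> max (energy P \<theta> / \<rho>) \<sigma>" and "\<tau> \<equiv> max (Nt \<omega> j \<theta> / \<rho>) \<sigma>"
  defines "\<delta> \<equiv> \<lambda>x. bj j / (2 * real m * x)"
  defines "good \<equiv> \<lambda>d. kurt_block / (kurt_block - 1) * u1 j + (2 * u1 j + u2 c j) + (u1 j + u2 c j + u3 c j) + 2 * d < 1"
  defines "bnd \<equiv> \<lambda>d. (u1 j + u2 c j + u3 c j + d) / (1 - (2 * u1 j + u2 c j) - (u1 j + u2 c j + u3 c j) - 2 * d)"
  shows "good (\<delta> t) \<Longrightarrow> t \<le> (1 + bnd (\<delta> t)) * \<tau>"
    "good (\<delta> \<tau>) \<Longrightarrow> \<bar>t / \<tau> - 1\<bar> \<le> bnd (\<delta> \<tau>)"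
proof -
  define p w d where "p = u2 c j" and "w = lj j * u3 c j" and "d = bj j * (norm \<theta>)\<^sup>2 / (2 * real m)"
  have c0: "0 \<le> c" using c dev_cst_pos by linarith
  have \<rho>: "0 < \<rho>" unfolding \<rho>_def using \<theta> by simp
  have w_eq: "w = (2 + 3 * c) * V2 / (2 * (bj j)\<^sup>2) + L / real m"
    unfolding w_def u3_def using lj_pos[of j] by (simp add: distrib_left)
  have V2: "0 \<le> V2" using M2_le_V2 M2_pos by linarith
  have p: "dev_p (bj j) \<le> p" unfolding p_def u2_def dev_p_def
    using c A4_pos kurt_block_gt_1 bj_pos[of j] by (simp add: divide_right_mono mult_right_mono)
  have w: "dev_w (bj j) + L / real m \<le> w" unfolding w_eq dev_w_def
    using c V2 by (intro add_right_mono divide_right_mono mult_right_mono) auto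
  have p0: "0 \<le> p" unfolding p_def using u_nonneg(2)[OF c0] by (simp add: less_imp_le)
  have w0: "0 \<le> w" unfolding w_def using u_nonneg(3)[OF c0] lj_pos by (simp add: less_imp_le)
  have d0: "0 \<le> d" unfolding d_def using bj_pos[of j] by simp
  have sg\<rho>: "0 < \<sigma> * \<rho>" using sg \<rho> by simp
  note facts = lj_pos[of j] kurt_block_gt_1 p0 w0 d0 energy_nonneg[of \<theta>] sg\<rho>
    empirical_bounds[OF \<Delta> j p w, of _ \<theta>, folded d_def] N_tilde_root(2)[of _ \<omega> j \<theta>] N_tilde_root(3)[of \<omega> j \<theta>]
  have scale: "max x (\<sigma> * \<rho>) = max (x / \<rho>) \<sigma> * \<rho>" for x using \<rho> by (simp add: max_mult_distrib_right)
  have t: "max (energy P \<theta>) (\<sigma> * \<rho>) = t * \<rho>" unfolding t_def by (rule scale)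
  have \<tau>: "max (Nt \<omega> j \<theta>) (\<sigma> * \<rho>) = \<tau> * \<rho>" unfolding \<tau>_def by (rule scale)
  have eq: "kurt_block * lj j / 2 = kurt_block / (kurt_block - 1) * u1 j" "lj j * (kurt_block - 1) + p = 2 * u1 j + u2 c j"
    "lj j / 2 * (kurt_block - 1) + p + w / lj j = u1 j + u2 c j + u3 c j" "d / (x * \<rho>) = \<delta> x" for x
    unfolding u1_def p_def w_def d_def \<delta>_def using kurt_block_gt_1 lj_pos[of j] \<rho> by (auto simp: \<rho>_def)
  show "t \<le> (1 + bnd (\<delta> t)) * \<tau>" if "good (\<delta> t)"
  proof -
    have "max (energy P \<theta>) (\<sigma> * \<rho>) \<le> (1 + bnd (\<delta> t)) * max (Nt \<omega> j \<theta>) (\<sigma> * \<rho>)"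
      unfolding bnd_def t
      by (rule estimate_lower_bound[where r = "\<lambda>\<alpha>. r_emp m (A \<omega>) (lj j) (\<alpha> *\<^sub>R \<theta>)" and Nt = "Nt \<omega> j \<theta>" and sg = "\<sigma> * \<rho>",
          OF facts, unfolded t eq]; (assumption | rule that[unfolded good_def]))
    then show ?thesis unfolding t \<tau> using \<rho> by (simp add: mult.assoc[symmetric])
  qed
  show "\<bar>t / \<tau> - 1\<bar> \<le> bnd (\<delta> \<tau>)" if "good (\<delta> \<tau>)"
  proof -
    have "\<bar>max (energy P \<theta>) (\<sigma> * \<rho>) / max (Nt \<omega> j \<theta>) (\<sigma> * \<rho>) - 1\<bar> \<le> bnd (\<delta> \<tau>)"
      unfolding bnd_def \<tau>
      by (rule relative_error_bound[where r = "\<lambda>\<alpha>. r_emp m (A \<omega>) (lj j) (\<alpha> *\<^sub>R \<theta>)" and Nt = "Nt \<omega> j \<theta>" and sg = "\<sigma> * \<rho>",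
          OF facts, unfolded \<tau> eq]; (assumption | rule that[unfolded good_def]))
    then show ?thesis unfolding t \<tau> using \<rho> by simp
  qed
qed

lemma B_bound_eq:
  fixes s :: real and j :: nat
  assumes "0 < max s \<sigma>"
  defines "c \<equiv> cst_c" and "d \<equiv> bj j / (2 * real m * max s \<sigma>)"
  shows "B_bound Q m \<epsilon> \<sigma> (lj j) (bj j) s =
    (if kurt_block / (kurt_block - 1) * u1 j + (2 * u1 j + u2 c j) + (u1 j + u2 c j + u3 c j) + 2 * d < 1
     then ereal ((u1 j + u2 c j + u3 c j + d) / (1 - (2 * u1 j + u2 c j) - (u1 j + u2 c j + u3 c j) - 2 * d)) else \<infinity>)"
proof -
  have eq: "kurt_block * lj j / 2 = kurt_block / (kurt_block - 1) * u1 j" 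
    "lj j * (kurt_block - 1) + (2 + cst_c) * sqrt kurt_block * (s4 Q)\<^sup>2 / bj j = 2 * u1 j + u2 c j"
    "lj j / 2 * (kurt_block - 1) + (2 + cst_c) * sqrt kurt_block * (s4 Q)\<^sup>2 / bj j + (2 + 3 * cst_c) * V2 / (2 * (bj j)\<^sup>2 * lj j)
       + L / (real m * lj j) = u1 j + u2 c j + u3 c j"
    "2 * (bj j / (2 * real m * lj j)) * lj j / max s \<sigma> = 2 * d"
    "2 * lj j * (bj j / (2 * real m * lj j)) / max s \<sigma> = 2 * d"
    "lj j * (bj j / (2 * real m * lj j)) / max s \<sigma> = d"
    unfolding u1_def u2_def u3_def d_def c_def s4_square A4_def using kurt_block_gt_1 lj_pos[of j] m_pos by auto
  show ?thesis unfolding B_bound_def Let_def kurt_block_enn ln_card_Lam V2_def[symmetric] eq ..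
qed

section \<open>Moderate energy levels\<close>

text \<open>This is \<open>zeta\<close> divided by sqrt (q m), where tau = q (kappa' - 1) makes q
  disappear.\<close>

definition "error_rate t = (sqrt (2032/1000 * (kurt_block - 1) * (73/100 * (Tr / t) + ln (real_of_int (K q kurt_coeff n)) + ln (1 / \<epsilon>)))
  + sqrt (985/10 * (kurt_block * (Tr / t)))) / sqrt (real m)"

lemma tau_eq: "tau q kurt_coeff = real q * (kurt_block - 1)" using q by (simp add: kurt_block_def)

lemma zeta_eq: "zeta P q n \<epsilon> t / sqrt (real (q * m)) = error_rate t"
proof -
  have q0: "0 < real q" using q by simp
  have 1: "2.032 * tau q kurt_coeff * (0.73 * Tr / t + ln (real_of_int (K q kurt_coeff n)) + ln (1 / \<epsilon>))
      = real q * (2032/1000 * (kurt_block - 1) * (73/100 * (Tr / t) + ln (real_of_int (K q kurt_coeff n)) + ln (1 / \<epsilon>)))"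
    unfolding tau_eq by simp
  have 2: "98.5 * (real q + tau q kurt_coeff) * Tr / t = real q * (985/10 * (kurt_block * (Tr / t)))"
    unfolding tau_eq by (simp add: algebra_simps)
  have "zeta P q n \<epsilon> t = sqrt (2.032 * tau q kurt_coeff * (0.73 * Tr / t + ln (real_of_int (K q kurt_coeff n)) + ln (1 / \<epsilon>)))
     + sqrt (98.5 * (real q + tau q kurt_coeff) * Tr / t)"
    unfolding zeta_def Let_def kurt_coeff_def[symmetric] Tr_def[symmetric] ..
  also have "\<dots> = sqrt (real q) * (error_rate t * sqrt (real m))"
    unfolding 1 2 real_sqrt_mult[of "real q"] error_rate_def using m_pos by (simp add: distrib_left)
  finally show ?thesis using q0 m_pos by (simp add: real_sqrt_mult)
qed

lemma B_star_eq:
  "B_star P q n \<epsilon> \<sigma> t = (if (6 + 1 / (kurt_block - 1)) * error_rate (max t \<sigma>) \<le> 1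
     then ereal (error_rate (max t \<sigma>) / (1 - 4 * error_rate (max t \<sigma>))) else \<infinity>)"
proof -
  have R: "0 < sqrt (real (q * m))" using q m_pos by simp
  have "(6 + real q / tau q kurt_coeff) = (6 + 1 / (kurt_block - 1))" unfolding tau_eq using q by simp
  moreover have "(a * z \<le> r) = (a * (z / r) \<le> 1)" if "0 < r" for a z r :: real using that by (simp add: pos_divide_le_eq)
  ultimately have "((6 + real q / tau q kurt_coeff) * zeta P q n \<epsilon> (max t \<sigma>) \<le> sqrt (real (q * m)))
     = ((6 + 1 / (kurt_block - 1)) * error_rate (max t \<sigma>) \<le> 1)" using R zeta_eq by metis
  then show ?thesis unfolding B_star_def Let_def kurt_coeff_def[symmetric] zeta_eq by simp
qed

text \<open>Two grid points occur: j, found from the true energy, bounds the minimum of the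
  criterion, and i, selected by the data, inherits this bound by minimality. The error at i is then
  improved by passing from \<open>cst_c\<close> to \<open>dev_cst\<close>.\<close>

lemma natural_regime:
  assumes \<Delta>: "two_sided_bounds \<omega>" and \<theta>: "\<theta> \<noteq> 0" and best: "is_best_pair Q m \<epsilon> \<sigma> (A \<omega>) \<theta> pr"
  defines "t \<equiv> max (energy P \<theta> / (norm \<theta>)\<^sup>2) \<sigma>"
  assumes cond: "(6 + 1 / (kurt_block - 1)) * error_rate t \<le> 1" and tA: "t \<le> 4 * A4"
  shows "\<bar>t / max (N_tilde m (A \<omega>) (fst pr) \<theta> / (norm \<theta>)\<^sup>2) \<sigma> - 1\<bar> \<le> error_rate t / (1 - 4 * error_rate t)"
proof -
  define \<rho> where "\<rho> = (norm \<theta>)\<^sup>2"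
  have \<rho>: "0 < \<rho>" unfolding \<rho>_def using \<theta> by simp
  have t0: "0 < t" unfolding t_def using sg by simp
  have tT: "t \<le> Tr" unfolding t_def using sg energy_le_Tr[of \<theta>] \<rho> by (simp add: Tr_def \<rho>_def pos_divide_le_eq)
  have m0: "0 < real m" using m_pos by simp
  define c where "c = cst_c"
  have c: "44 \<le> c" "dev_cst \<le> c" "0 \<le> c" unfolding c_def using cst_c_bounds dev_cst_le by linarith+
  define z where "z = error_rate t"
  define \<tau> where "\<tau> j = max (Nt \<omega> j \<theta> / \<rho>) \<sigma>" for j
  have \<tau>0: "0 < \<tau> j" for j unfolding \<tau>_def using sg by simp
  have KK: "K q kurt_coeff n = 1 + \<lceil>1 / 2 * ln (real m / (72 * (2 + cst_c) * sqrt kurt_block))\<rceil>" by (simp add: K_def kurt_block_def)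
  have KK': "K' Q m = 1 + \<lceil>2 * ln (real m / (72 * (2 + cst_c) * sqrt kurt_block))\<rceil>" by (simp add: K'_def kurt_block_enn mesh_def)
  have k: "1 < kurt_block" by (rule kurt_block_gt_1)
  have A4V: "A4\<^sup>2 \<le> V2" "V2 \<le> A4 * (sqrt kurt_block * Tr)" unfolding A4_square using M2_le_V2 V2_le by (auto simp: A4_def)
  obtain j G where j: "int j < K' Q m" "grid_numerics kurt_block (real m) Tr t A4 V2 L (exp (real j / 2))"
    "G = grid_numerics.t1 kurt_block (real m) A4 V2 L (exp (real j / 2)) + grid_numerics.t2 kurt_block (real m) A4 (exp (real j / 2))
      + grid_numerics.t3 kurt_block (real m) A4 V2 L (exp (real j / 2)) + grid_numerics.t4 kurt_block (real m) t A4 (exp (real j / 2))"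
    "grid_numerics.t4 kurt_block (real m) t A4 (exp (real j / 2)) \<le> 165/100 * grid_numerics.t2 kurt_block (real m) A4 (exp (real j / 2))"
    "G \<le> 11/10 * z" "z < G \<Longrightarrow> G * (G - z) \<le> 223/10 * (sqrt kurt_block * A4 / (2 * real m * t))"
    unfolding L_def
    by (rule grid_choice[OF k m0 t0 tT A4_pos A4_le A4V eps KK K_ge KK' K'_ge refl _ _ tA, of z])
      (use cond in \<open>auto simp: z_def error_rate_def\<close>)
  interpret g: grid_numerics kurt_block "real m" Tr t A4 V2 L "exp (real j / 2)" by (rule j(2))
  have gt: "g.t1 = u1 j" "g.t2 = u2 c j" "g.t3 = u3 c j" "g.t4 = bj j / (2 * real m * t)"
    unfolding g.t1_def g.t2_def g.t3_def g.t4_def u1_def u2_def u3_def lj_eq bj_eq c_def by simp_all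
  note G = j(3-6)[unfolded gt]
  note u3j = g.t3_bounds[unfolded gt]
  have jK: "j < nat (K' Q m)" using j(1) by linarith
  define \<delta> where "\<delta> i x = bj i / (2 * real m * x)" for i x
  have \<delta>_pos: "0 < x \<Longrightarrow> 0 < \<delta> i x" for i x unfolding \<delta>_def using bj_pos[of i] m0 by simp
  define bnd where "bnd c i d = (u1 i + u2 c i + u3 c i + d) / (1 - (2 * u1 i + u2 c i) - (u1 i + u2 c i + u3 c i) - 2 * d)" for c i d
  define good where "good c i d \<longleftrightarrow> kurt_block / (kurt_block - 1) * u1 i + (2 * u1 i + u2 c i) + (u1 i + u2 c i + u3 c i) + 2 * d < 1" for c i d
  note eb = error_bounds[OF \<Delta> _ _ \<theta>, folded \<rho>_def, folded t_def[folded \<rho>_def] \<tau>_def \<delta>_def good_def bnd_def]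
  have u: "0 < u1 i" "0 < u2 c i" "0 < u3 c i" for i using u_nonneg[OF c(3)] by auto
  have G0: "0 < G" using G(1) u[of j] \<delta>_pos[OF t0, of j] by (simp add: \<delta>_def)
  have z0: "0 < z" using G0 G(3) by linarith
  have z6: "z \<le> 1/6" 
  proof -
    have "0 < 1 / (kurt_block - 1) * z" using k z0 by simp
    then show ?thesis using cond unfolding z_def[symmetric] distrib_right by linarith
  qed
  define b where "b = bnd c j (\<delta> j t)"
  have b_eq: "b = G / (1 - (2 * u1 j + u2 c j) - (u1 j + u2 c j + u3 c j) - 2 * \<delta> j t)"
    unfolding b_def bnd_def G(1) \<delta>_def by simp
  note sel = selection_bound[OF u(1)[of j] u(2)[of j] less_imp_le[OF \<delta>_pos[OF t0, of j]] k z0 u3j G(2)[folded \<delta>_def] G(1)[folded \<delta>_def] G(3)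
      cond[folded z_def] b_eq, folded good_def bnd_def]
  \<comment> \<open>The value d = 0 satisfies the premises of \<open>selection_bound\<close>
    trivially. This gives the side condition at the true energy, from which the premise for the real
    d follows.\<close>
  have sel0: "good c j (\<delta> j t)" "0 \<le> b" using sel(1,2)[of 0] less_imp_le[OF \<delta>_pos[OF t0, of j]] by auto
  have t_le: "t \<le> (1 + b) * \<tau> j" using eb(1)[OF jK c(2) sel0(1)] unfolding b_def .
  have d_le: "\<delta> j (\<tau> j) \<le> (1 + b) * \<delta> j t"
  proof -
    have "1 / \<tau> j \<le> (1 + b) / t" using t_le \<tau>0[of j] t0 by (simp add: field_simps)
    then have "bj j / (2 * real m) * (1 / \<tau> j) \<le> bj j / (2 * real m) * ((1 + b) / t)"
      using bj_pos[of j] by (intro mult_left_mono) auto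
    then show ?thesis unfolding \<delta>_def by (simp add: mult_ac)
  qed
  note sel1 = sel(3,4)[OF less_imp_le[OF \<delta>_pos[OF \<tau>0]] d_le]
  have B: "B_bound Q m \<epsilon> \<sigma> (lj i) (bj i) (Nt \<omega> i \<theta> / \<rho>) = (if good c i (\<delta> i (\<tau> i)) then ereal (bnd c i (\<delta> i (\<tau> i))) else \<infinity>)" for i
    using B_bound_eq[of "Nt \<omega> i \<theta> / \<rho>" i, folded \<tau>_def, OF \<tau>0] unfolding good_def bnd_def c_def \<delta>_def .
  have prL: "pr \<in> Lam Q m \<epsilon>" using best unfolding is_best_pair_def is_arg_min_def by blast
  then obtain i where i: "pr = (lj i, bj i)" "i < nat (K' Q m)" unfolding Lam_eq by auto
  have jL: "(lj j, bj j) \<in> Lam Q m \<epsilon>" unfolding Lam_eq using jK by auto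
  have "B_bound Q m \<epsilon> \<sigma> (lj i) (bj i) (Nt \<omega> i \<theta> / \<rho>) \<le> B_bound Q m \<epsilon> \<sigma> (lj j) (bj j) (Nt \<omega> j \<theta> / \<rho>)"
    using best jL unfolding is_best_pair_def is_arg_min_def i(1) \<rho>_def by (auto simp: not_less)
  also have "\<dots> \<le> ereal (G / (1 - 3 * G))" unfolding B using sel1 by simp
  finally have Bi: "good c i (\<delta> i (\<tau> i))" "bnd c i (\<delta> i (\<tau> i)) \<le> G / (1 - 3 * G)" unfolding B by (auto split: if_splits)
  define d where "d = \<delta> i (\<tau> i)"
  have d0: "0 < d" unfolding d_def using \<delta>_pos \<tau>0 by simp
  have dev0: "0 \<le> dev_cst" using dev_cst_pos by simp
  have V0: "0 \<le> V2" using M2_le_V2 M2_pos by linarith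
  have u': "u2 dev_cst i = u2 c i - (c - dev_cst) * (sqrt kurt_block * A4) / bj i" "u3 dev_cst i \<le> u3 c i"
  proof -
    show "u2 dev_cst i = u2 c i - (c - dev_cst) * (sqrt kurt_block * A4) / bj i"
      unfolding u2_def diff_divide_distrib[symmetric] by (simp add: algebra_simps)
    show "u3 dev_cst i \<le> u3 c i" unfolding u3_def
      using c V0 lj_pos[of i] by (intro add_right_mono divide_right_mono mult_right_mono) auto
  qed
  \<comment> \<open>The gain in gamma at the selected point when \<open>cst_c\<close> is replaced by
    \<open>dev_cst\<close>.\<close>
  define s where "s = (c - dev_cst) * (sqrt kurt_block * A4) / bj i"
  have s0: "0 \<le> s" unfolding s_def using c k A4_pos bj_pos[of i] by simp
  have ud: "0 < u2 dev_cst i" "0 < u3 dev_cst i" using u_nonneg[OF dev0] by auto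
  have kk: "0 < kurt_block / (kurt_block - 1) * u1 i" using k u by simp
  have gd: "good dev_cst i d" using Bi(1) u' s0 unfolding good_def d_def[symmetric] s_def[symmetric] by linarith
  define y where "y = \<bar>t / \<tau> i - 1\<bar>"
  have y1: "y \<le> bnd dev_cst i d" unfolding y_def d_def by (rule eb(2)[OF i(2) order_refl]) (use gd in \<open>simp add: d_def\<close>)
  have den: "0 < 1 - (2 * u1 i + u2 c i) - (u1 i + u2 c i + u3 c i) - 2 * d"
    using Bi(1) kk unfolding good_def d_def[symmetric] by linarith
  have y2: "y \<le> bnd c i d"
  proof -
    have "bnd dev_cst i d \<le> bnd c i d" unfolding bnd_def
      using u' s0 den d0 u[of i] ud unfolding s_def[symmetric] by (intro frac_le) linarith+
    then show ?thesis using y1 by linarith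
  qed
  define \<Omega> where "\<Omega> = 223/10 * (sqrt kurt_block * A4 / (2 * real m * t))"
  have \<Omega>0: "0 \<le> \<Omega>" unfolding \<Omega>_def using k A4_pos m0 t0 by simp
  have \<Omega>s: "\<Omega> * (1 - bnd c i d) \<le> s * d"
  proof -
    \<comment> \<open>The error bound with \<open>cst_c\<close> already compares t with the estimate
      and so converts the loss at the true energy into one at the estimated energy. There it is
      measured against s d, in which beta cancels.\<close>
    have "1 - bnd c i d \<le> t / \<tau> i" using y2 unfolding y_def by linarith
    then have "\<Omega> * (1 - bnd c i d) \<le> \<Omega> * (t / \<tau> i)" using \<Omega>0 by (rule mult_left_mono)
    also have "\<dots> = 223/10 * (sqrt kurt_block * A4 / (2 * real m * \<tau> i))" unfolding \<Omega>_def using t0 by simp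
    also have "\<dots> \<le> (c - dev_cst) * (sqrt kurt_block * A4 / (2 * real m * \<tau> i))"
      using c dev_cst_le k A4_pos m0 \<tau>0[of i] by (intro mult_right_mono) auto
    also have "\<dots> = s * d" unfolding s_def d_def \<delta>_def using bj_pos[of i] by simp
    finally show ?thesis .
  qed
  have "y \<le> z / (1 - 4 * z)"
  proof (rule final_error[OF _ _ d0 _ \<Omega>0 z0 z6 _ _ _ s0 _ Bi(2)[folded d_def] y1[unfolded bnd_def] \<Omega>s G0 G(3) G(4)[folded \<Omega>_def]])
    show "0 \<le> 2 * u1 i + u2 c i" "0 < u1 i + u2 c i + u3 c i" "0 \<le> u1 i + u2 dev_cst i + u3 dev_cst i"
      using u[of i] ud by auto
    show "2 * u1 i + u2 c i + (u1 i + u2 c i + u3 c i) + 2 * d < 1" using den by linarith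
    show "2 * u1 i + u2 dev_cst i \<le> 2 * u1 i + u2 c i" "u1 i + u2 dev_cst i + u3 dev_cst i \<le> u1 i + u2 c i + u3 c i - s"
      using u' s0 unfolding s_def[symmetric] by linarith+
    show "bnd c i d = (u1 i + u2 c i + u3 c i + d) / (1 - (2 * u1 i + u2 c i) - (u1 i + u2 c i + u3 c i) - 2 * d)"
      by (simp add: bnd_def)
  qed
  then show ?thesis unfolding y_def \<tau>_def z_def i(1) \<rho>_def by simp
qed

end

section \<open>High energy levels\<close>

text \<open>What the side condition of \<open>B_star\<close> says about m. The first two constants
  are 36 times 98.5 and 36 times 2.032, the latter rounded down. The last one comes from (6 + a)^2
  >= 24 a with a = 1 / (k - 1), which cancels the factor k - 1.\<close>

lemma sample_size_bounds:
  fixes k m T' y :: real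
  assumes k: "1 < k" and m: "0 < m" and T': "1 \<le> T'" and y: "0 \<le> y"
    and cond: "(6 + 1 / (k - 1)) * ((sqrt (2032/1000 * (k - 1) * y) + sqrt (985/10 * (k * T'))) / sqrt m) \<le> 1"
  shows "3546 * (k * T') \<le> m" "7315/100 * ((k - 1) * y) \<le> m" "4876/100 * y \<le> m"
proof -
  define a a1 b1 where "a = 1 / (k - 1)" and "a1 = sqrt (2032/1000 * (k - 1) * y)" and "b1 = sqrt (985/10 * (k * T'))"
  have a: "0 < a" unfolding a_def using k by simp
  have a1: "0 \<le> a1" "a1\<^sup>2 = 2032/1000 * (k - 1) * y" unfolding a1_def using k y by simp_all
  have b1: "0 \<le> b1" "b1\<^sup>2 = 985/10 * (k * T')" unfolding b1_def using k T' by simp_all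
  have "(6 + a) * (a1 + b1) \<le> sqrt m" using cond m unfolding a_def[symmetric] a1_def[symmetric] b1_def[symmetric]
    by (simp add: pos_divide_le_eq)
  then have s: "6 * a1 + a * a1 + 6 * b1 + a * b1 \<le> sqrt m" by (simp add: algebra_simps)
  have nn: "0 \<le> a * a1" "0 \<le> a * b1" using a a1 b1 by auto
  have sq: "x\<^sup>2 \<le> m" if "0 \<le> x" "x \<le> sqrt m" for x using power_mono[OF that(2,1), of 2] m by simp
  have "(6 * b1)\<^sup>2 \<le> m" by (rule sq) (use s nn a1 b1 in auto)
  then show "3546 * (k * T') \<le> m" unfolding power_mult_distrib b1 by (simp add: mult.commute)
  have "(6 * a1)\<^sup>2 \<le> m" by (rule sq) (use s nn a1 b1 in auto)
  moreover define w where "w = (k - 1) * y"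
  moreover have "0 \<le> w" unfolding w_def using k y by simp
  moreover have "a1\<^sup>2 = 2032/1000 * w" unfolding a1 w_def by simp
  ultimately show "7315/100 * ((k - 1) * y) \<le> m" by (simp add: power_mult_distrib)
  have "((6 + a) * a1)\<^sup>2 \<le> m"
  proof (rule sq)
    show "0 \<le> (6 + a) * a1" using a a1 by simp
    show "(6 + a) * a1 \<le> sqrt m" unfolding distrib_right using s nn b1(1) by linarith
  qed
  moreover have "24 * a * a1\<^sup>2 \<le> ((6 + a) * a1)\<^sup>2"
  proof -
    have "24 * a \<le> (6 + a)\<^sup>2" using zero_le_power2[of "6 - a"] by (simp add: power2_eq_square algebra_simps)
    then show ?thesis unfolding power_mult_distrib by (intro mult_right_mono) auto
  qed
  moreover have "24 * a * a1\<^sup>2 = 24 * (2032/1000) * y"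
  proof -
    have "a * (k - 1) = 1" unfolding a_def using k by simp
    moreover have "24 * a * a1\<^sup>2 = 24 * (2032/1000) * y * (a * (k - 1))" unfolding a1 by simp
    ultimately show ?thesis by simp
  qed
  ultimately show "4876/100 * y \<le> m" using y by simp
qed

context robust_estimation begin

definition "crude_bound l b \<delta> \<theta> = real m * ((energy P \<theta> - l) + (M2 * ((norm \<theta>)\<^sup>2)\<^sup>2 - 2 * l * energy P \<theta> + l\<^sup>2) / 2
  + (2 + dev_cst) * (M2 * (norm \<theta>)\<^sup>2) / b + dev_w b) + b * (norm \<theta>)\<^sup>2 / 2 + ln (1 / \<delta>)"

lemma crude_deviation_event:
  assumes b: "0 < b" and \<delta>: "0 < \<delta>"
  shows "\<exists>E\<in>sets M. 1 - \<delta> \<le> measure M E \<and> (\<forall>\<omega>\<in>E. \<forall>\<theta>. (\<Sum>i=1..m. psi (\<theta> \<bullet> (A \<omega> i *v \<theta>) - l)) \<le> crude_bound l b \<delta> \<theta>)"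
proof -
  obtain E where E: "E \<in> sets M" "1 - \<delta> \<le> measure M E" "\<And>\<omega> \<theta>. \<omega> \<in> E \<Longrightarrow> (\<Sum>i=1..m. psi (1 * (\<theta> \<bullet> (A \<omega> i *v \<theta>) - l)))
    \<le> real m * (1 * (energy P \<theta> - l) + ((\<integral>A. (\<theta> \<bullet> (A *v \<theta>))\<^sup>2 \<partial>Q) - 2 * l * energy P \<theta> + l\<^sup>2) / 2
         + (2 + dev_cst) * (\<integral>A. (norm (A *v \<theta>))\<^sup>2 \<partial>Q) / b + dev_w b)
      + b * (norm \<theta>)\<^sup>2 / 2 + ln (1 / \<delta>)"
    using deviation_event[OF b \<delta>, of 1 l, OF abs_one] by (elim bexE conjE) blast
  have "(\<Sum>i=1..m. psi (\<theta> \<bullet> (A \<omega> i *v \<theta>) - l)) \<le> crude_bound l b \<delta> \<theta>" if "\<omega> \<in> E" for \<omega> \<theta>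
  proof -
    have "real m * (1 * (energy P \<theta> - l) + ((\<integral>A. (\<theta> \<bullet> (A *v \<theta>))\<^sup>2 \<partial>Q) - 2 * l * energy P \<theta> + l\<^sup>2) / 2
         + (2 + dev_cst) * (\<integral>A. (norm (A *v \<theta>))\<^sup>2 \<partial>Q) / b + dev_w b)
      + b * (norm \<theta>)\<^sup>2 / 2 + ln (1 / \<delta>)
      \<le> real m * (1 * (energy P \<theta> - l) + (M2 * ((norm \<theta>)\<^sup>2)\<^sup>2 - 2 * l * energy P \<theta> + l\<^sup>2) / 2
         + (2 + dev_cst) * (M2 * (norm \<theta>)\<^sup>2) / b + dev_w b)
      + b * (norm \<theta>)\<^sup>2 / 2 + ln (1 / \<delta>)"
      using quad_square_le[of \<theta>] image_square_le(2)[of \<theta>] dev_cst_pos b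
      by (intro order_refl add_mono mult_left_mono divide_right_mono diff_right_mono) auto
    then show ?thesis using E(3)[OF that, of \<theta>] unfolding crude_bound_def by simp
  qed
  then show ?thesis using E(1,2) by blast
qed

text \<open>Only upper deviations matter at high levels. The grid then uses up epsilon instead of 2
  epsilon, and the rest is spent on one further event with l = 0. The parameter beta of the
  deviation inequality is free and is taken proportional to m sigma.\<close>

definition "one_sided_bounds \<omega> \<longleftrightarrow>
  (\<forall>j<nat (K' Q m). \<forall>\<theta>. (\<Sum>i=1..m. psi (\<theta> \<bullet> (A \<omega> i *v \<theta>) - lj j)) \<le> crude_bound (lj j) (real m * \<sigma> / 10) (\<epsilon> / real_of_int (K' Q m)) \<theta>) \<and>
  (\<forall>\<theta>. (\<Sum>i=1..m. psi (\<theta> \<bullet> (A \<omega> i *v \<theta>) - 0)) \<le> crude_bound 0 (real m * \<sigma> / 20) \<epsilon> \<theta>)"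

lemma crude_event: "\<exists>E\<in>sets M. 1 - 2 * \<epsilon> \<le> measure M E \<and> (\<forall>\<omega>\<in>E. one_sided_bounds \<omega>)"
proof -
  interpret M: prob_space M by (rule M)
  define k0 where "k0 = nat (K' Q m)"
  have K0: "0 < real_of_int (K' Q m)" "real k0 = real_of_int (K' Q m)" using K'_ge by (simp_all add: k0_def)
  define l b \<delta> where "l j = (if j < k0 then lj j else 0)" and "b j = (if j < k0 then real m * \<sigma> / 10 else real m * \<sigma> / 20)"
    and "\<delta> j = (if j < k0 then \<epsilon> / real_of_int (K' Q m) else \<epsilon>)" for j
  have "\<exists>E\<in>sets M. 1 - \<delta> j \<le> measure M E \<and> (\<forall>\<omega>\<in>E. \<forall>\<theta>. (\<Sum>i=1..m. psi (\<theta> \<bullet> (A \<omega> i *v \<theta>) - l j)) \<le> crude_bound (l j) (b j) (\<delta> j) \<theta>)" for j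
    by (rule crude_deviation_event) (use sg eps K0 m_pos in \<open>auto simp: b_def \<delta>_def\<close>)
  then have "\<exists>E\<in>sets M. 1 - sum \<delta> {..k0} \<le> measure M E \<and> (\<forall>\<omega>\<in>E. \<forall>j\<in>{..k0}. \<forall>\<theta>. (\<Sum>i=1..m. psi (\<theta> \<bullet> (A \<omega> i *v \<theta>) - l j)) \<le> crude_bound (l j) (b j) (\<delta> j) \<theta>)"
    by (intro M.finite_intersection_event) auto
  then obtain E where E: "E \<in> sets M" "1 - sum \<delta> {..k0} \<le> measure M E"
    "\<And>\<omega> j \<theta>. \<omega> \<in> E \<Longrightarrow> j \<le> k0 \<Longrightarrow> (\<Sum>i=1..m. psi (\<theta> \<bullet> (A \<omega> i *v \<theta>) - l j)) \<le> crude_bound (l j) (b j) (\<delta> j) \<theta>"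
    by (elim bexE conjE) auto
  have "sum \<delta> {..k0} = sum \<delta> {..<k0} + \<delta> k0" by (metis lessThan_Suc_atMost sum.lessThan_Suc)
  also have "\<dots> = 2 * \<epsilon>" using K0 by (simp add: \<delta>_def)
  finally have "1 - 2 * \<epsilon> \<le> measure M E" using E(2) by simp
  moreover have "one_sided_bounds \<omega>" if "\<omega> \<in> E" for \<omega>
    unfolding one_sided_bounds_def k0_def[symmetric]
  proof (intro conjI allI impI)
    show "(\<Sum>i=1..m. psi (\<theta> \<bullet> (A \<omega> i *v \<theta>) - lj j)) \<le> crude_bound (lj j) (real m * \<sigma> / 10) (\<epsilon> / real_of_int (K' Q m)) \<theta>" if "j < k0" for j \<theta>
      using E(3)[OF \<open>\<omega> \<in> E\<close>, of j \<theta>] that by (simp add: l_def b_def \<delta>_def)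
    show "(\<Sum>i=1..m. psi (\<theta> \<bullet> (A \<omega> i *v \<theta>) - 0)) \<le> crude_bound 0 (real m * \<sigma> / 20) \<epsilon> \<theta>" for \<theta>
      using E(3)[OF \<open>\<omega> \<in> E\<close>, of k0 \<theta>] by (simp add: l_def b_def \<delta>_def)
  qed
  ultimately show ?thesis using E(1) by blast
qed

text \<open>At such energy levels no grid point need be balanced, but then \<open>N(\<theta>) < \<sigma> |\<theta>|\<^sup>2\<close> for all \<open>\<theta>\<close>, and it
  is enough that no estimator exceeds \<open>\<sigma> |\<theta>|\<^sup>2\<close>. Grid points with \<open>\<lambda>\<close> at least 1 are not controlled by a quadratic
  expansion at \<open>\<lambda>\<close>; for them \<open>\<psi>(\<lambda>(x - 1)) \<le> 2 \<psi>(x) - ln 2\<close> reduces the question to the deviations of \<open>\<psi>(x)\<close>.\<close>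

lemma crude_regime:
  assumes \<Gamma>: "one_sided_bounds \<omega>" and \<theta>: "\<theta> \<noteq> 0" and j: "j < nat (K' Q m)"
    and cond: "(6 + 1 / (kurt_block - 1)) * error_rate \<sigma> \<le> 1" and A\<sigma>: "4 * A4 \<le> \<sigma>"
  shows "Nt \<omega> j \<theta> \<le> \<sigma> * (norm \<theta>)\<^sup>2"
proof -
  define \<rho> where "\<rho> = (norm \<theta>)\<^sup>2"
  have \<rho>: "0 < \<rho>" unfolding \<rho>_def using \<theta> by simp
  have m0: "0 < real m" using m_pos by simp
  have \<sigma>: "0 < \<sigma>" "\<sigma> \<le> Tr" using sg by (auto simp: Tr_def)
  define T' where "T' = Tr / \<sigma>"
  have T': "1 \<le> T'" unfolding T'_def using \<sigma> by simp
  define y where "y = 73/100 * T' + ln (real_of_int (K q kurt_coeff n)) + ln (1 / \<epsilon>)"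
  have lK: "0 \<le> ln (real_of_int (K q kurt_coeff n))" "0 \<le> ln (1 / \<epsilon>)" using K_ge eps by auto
  have y0: "73/100 \<le> y" unfolding y_def using lK T' by linarith
  have y00: "0 \<le> y" using y0 by simp
  have cond': "(6 + 1 / (kurt_block - 1)) * ((sqrt (2032/1000 * (kurt_block - 1) * y) + sqrt (985/10 * (kurt_block * T'))) / sqrt (real m)) \<le> 1"
    using cond unfolding error_rate_def y_def T'_def .
  note sz = sample_size_bounds[OF kurt_block_gt_1 m0 T' y00 cond']
  have KK: "K q kurt_coeff n = 1 + \<lceil>1 / 2 * ln (real m / (72 * (2 + cst_c) * sqrt kurt_block))\<rceil>" by (simp add: K_def kurt_block_def)
  have KK': "K' Q m = 1 + \<lceil>2 * ln (real m / (72 * (2 + cst_c) * sqrt kurt_block))\<rceil>" by (simp add: K'_def kurt_block_enn mesh_def)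
  define r where "r = ln (real_of_int (K' Q m) / real_of_int (K q kurt_coeff n))"
  have "73/100 + ln (real_of_int (K q kurt_coeff n)) \<le> y" unfolding y_def using lK T' by linarith
  note gap = log_gap(2)[OF KK KK' K_ge K'_ge this, folded r_def]
  have Lr: "73/100 * T' + L = y + r"
    unfolding L_def y_def r_def using K_ge K'_ge eps by (simp add: ln_div)
  have Ly: "L \<le> 234/100 * y"
  proof -
    have yr: "0 \<le> y + r" using Lr L_nonneg T' by linarith
    have sy: "854/1000 \<le> sqrt y" by (rule real_le_rsqrt) (use y0 in \<open>simp add: power_divide\<close>)
    have "sqrt (y + r) \<le> 1527/1000 * sqrt y" using gap sy by linarith
    then have "(sqrt (y + r))\<^sup>2 \<le> (1527/1000 * sqrt y)\<^sup>2" using yr by (intro power_mono) auto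
    then have "y + r \<le> (1527/1000)\<^sup>2 * y" unfolding power_mult_distrib real_sqrt_pow2[OF yr] real_sqrt_pow2[OF y00] .
    moreover have "(1527/1000)\<^sup>2 * y \<le> 234/100 * y" using y0 by (intro mult_right_mono) (auto simp: power_divide)
    ultimately show ?thesis using Lr T' by linarith
  qed
  have kT: "1 < kurt_block * T'" using kurt_block_gt_1 T' by (smt (verit) mult_le_cancel_left1)
  have m1: "3546 \<le> real m" using sz(1) kT by linarith
  have sk: "1 < sqrt kurt_block" using kurt_block_gt_1 by simp
  have A4': "A4 / \<sigma> \<le> 1/4" "0 \<le> A4 / \<sigma>" using A\<sigma> \<sigma> A4_pos by (auto simp: pos_divide_le_eq)
  have M2': "M2 / \<sigma>\<^sup>2 \<le> 1/16"
    using power_mono[OF A4', of 2] by (simp add: power_divide A4_square)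
  have V': "V2 / \<sigma>\<^sup>2 \<le> sqrt kurt_block * T' / 4"
  proof -
    have "V2 / \<sigma>\<^sup>2 \<le> A4 * (sqrt kurt_block * Tr) / \<sigma>\<^sup>2" unfolding A4_def by (intro divide_right_mono V2_le) simp
    also have "\<dots> = (A4 / \<sigma>) * (sqrt kurt_block * T')" unfolding T'_def by (simp add: power2_eq_square)
    also have "\<dots> \<le> 1/4 * (sqrt kurt_block * T')" using A4' sk T' by (intro mult_right_mono) auto
    finally show ?thesis by simp
  qed
  have V0: "0 \<le> V2 / \<sigma>\<^sup>2" using M2_le_V2 M2_pos by simp
  have dev: "0 < dev_cst" "dev_cst \<le> 217/10" by (rule dev_cst_pos dev_cst_le)+
  \<comment> \<open>What s4^2 <= sigma / 4 yields at the scale where alpha^2 sigma |theta|^2 =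
    x.\<close>
  have quad: "N \<le> x / 4 \<and> M2 * (x / \<sigma>)\<^sup>2 \<le> x\<^sup>2 / 16 \<and> (2 + dev_cst) * (M2 * (x / \<sigma>)) \<le> 1482/1000 * (x * \<sigma>)"
    if "0 < x" "N \<le> A4 * (x / \<sigma>)" for x N
  proof (intro conjI)
    show "N \<le> x / 4" using that mult_right_mono[OF A4'(1), of x] by (simp add: mult.commute)
    show "M2 * (x / \<sigma>)\<^sup>2 \<le> x\<^sup>2 / 16" using mult_right_mono[OF M2', of "x\<^sup>2"] by (simp add: power_divide)
    have "(2 + dev_cst) * (M2 * (x / \<sigma>)) = (2 + dev_cst) * (M2 / \<sigma>\<^sup>2) * (x * \<sigma>)" using \<sigma> by (simp add: power2_eq_square)
    also have "\<dots> \<le> 237/10 * (1/16) * (x * \<sigma>)"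
      using dev M2' M2_nonneg that \<sigma> by (intro mult_right_mono mult_mono) auto
    also have "\<dots> \<le> 1482/1000 * (x * \<sigma>)" using that \<sigma> by (intro mult_right_mono) auto
    finally show "(2 + dev_cst) * (M2 * (x / \<sigma>)) \<le> 1482/1000 * (x * \<sigma>)" .
  qed
  have energy: "energy P (\<alpha> *\<^sub>R \<theta>) \<le> A4 * (x / \<sigma>)" "(norm (\<alpha> *\<^sub>R \<theta>))\<^sup>2 = x / \<sigma>"
    if "\<alpha>\<^sup>2 * (\<sigma> * \<rho>) = x" for \<alpha> x
  proof -
    show n: "(norm (\<alpha> *\<^sub>R \<theta>))\<^sup>2 = x / \<sigma>" using that \<sigma> by (simp add: power_mult_distrib \<rho>_def field_simps)
    show "energy P (\<alpha> *\<^sub>R \<theta>) \<le> A4 * (x / \<sigma>)" unfolding n[symmetric] A4_def by (rule energy_le)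
  qed
  define \<alpha> where "\<alpha> x = sqrt (x / (\<sigma> * \<rho>))" for x
  have \<alpha>: "0 \<le> \<alpha> x" "(\<alpha> x)\<^sup>2 * (\<sigma> * \<rho>) = x" if "0 < x" for x using that \<sigma> \<rho> by (auto simp: \<alpha>_def)
  interpret g: grid_numerics kurt_block "real m" Tr Tr A4 V2 L "exp (real j / 2)" by (rule grid) (use Tr_pos in auto)
  define l where "l = lj j"
  have l0: "0 < l" unfolding l_def by (rule lj_pos)
  have l_sq: "l\<^sup>2 = 2 / ((kurt_block - 1) * real m) * (g.Wc * exp (real j / 2) + L)"
    unfolding l_def lj_eq g.lc_square g.Gc_def ..
  have km: "0 < (kurt_block - 1) * real m" using kurt_block_gt_1 m0 by simp
  have r_eq: "r_emp m (A \<omega>) l (a *\<^sub>R \<theta>) = (1 / real m) * (\<Sum>i = 1..m. psi (a\<^sup>2 * (\<theta> \<bullet> (A \<omega> i *v \<theta>)) - l))" for a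
    by (rule r_emp_eq[OF m_pos A_psd l0])
  have scal: "(a *\<^sub>R \<theta>) \<bullet> (A \<omega> i *v (a *\<^sub>R \<theta>)) = a\<^sup>2 * (\<theta> \<bullet> (A \<omega> i *v \<theta>))" for a i
    by (simp add: matrix_vector_mult_scaleR power2_eq_square)
  have w_eq: "D * V / (2 * (u * v / c)\<^sup>2) = D / 2 * (c\<^sup>2 / u\<^sup>2) * (V / v\<^sup>2)" for D V u v c :: real
    by (simp add: power_divide power_mult_distrib mult_ac)
  have "(\<Sum>i = 1..m. psi ((\<alpha> l)\<^sup>2 * (\<theta> \<bullet> (A \<omega> i *v \<theta>)) - l)) \<le> 0"
  proof (cases "l \<le> 1")
    case True
    \<comment> \<open>Lambda satisfies 2 L <= (k - 1) m l^2, and the sample size gives (k - 1) L <=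
      0.0338 m, where 0.0338 is twice the square of 0.13. Multiplying the two bounds L^2.\<close>
    have L_le: "L \<le> 13/100 * (real m * l)"
    proof (rule power2_le_imp_le)
      show "0 \<le> 13/100 * (real m * l)" using m0 l0 by simp
      have "(kurt_block - 1) * L \<le> (kurt_block - 1) * (234/100 * y)" using Ly kurt_block_gt_1 by (intro mult_left_mono) auto
      also have "\<dots> = 234/100 * ((kurt_block - 1) * y)" by simp
      also have "\<dots> \<le> 338/10000 * real m" using sz(2) m0 by linarith
      finally have 1: "(kurt_block - 1) * L \<le> 338/10000 * real m" .
      have "0 \<le> g.Wc * exp (real j / 2)" using g.Wc_pos by simp
      then have "2 / ((kurt_block - 1) * real m) * L \<le> l\<^sup>2" unfolding l_sq using km by (intro mult_left_mono) auto
      then have 2: "2 * L \<le> (kurt_block - 1) * real m * l\<^sup>2" using km by (simp add: field_simps)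
      have "L\<^sup>2 * (kurt_block - 1) = L * ((kurt_block - 1) * L)" by (simp add: power2_eq_square)
      also have "\<dots> \<le> L * (338/10000 * real m)" using 1 L_nonneg by (intro mult_left_mono) auto
      also have "\<dots> = 169/10000 * real m * (2 * L)" by simp
      also have "\<dots> \<le> 169/10000 * real m * ((kurt_block - 1) * real m * l\<^sup>2)"
        using 2 m0 by (intro mult_left_mono) auto
      also have "\<dots> = (13/100 * (real m * l))\<^sup>2 * (kurt_block - 1)" by (simp add: power2_eq_square)
      finally show "L\<^sup>2 \<le> (13/100 * (real m * l))\<^sup>2" by (rule mult_right_le_imp_le) (use kurt_block_gt_1 in simp)
    qed
    \<comment> \<open>This term carries no factor l, so lambda needs a lower bound: Wc sqrt k >= 0.7
      gives l^2 k^2 m >= 1.4. The cube of k T' / m <= 1 / 3546 then provides the small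
      constant.\<close>
    have V_le: "839 * (sqrt kurt_block * T' / (real m)\<^sup>2) \<le> 4/1000 * l"
    proof -
      have "(sqrt kurt_block * T' / (real m)\<^sup>2)\<^sup>2 \<le> (4/839000 * l)\<^sup>2"
      proof -
        have W: "7/10 \<le> g.Wc * exp (real j / 2) * sqrt kurt_block"
        proof -
          have "g.Wc * sqrt kurt_block * 1 \<le> g.Wc * sqrt kurt_block * exp (real j / 2)" using g.Wc_pos sk by (intro mult_left_mono) auto
          then show ?thesis using g.Wc_bounds(1) by (simp add: mult_ac)
        qed
        have l2: "14/10 \<le> l\<^sup>2 * (sqrt kurt_block * (kurt_block - 1) * real m)"
        proof -
          have eq: "l\<^sup>2 * (sqrt kurt_block * (kurt_block - 1) * real m) = 2 * (g.Wc * exp (real j / 2) * sqrt kurt_block + L * sqrt kurt_block)"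
            unfolding l_sq using kurt_block_gt_1 m0 by (simp add: field_simps)
          have "0 \<le> L * sqrt kurt_block" using L_nonneg sk by simp
          then show ?thesis unfolding eq using W by simp
        qed
        have s2: "sqrt kurt_block * (kurt_block - 1) \<le> kurt_block\<^sup>2"
          unfolding power2_eq_square using kurt_block_gt_1 by (intro mult_mono real_le_lsqrt) (auto simp: power2_eq_square)
        have "l\<^sup>2 * (sqrt kurt_block * (kurt_block - 1) * real m) \<le> l\<^sup>2 * (kurt_block\<^sup>2 * real m)"
          by (intro mult_left_mono mult_right_mono s2) auto
        then have "14/10 \<le> l\<^sup>2 * (kurt_block\<^sup>2 * real m)" using l2 by (rule order_trans[rotated])
        moreover have "(kurt_block * T' / real m) ^ 3 \<le> (1/3546) ^ 3"
          using sz(1) m0 kT by (intro power_mono) (auto simp: pos_divide_le_eq)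
        ultimately have "(kurt_block * T' / real m) ^ 3 * (14/10) \<le> (1/3546) ^ 3 * (l\<^sup>2 * (kurt_block\<^sup>2 * real m))"
          by (intro mult_mono) auto
        then have "(kurt_block * T' / real m) ^ 3 * (14/10) / (kurt_block\<^sup>2 * real m) \<le> (1/3546) ^ 3 * l\<^sup>2"
          using kurt_block_gt_1 m0 by (simp add: pos_divide_le_eq mult_ac)
        moreover have "(kurt_block * T' / real m) ^ 3 * (14/10) / (kurt_block\<^sup>2 * real m) = 14/10 * ((sqrt kurt_block * T' / (real m)\<^sup>2)\<^sup>2 * T')"
        proof -
          have "(sqrt kurt_block * T' / (real m)\<^sup>2)\<^sup>2 = kurt_block * T'\<^sup>2 / ((real m)\<^sup>2)\<^sup>2"
            using kurt_block_gt_1 by (simp add: power_mult_distrib power_divide)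
          moreover have "(x * T' / u) ^ 3 * (14/10) / (x\<^sup>2 * u) = 14/10 * (x * T'\<^sup>2 / (u\<^sup>2)\<^sup>2 * T')" if "x \<noteq> 0" "u \<noteq> 0" for x u
            using that by (simp add: field_simps power2_eq_square power3_eq_cube)
          ultimately show ?thesis using kurt_block_gt_1 m0 by simp
        qed
        moreover have "(sqrt kurt_block * T' / (real m)\<^sup>2)\<^sup>2 \<le> (sqrt kurt_block * T' / (real m)\<^sup>2)\<^sup>2 * T'"
          using T' by (simp add: mult_le_cancel_left1)
        ultimately have "14/10 * (sqrt kurt_block * T' / (real m)\<^sup>2)\<^sup>2 \<le> (1/3546) ^ 3 * l\<^sup>2" by linarith
        moreover have "(1/3546) ^ 3 * l\<^sup>2 \<le> 14/10 * (4/839000)\<^sup>2 * l\<^sup>2"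
          by (intro mult_right_mono) (auto simp: power_divide)
        ultimately have "(sqrt kurt_block * T' / (real m)\<^sup>2)\<^sup>2 \<le> (4/839000)\<^sup>2 * l\<^sup>2" by linarith
        then show ?thesis by (simp only: power_mult_distrib)
      qed
      then have "sqrt kurt_block * T' / (real m)\<^sup>2 \<le> 4/839000 * l" by (rule power2_le_imp_le) (use l0 in simp)
      then show ?thesis by linarith
    qed
    define N where "N = energy P (\<alpha> l *\<^sub>R \<theta>)"
    define b where "b = real m * \<sigma> / 10"
    have b0: "0 < b" unfolding b_def using m0 \<sigma> by simp
    note e = energy[OF \<alpha>(2)[OF l0], folded N_def]
    note q = quad[OF l0 e(1)]
    have N0: "0 \<le> N" unfolding N_def by (rule energy_nonneg)
    have "(\<Sum>i = 1..m. psi ((\<alpha> l)\<^sup>2 * (\<theta> \<bullet> (A \<omega> i *v \<theta>)) - l)) \<le> crude_bound l b (\<epsilon> / real_of_int (K' Q m)) (\<alpha> l *\<^sub>R \<theta>)"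
      using \<Gamma> j unfolding one_sided_bounds_def scal[symmetric] l_def b_def by blast
    also have "\<dots> = real m * ((N - l) + (M2 * (l / \<sigma>)\<^sup>2 - 2 * l * N + l\<^sup>2) / 2 + (2 + dev_cst) * (M2 * (l / \<sigma>)) / b + dev_w b)
        + b * (l / \<sigma>) / 2 + L"
      unfolding crude_bound_def e(2) N_def[symmetric] L_def by simp
    \<comment> \<open>Per unit of m l the balance is -0.45 from the expansion, 0.05 from the
      Gaussian penalty and at most 0.13 from \<open>L\<close>.\<close>
    also have "\<dots> \<le> 0"
    proof -
      have "N * (1 - l) \<le> l / 4 * (1 - l)" using q True by (intro mult_right_mono) auto
      moreover have "(N - l) + (M - 2 * l * N + l\<^sup>2) / 2 \<le> - (3/4 * l) + 9/32 * l\<^sup>2"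
        if "N * (1 - l) \<le> l / 4 * (1 - l)" "M \<le> l\<^sup>2 / 16" for M
        using that by (simp add: algebra_simps power2_eq_square add_divide_distrib diff_divide_distrib)
      ultimately have "(N - l) + (M2 * (l / \<sigma>)\<^sup>2 - 2 * l * N + l\<^sup>2) / 2 \<le> - (3/4 * l) + 9/32 * l\<^sup>2"
        using q by blast
      moreover have "l\<^sup>2 \<le> l" using l0 True by (simp add: power2_eq_square mult_le_cancel_left1)
      ultimately have 1: "(N - l) + (M2 * (l / \<sigma>)\<^sup>2 - 2 * l * N + l\<^sup>2) / 2 \<le> - (15/32 * l)" by linarith
      have "(2 + dev_cst) * (M2 * (l / \<sigma>)) / b \<le> 1482/1000 * (l * \<sigma>) / b" using q b0 by (intro divide_right_mono) auto
      also have "\<dots> = 1482/100 * l / real m" unfolding b_def using m0 \<sigma> by simp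
      also have "\<dots> \<le> 1482/100 * l / 3546" using m1 l0 by (intro divide_left_mono) auto
      finally have 2: "(2 + dev_cst) * (M2 * (l / \<sigma>)) / b \<le> 5/1000 * l" using l0 by simp
      have "dev_w b = (2 + 3 * dev_cst) / 2 * (10\<^sup>2 / (real m)\<^sup>2) * (V2 / \<sigma>\<^sup>2)"
        unfolding dev_w_def b_def by (rule w_eq)
      also have "\<dots> \<le> (671/10) / 2 * (10\<^sup>2 / (real m)\<^sup>2) * (sqrt kurt_block * T' / 4)"
        using dev V' V0 by (intro mult_mono mult_right_mono divide_right_mono) auto
      also have "\<dots> = 3355/4 * (sqrt kurt_block * T' / (real m)\<^sup>2)" by simp
      also have "\<dots> \<le> 839 * (sqrt kurt_block * T' / (real m)\<^sup>2)" using sk T' by (intro mult_right_mono) auto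
      finally have 3: "dev_w b \<le> 4/1000 * l" using V_le by linarith
      have 4: "b * (l / \<sigma>) / 2 = real m * (l / 20)" unfolding b_def using \<sigma> by simp
      have "real m * ((N - l) + (M2 * (l / \<sigma>)\<^sup>2 - 2 * l * N + l\<^sup>2) / 2 + (2 + dev_cst) * (M2 * (l / \<sigma>)) / b + dev_w b)
        \<le> real m * (- (45/100 * l))" using 1 2 3 l0 m0 by (intro mult_left_mono) auto
      also have "\<dots> = - (45/100) * (real m * l)" by simp
      finally have "real m * ((N - l) + (M2 * (l / \<sigma>)\<^sup>2 - 2 * l * N + l\<^sup>2) / 2 + (2 + dev_cst) * (M2 * (l / \<sigma>)) / b + dev_w b)
        \<le> - (45/100) * (real m * l)" .
      moreover have "b * (l / \<sigma>) / 2 = 5/100 * (real m * l)" unfolding 4 by simp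
      moreover have "X + Y + L \<le> 0" if "X \<le> - (45/100) * u" "Y = 5/100 * u" "L \<le> 13/100 * u" "0 < u" for X Y u :: real
        using that by linarith
      ultimately show ?thesis using L_le mult_pos_pos[OF m0 l0] by blast
    qed
    finally show ?thesis .
  next
    case False
    define N where "N = energy P (\<alpha> 1 *\<^sub>R \<theta>)"
    define b where "b = real m * \<sigma> / 20"
    define x where "x i = (\<alpha> 1)\<^sup>2 * (\<theta> \<bullet> (A \<omega> i *v \<theta>))" for i
    have b0: "0 < b" unfolding b_def using m0 \<sigma> by simp
    note e = energy[OF \<alpha>(2)[OF zero_less_one], folded N_def]
    have q: "N \<le> 1/4" "M2 * (1 / \<sigma>)\<^sup>2 \<le> 1/16" "(2 + dev_cst) * (M2 * (1 / \<sigma>)) \<le> 1482/1000 * \<sigma>"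
      using quad[of 1 N] e by auto
    have "(\<Sum>i = 1..m. psi (x i - 0)) \<le> crude_bound 0 b \<epsilon> (\<alpha> 1 *\<^sub>R \<theta>)"
      using \<Gamma> unfolding one_sided_bounds_def scal[symmetric] b_def x_def by blast
    then have "(\<Sum>i = 1..m. psi (x i)) \<le> crude_bound 0 b \<epsilon> (\<alpha> 1 *\<^sub>R \<theta>)" unfolding diff_zero .
    also have "\<dots> = real m * (N + (M2 * (1 / \<sigma>)\<^sup>2) / 2 + (2 + dev_cst) * (M2 * (1 / \<sigma>)) / b + dev_w b)
        + b * (1 / \<sigma>) / 2 + ln (1 / \<epsilon>)"
      unfolding crude_bound_def e(2) N_def[symmetric] by simp
    \<comment> \<open>The target 0.3465 is half of 0.693 < ln 2: after \<open>psi_scaled_le\<close>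
      the mean of psi has to stay below half of ln 2.\<close>
    also have "\<dots> \<le> real m * (3465/10000)"
    proof -
      have "(2 + dev_cst) * (M2 * (1 / \<sigma>)) / b \<le> 1482/1000 * \<sigma> / b" using q b0 by (intro divide_right_mono) auto
      also have "\<dots> = 2964/100 / real m" unfolding b_def using m0 \<sigma> by simp
      also have "\<dots> \<le> 2964/100 / 3546" using m1 by (intro divide_left_mono) auto
      finally have 2: "(2 + dev_cst) * (M2 * (1 / \<sigma>)) / b \<le> 9/1000" by simp
      have "dev_w b = (2 + 3 * dev_cst) / 2 * (20\<^sup>2 / (real m)\<^sup>2) * (V2 / \<sigma>\<^sup>2)"
        unfolding dev_w_def b_def by (rule w_eq)
      also have "\<dots> \<le> (671/10) / 2 * (20\<^sup>2 / (real m)\<^sup>2) * (sqrt kurt_block * T' / 4)"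
        using dev V' V0 by (intro mult_mono mult_right_mono divide_right_mono) auto
      also have "\<dots> = 3355 * (sqrt kurt_block * T') / (real m)\<^sup>2" by simp
      also have "\<dots> \<le> 3355 * (1/3546 * real m) / (real m)\<^sup>2"
      proof -
        have "sqrt kurt_block * T' \<le> kurt_block * T'" using kurt_block_gt_1 T' by (intro mult_right_mono real_le_lsqrt) (auto simp: power2_eq_square)
        then show ?thesis using sz(1) by (intro divide_right_mono mult_left_mono) auto
      qed
      also have "\<dots> = 3355/3546 / real m" using m0 by (simp add: power2_eq_square)
      also have "\<dots> \<le> 3355/3546 / 3546" using m1 by (intro divide_left_mono) auto
      finally have 3: "dev_w b \<le> 1/1000" by simp
      have 4: "b * (1 / \<sigma>) / 2 = real m * (25/1000)" unfolding b_def using \<sigma> by simp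
      have 5: "ln (1 / \<epsilon>) \<le> real m * (206/10000)"
      proof -
        have "ln (1 / \<epsilon>) \<le> y" unfolding y_def using lK T' by linarith
        then show ?thesis using sz(3) by simp
      qed
      have "real m * (N + (M2 * (1 / \<sigma>)\<^sup>2) / 2 + (2 + dev_cst) * (M2 * (1 / \<sigma>)) / b + dev_w b) \<le> real m * (2913/10000)"
        using q 2 3 by (intro mult_left_mono) auto
      moreover have "X + Y + Z \<le> u * (3465/10000)"
        if "X \<le> u * (2913/10000)" "Y = u * (25/1000)" "Z \<le> u * (206/10000)" "0 < u" for X Y Z u :: real
        using that by linarith
      ultimately show ?thesis using 4 5 m0 by blast
    qed
    finally have S: "(\<Sum>i = 1..m. psi (x i)) \<le> real m * (3465/10000)" .
    \<comment> \<open>The scale for l is that for 1 stretched by l, so the summands are psi(l (x -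
      1)) with x independent of l.\<close>
    have "(\<alpha> l)\<^sup>2 = l * (\<alpha> 1)\<^sup>2" unfolding \<alpha>_def using l0 \<sigma> \<rho> by simp
    then have "(\<Sum>i = 1..m. psi ((\<alpha> l)\<^sup>2 * (\<theta> \<bullet> (A \<omega> i *v \<theta>)) - l)) = (\<Sum>i = 1..m. psi (l * (x i - 1)))"
      unfolding x_def by (simp add: algebra_simps)
    also have "\<dots> \<le> (\<Sum>i = 1..m. 2 * psi (x i) - ln 2)"
    proof (intro sum_mono psi_scaled_le)
      show "0 \<le> x i" for i unfolding x_def using A_psd[of \<omega> i] by (simp add: sym_psd_def)
    qed (use False in simp)
    also have "\<dots> = 2 * (\<Sum>i = 1..m. psi (x i)) - real m * ln 2" by (simp add: sum_subtractf sum_distrib_left)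
    also have "\<dots> \<le> real m * (693/1000) - real m * ln 2" using S by simp
    also have "\<dots> \<le> 0" using mult_left_mono[of "693/1000" "ln 2" "real m"] ln2_bounds by simp
    finally show ?thesis .
  qed
  then have "r_emp m (A \<omega>) l (\<alpha> l *\<^sub>R \<theta>) \<le> 0" unfolding r_eq using m0 by (simp add: divide_nonpos_pos)
  then show ?thesis unfolding \<rho>_def[symmetric] l_def
    by (intro N_tilde_le[of m "A \<omega>" "lj j" "\<alpha> l", OF m_pos A_psd lj_pos]) (use \<alpha>[OF l0] \<sigma> \<rho> in \<open>auto simp: l_def\<close>)
qed

end

section \<open>Assembly of the two regimes\<close>

lemma (in block_kurtosis) zeta_pos:
  assumes "0 < t" "0 < \<epsilon>" "\<epsilon> < 1" "1 \<le> K q kurt_coeff n"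
  shows "0 < zeta P q n \<epsilon> t"
proof -
  have "0 < real q + tau q kurt_coeff" using tau_pos q by (intro add_pos_pos) auto
  then have "0 < sqrt (98.5 * (real q + tau q kurt_coeff) * Tr / t)" using Tr_pos assms by simp
  moreover have "0 \<le> sqrt (2.032 * tau q kurt_coeff * (0.73 * Tr / t + ln (real_of_int (K q kurt_coeff n)) + ln (1 / \<epsilon>)))"
    using tau_pos Tr_pos assms by simp
  ultimately show ?thesis unfolding zeta_def Let_def kurt_coeff_def[symmetric] Tr_def[symmetric] by linarith
qed

context robust_estimation begin

lemma ratio_scale:
  assumes "\<theta> \<noteq> 0"
  shows "max N (\<sigma> * (norm \<theta>)\<^sup>2) / max N' (\<sigma> * (norm \<theta>)\<^sup>2) = max (N / (norm \<theta>)\<^sup>2) \<sigma> / max (N' / (norm \<theta>)\<^sup>2) \<sigma>"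
proof -
  have \<rho>: "0 < (norm \<theta>)\<^sup>2" using assms by simp
  have "max x (\<sigma> * (norm \<theta>)\<^sup>2) = max (x / (norm \<theta>)\<^sup>2) \<sigma> * (norm \<theta>)\<^sup>2" for x
    using \<rho> by (simp add: max_mult_distrib_right)
  then show ?thesis using \<rho> by simp
qed

lemma Lam_cases: "pr \<in> Lam Q m \<epsilon> \<Longrightarrow> \<exists>j<nat (K' Q m). fst pr = lj j"
  unfolding Lam_eq by auto

text \<open>Which regime applies depends on sigma and the law, not on the sample or theta, so that a
  single event suffices. At high levels both maxima equal sigma |theta|^2 and the ratio is exactly
  1.\<close>

theorem robust_bound:
  assumes best: "\<And>\<omega> \<theta>. \<omega> \<in> space M \<Longrightarrow> \<theta> \<noteq> 0 \<Longrightarrow> is_best_pair Q m \<epsilon> \<sigma> (A \<omega>) \<theta> (pr \<omega> \<theta>)"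
  shows "\<exists>E\<in>sets M. 1 - 2 * \<epsilon> \<le> measure M E \<and> (\<forall>\<omega>\<in>E. \<forall>\<theta>. \<theta> \<noteq> 0 \<longrightarrow>
    ereal \<bar>max (energy P \<theta>) (\<sigma> * (norm \<theta>)\<^sup>2) / max (N_tilde m (A \<omega>) (fst (pr \<omega> \<theta>)) \<theta>) (\<sigma> * (norm \<theta>)\<^sup>2) - 1\<bar>
      \<le> B_star P q n \<epsilon> \<sigma> (energy P \<theta> / (norm \<theta>)\<^sup>2))"
proof (cases "\<sigma> \<le> 4 * A4")
  case True
  obtain E where E: "E \<in> sets M" "1 - 2 * \<epsilon> \<le> measure M E" "\<And>\<omega>. \<omega> \<in> E \<Longrightarrow> two_sided_bounds \<omega>"
    using good_event unfolding two_sided_bounds_def[symmetric] by blast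
  have "ereal \<bar>max (energy P \<theta>) (\<sigma> * (norm \<theta>)\<^sup>2) / max (N_tilde m (A \<omega>) (fst (pr \<omega> \<theta>)) \<theta>) (\<sigma> * (norm \<theta>)\<^sup>2) - 1\<bar>
      \<le> B_star P q n \<epsilon> \<sigma> (energy P \<theta> / (norm \<theta>)\<^sup>2)" if "\<omega> \<in> E" "\<theta> \<noteq> 0" for \<omega> \<theta>
  proof -
    have \<omega>: "\<omega> \<in> space M" using E(1) that(1) sets.sets_into_space by blast
    have "energy P \<theta> / (norm \<theta>)\<^sup>2 \<le> A4" using energy_le[of \<theta>] that(2) by (simp add: A4_def pos_divide_le_eq)
    then have "max (energy P \<theta> / (norm \<theta>)\<^sup>2) \<sigma> \<le> 4 * A4" using True A4_pos by simp
    from natural_regime[OF E(3)[OF that(1)] that(2) best[OF \<omega> that(2)] _ this]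
    show ?thesis unfolding B_star_eq ratio_scale[OF that(2)] by simp
  qed
  then show ?thesis using E(1,2) by blast
next
  case False
  interpret M: prob_space M by (rule M)
  have t: "max (energy P \<theta> / (norm \<theta>)\<^sup>2) \<sigma> = \<sigma>" if "\<theta> \<noteq> 0" for \<theta>
  proof -
    have "energy P \<theta> / (norm \<theta>)\<^sup>2 \<le> A4" using energy_le[of \<theta>] that by (simp add: A4_def pos_divide_le_eq)
    then show ?thesis using False A4_pos by simp
  qed
  show ?thesis
  proof (cases "(6 + 1 / (kurt_block - 1)) * error_rate \<sigma> \<le> 1")
    case cond: True
    have error_rate: "0 \<le> error_rate \<sigma>" unfolding zeta_eq[symmetric]
      using zeta_pos[OF sg(1) eps K_ge] by simp
    have "0 \<le> 1 / (kurt_block - 1) * error_rate \<sigma>" using error_rate kurt_block_gt_1 by simp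
    then have z6: "6 * error_rate \<sigma> \<le> 1" using cond unfolding distrib_right by linarith
    obtain E where E: "E \<in> sets M" "1 - 2 * \<epsilon> \<le> measure M E" "\<And>\<omega>. \<omega> \<in> E \<Longrightarrow> one_sided_bounds \<omega>"
      using crude_event by blast
    have "ereal \<bar>max (energy P \<theta>) (\<sigma> * (norm \<theta>)\<^sup>2) / max (N_tilde m (A \<omega>) (fst (pr \<omega> \<theta>)) \<theta>) (\<sigma> * (norm \<theta>)\<^sup>2) - 1\<bar>
      \<le> B_star P q n \<epsilon> \<sigma> (energy P \<theta> / (norm \<theta>)\<^sup>2)" if "\<omega> \<in> E" "\<theta> \<noteq> 0" for \<omega> \<theta>
    proof -
      have \<omega>: "\<omega> \<in> space M" using E(1) that(1) sets.sets_into_space by blast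
      have "pr \<omega> \<theta> \<in> Lam Q m \<epsilon>" using best[OF \<omega> that(2)] unfolding is_best_pair_def is_arg_min_def by blast
      then obtain j where j: "j < nat (K' Q m)" "fst (pr \<omega> \<theta>) = lj j" using Lam_cases by blast
      have "Nt \<omega> j \<theta> \<le> \<sigma> * (norm \<theta>)\<^sup>2" by (rule crude_regime[OF E(3)[OF that(1)] that(2) j(1) cond]) (use False in simp)
      then have "max (Nt \<omega> j \<theta> / (norm \<theta>)\<^sup>2) \<sigma> = \<sigma>" using that(2) by (intro max_absorb2) (simp add: pos_divide_le_eq)
      then have "\<bar>max (energy P \<theta>) (\<sigma> * (norm \<theta>)\<^sup>2) / max (N_tilde m (A \<omega>) (fst (pr \<omega> \<theta>)) \<theta>) (\<sigma> * (norm \<theta>)\<^sup>2) - 1\<bar> = 0"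
        unfolding ratio_scale[OF that(2)] t[OF that(2)] j(2) using sg by simp
      moreover have "0 \<le> B_star P q n \<epsilon> \<sigma> (energy P \<theta> / (norm \<theta>)\<^sup>2)"
        unfolding B_star_eq t[OF that(2)] using cond error_rate z6 by simp
      ultimately show ?thesis by (metis zero_ereal_def)
    qed
    then show ?thesis using E(1,2) by blast
  next
    case cond: False
    have "B_star P q n \<epsilon> \<sigma> (energy P \<theta> / (norm \<theta>)\<^sup>2) = \<infinity>" if "\<theta> \<noteq> 0" for \<theta>
      unfolding B_star_eq t[OF that] using cond by simp
    then show ?thesis using eps by (intro bexI[of _ "space M"]) (auto simp: M.prob_space)
  qed
qed

end

theorem proposition6p2:
  fixes P :: "(real^'d) measure"
    and M :: "'w measure"
    and X :: "nat \<Rightarrow> 'w \<Rightarrow> real^'d"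
    and q n :: nat
    and \<epsilon> \<sigma> :: real
    and pair_hat :: "'w \<Rightarrow> real^'d \<Rightarrow> real \<times> real"
  defines "m \<equiv> n div q"
    and "Q \<equiv> block_law q P"
    and "A \<equiv> (\<lambda>\<omega>. block_mat q (\<lambda>j. X j \<omega>))"
  defines "N_hat \<equiv> (\<lambda>\<omega> \<theta>. N_tilde m (A \<omega>) (fst (pair_hat \<omega> \<theta>)) \<theta>)"
  assumes law: "prob_space P" "sets P = sets borel"
    and second_moment: "integrable P (\<lambda>x. (norm x)\<^sup>2)"
    and finite_kurtosis: "kurtosis P < \<infinity>"
    and sample_space: "prob_space M"
    and independent: "prob_space.indep_vars M (\<lambda>_. borel) X {1..n}"
    and identical: "\<And>i. i \<in> {1..n} \<Longrightarrow> distr M borel (X i) = P"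
    and q: "2 \<le> q"
    and eps: "0 < \<epsilon>" "\<epsilon> < 1"
    and sigma: "0 < \<sigma>" "\<sigma> \<le> trace (cov_mat P)"
    and K_pos: "1 \<le> K q (enn2real (kurtosis P)) n"
    and K'_pos: "1 \<le> K' Q m"
    and pair_hat: "\<And>\<omega> \<theta>. \<omega> \<in> space M \<Longrightarrow> \<theta> \<noteq> 0 \<Longrightarrow>
                     is_best_pair Q m \<epsilon> \<sigma> (A \<omega>) \<theta> (pair_hat \<omega> \<theta>)"
  shows "\<exists>E \<in> sets M. 1 - 2 * \<epsilon> \<le> measure M E \<and>
           (\<forall>\<omega>\<in>E. \<forall>\<theta>. \<theta> \<noteq> 0 \<longrightarrow>
              ereal \<bar>max (energy P \<theta>) (\<sigma> * (norm \<theta>)\<^sup>2) /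
                     max (N_hat \<omega> \<theta>) (\<sigma> * (norm \<theta>)\<^sup>2) - 1\<bar>
              \<le> B_star P q n \<epsilon> \<sigma> (energy P \<theta> / (norm \<theta>)\<^sup>2))"
proof -
  interpret bk: block_kurtosis P q
    by (intro block_kurtosis.intro kurtosis_law.intro block_kurtosis_axioms.intro law second_moment
        finite_kurtosis less_le_trans[OF sigma] q)
  interpret M: prob_space M by (rule sample_space)
  have K_ge: "1 \<le> K q bk.kurt_coeff n" using K_pos by (simp add: bk.kurt_coeff_def)
  show ?thesis
  proof (cases "1 \<le> n div q")
    case True
    interpret re: robust_estimation P q M X n \<epsilon> \<sigma>
      by (intro robust_estimation.intro robust_estimation_axioms.intro bk.block_kurtosis_axioms sample_space
          independent identical eps sigma K_ge K'_pos[unfolded Q_def m_def] True)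
    have A_eq: "re.A \<omega> = A \<omega>" for \<omega> by (simp add: re.A_def A_def)
    show ?thesis unfolding N_hat_def m_def A_eq[symmetric]
      by (rule re.robust_bound) (use pair_hat in \<open>simp add: A_eq Q_def m_def\<close>)
  next
    case False
    \<comment> \<open>Without a complete block the right side of the condition in
      \<open>B_star\<close> is 0 while \<open>zeta\<close> is positive, so the claimed bound is
      void.\<close>
    have "B_star P q n \<epsilon> \<sigma> t = \<infinity>" for t
    proof -
      have "0 < zeta P q n \<epsilon> (max t \<sigma>)" using sigma by (intro bk.zeta_pos eps K_ge) auto
      moreover have "0 < 6 + real q / tau q bk.kurt_coeff" using bk.tau_pos by (intro add_pos_nonneg) auto
      ultimately have "\<not> (6 + real q / tau q bk.kurt_coeff) * zeta P q n \<epsilon> (max t \<sigma>) \<le> 0" by (simp add: not_le)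
      moreover have "n div q = 0" using False by simp
      ultimately show ?thesis by (simp add: B_star_def Let_def bk.kurt_coeff_def[symmetric])
    qed
    then show ?thesis using eps by (intro bexI[of _ "space M"]) (auto simp: M.prob_space)
  qed
qed

end
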